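(* Assume $n$ is odd. Let $I=(x,z)\subset A=\mathbb{C}_\rho[x,y,z]$, $B=A\oplus It\oplus I^2t^2\oplus\cdots\subset A[t]$, and let $\mathcal{B}$ be the coherent sheaf of Cayley–Hamilton algebras of degree $n$ over $\mathrm{proj}\,Z(B)$ defined by $B$. Let $b\in\mathbb{C}$, $b\neq0$. For a semisimple but not simple representation in $\mathrm{trep}_n\mathcal{B}$ over the point $(0,b^n,0,0)\in\mathrm{max}\,Z(A)$, the local quiver setting is the quiver with $n$ vertices indexed by $\mathbb{Z}/n\mathbb{Z}$, all of dimension $1$, with for each $i$ one arrow $i\to i+1$ and one arrow $i\to i-2$, together with one additional loop. Therefore, the defect of $\mathcal{B}$ at such a point is $n-1$, i.e. it stays equal to the defect of $A$ at $(0,b^n,0,0)$.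
   Context: Let $n\ge 2$ with $\gcd(n,3)=1$ and $\rho\in\mathbb{C}$ a primitive $n$-th root of unity. $A=\mathbb{C}_\rho[x,y,z]=\mathbb{C}\langle x,y,z\rangle/(xy-\rho yx,\ yz-\rho zy,\ zx-\rho xz)$, with center generated by $x^n,y^n,z^n,xyz$ (points of $\mathrm{max}\,Z(A)$ are written by the values of these four elements). The reduced trace $tr:A\to Z(A)$ makes $A$ a Cayley–Hamilton algebra of degree $n$, and $B$ inherits the $t$-linear extension; $B$ is graded with $A$ in degree $0$ and $t$ (central) in degree $1$, and is finite over its center $Z(B)$. Put $X=xt$, $Z=zt$. The sheaf $\mathcal{B}$ on $\mathrm{proj}\,Z(B)$ is given on the affine open $\mathbb{X}(X^n)=\{X^n\neq0\}$ by the degree zero part $(Q^g_{X^n}(B))_0$ of the graded localisation of $B$ at powers of $X^n$, and similarly for $Z^n$; $\mathrm{trep}_n\mathcal{B}$ refers to trace preserving representations of these algebras of sections. For a Cayley–Hamilton algebra $R$ of degree $n$ with trace $tr$, $\mathrm{trep}_nR$ is the scheme of trace preserving representations $\phi:R\to M_n(\mathbb{C})$ ($\phi(tr(a))=\mathrm{Tr}(\phi(a))$), with conjugation action of $\mathrm{PGL}_n$. If $M=\bigoplus_i S_i^{\oplus e_i}$ (distinct simples) is a semisimple trace preserving representation with orbit $\mathcal{O}(M)$, put $\mathrm{Ext}^{tr}_R(M,M)=T_M\mathrm{trep}_nR/T_M\mathcal{O}(M)$. The local quiver setting at $M$ is the quiver with one vertex of dimension $e_i$ for each $S_i$ such that $\mathrm{Ext}^{tr}_R(M,M)$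 is isomorphic, as $\mathrm{Stab}(M)=\prod_iGL_{e_i}$-representation, to the space of representations of the quiver of that dimension vector. The defect at the corresponding central point is $\dim\mathrm{Ext}^{tr}_R(M,M)+(n^2-\sum_ie_i^2)-\dim\mathrm{trep}_nR$, where the relevant dimension is $\dim \mathrm{trep}_nR=n^2+2$ (the dimension of the part lying over the Azumaya locus). *)

theory Defs
  imports
    "HOL-Library.Poly_Mapping"
    "HOL-Algebra.QuotRing"
    "HOL-Algebra.Ideal_Product"
    "HOL-Algebra.UnivPoly"
    "Jordan_Normal_Form.VS_Connect"
    "Graph_Theory.Digraph"
begin

text \<open>
  A complex algebra, not necessarily commutative, is a record of type \<open>(complex, 'r) module\<close>
  (ring operations together with \<open>smult\<close>). Vector spaces are records of the same type; their
  fields \<open>mult\<close> and \<open>one\<close> carry no meaning.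
\<close>

section \<open>Generalities on algebras\<close>

definition quotient_by :: "(complex, 'r) module \<Rightarrow> 'r set \<Rightarrow> (complex, 'r set) module" where
  "quotient_by R J = ring.extend (R Quot J)
     (module.fields (\<lambda>c C. \<Union>a\<in>C. J +>\<^bsub>R\<^esub> (c \<odot>\<^bsub>R\<^esub> a)))"

definition centre :: "('r, 'm) ring_scheme \<Rightarrow> 'r set" where
  "centre R = {c \<in> carrier R. \<forall>a\<in>carrier R. c \<otimes>\<^bsub>R\<^esub> a = a \<otimes>\<^bsub>R\<^esub> c}"

text \<open>Points of \<open>max Z(R)\<close>, as complex valued characters of the centre.\<close>

definition maxZ :: "(complex, 'r) module \<Rightarrow> ('r \<Rightarrow> complex) set" where
  "maxZ R = {p \<in> centre R \<rightarrow>\<^sub>E UNIV.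
     p \<in> Ring.ring_hom (R\<lparr>carrier := centre R\<rparr>) class_ring \<and>
     (\<forall>c. \<forall>a\<in>centre R. p (c \<odot>\<^bsub>R\<^esub> a) = c * p a)}"

primrec ideal_power :: "('r, 'm) ring_scheme \<Rightarrow> 'r set \<Rightarrow> nat \<Rightarrow> 'r set" where
  "ideal_power R I 0 = carrier R"
| "ideal_power R I (Suc k) = ideal_prod R I (ideal_power R I k)"

subsection \<open>Reduced trace\<close>

text \<open>
  Let \<open>R\<close> be an order in a central simple algebra \<open>S\<close> of dimension \<open>m\<close> over the fraction field
  \<open>K\<close> of the centre of \<open>R\<close>. The following family is a \<open>K\<close>-basis of \<open>S\<close> whose members lie in \<open>R\<close>;
  denominators are cleared so that everything is expressed inside \<open>R\<close>.
\<close>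

definition frac_basis :: "('r, 'm) ring_scheme \<Rightarrow> nat \<Rightarrow> (nat \<Rightarrow> 'r) \<Rightarrow> bool" where
  "frac_basis R m e \<longleftrightarrow>
     e \<in> {..<m} \<rightarrow> carrier R \<and>
     (\<forall>c \<in> {..<m} \<rightarrow> centre R.
        (\<Oplus>\<^bsub>R\<^esub>i\<in>{..<m}. c i \<otimes>\<^bsub>R\<^esub> e i) = \<zero>\<^bsub>R\<^esub> \<longrightarrow> (\<forall>i<m. c i = \<zero>\<^bsub>R\<^esub>)) \<and>
     (\<forall>a \<in> carrier R. \<exists>s \<in> centre R - {\<zero>\<^bsub>R\<^esub>}. \<exists>c \<in> {..<m} \<rightarrow> centre R.
        s \<otimes>\<^bsub>R\<^esub> a = (\<Oplus>\<^bsub>R\<^esub>i\<in>{..<m}. c i \<otimes>\<^bsub>R\<^esub> e i))"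

text \<open>
  In characteristic zero the reduced trace of a central simple algebra of degree \<open>n\<close> is \<open>1/n\<close> times
  the trace of left multiplication. Below, \<open>c/s\<close> is the matrix of left multiplication by \<open>a\<close> on
  the \<open>n\<^sup>2\<close>-dimensional algebra \<open>S\<close>.
\<close>

definition reduced_trace :: "('r, 'm) ring_scheme \<Rightarrow> nat \<Rightarrow> 'r \<Rightarrow> 'r" where
  "reduced_trace R n a = (THE t. t \<in> centre R \<and>
     (\<exists>e s c. frac_basis R (n^2) e \<and> s \<in> centre R - {\<zero>\<^bsub>R\<^esub>} \<and>
        (\<forall>i<n^2. \<forall>j<n^2. c i j \<in> centre R) \<and>
        (\<forall>j<n^2. s \<otimes>\<^bsub>R\<^esub> (a \<otimes>\<^bsub>R\<^esub> e j) = (\<Oplus>\<^bsub>R\<^esub>i\<in>{..<n^2}. c i j \<otimes>\<^bsub>R\<^esub> e i)) \<and>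
        s \<otimes>\<^bsub>R\<^esub> (add_pow R n t) = (\<Oplus>\<^bsub>R\<^esub>i\<in>{..<n^2}. c i i)))"

subsection \<open>Graded localisation\<close>

text \<open>The fraction \<open>b / s^k\<close>, for central \<open>s\<close>, as an equivalence class of pairs.\<close>

definition fraction :: "('r, 'm) ring_scheme \<Rightarrow> 'r \<Rightarrow> 'r \<Rightarrow> nat \<Rightarrow> ('r \<times> nat) set" where
  "fraction R s b k = {(b', k'). b' \<in> carrier R \<and>
     (\<exists>m. (s [^]\<^bsub>R\<^esub> (m + k')) \<otimes>\<^bsub>R\<^esub> b = (s [^]\<^bsub>R\<^esub> (m + k)) \<otimes>\<^bsub>R\<^esub> b')}"

text \<open>
  The degree zero part of the localisation of the graded algebra \<open>R\<close>, with homogeneous components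
  \<open>gr j\<close>, at the powers of a central element \<open>s\<close> homogeneous of degree \<open>d\<close>.
\<close>

definition loc_deg0 ::
  "(complex, 'r) module \<Rightarrow> (nat \<Rightarrow> 'r set) \<Rightarrow> 'r \<Rightarrow> nat \<Rightarrow> (complex, ('r \<times> nat) set) module" where
  "loc_deg0 R gr s d = \<lparr>
     carrier = {fraction R s b k | b k. b \<in> gr (d * k)},
     mult = (\<lambda>P Q. \<Union>(b, k)\<in>P. \<Union>(c, l)\<in>Q. fraction R s (b \<otimes>\<^bsub>R\<^esub> c) (k + l)),
     one = fraction R s \<one>\<^bsub>R\<^esub> 0,
     zero = fraction R s \<zero>\<^bsub>R\<^esub> 0,
     add = (\<lambda>P Q. \<Union>(b, k)\<in>P. \<Union>(c, l)\<in>Q.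
        fraction R s (((s [^]\<^bsub>R\<^esub> l) \<otimes>\<^bsub>R\<^esub> b) \<oplus>\<^bsub>R\<^esub> ((s [^]\<^bsub>R\<^esub> k) \<otimes>\<^bsub>R\<^esub> c)) (k + l)),
     smult = (\<lambda>z P. \<Union>(b, k)\<in>P. fraction R s (z \<odot>\<^bsub>R\<^esub> b) k)\<rparr>"

definition loc_trace ::
  "('r, 'm) ring_scheme \<Rightarrow> ('r \<Rightarrow> 'r) \<Rightarrow> 'r \<Rightarrow> ('r \<times> nat) set \<Rightarrow> ('r \<times> nat) set" where
  "loc_trace R tr s P = (\<Union>(b, k)\<in>P. fraction R s (tr b) k)"

section \<open>The quantum polynomial algebra\<close>

datatype 'g free_monoid = Word (letters: "'g list")

instantiation free_monoid :: (type) monoid_add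
begin

definition "0 = Word []"

definition "u + v = Word (letters u @ letters v)"

instance
  by standard (simp_all add: zero_free_monoid_def plus_free_monoid_def)

end

definition free_algebra :: "(complex, 'g free_monoid \<Rightarrow>\<^sub>0 complex) module" where
  "free_algebra = \<lparr> carrier = UNIV, mult = (*), one = 1, zero = 0, add = (+),
     smult = (\<lambda>c f. Poly_Mapping.single 0 c * f)\<rparr>"

definition fvar :: "'g \<Rightarrow> 'g free_monoid \<Rightarrow>\<^sub>0 complex" where
  "fvar g = Poly_Mapping.single (Word [g]) 1"

datatype gen = gx | gy | gz

definition q_relations :: "complex \<Rightarrow> (gen free_monoid \<Rightarrow>\<^sub>0 complex) set" where
  "q_relations \<rho> =
     {fvar gx * fvar gy - \<rho> \<odot>\<^bsub>free_algebra\<^esub> (fvar gy * fvar gx),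
      fvar gy * fvar gz - \<rho> \<odot>\<^bsub>free_algebra\<^esub> (fvar gz * fvar gy),
      fvar gz * fvar gx - \<rho> \<odot>\<^bsub>free_algebra\<^esub> (fvar gx * fvar gz)}"

type_synonym qpoly = "(gen free_monoid \<Rightarrow>\<^sub>0 complex) set"

definition q_ideal :: "complex \<Rightarrow> (gen free_monoid \<Rightarrow>\<^sub>0 complex) set" where
  "q_ideal \<rho> = genideal free_algebra (q_relations \<rho>)"

definition q_alg :: "complex \<Rightarrow> (complex, qpoly) module" where
  "q_alg \<rho> = quotient_by free_algebra (q_ideal \<rho>)"

definition q_var :: "complex \<Rightarrow> gen \<Rightarrow> qpoly" where
  "q_var \<rho> g = q_ideal \<rho> +>\<^bsub>free_algebra\<^esub> fvar g"

text \<open>The point of \<open>max Z(A)\<close> with prescribed values of \<open>x^n\<close>, \<open>y^n\<close>, \<open>z^n\<close> and \<open>xyz\<close>.\<close>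

definition q_point ::
  "complex \<Rightarrow> nat \<Rightarrow> complex \<Rightarrow> complex \<Rightarrow> complex \<Rightarrow> complex \<Rightarrow> qpoly \<Rightarrow> complex" where
  "q_point \<rho> n a b c d = (THE p. p \<in> maxZ (q_alg \<rho>) \<and>
     p (q_var \<rho> gx [^]\<^bsub>q_alg \<rho>\<^esub> n) = a \<and>
     p (q_var \<rho> gy [^]\<^bsub>q_alg \<rho>\<^esub> n) = b \<and>
     p (q_var \<rho> gz [^]\<^bsub>q_alg \<rho>\<^esub> n) = c \<and>
     p (q_var \<rho> gx \<otimes>\<^bsub>q_alg \<rho>\<^esub> q_var \<rho> gy \<otimes>\<^bsub>q_alg \<rho>\<^esub> q_var \<rho> gz) = d)"

section \<open>The Rees algebra and its charts\<close>

text \<open>\<open>A \<oplus> It \<oplus> I\<^sup>2t\<^sup>2 \<oplus> \<dots>\<close> inside \<open>A[t]\<close>; a polynomial is the function giving its coefficients.\<close>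

definition rees :: "(complex, 'r) module \<Rightarrow> 'r set \<Rightarrow> (complex, nat \<Rightarrow> 'r) module" where
  "rees A I = \<lparr>
     carrier = {f \<in> carrier (UP A). \<forall>k. f k \<in> ideal_power A I k},
     mult = mult (UP A), one = one (UP A), zero = zero (UP A), add = add (UP A),
     smult = (\<lambda>c f k. c \<odot>\<^bsub>A\<^esub> f k)\<rparr>"

definition rees_component :: "(complex, 'r) module \<Rightarrow> 'r set \<Rightarrow> nat \<Rightarrow> (nat \<Rightarrow> 'r) set" where
  "rees_component A I d = {f \<in> carrier (rees A I). \<forall>k. k \<noteq> d \<longrightarrow> f k = \<zero>\<^bsub>A\<^esub>}"

definition rees_trace :: "('r \<Rightarrow> 'r) \<Rightarrow> (nat \<Rightarrow> 'r) \<Rightarrow> (nat \<Rightarrow> 'r)" where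
  "rees_trace tr f = (\<lambda>k. tr (f k))"

definition xz_ideal :: "complex \<Rightarrow> qpoly set" where
  "xz_ideal \<rho> = genideal (q_alg \<rho>) {q_var \<rho> gx, q_var \<rho> gz}"

abbreviation B_alg :: "complex \<Rightarrow> (complex, nat \<Rightarrow> qpoly) module" where
  "B_alg \<rho> \<equiv> rees (q_alg \<rho>) (xz_ideal \<rho>)"

text \<open>\<open>X^n = (xt)^n\<close> for \<open>g = gx\<close>, and \<open>Z^n = (zt)^n\<close> for \<open>g = gz\<close>.\<close>

definition chart_elem :: "complex \<Rightarrow> nat \<Rightarrow> gen \<Rightarrow> nat \<Rightarrow> qpoly" where
  "chart_elem \<rho> n g = up_ring.monom (UP (q_alg \<rho>)) (q_var \<rho> g) 1 [^]\<^bsub>B_alg \<rho>\<^esub> n"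

text \<open>
  The algebra of sections of the sheaf over the affine open set where \<open>chart_elem \<rho> n g\<close> is nonzero,
  its trace, and the structure map from \<open>A\<close>.
\<close>

definition chart_alg :: "complex \<Rightarrow> nat \<Rightarrow> gen \<Rightarrow> (complex, ((nat \<Rightarrow> qpoly) \<times> nat) set) module" where
  "chart_alg \<rho> n g =
     loc_deg0 (B_alg \<rho>) (rees_component (q_alg \<rho>) (xz_ideal \<rho>)) (chart_elem \<rho> n g) n"

definition chart_trace ::
  "complex \<Rightarrow> nat \<Rightarrow> gen \<Rightarrow> ((nat \<Rightarrow> qpoly) \<times> nat) set \<Rightarrow> ((nat \<Rightarrow> qpoly) \<times> nat) set" where
  "chart_trace \<rho> n g =
     loc_trace (B_alg \<rho>) (rees_trace (reduced_trace (q_alg \<rho>) n)) (chart_elem \<rho> n g)"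

definition to_chart :: "complex \<Rightarrow> nat \<Rightarrow> gen \<Rightarrow> qpoly \<Rightarrow> ((nat \<Rightarrow> qpoly) \<times> nat) set" where
  "to_chart \<rho> n g a =
     fraction (B_alg \<rho>) (chart_elem \<rho> n g) (up_ring.monom (UP (q_alg \<rho>)) a 0) 0"

section \<open>Trace preserving representations\<close>

text \<open>
  \<open>alg_reps R n \<iota>\<close> and \<open>trep R tr n \<iota>\<close> are the sets of \<open>C\<close>-points of the corresponding schemes, for
  a commutative complex algebra \<open>C\<close> with structure map \<open>\<iota>\<close>. Representations are extensional
  functions on the carrier.
\<close>

definition alg_reps ::
  "(complex, 'r) module \<Rightarrow> nat \<Rightarrow> (complex \<Rightarrow> 'c::comm_ring_1) \<Rightarrow> ('r \<Rightarrow> 'c mat) set" where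
  "alg_reps R n \<iota> = {\<phi> \<in> extensional (carrier R).
     \<phi> \<in> Ring.ring_hom R (ring_mat TYPE('c) n ()) \<and>
     (\<forall>c. \<forall>a\<in>carrier R. \<phi> (c \<odot>\<^bsub>R\<^esub> a) = \<iota> c \<cdot>\<^sub>m \<phi> a)}"

definition trep ::
  "(complex, 'r) module \<Rightarrow> ('r \<Rightarrow> 'r) \<Rightarrow> nat \<Rightarrow> (complex \<Rightarrow> 'c::comm_ring_1) \<Rightarrow> ('r \<Rightarrow> 'c mat) set"
where
  "trep R tr n \<iota> = {\<phi> \<in> alg_reps R n \<iota>.
     \<forall>a\<in>carrier R. \<phi> (tr a) = (\<Sum>i<n. \<phi> a $$ (i, i)) \<cdot>\<^sub>m 1\<^sub>m n}"

definition lies_over :: "(complex, 'r) module \<Rightarrow> nat \<Rightarrow> ('r \<Rightarrow> complex mat) \<Rightarrow> ('r \<Rightarrow> complex) \<Rightarrow> bool"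
where
  "lies_over R n \<phi> p \<longleftrightarrow> (\<forall>c\<in>centre R. \<phi> c = p c \<cdot>\<^sub>m 1\<^sub>m n)"

text \<open>
  A trace preserving representation sends central elements to scalar matrices, since
  \<open>tr(c) = n c\<close>; so any diagonal entry may be used to read off the central character.
\<close>

definition central_point :: "(complex, 'r) module \<Rightarrow> ('r \<Rightarrow> complex mat) \<Rightarrow> 'r \<Rightarrow> complex" where
  "central_point R \<phi> = (\<lambda>c\<in>centre R. \<phi> c $$ (0, 0))"

definition simple_rep :: "(complex, 'r) module \<Rightarrow> nat \<Rightarrow> ('r \<Rightarrow> complex mat) \<Rightarrow> bool" where
  "simple_rep R d \<sigma> \<longleftrightarrow> \<sigma> \<in> alg_reps R d id \<and> d > 0 \<and>
     (\<forall>W. VectorSpace.subspace class_ring W (module_vec TYPE(complex) d) \<and>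
          (\<forall>a\<in>carrier R. \<forall>v\<in>W. \<sigma> a *\<^sub>v v \<in> W) \<longrightarrow> W = {0\<^sub>v d} \<or> W = carrier_vec d)"

definition rep_iso :: "(complex, 'r) module \<Rightarrow> ('r \<Rightarrow> complex mat) \<Rightarrow> ('r \<Rightarrow> complex mat) \<Rightarrow> bool" where
  "rep_iso R \<sigma> \<tau> \<longleftrightarrow> (\<exists>P Q. \<forall>a\<in>carrier R. similar_mat_wit (\<sigma> a) (\<tau> a) P Q)"

definition kron :: "'a::semiring_1 mat \<Rightarrow> 'a mat \<Rightarrow> 'a mat" where
  "kron A B = mat (dim_row A * dim_row B) (dim_col A * dim_col B)
     (\<lambda>(i, j). A $$ (i div dim_row B, j div dim_col B) * B $$ (i mod dim_row B, j mod dim_col B))"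

text \<open>
  \<open>isotypic R n \<phi> m d e \<sigma> g g'\<close>: the matrix \<open>g\<close>, with inverse \<open>g'\<close>, identifies \<open>\<phi>\<close> with the direct
  sum of the \<open>S\<^sub>i\<^sup>\<oplus>\<^sup>e\<^sup>i\<close>, \<open>i < m\<close>, where the \<open>S\<^sub>i\<close> are pairwise non-isomorphic simple
  representations \<open>\<sigma> i\<close> of dimension \<open>d i\<close>; the block \<open>kron 1 (\<sigma> i a)\<close> consists of \<open>e i\<close> diagonal
  copies of \<open>\<sigma> i a\<close>.
\<close>

definition isotypic ::
  "(complex, 'r) module \<Rightarrow> nat \<Rightarrow> ('r \<Rightarrow> complex mat) \<Rightarrow> nat \<Rightarrow> (nat \<Rightarrow> nat) \<Rightarrow> (nat \<Rightarrow> nat) \<Rightarrow>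
   (nat \<Rightarrow> 'r \<Rightarrow> complex mat) \<Rightarrow> complex mat \<Rightarrow> complex mat \<Rightarrow> bool" where
  "isotypic R n \<phi> m d e \<sigma> g g' \<longleftrightarrow>
     \<phi> \<in> alg_reps R n id \<and>
     (\<forall>i<m. e i > 0 \<and> simple_rep R (d i) (\<sigma> i)) \<and>
     (\<forall>i<m. \<forall>j<m. i \<noteq> j \<longrightarrow> \<not> rep_iso R (\<sigma> i) (\<sigma> j)) \<and>
     (\<forall>a\<in>carrier R. similar_mat_wit (\<phi> a)
        (diag_block_mat (map (\<lambda>i. kron (1\<^sub>m (e i)) (\<sigma> i a)) [0..<m])) g g')"

definition semisimple_rep :: "(complex, 'r) module \<Rightarrow> nat \<Rightarrow> ('r \<Rightarrow> complex mat) \<Rightarrow> bool" where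
  "semisimple_rep R n \<phi> \<longleftrightarrow> (\<exists>m d e \<sigma> g g'. isotypic R n \<phi> m d e \<sigma> g g')"

text \<open>
  The element of \<open>Stab(M)\<close> corresponding to \<open>h = (h\<^sub>i)\<close> in the product of the \<open>GL\<^sub>e\<^sub>i\<close>, in terms of
  an isotypic decomposition: \<open>h\<^sub>i\<close> acts on the multiplicity space of \<open>S\<^sub>i\<close>.
\<close>

definition stab_elem ::
  "nat \<Rightarrow> (nat \<Rightarrow> nat) \<Rightarrow> complex mat \<Rightarrow> complex mat \<Rightarrow> (nat \<Rightarrow> complex mat) \<Rightarrow> complex mat" where
  "stab_elem m d g g' h = g * diag_block_mat (map (\<lambda>i. kron (h i) (1\<^sub>m (d i))) [0..<m]) * g'"

section \<open>Tangent spaces\<close>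

text \<open>The dual numbers \<open>\<complex>[\<epsilon>]/(\<epsilon>\<^sup>2)\<close>; \<open>Dual u v\<close> stands for \<open>u + \<epsilon>v\<close>.\<close>

datatype dual = Dual (dual_std: complex) (dual_eps: complex)

instantiation dual :: comm_ring_1
begin

definition "0 = Dual 0 0"

definition "1 = Dual 1 0"

definition "a + b = Dual (dual_std a + dual_std b) (dual_eps a + dual_eps b)"

definition "a - b = Dual (dual_std a - dual_std b) (dual_eps a - dual_eps b)"

definition "- a = Dual (- dual_std a) (- dual_eps a)"

definition "a * b = Dual (dual_std a * dual_std b)
  (dual_std a * dual_eps b + dual_eps a * dual_std b)"

instance
  by standard (simp_all add: zero_dual_def one_dual_def plus_dual_def minus_dual_def
    uminus_dual_def times_dual_def algebra_simps)

end

definition dual_mat :: "nat \<Rightarrow> complex mat \<Rightarrow> complex mat \<Rightarrow> dual mat" where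
  "dual_mat n A B = mat n n (\<lambda>ij. Dual (A $$ ij) (B $$ ij))"

text \<open>\<open>T\<^sub>M trep\<^sub>n R\<close>: the directions \<open>D\<close> for which \<open>\<phi> + \<epsilon>D\<close> is a point over the dual numbers.\<close>

definition tangent_space ::
  "(complex, 'r) module \<Rightarrow> ('r \<Rightarrow> 'r) \<Rightarrow> nat \<Rightarrow> ('r \<Rightarrow> complex mat) \<Rightarrow> (complex, 'r \<Rightarrow> complex mat) module"
where
  "tangent_space R tr n \<phi> = \<lparr>
     carrier = {D \<in> carrier R \<rightarrow>\<^sub>E carrier_mat n n.
        (\<lambda>a\<in>carrier R. dual_mat n (\<phi> a) (D a)) \<in> trep R tr n (\<lambda>c. Dual c 0)},
     mult = undefined, one = undefined,
     zero = (\<lambda>a\<in>carrier R. 0\<^sub>m n n),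
     add = (\<lambda>D E. \<lambda>a\<in>carrier R. D a + E a),
     smult = (\<lambda>c D. \<lambda>a\<in>carrier R. c \<cdot>\<^sub>m D a)\<rparr>"

text \<open>
  \<open>T\<^sub>M O(M)\<close>: the image of the differential at the identity of the orbit map
  \<open>g \<mapsto> g \<phi> g\<^sup>-\<^sup>1\<close>.
\<close>

definition orbit_tangent :: "(complex, 'r) module \<Rightarrow> nat \<Rightarrow> ('r \<Rightarrow> complex mat) \<Rightarrow> ('r \<Rightarrow> complex mat) set"
where
  "orbit_tangent R n \<phi> = {\<lambda>a\<in>carrier R. \<xi> * \<phi> a - \<phi> a * \<xi> | \<xi>. \<xi> \<in> carrier_mat n n}"

definition ext_tr ::
  "(complex, 'r) module \<Rightarrow> ('r \<Rightarrow> 'r) \<Rightarrow> nat \<Rightarrow> ('r \<Rightarrow> complex mat) \<Rightarrow> (complex, ('r \<Rightarrow> complex mat) set) module"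
where
  "ext_tr R tr n \<phi> = quotient_by (tangent_space R tr n \<phi>) (orbit_tangent R n \<phi>)"

section \<open>Defect\<close>

text \<open>The number \<open>\<Sum>\<^sub>i e\<^sub>i\<^sup>2\<close> attached to a semisimple representation.\<close>

definition mult_square_sum :: "(complex, 'r) module \<Rightarrow> nat \<Rightarrow> ('r \<Rightarrow> complex mat) \<Rightarrow> nat" where
  "mult_square_sum R n \<phi> =
     (THE q. \<exists>m d e \<sigma> g g'. isotypic R n \<phi> m d e \<sigma> g g' \<and> q = (\<Sum>i<m. (e i)^2))"

text \<open>The last term \<open>n\<^sup>2 + 2\<close> is the dimension of \<open>trep\<^sub>n\<close> over the Azumaya locus.\<close>

definition defect :: "(complex, 'r) module \<Rightarrow> ('r \<Rightarrow> 'r) \<Rightarrow> nat \<Rightarrow> ('r \<Rightarrow> complex mat) \<Rightarrow> int" where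
  "defect R tr n \<phi> = int (vectorspace.dim class_ring (ext_tr R tr n \<phi>))
     + (int (n^2) - int (mult_square_sum R n \<phi>)) - (int (n^2) + 2)"

definition defect_at :: "(complex, 'r) module \<Rightarrow> ('r \<Rightarrow> 'r) \<Rightarrow> nat \<Rightarrow> ('r \<Rightarrow> complex) \<Rightarrow> int" where
  "defect_at R tr n p = (THE k. \<exists>\<phi>\<in>trep R tr n id.
     semisimple_rep R n \<phi> \<and> lies_over R n \<phi> p \<and> k = defect R tr n \<phi>)"

section \<open>Local quivers\<close>

text \<open>The space of representations of a quiver \<open>Q\<close> of dimension vector \<open>\<alpha>\<close>.\<close>

definition quiver_reps ::
  "(nat, 'q) pre_digraph \<Rightarrow> (nat \<Rightarrow> nat) \<Rightarrow> (complex, 'q \<Rightarrow> complex mat) module" where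
  "quiver_reps Q \<alpha> = \<lparr>
     carrier = (\<Pi>\<^sub>E a\<in>arcs Q. carrier_mat (\<alpha> (head Q a)) (\<alpha> (tail Q a))),
     mult = undefined, one = undefined,
     zero = (\<lambda>a\<in>arcs Q. 0\<^sub>m (\<alpha> (head Q a)) (\<alpha> (tail Q a))),
     add = (\<lambda>V W. \<lambda>a\<in>arcs Q. V a + W a),
     smult = (\<lambda>c V. \<lambda>a\<in>arcs Q. c \<cdot>\<^sub>m V a)\<rparr>"

text \<open>
  \<open>(Q, \<alpha>)\<close> is the local quiver setting at \<open>\<phi>\<close>: the vertices \<open>0, \<dots>, m - 1\<close> index the isotypic
  components, \<open>\<alpha>\<close> gives the multiplicities, and \<open>\<Psi>\<close> is a linear isomorphism which is equivariant
  under \<open>Stab(M)\<close>, i.e. under the product of the \<open>GL\<^bsub>\<alpha> i\<^esub>\<close>; \<open>h'\<close> is the inverse of \<open>h\<close>.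
\<close>

definition local_quiver_setting ::
  "(complex, 'r) module \<Rightarrow> ('r \<Rightarrow> 'r) \<Rightarrow> nat \<Rightarrow> ('r \<Rightarrow> complex mat) \<Rightarrow>
   (nat, 'q) pre_digraph \<Rightarrow> (nat \<Rightarrow> nat) \<Rightarrow> bool" where
  "local_quiver_setting R tr n \<phi> Q \<alpha> \<longleftrightarrow> fin_digraph Q \<and>
     (\<exists>m d \<sigma> g g'. verts Q = {..<m} \<and> isotypic R n \<phi> m d \<alpha> \<sigma> g g' \<and>
      (\<exists>\<Psi> \<in> LinearCombinations.module_hom class_ring (ext_tr R tr n \<phi>) (quiver_reps Q \<alpha>).
         bij_betw \<Psi> (carrier (ext_tr R tr n \<phi>)) (carrier (quiver_reps Q \<alpha>)) \<and>
         (\<forall>h h'.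
            (\<forall>i<m. {h i, h' i} \<subseteq> carrier_mat (\<alpha> i) (\<alpha> i) \<and>
                   h i * h' i = 1\<^sub>m (\<alpha> i) \<and> h' i * h i = 1\<^sub>m (\<alpha> i)) \<longrightarrow>
            (\<forall>D\<in>carrier (tangent_space R tr n \<phi>).
               \<Psi> (orbit_tangent R n \<phi> +>\<^bsub>tangent_space R tr n \<phi>\<^esub>
                  (\<lambda>a\<in>carrier R. stab_elem m d g g' h * D a * stab_elem m d g g' h'))
               = (\<lambda>a\<in>arcs Q. h (head Q a) *
                  \<Psi> (orbit_tangent R n \<phi> +>\<^bsub>tangent_space R tr n \<phi>\<^esub> D) a * h' (tail Q a))))))"

text \<open>
  Vertices \<open>\<int>/n\<close>, represented by \<open>0, \<dots>, n - 1\<close>; arrows \<open>i \<rightarrow> i + 1\<close> (labelled \<open>(0, i)\<close>),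
  \<open>i \<rightarrow> i - 2\<close> (labelled \<open>(1, i)\<close>), and one loop \<open>(2, v)\<close> at \<open>v\<close>. It is meant for \<open>n \<ge> 2\<close>, so that the
  subtraction is not truncated.
\<close>

definition cyclic_quiver :: "nat \<Rightarrow> nat \<Rightarrow> (nat, nat \<times> nat) pre_digraph" where
  "cyclic_quiver n v = \<lparr>
     verts = {..<n},
     arcs = {0, 1} \<times> {..<n} \<union> {(2, v)},
     tail = snd,
     head = (\<lambda>(k, i). if k = 0 then (i + 1) mod n else if k = 1 then (i + n - 2) mod n else i)\<rparr>"

definition primitive_root_of_unity :: "nat \<Rightarrow> complex \<Rightarrow> bool" where
  "primitive_root_of_unity n \<rho> \<longleftrightarrow> \<rho> ^ n = 1 \<and> (\<forall>k. 0 < k \<and> k < n \<longrightarrow> \<rho> ^ k \<noteq> 1)"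

end

theory Submission
  imports
    Defs
    "HOL-Library.Product_Plus"
    "HOL-Library.Product_Lexorder"
    "Jordan_Normal_Form.Spectral_Radius"
begin

text \<open>
  Write \<open>{w, u} = {x, z}\<close>. Both \<open>A\<close> and the chart \<open>wt \<noteq> 0\<close> have a basis of monomials that multiply up to
  powers of \<open>\<rho>\<close>, that is, they are twisted monoid algebras of \<open>\<nat>\<^sup>3\<close>; so the reduced trace is \<open>n\<close> times
  the projection onto the central monomials. The chart is generated by \<open>W = w\<close>, \<open>Y = y\<close> and \<open>U = uw\<^bsup>-1\<^esup>\<close>,
  so that \<open>YW = \<alpha>WY\<close> and \<open>YU = \<alpha>\<^bsup>-2\<^esup>UY\<close>, where \<open>yu = \<alpha>\<^bsup>-1\<^esup>uy\<close> in \<open>A\<close> (\<open>\<alpha> = \<rho>\<^bsup>\<plusminus>1\<^esup>\<close>); this is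
  the reason for the arrows \<open>i \<rightarrow> i - 2\<close>. If \<open>Y\<close> and \<open>U\<close> are both invertible in a representation, the
  dimensions of its simple summands are multiples of \<open>n\<close>, because \<open>\<alpha>\<^sup>2\<close> has order \<open>n\<close> for odd \<open>n\<close>.
  Hence \<open>W\<close> and \<open>U\<close> vanish in a semisimple representation that is not simple and lies over
  \<open>(0, b\<^sup>n, 0, 0)\<close>, and since the powers \<open>Y, \<dots>, Y\<^bsup>n-1\<^esup>\<close> have trace zero, \<open>Y\<close> is diagonal with the \<open>n\<close>
  distinct eigenvalues \<open>\<mu>\<alpha>\<^sup>r\<close>. The entries of a tangent vector at this point are derivations between
  characters: the relations confine its value at \<open>W\<close> to the positions \<open>(i + 1, i)\<close> and at \<open>U\<close> to the
  positions \<open>(i - 2, i)\<close>; trace preservation makes the diagonal of the value at \<open>Y\<close>, relative to \<open>Y\<close>,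
  constant, which gives the loop; and the off-diagonal entries at \<open>Y\<close> are the inner derivations.
\<close>

section \<open>Twisted monoid algebras\<close>

text \<open>The reduced trace, the point of \<open>max Z(A)\<close>, the sum of squared
  multiplicities and the defect are definite descriptions, so each needs uniqueness besides a value.
  For the reduced trace this is independence of the basis, proved without a fraction field: base
  changes are matrices over the centre with denominators cleared, and the denominators are cancelled
  at the end in a domain. For the defect of \<open>A\<close> a representation over the point must
  exist; the one with \<open>Y\<close> acting as \<open>diag(\<mu>\<alpha>^r)\<close> serves.

  Indexing by \<open>i\<close> instead of the true exponent \<open>i - (s - 1)k\<close> of
  \<open>w\<close> keeps all exponents in \<nat> and lets one bicharacter with parameter
  \<open>s\<close> describe \<open>A\<close> and both charts. Elements of a chart are compared
  through numerators over powers of \<open>w^n\<close>; these are central, so products and traces of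
  numerators computed in \<open>A\<close> descend to the chart.

  The count behind the defect is \<open>(2n + 1) + (n^2 - n) - (n^2 + 2) = n - 1\<close>:
  \<open>n\<close> arrows from \<open>W\<close>, \<open>n\<close> from \<open>U\<close>, one loop
  from \<open>Y\<close>. Changing \<open>s\<close> only changes where the arrows of \<open>U\<close>
  end, not their number, which is why the blowup does not lower the defect.\<close>

abbreviation sgl :: "'k \<Rightarrow> complex \<Rightarrow> 'k \<Rightarrow>\<^sub>0 complex" where "sgl \<equiv> Poly_Mapping.single"
abbreviation coef :: "('k \<Rightarrow>\<^sub>0 complex) \<Rightarrow> 'k \<Rightarrow> complex" where "coef \<equiv> Poly_Mapping.lookup"
abbreviation supp :: "('k \<Rightarrow>\<^sub>0 complex) \<Rightarrow> 'k set" where "supp \<equiv> Poly_Mapping.keys"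

section \<open>Linear maps on finitely supported functions\<close>

definition scal :: "complex \<Rightarrow> ('k \<Rightarrow>\<^sub>0 complex) \<Rightarrow> 'k \<Rightarrow>\<^sub>0 complex" where
  "scal c f = Poly_Mapping.map ((*) c) f"

lemma coef_scal [simp]: "coef (scal c f) p = c * coef f p"
  unfolding scal_def by (simp add: Poly_Mapping.map.rep_eq when_def)

lemma scal_add: "scal c (f + g) = scal c f + scal c g"
  by (rule poly_mapping_eqI) (simp add: lookup_add algebra_simps)

lemma scal_sum: "scal c (sum f A) = (\<Sum>a\<in>A. scal c (f a))"
  by (rule poly_mapping_eqI) (simp add: lookup_sum sum_distrib_left)

lemma scal_scal [simp]: "scal c (scal d f) = scal (c * d) f"
  by (rule poly_mapping_eqI) simp

lemma scal_one [simp]: "scal 1 f = f"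
  by (rule poly_mapping_eqI) simp

lemma scal_zero [simp]: "scal 0 f = 0" "scal c 0 = 0"
  by (rule poly_mapping_eqI, simp)+

lemma scal_sgl [simp]: "scal c (sgl p d) = sgl p (c * d)"
  by (rule poly_mapping_eqI) (simp add: lookup_single when_def)

lemma supp_scal_subset: "supp (scal c f) \<subseteq> supp f"
  by (auto simp: in_keys_iff)

lemma sgl_0_mult: "sgl 0 c * f = scal c f"
  unfolding scal_def by (rule mult_map_scale_conv_mult[symmetric])

lemma poly_mapping_additive_induct [case_names single add]:
  assumes single: "\<And>k c. P (sgl k c)" and add: "\<And>f g. P f \<Longrightarrow> P g \<Longrightarrow> P (f + g)"
  shows "P f"
proof (induction f rule: update_induct)
  case const
  \<comment> \<open>The zero function is a monomial with coefficient zero at an arbitrary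
    index.\<close>
  show ?case using single[of undefined 0] by simp
next
  case (update f a b)
  have "Poly_Mapping.update a b f = f + sgl a b"
    using update(1) by (intro poly_mapping_eqI)
      (auto simp: lookup_update lookup_add lookup_single when_def in_keys_iff)
  then show ?case using add[OF update(3) single] by simp
qed

text \<open>This is the linear functional with prescribed values \<open>h\<close> on the basis;
  characters and derivations are given in this form below.\<close>

definition lin :: "('k \<Rightarrow> complex) \<Rightarrow> ('k \<Rightarrow>\<^sub>0 complex) \<Rightarrow> complex" where
  "lin h f = (\<Sum>p\<in>supp f. coef f p * h p)"

lemma lin_superset:
  assumes "finite S" "supp f \<subseteq> S"
  shows "lin h f = (\<Sum>p\<in>S. coef f p * h p)"
  unfolding lin_def by (rule sum.mono_neutral_left) (use assms in \<open>auto simp: in_keys_iff\<close>)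

lemma lin_add [simp]: "lin h (f + g) = lin h f + lin h g"
proof -
  let ?S = "supp f \<union> supp g"
  have "lin h (f + g) = (\<Sum>p\<in>?S. coef (f + g) p * h p)"
    by (rule lin_superset) (auto simp: keys_add)
  also have "\<dots> = (\<Sum>p\<in>?S. coef f p * h p) + (\<Sum>p\<in>?S. coef g p * h p)"
    by (simp add: lookup_add algebra_simps sum.distrib)
  also have "\<dots> = lin h f + lin h g"
    using lin_superset[of ?S f h] lin_superset[of ?S g h] by simp
  finally show ?thesis .
qed

lemma lin_scal [simp]: "lin h (scal c f) = c * lin h f"
proof -
  have "lin h (scal c f) = (\<Sum>p\<in>supp f. coef (scal c f) p * h p)"
    by (rule lin_superset) (auto simp: supp_scal_subset)
  then show ?thesis by (simp add: lin_def sum_distrib_left mult.assoc)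
qed

lemma lin_sgl [simp]: "lin h (sgl p c) = c * h p"
  by (simp add: lin_def)

lemma lin_0 [simp]: "lin h 0 = 0"
  by (simp add: lin_def)

text \<open>The vector-valued counterpart of \<open>lin\<close>: the linear map determined by the
  images \<open>h p\<close> of the basis elements.\<close>

definition plin :: "('k \<Rightarrow> 'l \<Rightarrow>\<^sub>0 complex) \<Rightarrow> ('k \<Rightarrow>\<^sub>0 complex) \<Rightarrow> 'l \<Rightarrow>\<^sub>0 complex" where
  "plin h f = (\<Sum>p\<in>supp f. scal (coef f p) (h p))"

lemma coef_plin: "coef (plin h f) r = lin (\<lambda>p. coef (h p) r) f"
  by (simp add: plin_def lin_def lookup_sum)

lemma plin_add [simp]: "plin h (f + g) = plin h f + plin h g"
  by (rule poly_mapping_eqI) (simp add: coef_plin lookup_add)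

lemma plin_scal [simp]: "plin h (scal c f) = scal c (plin h f)"
  by (rule poly_mapping_eqI) (simp add: coef_plin)

lemma plin_sgl [simp]: "plin h (sgl p c) = scal c (h p)"
  by (rule poly_mapping_eqI) (simp add: coef_plin)

lemma plin_0 [simp]: "plin h 0 = 0"
  by (rule poly_mapping_eqI) (simp add: coef_plin)

lemma plin_cong: "(\<And>p. p \<in> supp f \<Longrightarrow> h p = k p) \<Longrightarrow> plin h f = plin k f"
  by (simp add: plin_def)

lemma plin_add_fun: "plin (\<lambda>p. h p + k p) f = plin h f + plin k f"
  by (simp add: plin_def scal_add sum.distrib)

lemma plin_scal_fun: "plin (\<lambda>p. scal c (h p)) f = scal c (plin h f)"
  by (simp add: plin_def scal_sum mult.commute)

lemma plin_sgl_id: "plin (\<lambda>p. sgl p 1) f = f"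
  by (induction f rule: poly_mapping_additive_induct) auto

lemma plin_plin: "plin h (plin k f) = plin (\<lambda>p. plin h (k p)) f"
  by (induction f rule: poly_mapping_additive_induct) auto

lemma supp_plin: "supp (plin h f) \<subseteq> (\<Union>p\<in>supp f. supp (h p))"
proof
  fix r assume "r \<in> supp (plin h f)"
  then have "lin (\<lambda>p. coef (h p) r) f \<noteq> 0" by (simp add: in_keys_iff coef_plin)
  then obtain p where "p \<in> supp f" "coef f p * coef (h p) r \<noteq> 0"
    unfolding lin_def by (meson sum.neutral)
  then show "r \<in> (\<Union>p\<in>supp f. supp (h p))" by (auto simp: in_keys_iff)
qed

text \<open>The product of a twisted monoid algebra: basis elements multiply by adding exponents, up
  to the scalar \<open>\<chi> p q\<close>.\<close>

definition tmult :: "('k::comm_monoid_add \<Rightarrow> 'k \<Rightarrow> complex) \<Rightarrow> ('k \<Rightarrow>\<^sub>0 complex) \<Rightarrow>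
    ('k \<Rightarrow>\<^sub>0 complex) \<Rightarrow> 'k \<Rightarrow>\<^sub>0 complex" where
  "tmult \<chi> f g = plin (\<lambda>p. plin (\<lambda>q. sgl (p + q) (\<chi> p q)) g) f"

lemma tmult_add_left: "tmult \<chi> (f + g) h = tmult \<chi> f h + tmult \<chi> g h"
  by (simp add: tmult_def)

lemma tmult_add_right: "tmult \<chi> f (g + h) = tmult \<chi> f g + tmult \<chi> f h"
  by (simp add: tmult_def plin_add_fun)

lemma tmult_scal_left: "tmult \<chi> (scal c f) h = scal c (tmult \<chi> f h)"
  by (simp add: tmult_def)

lemma tmult_scal_right: "tmult \<chi> f (scal c h) = scal c (tmult \<chi> f h)"
  by (simp add: tmult_def plin_scal_fun)

lemma tmult_sgl [simp]: "tmult \<chi> (sgl p a) (sgl q b) = sgl (p + q) (a * b * \<chi> p q)"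
  by (simp add: tmult_def mult.assoc)

lemma tmult_0 [simp]: "tmult \<chi> 0 f = 0" "tmult \<chi> f 0 = 0"
  using tmult_scal_left[of \<chi> 0 f f] tmult_scal_right[of \<chi> f 0 f] by simp_all

lemma tmult_sum_left: "tmult \<chi> (sum f A) h = (\<Sum>a\<in>A. tmult \<chi> (f a) h)"
  by (induction A rule: infinite_finite_induct) (auto simp: tmult_add_left)

lemma tmult_sum_right: "tmult \<chi> h (sum f A) = (\<Sum>a\<in>A. tmult \<chi> h (f a))"
  by (induction A rule: infinite_finite_induct) (auto simp: tmult_add_right)

lemma supp_tmult: "supp (tmult \<chi> f g) \<subseteq> {p + q | p q. p \<in> supp f \<and> q \<in> supp g}"
proof -
  have "supp (tmult \<chi> f g) \<subseteq> (\<Union>p\<in>supp f. supp (plin (\<lambda>q. sgl (p + q) (\<chi> p q)) g))"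
    unfolding tmult_def by (rule supp_plin)
  also have "\<dots> \<subseteq> (\<Union>p\<in>supp f. \<Union>q\<in>supp g. supp (sgl (p + q) (\<chi> p q)))"
    by (rule UN_mono[OF order_refl supp_plin])
  also have "\<dots> \<subseteq> {p + q | p q. p \<in> supp f \<and> q \<in> supp g}"
    by (auto split: if_splits)
  finally show ?thesis .
qed

section \<open>Bicharacters on exponents: associativity, centre, cancellation\<close>

type_synonym tri = "nat \<times> nat \<times> nat"
type_synonym tpoly = "tri \<Rightarrow>\<^sub>0 complex"

text \<open>A bimultiplicative \<chi> is in particular a 2-cocycle, which gives associativity of the
  twisted product; nonvanishing keeps products of monomials nonzero.\<close>

locale bicharacter =
  fixes \<chi> :: "tri \<Rightarrow> tri \<Rightarrow> complex"
  assumes chi_add_left: "\<chi> (p + q) r = \<chi> p r * \<chi> q r"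
    and chi_add_right: "\<chi> p (q + r) = \<chi> p q * \<chi> p r"
    and chi_nz [simp]: "\<chi> p q \<noteq> 0"
begin

abbreviation tm :: "tpoly \<Rightarrow> tpoly \<Rightarrow> tpoly" (infixl \<open>\<star>\<close> 70) where
  "f \<star> g \<equiv> tmult \<chi> f g"

lemma chi_0 [simp]: "\<chi> 0 q = 1" "\<chi> p 0 = 1"
  using chi_add_left[of 0 0 q] chi_add_right[of p 0 0] by simp_all

lemma chi_00 [simp]: "\<chi> (0, 0, 0) q = 1" "\<chi> p (0, 0, 0) = 1"
  using chi_0 by (simp_all add: zero_prod_def)

lemma tm_assoc: "(f \<star> g) \<star> h = f \<star> (g \<star> h)"
proof (induction f rule: poly_mapping_additive_induct)
  case (single p a)
  show ?case
  proof (induction g rule: poly_mapping_additive_induct)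
    case (single q b)
    show ?case
      by (induction h rule: poly_mapping_additive_induct)
        (simp_all add: tmult_add_right chi_add_left chi_add_right ac_simps)
  qed (simp add: tmult_add_right tmult_add_left)
qed (simp add: tmult_add_left)

lemma tm_one [simp]: "1 \<star> f = f" "f \<star> 1 = f"
  unfolding single_one[symmetric]
  by (induction f rule: poly_mapping_additive_induct)
    (simp_all add: tmult_add_right tmult_add_left del: single_one)

definition Cset :: "tri set" where
  "Cset = {p. \<forall>q. \<chi> p q = \<chi> q p}"

definition Zset :: "tpoly set" where
  "Zset = {f. supp f \<subseteq> Cset}"

lemma Cset_0 [simp]: "0 \<in> Cset" "(0, 0, 0) \<in> Cset"
  by (simp_all add: Cset_def)

lemma Cset_add: "p \<in> Cset \<Longrightarrow> q \<in> Cset \<Longrightarrow> p + q \<in> Cset"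
  by (simp add: Cset_def chi_add_left chi_add_right)

text \<open>Both sides of the commutation condition are multiplicative and nonzero, so a central
  factor can be divided out. Hence a central shift never turns a noncentral exponent into a central
  one.\<close>

lemma Cset_add_cancel: "p + q \<in> Cset \<Longrightarrow> q \<in> Cset \<Longrightarrow> p \<in> Cset"
  by (auto simp: Cset_def chi_add_left chi_add_right)

lemma Zset_sgl [simp]: "p \<in> Cset \<Longrightarrow> sgl p c \<in> Zset"
  by (simp add: Zset_def)

lemma Zset_0_1 [simp]: "0 \<in> Zset" "1 \<in> Zset"
  by (simp_all add: Zset_def)

lemma Zset_add [simp]: "f \<in> Zset \<Longrightarrow> g \<in> Zset \<Longrightarrow> f + g \<in> Zset"
  using keys_add[of f g] by (auto simp: Zset_def)

lemma Zset_scal [simp]: "f \<in> Zset \<Longrightarrow> scal c f \<in> Zset"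
  using supp_scal_subset[of c f] by (auto simp: Zset_def)

lemma Zset_sum: "(\<And>a. a \<in> A \<Longrightarrow> f a \<in> Zset) \<Longrightarrow> sum f A \<in> Zset"
  by (induction A rule: infinite_finite_induct) auto

lemma Zset_plin: "(\<And>p. p \<in> supp f \<Longrightarrow> h p \<in> Zset) \<Longrightarrow> plin h f \<in> Zset"
  unfolding plin_def by (rule Zset_sum) auto

lemma Zset_tm [simp]: "f \<in> Zset \<Longrightarrow> g \<in> Zset \<Longrightarrow> f \<star> g \<in> Zset"
  using supp_tmult[of \<chi> f g] Cset_add by (fastforce simp: Zset_def)

lemma Zset_commute:
  assumes "f \<in> Zset"
  shows "f \<star> g = g \<star> f"
proof (induction g rule: poly_mapping_additive_induct)
  case (single q b)
  have "f \<star> sgl q b = plin (\<lambda>p. sgl p 1 \<star> sgl q b) f"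
    by (simp add: tmult_def)
  also have "\<dots> = plin (\<lambda>p. sgl q b \<star> sgl p 1) f"
  proof (rule plin_cong)
    fix p assume "p \<in> supp f"
    then have "\<chi> p q = \<chi> q p" using assms unfolding Zset_def Cset_def by blast
    then show "sgl p 1 \<star> sgl q b = sgl q b \<star> sgl p 1" by (simp add: add.commute)
  qed
  also have "\<dots> = sgl q b \<star> f"
    by (simp add: tmult_def flip: plin_scal_fun)
  finally show ?case .
qed (simp add: tmult_add_right tmult_add_left)

lemma Zset_left_commute:
  assumes "f \<in> Zset"
  shows "f \<star> (g \<star> h) = g \<star> (f \<star> h)"
  using Zset_commute[OF assms, of g] by (simp flip: tm_assoc)

text \<open>Addition of exponents is cancellative, so multiplication by a monomial moves
  coefficients without mixing them.\<close>

lemma coef_tm_sgl: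
  "coef (f \<star> sgl q b) (p + q) = coef f p * b * \<chi> p q"
  "coef (sgl q b \<star> f) (p + q) = coef f p * b * \<chi> q p"
proof -
  have inj: "a + q = p + q \<longleftrightarrow> a = p" "q + a = p + q \<longleftrightarrow> a = p" for a
    by (cases a; cases p; cases q; auto)+
  show "coef (f \<star> sgl q b) (p + q) = coef f p * b * \<chi> p q"
    "coef (sgl q b \<star> f) (p + q) = coef f p * b * \<chi> q p"
    by (induction f rule: poly_mapping_additive_induct)
      (auto simp: tmult_add_left tmult_add_right lookup_single lookup_add inj when_def algebra_simps)
qed

text \<open>Commutation with a monomial can be tested at each coefficient separately, by
  \<open>coef_tm_sgl\<close>; thus every monomial of a central element is itself central.\<close>

lemma Zset_iff_commutes: "f \<in> Zset \<longleftrightarrow> (\<forall>g. f \<star> g = g \<star> f)"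
proof
  assume h: "\<forall>g. f \<star> g = g \<star> f"
  show "f \<in> Zset" unfolding Zset_def Cset_def
  proof (safe)
    fix i j k i' j' k' :: nat assume p: "(i, j, k) \<in> supp f"
    let ?p = "(i, j, k)" and ?q = "(i', j', k')"
    have "f \<star> sgl ?q 1 = sgl ?q 1 \<star> f" using h by blast
    then have "coef f ?p * 1 * \<chi> ?p ?q = coef f ?p * 1 * \<chi> ?q ?p"
      unfolding coef_tm_sgl(1)[symmetric] coef_tm_sgl(2)[symmetric] by simp
    then show "\<chi> ?p ?q = \<chi> ?q ?p" using p by (simp add: in_keys_iff)
  qed
qed (use Zset_commute in blast)

text \<open>Leading terms for the lexicographic order: the coefficient at the sum
  \<open>P + Q\<close> of the two leading exponents receives the contribution of a single pair, and
  \<chi> does not vanish there.\<close>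

lemma tm_eq_0_iff: "f \<star> g = 0 \<longleftrightarrow> f = 0 \<or> g = 0"
proof
  assume h: "f \<star> g = 0"
  show "f = 0 \<or> g = 0"
  proof (rule ccontr)
    assume "\<not> (f = 0 \<or> g = 0)"
    then have ne: "supp f \<noteq> {}" "supp g \<noteq> {}" by auto
    define P Q where "P = Max (supp f)" and "Q = Max (supp g)"
    have P: "P \<in> supp f" and Q: "Q \<in> supp g" using ne by (simp_all add: P_def Q_def)
    have max: "p \<le> P" "q \<le> Q" if "p \<in> supp f" "q \<in> supp g" for p q
      using that by (simp_all add: P_def Q_def)
    have key: "p = P \<and> q = Q" if "p \<in> supp f" "q \<in> supp g" "p + q = P + Q" for p q
      using max[OF that(1,2)] that(3)
      by (cases p; cases q; cases P; cases Q) (auto simp: less_eq_prod_def)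
    have "0 = coef (f \<star> g) (P + Q)" using h by simp
    also have "\<dots> = (\<Sum>p\<in>supp f. coef f p * (\<Sum>q\<in>supp g. coef g q * (\<chi> p q when p + q = P + Q)))"
      by (simp add: tmult_def coef_plin lin_def lookup_single)
    also have "\<dots> = (\<Sum>p\<in>supp f. if p = P then coef f p * (coef g Q * \<chi> p Q) else 0)"
    proof (rule sum.cong[OF refl])
      fix p assume p: "p \<in> supp f"
      have "(\<Sum>q\<in>supp g. coef g q * (\<chi> p q when p + q = P + Q)) =
        (\<Sum>q\<in>supp g. if q = Q then (if p = P then coef g q * \<chi> p q else 0) else 0)"
        by (rule sum.cong) (use key[OF p] in \<open>auto simp: when_def\<close>)
      then show "coef f p * (\<Sum>q\<in>supp g. coef g q * (\<chi> p q when p + q = P + Q)) =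
        (if p = P then coef f p * (coef g Q * \<chi> p Q) else 0)" using Q by (simp add: sum.delta)
    qed
    also have "\<dots> = coef f P * (coef g Q * \<chi> P Q)" using P by (simp add: sum.delta)
    finally show False using P Q by (auto simp: in_keys_iff)
  qed
qed auto

lemma tm_diff_right: "f \<star> (g - h) = f \<star> g - f \<star> h"
  using tmult_add_right[of \<chi> f "g - h" h] by (simp add: algebra_simps)

lemma tm_cancel: "f \<star> g = f \<star> h \<Longrightarrow> f \<noteq> 0 \<Longrightarrow> g = h"
  using tm_eq_0_iff[of f "g - h"] by (simp add: tm_diff_right)

subsection \<open>The trace of left multiplication\<close>

text \<open>Linear independence over the fraction field of the centre; after clearing denominators
  the coefficients may be taken in the centre itself.\<close>

definition indep :: "nat \<Rightarrow> (nat \<Rightarrow> tpoly) \<Rightarrow> bool" where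
  "indep m e \<longleftrightarrow> (\<forall>c \<in> {..<m} \<rightarrow> Zset. (\<Sum>i<m. c i \<star> e i) = 0 \<longrightarrow> (\<forall>i<m. c i = 0))"

lemma indep_eqD:
  assumes "indep m e" "\<And>i. i < m \<Longrightarrow> c i \<in> Zset" "\<And>i. i < m \<Longrightarrow> d i \<in> Zset"
    "(\<Sum>i<m. c i \<star> e i) = (\<Sum>i<m. d i \<star> e i)" "i < m"
  shows "c i = d i"
proof -
  let ?b = "\<lambda>i. c i + scal (- 1) (d i)"
  have "(\<Sum>i<m. ?b i \<star> e i) = (\<Sum>i<m. c i \<star> e i) + scal (- 1) (\<Sum>i<m. d i \<star> e i)"
    by (simp add: tmult_add_left tmult_scal_left sum.distrib scal_sum)
  also have "\<dots> = 0" unfolding assms(4) by (rule poly_mapping_eqI) (simp add: lookup_add)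
  finally have "?b i = 0" using assms unfolding indep_def by auto
  then have "coef (?b i) p = 0" for p by simp
  then show ?thesis by (intro poly_mapping_eqI) (simp add: lookup_add)
qed

text \<open>Membership of \<open>a\<close> in the span over the fraction field of the centre, with
  \<open>s\<close> as a denominator that works.\<close>

definition span_den :: "nat \<Rightarrow> (nat \<Rightarrow> tpoly) \<Rightarrow> tpoly \<Rightarrow> tpoly \<Rightarrow> bool" where
  "span_den m e s a \<longleftrightarrow> (\<exists>c. (\<forall>i<m. c i \<in> Zset) \<and> s \<star> a = (\<Sum>i<m. c i \<star> e i))"

lemma span_den_mult:
  assumes "span_den m e s a" "t \<in> Zset" "s \<in> Zset"
  shows "span_den m e (s \<star> t) a"
proof -
  obtain c where c: "\<forall>i<m. c i \<in> Zset" "s \<star> a = (\<Sum>i<m. c i \<star> e i)"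
    using assms(1) by (auto simp: span_den_def)
  have "(s \<star> t) \<star> a = t \<star> (s \<star> a)"
    using Zset_commute[OF assms(2), of s] by (simp add: tm_assoc[symmetric])
  also have "\<dots> = (\<Sum>i<m. (t \<star> c i) \<star> e i)" by (simp add: c(2) tmult_sum_right tm_assoc)
  finally show ?thesis unfolding span_den_def
    using c(1) assms(2) by (intro exI[of _ "\<lambda>i. t \<star> c i"]) auto
qed

text \<open>The product of the individual denominators serves; it is nonzero because there are no
  zero divisors.\<close>

lemma common_denominator:
  fixes k m :: nat and f :: "nat \<Rightarrow> tpoly"
  assumes "\<And>i. i < k \<Longrightarrow> \<exists>s\<in>Zset - {0}. span_den m e s (f i)"
  shows "\<exists>s\<in>Zset - {0}. \<forall>i<k. span_den m e s (f i)"
  using assms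
proof (induction k)
  case 0
  show ?case by (intro bexI[of _ 1]) auto
next
  case (Suc k)
  then obtain s where s: "s \<in> Zset" "s \<noteq> 0" "\<forall>i<k. span_den m e s (f i)" by auto
  obtain t where t: "t \<in> Zset" "t \<noteq> 0" "span_den m e t (f k)" using Suc.prems[of k] by auto
  have "span_den m e (s \<star> t) (f i)" if "i < Suc k" for i
  proof (cases "i < k")
    case True
    then show ?thesis using span_den_mult[OF _ t(1) s(1)] s(3) by blast
  next
    case False
    then have "i = k" using that by simp
    then show ?thesis using span_den_mult[OF t(3) s(1) t(1)] Zset_commute[OF s(1), of t] by simp
  qed
  then show ?case using s t by (intro bexI[of _ "s \<star> t"]) (auto simp: tm_eq_0_iff)
qed

text \<open>Here \<open>P / p\<close> and \<open>Q / q\<close> are the two base change matrices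
  between \<open>e\<close> and \<open>f\<close>. Expanding \<open>p q f i\<close> in the family
  \<open>f\<close> in two ways shows that they are inverse to each other, with the denominators kept
  on the right.\<close>

lemma base_change_product:
  assumes ind: "indep m f"
    and P: "\<And>i j. i < m \<Longrightarrow> j < m \<Longrightarrow> P i j \<in> Zset" and Q: "\<And>i j. i < m \<Longrightarrow> j < m \<Longrightarrow> Q i j \<in> Zset"
    and p: "p \<in> Zset" "\<And>j. j < m \<Longrightarrow> p \<star> e j = (\<Sum>i<m. P i j \<star> f i)"
    and q: "q \<in> Zset" "\<And>i. i < m \<Longrightarrow> q \<star> f i = (\<Sum>k<m. Q k i \<star> e k)"
    and l: "l < m" and i: "i < m"
  shows "(\<Sum>k<m. P l k \<star> Q k i) = (if l = i then p \<star> q else 0)"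
proof -
  have "(\<Sum>l<m. (\<Sum>k<m. P l k \<star> Q k i) \<star> f l) = (\<Sum>l<m. \<Sum>k<m. P l k \<star> Q k i \<star> f l)"
    by (simp add: tmult_sum_left)
  also have "\<dots> = (\<Sum>k<m. \<Sum>l<m. P l k \<star> Q k i \<star> f l)" by (rule sum.swap)
  also have "\<dots> = (\<Sum>k<m. Q k i \<star> (\<Sum>l<m. P l k \<star> f l))"
    by (intro sum.cong refl) (simp add: tmult_sum_right tm_assoc Zset_left_commute[OF Q] i)
  also have "\<dots> = (\<Sum>k<m. Q k i \<star> (p \<star> e k))" using p(2) by simp
  also have "\<dots> = p \<star> (\<Sum>k<m. Q k i \<star> e k)"
    by (simp add: tmult_sum_right Zset_left_commute[OF p(1)])
  also have "\<dots> = p \<star> q \<star> f i" using q(2)[OF i] by (simp add: tm_assoc)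
  also have "\<dots> = (\<Sum>l<m. (if l = i then p \<star> q else 0) \<star> f l)"
    using i by (simp add: if_distrib[of "\<lambda>x. x \<star> _"] cong: if_cong)
  finally have eq: "(\<Sum>l<m. (\<Sum>k<m. P l k \<star> Q k i) \<star> f l) = (\<Sum>l<m. (if l = i then p \<star> q else 0) \<star> f l)" .
  show ?thesis
    by (rule indep_eqD[OF ind _ _ eq l]) (use P Q p(1) q(1) i in \<open>auto intro!: Zset_sum\<close>)
qed

text \<open>The matrices \<open>c / s\<close> and \<open>d / t\<close> of left multiplication by
  \<open>a\<close> are conjugate under the base change, hence have equal trace. The argument is run
  over the centre and the common factor \<open>p q\<close> is cancelled at the end.\<close>

lemma trace_independent_of_basis:
  assumes ie: "indep m e" and if': "indep m f"
    and fe: "\<And>i. i < m \<Longrightarrow> \<exists>s\<in>Zset - {0}. span_den m e s (f i)"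
    and ef: "\<And>i. i < m \<Longrightarrow> \<exists>s\<in>Zset - {0}. span_den m f s (e i)"
    and c: "\<And>i j. i < m \<Longrightarrow> j < m \<Longrightarrow> c i j \<in> Zset" and d: "\<And>i j. i < m \<Longrightarrow> j < m \<Longrightarrow> d i j \<in> Zset"
    and s: "s \<in> Zset" "\<And>j. j < m \<Longrightarrow> s \<star> (a \<star> e j) = (\<Sum>i<m. c i j \<star> e i)"
    and t: "t \<in> Zset" "\<And>j. j < m \<Longrightarrow> t \<star> (a \<star> f j) = (\<Sum>i<m. d i j \<star> f i)"
  shows "s \<star> (\<Sum>i<m. d i i) = t \<star> (\<Sum>i<m. c i i)"
proof -
  obtain p where p: "p \<in> Zset" "p \<noteq> 0" "\<forall>i<m. span_den m f p (e i)"
    using common_denominator[of m m f e] ef by auto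
  then have "\<forall>j. \<exists>P. j < m \<longrightarrow> (\<forall>i<m. P i \<in> Zset) \<and> p \<star> e j = (\<Sum>i<m. P i \<star> f i)"
    unfolding span_den_def by blast
  then obtain P' where P': "\<And>j. j < m \<Longrightarrow> (\<forall>i<m. P' j i \<in> Zset) \<and> p \<star> e j = (\<Sum>i<m. P' j i \<star> f i)"
    by metis
  obtain q where q: "q \<in> Zset" "q \<noteq> 0" "\<forall>i<m. span_den m e q (f i)"
    using common_denominator[of m m e f] fe by auto
  then have "\<forall>j. \<exists>Q. j < m \<longrightarrow> (\<forall>i<m. Q i \<in> Zset) \<and> q \<star> f j = (\<Sum>i<m. Q i \<star> e i)"
    unfolding span_den_def by blast
  then obtain Q' where Q': "\<And>j. j < m \<Longrightarrow> (\<forall>i<m. Q' j i \<in> Zset) \<and> q \<star> f j = (\<Sum>i<m. Q' j i \<star> e i)"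
    by metis
  define P Q where "P = (\<lambda>i j. P' j i)" and "Q = (\<lambda>i j. Q' j i)"
  have PZ: "P i j \<in> Zset" and QZ: "Q i j \<in> Zset" if "i < m" "j < m" for i j
    using P' Q' that by (auto simp: P_def Q_def)
  have Pe: "p \<star> e j = (\<Sum>i<m. P i j \<star> f i)" and Qf: "q \<star> f j = (\<Sum>i<m. Q i j \<star> e i)" if "j < m" for j
    using P' Q' that by (auto simp: P_def Q_def)
  have PQ: "(\<Sum>k<m. P l k \<star> Q k i) = (if l = i then p \<star> q else 0)" if "l < m" "i < m" for l i
    by (rule base_change_product[OF if' PZ QZ p(1) Pe q(1) Qf that])
  have QP: "(\<Sum>k<m. Q l k \<star> P k i) = (if l = i then q \<star> p else 0)" if "l < m" "i < m" for l i
    by (rule base_change_product[OF ie QZ PZ q(1) Qf p(1) Pe that])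
  \<comment> \<open>The intertwining relation \<open>dP = Pc\<close> with denominators: both sides
    are the coordinates of \<open>s t p a e j\<close> in the family \<open>f\<close>.\<close>
  have dP: "s \<star> (\<Sum>i<m. d l i \<star> P i j) = t \<star> (\<Sum>i<m. P l i \<star> c i j)" if l: "l < m" and j: "j < m" for l j
  proof -
    have "(\<Sum>l<m. (s \<star> (\<Sum>i<m. d l i \<star> P i j)) \<star> f l) = s \<star> (\<Sum>l<m. \<Sum>i<m. d l i \<star> P i j \<star> f l)"
      by (simp add: tmult_sum_left tmult_sum_right tm_assoc)
    also have "(\<Sum>l<m. \<Sum>i<m. d l i \<star> P i j \<star> f l) = (\<Sum>i<m. \<Sum>l<m. d l i \<star> P i j \<star> f l)"
      by (rule sum.swap)
    also have "\<dots> = (\<Sum>i<m. P i j \<star> (\<Sum>l<m. d l i \<star> f l))"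
      by (intro sum.cong refl) (simp add: tmult_sum_right tm_assoc Zset_left_commute[OF PZ] j)
    also have "\<dots> = (\<Sum>i<m. P i j \<star> (t \<star> (a \<star> f i)))" using t(2) by simp
    also have "\<dots> = t \<star> (a \<star> (\<Sum>i<m. P i j \<star> f i))"
      by (simp add: tmult_sum_right Zset_left_commute[OF PZ] j)
    also have "\<dots> = t \<star> (a \<star> (p \<star> e j))" using Pe[OF j] by simp
    also have "\<dots> = t \<star> (p \<star> (a \<star> e j))" unfolding Zset_left_commute[OF p(1), of a] ..
    also have "s \<star> \<dots> = t \<star> (p \<star> (s \<star> (a \<star> e j)))"
      unfolding Zset_left_commute[OF s(1), of t] Zset_left_commute[OF s(1), of p] ..
    also have "\<dots> = t \<star> (p \<star> (\<Sum>i<m. c i j \<star> e i))" using s(2)[OF j] by simp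
    also have "\<dots> = t \<star> (\<Sum>i<m. c i j \<star> (p \<star> e i))"
      by (simp add: tmult_sum_right Zset_left_commute[OF p(1)])
    also have "\<dots> = t \<star> (\<Sum>i<m. c i j \<star> (\<Sum>l<m. P l i \<star> f l))" using Pe by simp
    also have "\<dots> = t \<star> (\<Sum>i<m. \<Sum>l<m. P l i \<star> c i j \<star> f l)"
      by (intro arg_cong[of _ _ "\<lambda>x. t \<star> x"] sum.cong refl)
        (simp add: tmult_sum_right tm_assoc Zset_left_commute[OF c] j)
    also have "\<dots> = t \<star> (\<Sum>l<m. \<Sum>i<m. P l i \<star> c i j \<star> f l)" by (subst sum.swap) (rule refl)
    also have "\<dots> = (\<Sum>l<m. (t \<star> (\<Sum>i<m. P l i \<star> c i j)) \<star> f l)"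
      by (simp add: tmult_sum_left tmult_sum_right tm_assoc)
    finally have eq: "(\<Sum>l<m. (s \<star> (\<Sum>i<m. d l i \<star> P i j)) \<star> f l) = (\<Sum>l<m. (t \<star> (\<Sum>i<m. P l i \<star> c i j)) \<star> f l)" .
    show ?thesis
      by (rule indep_eqD[OF if' _ _ eq l]) (use j PZ c d s(1) t(1) in \<open>auto intro!: Zset_sum Zset_tm\<close>)
  qed
  \<comment> \<open>The relation \<open>dP\<close> is multiplied by \<open>Q\<close> and the trace
    is taken. On this side \<open>PQ = pq\<close> leaves the trace of \<open>d\<close>; on the other
    side the trace of \<open>PcQ\<close> is first rotated to that of \<open>cQP\<close>.\<close>
  have "(\<Sum>l<m. \<Sum>j<m. (s \<star> (\<Sum>i<m. d l i \<star> P i j)) \<star> Q j l)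
      = s \<star> (\<Sum>l<m. \<Sum>j<m. \<Sum>i<m. d l i \<star> (P i j \<star> Q j l))"
    by (simp add: tmult_sum_left tmult_sum_right tm_assoc)
  also have "(\<Sum>l<m. \<Sum>j<m. \<Sum>i<m. d l i \<star> (P i j \<star> Q j l)) = (\<Sum>l<m. \<Sum>i<m. d l i \<star> (\<Sum>j<m. P i j \<star> Q j l))"
    unfolding tmult_sum_right by (rule sum.cong[OF refl]) (rule sum.swap)
  also have "\<dots> = (\<Sum>l<m. \<Sum>i<m. if i = l then d l l \<star> (p \<star> q) else 0)"
    by (intro sum.cong refl) (simp add: PQ)
  also have "\<dots> = (\<Sum>l<m. d l l) \<star> (p \<star> q)"
    by (simp add: tmult_sum_left)
  finally have L: "(\<Sum>l<m. \<Sum>j<m. (s \<star> (\<Sum>i<m. d l i \<star> P i j)) \<star> Q j l) = s \<star> ((\<Sum>l<m. d l l) \<star> (p \<star> q))" .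
  have "(\<Sum>l<m. \<Sum>j<m. (t \<star> (\<Sum>i<m. P l i \<star> c i j)) \<star> Q j l)
      = t \<star> (\<Sum>l<m. \<Sum>j<m. \<Sum>i<m. c i j \<star> (Q j l \<star> P l i))"
    unfolding tmult_sum_left tmult_sum_right tm_assoc
  proof (intro sum.cong refl)
    fix l j i assume "l \<in> {..<m}" "j \<in> {..<m}" "i \<in> {..<m}"
    then have m: "l < m" "j < m" "i < m" by auto
    have "P l i \<star> (c i j \<star> Q j l) = (c i j \<star> Q j l) \<star> P l i" by (rule Zset_commute[OF PZ[OF m(1,3)]])
    then show "t \<star> (P l i \<star> (c i j \<star> Q j l)) = t \<star> (c i j \<star> (Q j l \<star> P l i))" by (simp add: tm_assoc)
  qed
  also have "(\<Sum>l<m. \<Sum>j<m. \<Sum>i<m. c i j \<star> (Q j l \<star> P l i)) = (\<Sum>j<m. \<Sum>l<m. \<Sum>i<m. c i j \<star> (Q j l \<star> P l i))"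
    by (rule sum.swap)
  also have "\<dots> = (\<Sum>j<m. \<Sum>i<m. c i j \<star> (\<Sum>l<m. Q j l \<star> P l i))"
    unfolding tmult_sum_right by (rule sum.cong[OF refl]) (rule sum.swap)
  also have "\<dots> = (\<Sum>j<m. \<Sum>i<m. if i = j then c j j \<star> (q \<star> p) else 0)"
    by (intro sum.cong refl) (simp add: QP)
  also have "\<dots> = (\<Sum>j<m. c j j) \<star> (q \<star> p)"
    by (simp add: tmult_sum_left)
  finally have R: "(\<Sum>l<m. \<Sum>j<m. (t \<star> (\<Sum>i<m. P l i \<star> c i j)) \<star> Q j l) = t \<star> ((\<Sum>l<m. c l l) \<star> (q \<star> p))" .
  have "s \<star> ((\<Sum>l<m. d l l) \<star> (p \<star> q)) = t \<star> ((\<Sum>l<m. c l l) \<star> (q \<star> p))"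
    unfolding L[symmetric] R[symmetric] by (intro sum.cong refl) (simp add: dP)
  also have "q \<star> p = p \<star> q" by (rule Zset_commute[OF q(1)])
  finally have "(s \<star> (\<Sum>l<m. d l l)) \<star> (p \<star> q) = (t \<star> (\<Sum>l<m. c l l)) \<star> (p \<star> q)"
    by (simp only: tm_assoc)
  \<comment> \<open>The central factor is moved to the front, the side on which cancellation is
    available.\<close>
  then have "(p \<star> q) \<star> (s \<star> (\<Sum>l<m. d l l)) = (p \<star> q) \<star> (t \<star> (\<Sum>l<m. c l l))"
    unfolding Zset_commute[OF Zset_tm[OF p(1) q(1)], of "s \<star> (\<Sum>l<m. d l l)"]
      Zset_commute[OF Zset_tm[OF p(1) q(1)], of "t \<star> (\<Sum>l<m. c l l)"] .
  then show ?thesis by (rule tm_cancel) (use p q in \<open>simp add: tm_eq_0_iff\<close>)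
qed

end

lemma sgl_eq_0_iff [simp]: "sgl p c = 0 \<longleftrightarrow> c = 0"
  using keys_single[of p c] by (metis empty_not_insert keys_eq_empty)

section \<open>Algebras with a twisted monomial basis\<close>

text \<open>An algebra given by coordinates in a twisted monoid algebra. Everything about centre,
  reduced trace and representations is done once here and used for \<open>A\<close> as well as for
  the charts, whose elements are of quite different types.\<close>

locale coord_algebra = bicharacter \<chi> for \<chi> +
  fixes R :: "(complex, 'r) module" and \<kappa> :: "tpoly \<Rightarrow> 'r"
  assumes kap_bij: "bij_betw \<kappa> UNIV (carrier R)"
    and kap_add: "\<kappa> f \<oplus>\<^bsub>R\<^esub> \<kappa> g = \<kappa> (f + g)"
    and kap_mult: "\<kappa> f \<otimes>\<^bsub>R\<^esub> \<kappa> g = \<kappa> (f \<star> g)"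
    and kap_smult: "c \<odot>\<^bsub>R\<^esub> \<kappa> f = \<kappa> (scal c f)"
    and kap_zero: "\<zero>\<^bsub>R\<^esub> = \<kappa> 0"
    and kap_one: "\<one>\<^bsub>R\<^esub> = \<kappa> 1"
begin

lemma kap_closed [simp]: "\<kappa> f \<in> carrier R"
  using kap_bij by (auto simp: bij_betw_def)

lemma kap_eq_iff [simp]: "\<kappa> f = \<kappa> g \<longleftrightarrow> f = g"
  using kap_bij by (auto simp: bij_betw_def inj_def)

lemma carrier_eq: "carrier R = range \<kappa>"
  using kap_bij by (auto simp: bij_betw_def)

lemma carrierE:
  assumes "a \<in> carrier R"
  obtains f where "a = \<kappa> f"
  using assms by (auto simp: carrier_eq)

definition crd :: "'r \<Rightarrow> tpoly" where "crd = inv_into UNIV \<kappa>"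

lemma crd_kap [simp]: "crd (\<kappa> f) = f"
  unfolding crd_def by (rule inv_f_f) (auto simp: inj_def)

lemma kap_crd: "a \<in> carrier R \<Longrightarrow> \<kappa> (crd a) = a"
  by (auto simp: carrier_eq)

lemma ring_R: "ring R"
proof (rule ringI)
  show "abelian_group R"
  proof (rule abelian_groupI)
    fix x assume "x \<in> carrier R"
    then obtain f where "x = \<kappa> f" by (rule carrierE)
    then show "\<exists>y\<in>carrier R. y \<oplus>\<^bsub>R\<^esub> x = \<zero>\<^bsub>R\<^esub>"
      by (intro bexI[of _ "\<kappa> (- f)"]) (simp_all add: kap_add kap_zero)
  qed (auto elim!: carrierE simp: kap_add kap_zero add.assoc add.commute)
  show "Group.monoid R"
    by (rule monoidI) (auto elim!: carrierE simp: kap_mult kap_one tm_assoc)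
qed (auto elim!: carrierE simp: kap_mult kap_add tmult_add_left tmult_add_right)

sublocale ring R by (rule ring_R)

lemma finsum_kap:
  assumes "\<And>i. i \<in> A \<Longrightarrow> g i = \<kappa> (f i)"
  shows "finsum R g A = \<kappa> (sum f A)"
  using assms
proof (induction A rule: infinite_finite_induct)
  case (insert x F)
  then show ?case by (subst finsum_insert) (auto simp: kap_add)
qed (simp_all add: kap_zero)

lemma add_pow_kap: "add_pow R (k::nat) (\<kappa> f) = \<kappa> (scal (of_nat k) f)"
proof (induction k)
  case (Suc k)
  have "scal (of_nat (Suc k)) f = scal (of_nat k) f + f"
    by (rule poly_mapping_eqI) (simp add: lookup_add algebra_simps)
  with Suc show ?case by (simp add: kap_add add.nat_pow_Suc)
qed (simp add: kap_zero)

lemma centre_eq: "centre R = \<kappa> ` Zset"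
  by (auto simp: centre_def Zset_iff_commutes carrier_eq kap_mult)

lemma kap_in_centre [simp]: "\<kappa> f \<in> centre R \<longleftrightarrow> f \<in> Zset"
  by (auto simp: centre_eq)

lemma centre_crd: "c \<in> centre R \<Longrightarrow> \<kappa> (crd c) = c" "c \<in> centre R \<Longrightarrow> crd c \<in> Zset"
  by (auto simp: centre_eq)

lemma frac_basis_iff:
  assumes "\<And>i. i < m \<Longrightarrow> e i = \<kappa> (e' i)"
  shows "frac_basis R m e \<longleftrightarrow> indep m e' \<and> (\<forall>a. \<exists>s\<in>Zset - {0}. span_den m e' s a)"
proof -
  have sum: "(\<Oplus>\<^bsub>R\<^esub>i\<in>{..<m}. \<kappa> (c i) \<otimes>\<^bsub>R\<^esub> e i) = \<kappa> (\<Sum>i<m. c i \<star> e' i)" for c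
    by (rule finsum_kap) (simp add: assms kap_mult)
  have crd: "(\<Oplus>\<^bsub>R\<^esub>i\<in>{..<m}. c i \<otimes>\<^bsub>R\<^esub> e i) = \<kappa> (\<Sum>i<m. crd (c i) \<star> e' i)"
    if "c \<in> {..<m} \<rightarrow> centre R" for c
  proof (rule finsum_kap)
    fix i assume i: "i \<in> {..<m}"
    then have "c i \<in> centre R" using that by auto
    then have "c i = \<kappa> (crd (c i))" by (simp add: centre_crd)
    then show "c i \<otimes>\<^bsub>R\<^esub> e i = \<kappa> (crd (c i) \<star> e' i)" using assms i kap_mult by (metis lessThan_iff)
  qed
  have 1: "e \<in> {..<m} \<rightarrow> carrier R" using assms by simp
  have 2: "(\<forall>c \<in> {..<m} \<rightarrow> centre R. (\<Oplus>\<^bsub>R\<^esub>i\<in>{..<m}. c i \<otimes>\<^bsub>R\<^esub> e i) = \<zero>\<^bsub>R\<^esub> \<longrightarrow> (\<forall>i<m. c i = \<zero>\<^bsub>R\<^esub>))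
      \<longleftrightarrow> indep m e'" (is "?L \<longleftrightarrow> _")
  proof
    assume L: ?L
    show "indep m e'" unfolding indep_def
    proof (intro ballI impI)
      fix c assume c: "c \<in> {..<m} \<rightarrow> Zset" "(\<Sum>i<m. c i \<star> e' i) = 0"
      then show "\<forall>i<m. c i = 0"
        using L[rule_format, of "\<lambda>i. \<kappa> (c i)"] by (auto simp: sum kap_zero Pi_iff)
    qed
  next
    assume ind: "indep m e'"
    show ?L
    proof (intro ballI impI)
      fix c assume c: "c \<in> {..<m} \<rightarrow> centre R" "(\<Oplus>\<^bsub>R\<^esub>i\<in>{..<m}. c i \<otimes>\<^bsub>R\<^esub> e i) = \<zero>\<^bsub>R\<^esub>"
      have "(\<lambda>i. crd (c i)) \<in> {..<m} \<rightarrow> Zset" using Pi_mem[OF c(1)] by (auto intro: centre_crd(2))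
      moreover have "(\<Sum>i<m. crd (c i) \<star> e' i) = 0" using c(2) crd[OF c(1)] by (simp add: kap_zero)
      ultimately have "\<forall>i<m. crd (c i) = 0"
        using ind[unfolded indep_def, THEN bspec, of "\<lambda>i. crd (c i)"] by blast
      moreover have "c i = \<kappa> (crd (c i))" if "i < m" for i
        using Pi_mem[OF c(1), of i] that by (simp add: centre_crd)
      ultimately show "\<forall>i<m. c i = \<zero>\<^bsub>R\<^esub>" by (metis kap_zero)
    qed
  qed
  have 3: "(\<exists>s \<in> centre R - {\<zero>\<^bsub>R\<^esub>}. \<exists>c \<in> {..<m} \<rightarrow> centre R.
        s \<otimes>\<^bsub>R\<^esub> \<kappa> a = (\<Oplus>\<^bsub>R\<^esub>i\<in>{..<m}. c i \<otimes>\<^bsub>R\<^esub> e i)) \<longleftrightarrow> (\<exists>s\<in>Zset - {0}. span_den m e' s a)"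
    (is "?L \<longleftrightarrow> ?R") for a
  proof
    assume ?L
    then obtain s c where s: "s \<in> centre R" "s \<noteq> \<zero>\<^bsub>R\<^esub>" and c: "c \<in> {..<m} \<rightarrow> centre R"
      and eq: "s \<otimes>\<^bsub>R\<^esub> \<kappa> a = (\<Oplus>\<^bsub>R\<^esub>i\<in>{..<m}. c i \<otimes>\<^bsub>R\<^esub> e i)" by blast
    obtain s' where s': "s = \<kappa> s'" "s' \<in> Zset" using s(1) by (auto simp: centre_eq)
    have "span_den m e' s' a" unfolding span_den_def
      by (rule exI[of _ "\<lambda>i. crd (c i)"])
        (use eq crd[OF c] Pi_mem[OF c] in \<open>auto simp: s' kap_mult intro: centre_crd(2)\<close>)
    then show ?R using s s' by (auto simp: kap_zero)
  next
    assume ?R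
    then obtain s c where s: "s \<in> Zset" "s \<noteq> 0" and c: "\<forall>i<m. c i \<in> Zset" "s \<star> a = (\<Sum>i<m. c i \<star> e' i)"
      by (auto simp: span_den_def)
    show ?L
      by (rule bexI[of _ "\<kappa> s"], rule bexI[of _ "\<lambda>i. \<kappa> (c i)"])
        (use s c in \<open>auto simp: sum kap_mult kap_zero\<close>)
  qed
  show ?thesis unfolding frac_basis_def using 1 2 3 by (auto simp: carrier_eq)
qed

subsection \<open>The reduced trace\<close>

text \<open>The projection onto the centre along the span of the noncentral monomials.\<close>

definition proj_centre :: "tpoly \<Rightarrow> tpoly" where
  "proj_centre f = plin (\<lambda>p. if p \<in> Cset then sgl p 1 else 0) f"

lemma proj_centre_in_Zset [simp]: "proj_centre f \<in> Zset"
  unfolding proj_centre_def by (rule Zset_plin) auto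

lemma proj_centre_add [simp]: "proj_centre (f + g) = proj_centre f + proj_centre g"
  by (simp add: proj_centre_def)

lemma proj_centre_sgl: "proj_centre (sgl p c) = (if p \<in> Cset then sgl p c else 0)"
  by (simp add: proj_centre_def)

text \<open>The exponents \<open>u t\<close> represent the \<open>n^2\<close> classes modulo central
  exponents; the central shift \<open>z\<close> compensates for the absence of negative exponents.
  Multiplication by a noncentral monomial moves every class to another one and has trace zero; a
  central one acts as a scalar and has trace \<open>n^2\<close> times itself. Dividing by
  \<open>n\<close> leaves the factor \<open>n\<close>.\<close>

lemma reduced_trace_kap:
  assumes n: "n > 0"
    and z: "z \<in> Cset"
    and cover: "\<And>p. \<exists>t<n^2. \<exists>c\<in>Cset. p + z = c + u t"
    and disj: "\<And>c c' t t'. c \<in> Cset \<Longrightarrow> c' \<in> Cset \<Longrightarrow> t < n^2 \<Longrightarrow> t' < n^2 \<Longrightarrow> c + u t = c' + u t' \<Longrightarrow> t = t'"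
  shows "reduced_trace R n (\<kappa> a) = \<kappa> (scal (of_nat n) (proj_centre a))"
proof -
  define m where "m = n^2"
  note cover = cover[folded m_def] and disj = disj[folded m_def]
  obtain T K where TK: "\<And>p. T p < m" "\<And>p. K p \<in> Cset" "\<And>p. p + z = K p + u (T p)"
    using cover by metis
  define f where "f t = sgl (u t) 1" for t
  \<comment> \<open>The coordinate of a monomial at the basis element \<open>u t\<close>: its shift
    by \<open>z\<close> is the central exponent \<open>K p\<close> plus \<open>u (T p)\<close>, and
    the quotient of values of \<chi> corrects the twist.\<close>
  define cc where "cc t = plin (\<lambda>p. if T p = t then sgl (K p) (\<chi> z p / \<chi> (K p) (u t)) else 0)" for t
  have ccZ: "cc t g \<in> Zset" for t g unfolding cc_def by (rule Zset_plin) (auto simp: TK)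
  have expand: "sgl z 1 \<star> g = (\<Sum>t<m. cc t g \<star> f t)" for g
  proof (induction g rule: poly_mapping_additive_induct)
    case (single p c)
    have "(\<Sum>t<m. cc t (sgl p c) \<star> f t) = (\<Sum>t<m. if t = T p then sgl z 1 \<star> sgl p c else 0)"
      by (intro sum.cong refl) (simp add: cc_def f_def TK(3)[symmetric] add.commute)
    then show ?case using TK(1) by simp
  next
    case (add g h)
    then show ?case by (simp add: tmult_add_right cc_def tmult_add_left sum.distrib)
  qed
  \<comment> \<open>A monomial \<open>p\<close> contributes to the diagonal exactly when
    \<open>p + u t\<close> lies again in the class of \<open>u t\<close>, that is, when
    \<open>p\<close> is central.\<close>
  have diag: "cc t (g \<star> f t) = sgl z 1 \<star> proj_centre g" if t: "t < m" for t g
  proof (induction g rule: poly_mapping_additive_induct)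
    case (single p c)
    have eq: "p + u t + z = K (p + u t) + u (T (p + u t))" by (rule TK)
    show ?case
    proof (cases "p \<in> Cset")
      case True
      have "p + z + u t = K (p + u t) + u (T (p + u t))" using eq by (simp add: ac_simps)
      then have T: "T (p + u t) = t" using disj[OF Cset_add[OF True z] TK(2) t TK(1)] by metis
      then have "p + z + u t = K (p + u t) + u t" using eq by (simp add: ac_simps)
      then have K: "K (p + u t) = p + z"
        by (cases "K (p + u t)"; cases p; cases z; cases "u t") auto
      show ?thesis using True
        by (simp add: f_def cc_def T K proj_centre_sgl chi_add_left chi_add_right ac_simps)
    next
      case False
      have "T (p + u t) \<noteq> t"
      proof
        assume "T (p + u t) = t"
        then have "p + z + u t = K (p + u t) + u t" using eq by (simp add: ac_simps)
        then have "K (p + u t) = p + z"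
          by (cases "K (p + u t)"; cases p; cases z; cases "u t") auto
        then have "p + z \<in> Cset" using TK(2) by metis
        then show False using Cset_add_cancel z False by blast
      qed
      then show ?thesis using False by (simp add: f_def cc_def proj_centre_sgl)
    qed
  next
    case (add g h)
    then show ?case by (simp add: tmult_add_right tmult_add_left cc_def)
  qed
  \<comment> \<open>Distinct classes have disjoint exponents, so the coefficient at
    \<open>p + u t\<close> sees only the summand with index \<open>t\<close>.\<close>
  have indf: "indep m f" unfolding indep_def
  proof (intro ballI impI allI)
    fix c t assume c: "c \<in> {..<m} \<rightarrow> Zset" "(\<Sum>i<m. c i \<star> f i) = 0" and t: "t < m"
    have "coef (c t) p = 0" if "p \<in> Cset" for p
    proof -
      have "0 = coef (\<Sum>i<m. c i \<star> f i) (p + u t)" using c(2) by simp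
      also have "\<dots> = (\<Sum>i<m. if i = t then coef (c t) p * \<chi> p (u t) else 0)"
        unfolding lookup_sum
      proof (rule sum.cong[OF refl])
        fix i assume "i \<in> {..<m}"
        then have i: "i < m" by simp
        show "coef (c i \<star> f i) (p + u t) = (if i = t then coef (c t) p * \<chi> p (u t) else 0)"
        proof (cases "i = t")
          case True
          then show ?thesis by (simp add: f_def coef_tm_sgl)
        next
          case False
          have "p + u t \<notin> supp (c i \<star> f i)"
          proof
            assume "p + u t \<in> supp (c i \<star> f i)"
            then obtain q r where "q \<in> supp (c i)" "p + u t = q + r" "r \<in> supp (f i)"
              using supp_tmult[of \<chi> "c i" "f i"] by blast
            then have "p + u t = q + u i" by (simp add: f_def)
            moreover have "q \<in> Cset" using c(1) i \<open>q \<in> supp (c i)\<close> by (auto simp: Zset_def Pi_iff)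
            ultimately show False using disj[OF that _ t i] False by blast
          qed
          then show ?thesis using False by (simp add: in_keys_iff)
        qed
      qed
      also have "\<dots> = coef (c t) p * \<chi> p (u t)" using t by simp
      finally show ?thesis by simp
    qed
    moreover have "coef (c t) p = 0" if "p \<notin> Cset" for p
      using Pi_mem[OF c(1), of t] t that by (auto simp: Zset_def in_keys_iff)
    ultimately show "c t = 0" by (intro poly_mapping_eqI) (metis lookup_zero)
  qed
  have spanf: "\<exists>s\<in>Zset - {0}. span_den m f s g" for g
    unfolding span_den_def using z expand ccZ
    by (intro bexI[of _ "sgl z 1"]) (auto intro!: exI[of _ "\<lambda>t. cc t g"])
  define d where "d i j = cc i (a \<star> f j)" for i j
  have d: "sgl z 1 \<star> (a \<star> f j) = (\<Sum>i<m. d i j \<star> f i)" for j unfolding d_def by (rule expand)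
  have trd: "(\<Sum>i<m. d i i) = sgl z 1 \<star> scal (of_nat (n^2)) (proj_centre a)"
  proof -
    have "(\<Sum>i<m. d i i) = (\<Sum>i<m. sgl z 1 \<star> proj_centre a)"
      by (rule sum.cong) (simp_all add: d_def diag)
    also have "\<dots> = scal (of_nat m) (sgl z 1 \<star> proj_centre a)"
      by (rule poly_mapping_eqI) (unfold lookup_sum coef_scal, simp)
    finally show ?thesis by (simp add: tmult_scal_right m_def)
  qed
  show ?thesis
    unfolding reduced_trace_def m_def[symmetric]
  proof (rule the_equality)
    show "\<kappa> (scal (of_nat n) (proj_centre a)) \<in> centre R \<and> (\<exists>e s c. frac_basis R m e \<and>
      s \<in> centre R - {\<zero>\<^bsub>R\<^esub>} \<and> (\<forall>i<m. \<forall>j<m. c i j \<in> centre R) \<and>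
      (\<forall>j<m. s \<otimes>\<^bsub>R\<^esub> (\<kappa> a \<otimes>\<^bsub>R\<^esub> e j) = (\<Oplus>\<^bsub>R\<^esub>i\<in>{..<m}. c i j \<otimes>\<^bsub>R\<^esub> e i)) \<and>
      s \<otimes>\<^bsub>R\<^esub> add_pow R n (\<kappa> (scal (of_nat n) (proj_centre a))) = (\<Oplus>\<^bsub>R\<^esub>i\<in>{..<m}. c i i))"
    proof (intro conjI exI)
      show "frac_basis R m (\<lambda>i. \<kappa> (f i))"
        using frac_basis_iff[of m "\<lambda>i. \<kappa> (f i)" f] indf spanf by blast
      show "\<kappa> (sgl z 1) \<in> centre R - {\<zero>\<^bsub>R\<^esub>}" using z by (auto simp: kap_zero)
      show "\<forall>i<m. \<forall>j<m. \<kappa> (d i j) \<in> centre R" by (simp add: d_def ccZ)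
      show "\<forall>j<m. \<kappa> (sgl z 1) \<otimes>\<^bsub>R\<^esub> (\<kappa> a \<otimes>\<^bsub>R\<^esub> \<kappa> (f j)) = (\<Oplus>\<^bsub>R\<^esub>i\<in>{..<m}. \<kappa> (d i j) \<otimes>\<^bsub>R\<^esub> \<kappa> (f i))"
        by (simp add: kap_mult d finsum_kap)
      show "\<kappa> (sgl z 1) \<otimes>\<^bsub>R\<^esub> add_pow R n (\<kappa> (scal (of_nat n) (proj_centre a))) =
        (\<Oplus>\<^bsub>R\<^esub>i\<in>{..<m}. \<kappa> (d i i))"
        by (simp add: finsum_kap add_pow_kap kap_mult trd power2_eq_square)
    qed simp
  next
    \<comment> \<open>A competing value may come from any other basis \<open>e\<close> and
      denominator \<open>s\<close>; independence of the basis reduces it to the family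
      \<open>f\<close>.\<close>
    fix t
    assume "t \<in> centre R \<and> (\<exists>e s c. frac_basis R m e \<and>
      s \<in> centre R - {\<zero>\<^bsub>R\<^esub>} \<and> (\<forall>i<m. \<forall>j<m. c i j \<in> centre R) \<and>
      (\<forall>j<m. s \<otimes>\<^bsub>R\<^esub> (\<kappa> a \<otimes>\<^bsub>R\<^esub> e j) = (\<Oplus>\<^bsub>R\<^esub>i\<in>{..<m}. c i j \<otimes>\<^bsub>R\<^esub> e i)) \<and>
      s \<otimes>\<^bsub>R\<^esub> add_pow R n t = (\<Oplus>\<^bsub>R\<^esub>i\<in>{..<m}. c i i))"
    then obtain e s c where t: "t \<in> centre R" and e: "frac_basis R m e"
      and s: "s \<in> centre R" "s \<noteq> \<zero>\<^bsub>R\<^esub>" and c: "\<And>i j. i < m \<Longrightarrow> j < m \<Longrightarrow> c i j \<in> centre R"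
      and sa: "\<And>j. j < m \<Longrightarrow> s \<otimes>\<^bsub>R\<^esub> (\<kappa> a \<otimes>\<^bsub>R\<^esub> e j) = (\<Oplus>\<^bsub>R\<^esub>i\<in>{..<m}. c i j \<otimes>\<^bsub>R\<^esub> e i)"
      and st: "s \<otimes>\<^bsub>R\<^esub> add_pow R n t = (\<Oplus>\<^bsub>R\<^esub>i\<in>{..<m}. c i i)" by blast
    obtain t' where t': "t = \<kappa> t'" "t' \<in> Zset" using t by (auto simp: centre_eq)
    obtain s' where s': "s = \<kappa> s'" "s' \<in> Zset" "s' \<noteq> 0" using s by (auto simp: centre_eq kap_zero)
    define e' where "e' i = crd (e i)" for i
    define c' where "c' i j = crd (c i j)" for i j
    have e': "e i = \<kappa> (e' i)" if "i < m" for i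
      using e that by (auto simp: frac_basis_def e'_def kap_crd Pi_iff)
    have c': "c i j = \<kappa> (c' i j)" "c' i j \<in> Zset" if "i < m" "j < m" for i j
      using c[OF that] by (auto simp: c'_def centre_eq)
    have inde: "indep m e'" and spane: "\<exists>s\<in>Zset - {0}. span_den m e' s g" for g
      using e frac_basis_iff[of m e e'] e' by blast+
    have sa': "s' \<star> (a \<star> e' j) = (\<Sum>i<m. c' i j \<star> e' i)" if j: "j < m" for j
    proof -
      have "\<kappa> (s' \<star> (a \<star> e' j)) = s \<otimes>\<^bsub>R\<^esub> (\<kappa> a \<otimes>\<^bsub>R\<^esub> e j)" by (simp add: e' j s' kap_mult)
      also have "\<dots> = (\<Oplus>\<^bsub>R\<^esub>i\<in>{..<m}. c i j \<otimes>\<^bsub>R\<^esub> e i)" by (rule sa[OF j])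
      also have "\<dots> = \<kappa> (\<Sum>i<m. c' i j \<star> e' i)"
        by (rule finsum_kap) (simp add: c' e' j kap_mult)
      finally show ?thesis by simp
    qed
    have st': "s' \<star> scal (of_nat n) t' = (\<Sum>i<m. c' i i)"
    proof -
      have "\<kappa> (s' \<star> scal (of_nat n) t') = s \<otimes>\<^bsub>R\<^esub> add_pow R n t" by (simp add: s' t' kap_mult add_pow_kap)
      also have "\<dots> = (\<Oplus>\<^bsub>R\<^esub>i\<in>{..<m}. c i i)" by (rule st)
      also have "\<dots> = \<kappa> (\<Sum>i<m. c' i i)"
        by (rule finsum_kap) (simp add: c')
      finally show ?thesis by simp
    qed
    have "s' \<star> (\<Sum>i<m. d i i) = sgl z 1 \<star> (\<Sum>i<m. c' i i)"
      by (rule trace_independent_of_basis[OF inde indf spane spanf c'(2) _ s'(2) sa' _ d])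
        (use z in \<open>auto simp: d_def ccZ\<close>)
    then have "s' \<star> (sgl z 1 \<star> scal (of_nat (n^2)) (proj_centre a)) = s' \<star> (sgl z 1 \<star> scal (of_nat n) t')"
      unfolding trd st'[symmetric] using z by (simp only: Zset_left_commute[of "sgl z 1" s'] Zset_sgl)
    then have "sgl z 1 \<star> scal (of_nat (n^2)) (proj_centre a) = sgl z 1 \<star> scal (of_nat n) t'"
      by (rule tm_cancel) (rule s')
    then have eq: "scal (of_nat (n^2)) (proj_centre a) = scal (of_nat n) t'"
      by (rule tm_cancel) (metis lookup_single_eq lookup_zero zero_neq_one)
    have "scal (inverse (of_nat n)) (scal (of_nat (n^2)) (proj_centre a)) = scal (inverse (of_nat n)) (scal (of_nat n) t')"
      unfolding eq ..
    moreover have "inverse (of_nat n) * (of_nat n * of_nat n) = (of_nat n :: complex)"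
      using n by simp
    ultimately show "t = \<kappa> (scal (of_nat n) (proj_centre a))"
      using n by (simp add: t' power2_eq_square)
  qed
qed

end

section \<open>Matrices\<close>

lemma eq_mat_by_vecI:
  fixes A B :: "complex mat"
  assumes A: "A \<in> carrier_mat nr nc" and B: "B \<in> carrier_mat nr nc"
    and eq: "\<And>v. v \<in> carrier_vec nc \<Longrightarrow> A *\<^sub>v v = B *\<^sub>v v"
  shows "A = B"
proof (rule eq_matI)
  fix i j assume ij: "i < dim_row B" "j < dim_col B"
  have "(A *\<^sub>v unit_vec nc j) $ i = A $$ (i, j)" "(B *\<^sub>v unit_vec nc j) $ i = B $$ (i, j)"
    using A B ij by (auto simp: scalar_prod_right_unit)
  then show "A $$ (i, j) = B $$ (i, j)" using eq[of "unit_vec nc j"] by simp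
qed (use A B in auto)

lemma zero_mult_vec: "v \<in> carrier_vec nc \<Longrightarrow> 0\<^sub>m nr nc *\<^sub>v v = (0\<^sub>v nr :: complex vec)"
  by (intro eq_vecI) auto

lemma mult_mat_index:
  assumes "A \<in> carrier_mat n m" "B \<in> carrier_mat m l" "i < n" "j < l"
  shows "(A * B) $$ (i, j) = (\<Sum>k<m. A $$ (i, k) * B $$ (k, j))"
  using assms by (simp add: scalar_prod_def lessThan_atLeast0)

lemma diag_mult_index:
  fixes N :: "complex mat"
  assumes "N \<in> carrier_mat n n" "r < n" "c < n"
  shows "(mat n n (\<lambda>(r, c). if r = c then f r else 0) * N) $$ (r, c) = f r * N $$ (r, c)"
    "(N * mat n n (\<lambda>(r, c). if r = c then f r else 0)) $$ (r, c) = N $$ (r, c) * f c"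
proof -
  let ?D = "mat n n (\<lambda>(r, c). if r = c then f r else 0)"
  have "(?D * N) $$ (r, c) = (\<Sum>k<n. ?D $$ (r, k) * N $$ (k, c))"
    by (rule mult_mat_index[OF _ assms(1)]) (use assms in auto)
  also have "\<dots> = (\<Sum>k<n. if k = r then f r * N $$ (r, c) else 0)"
    by (rule sum.cong) (use assms in auto)
  finally show "(?D * N) $$ (r, c) = f r * N $$ (r, c)" using assms by simp
  have "(N * ?D) $$ (r, c) = (\<Sum>k<n. N $$ (r, k) * ?D $$ (k, c))"
    by (rule mult_mat_index[OF assms(1)]) (use assms in auto)
  also have "\<dots> = (\<Sum>k<n. if k = c then N $$ (r, c) * f c else 0)"
    by (rule sum.cong) (use assms in auto)
  finally show "(N * ?D) $$ (r, c) = N $$ (r, c) * f c" using assms by simp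
qed

lemma diag_conj_index:
  fixes P Q :: "complex mat"
  assumes "P \<in> carrier_mat n n" "Q \<in> carrier_mat n n" "r < n" "c < n"
  shows "(P * mat n n (\<lambda>(r, c). if r = c then f r else 0) * Q) $$ (r, c) = (\<Sum>k<n. P $$ (r, k) * f k * Q $$ (k, c))"
proof -
  have "(P * mat n n (\<lambda>(r, c). if r = c then f r else 0)) $$ (r, k) = P $$ (r, k) * f k" if "k < n" for k
    using assms that by (simp add: scalar_prod_def if_distrib sum.delta cong: if_cong)
  then show ?thesis using assms by (simp add: scalar_prod_def lessThan_atLeast0)
qed

lemma vec_subspaceI:
  assumes "W \<subseteq> carrier_vec d" "0\<^sub>v d \<in> W" "\<And>v w. v \<in> W \<Longrightarrow> w \<in> W \<Longrightarrow> v + w \<in> W"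
    "\<And>c v. v \<in> W \<Longrightarrow> c \<cdot>\<^sub>v v \<in> W"
  shows "VectorSpace.subspace class_ring W (module_vec TYPE(complex) d)"
proof -
  have "submodule class_ring W (module_vec TYPE(complex) d)"
    by (rule submodule.intro[OF vec_module]) (use assms in \<open>auto simp: module_vec_def\<close>)
  then show ?thesis unfolding VectorSpace.subspace_def using vec_vs by blast
qed

definition mtr :: "complex mat \<Rightarrow> complex" where
  "mtr A = (\<Sum>i<dim_row A. A $$ (i, i))"

lemma mtr_mult_commute:
  assumes "A \<in> carrier_mat n m" "B \<in> carrier_mat m n"
  shows "mtr (A * B) = mtr (B * A)"
proof -
  have "mtr (A * B) = (\<Sum>i<n. \<Sum>k<m. A $$ (i, k) * B $$ (k, i))"
    using assms by (simp add: mtr_def scalar_prod_def lessThan_atLeast0)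
  also have "\<dots> = (\<Sum>k<m. \<Sum>i<n. A $$ (i, k) * B $$ (k, i))" by (rule sum.swap)
  also have "\<dots> = mtr (B * A)"
    using assms by (simp add: mtr_def scalar_prod_def lessThan_atLeast0 mult.commute)
  finally show ?thesis .
qed

lemma mtr_conj:
  assumes "P \<in> carrier_mat n n" "B \<in> carrier_mat n n" "Q \<in> carrier_mat n n" "Q * P = 1\<^sub>m n"
  shows "mtr (P * B * Q) = mtr B"
proof -
  have "mtr (P * B * Q) = mtr (Q * (P * B))"
    by (rule mtr_mult_commute[of _ n n]) (use assms in auto)
  also have "Q * (P * B) = (Q * P) * B" by (rule assoc_mult_mat[symmetric]) (use assms in auto)
  finally show ?thesis using assms by simp
qed

lemma mtr_four_block:
  assumes "A \<in> carrier_mat n n" "D \<in> carrier_mat m m"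
  shows "mtr (four_block_mat A B C D) = mtr A + mtr D"
proof -
  have "mtr (four_block_mat A B C D) = (\<Sum>i<n + m. if i < n then A $$ (i, i) else D $$ (i - n, i - n))"
    using assms unfolding mtr_def by (intro sum.cong) auto
  also have "\<dots> = (\<Sum>i<n. A $$ (i, i)) + (\<Sum>i=n..<n + m. D $$ (i - n, i - n))"
    by (simp add: lessThan_atLeast0 flip: sum.atLeastLessThan_concat[of 0 n "n + m"])
  also have "(\<Sum>i=n..<n + m. D $$ (i - n, i - n)) = (\<Sum>i<m. D $$ (i, i))"
    using sum.shift_bounds_nat_ivl[of "\<lambda>i. D $$ (i - n, i - n)" 0 n m]
    by (simp add: lessThan_atLeast0 add.commute)
  finally show ?thesis using assms by (simp add: mtr_def)
qed

lemma diag_block_carrier: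
  assumes "\<And>A. A \<in> set As \<Longrightarrow> dim_row A = dim_col A"
  shows "diag_block_mat As \<in> carrier_mat (sum_list (map dim_row As)) (sum_list (map dim_row As))"
proof -
  have "map dim_col As = map dim_row As" using assms by simp
  then show ?thesis by (metis carrier_matI dim_diag_block_mat)
qed

lemma mtr_diag_block:
  assumes "\<And>A. A \<in> set As \<Longrightarrow> dim_row A = dim_col A"
  shows "mtr (diag_block_mat As) = sum_list (map mtr As)"
  using assms
proof (induction As)
  case (Cons A As)
  have "mtr (diag_block_mat (A # As)) = mtr A + mtr (diag_block_mat As)"
    unfolding diag_block_mat.simps Let_def
    by (rule mtr_four_block[OF _ diag_block_carrier]) (use Cons.prems in \<open>auto intro!: carrier_matI\<close>)
  then show ?case using Cons by simp
qed (simp add: mtr_def)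

lemma diag_block_scalarD:
  fixes c :: complex
  assumes "\<And>A. A \<in> set As \<Longrightarrow> dim_row A = dim_col A"
    and "diag_block_mat As = c \<cdot>\<^sub>m 1\<^sub>m m" and "A \<in> set As"
  shows "A = c \<cdot>\<^sub>m 1\<^sub>m (dim_row A)"
  using assms
proof (induction As arbitrary: m)
  case (Cons B As)
  let ?D = "diag_block_mat As" and ?b = "dim_row B"
  have D: "?D \<in> carrier_mat (sum_list (map dim_row As)) (sum_list (map dim_row As))"
    by (rule diag_block_carrier) (use Cons.prems in auto)
  have B: "dim_col B = ?b" using Cons.prems(1)[of B] by simp
  have eq: "four_block_mat B (0\<^sub>m (dim_row B) (dim_col ?D)) (0\<^sub>m (dim_row ?D) (dim_col B)) ?D = c \<cdot>\<^sub>m 1\<^sub>m m"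
    using Cons.prems(2) by (simp add: Let_def)
  have m: "m = ?b + dim_row ?D" using arg_cong[OF eq, of dim_row] by simp
  have "B = c \<cdot>\<^sub>m 1\<^sub>m ?b"
  proof (rule eq_matI)
    fix i j assume "i < dim_row (c \<cdot>\<^sub>m 1\<^sub>m ?b)" "j < dim_col (c \<cdot>\<^sub>m 1\<^sub>m ?b)"
    then have "i < ?b" "j < ?b" by auto
    then show "B $$ (i, j) = (c \<cdot>\<^sub>m 1\<^sub>m ?b) $$ (i, j)"
      using arg_cong[OF eq, of "\<lambda>M. M $$ (i, j)"] B D m by simp
  qed (use B in auto)
  moreover have "?D = c \<cdot>\<^sub>m 1\<^sub>m (dim_row ?D)"
  proof (rule eq_matI)
    fix i j assume "i < dim_row (c \<cdot>\<^sub>m 1\<^sub>m (dim_row ?D))" "j < dim_col (c \<cdot>\<^sub>m 1\<^sub>m (dim_row ?D))"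
    then have "i < dim_row ?D" "j < dim_row ?D" by auto
    then show "?D $$ (i, j) = (c \<cdot>\<^sub>m 1\<^sub>m (dim_row ?D)) $$ (i, j)"
      using arg_cong[OF eq, of "\<lambda>M. M $$ (i + ?b, j + ?b)"] B D m by simp
  qed (use D in auto)
  ultimately show ?case using Cons.IH[of "dim_row ?D"] Cons.prems by auto
qed simp

lemma kron_one_carrier: "S \<in> carrier_mat d d \<Longrightarrow> kron (1\<^sub>m e) S \<in> carrier_mat (e * d) (e * d)"
  by (auto simp: kron_def)

lemma kron_one_scalarD:
  assumes S: "S \<in> carrier_mat d d" and e: "e > 0" and k: "kron (1\<^sub>m e) S = c \<cdot>\<^sub>m 1\<^sub>m (e * d)"
  shows "S = c \<cdot>\<^sub>m 1\<^sub>m d"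
proof (rule eq_matI)
  fix i j assume "i < dim_row (c \<cdot>\<^sub>m 1\<^sub>m d)" "j < dim_col (c \<cdot>\<^sub>m 1\<^sub>m d)"
  then have ij: "i < d" "j < d" by auto
  have "d \<le> e * d" using e by simp
  then have "i < e * d" "j < e * d" using ij by linarith+
  then have "kron (1\<^sub>m e) S $$ (i, j) = S $$ (i, j)" using S ij e by (simp add: kron_def)
  then show "S $$ (i, j) = (c \<cdot>\<^sub>m 1\<^sub>m d) $$ (i, j)"
    using k ij \<open>i < e * d\<close> \<open>j < e * d\<close> by simp
qed (use S in auto)

lemma kron_one_one: "kron (1\<^sub>m (Suc 0)) S = S"
  by (rule eq_matI) (auto simp: kron_def)

lemma mtr_kron_one_dim1:
  assumes "S \<in> carrier_mat 1 1"
  shows "mtr (kron (1\<^sub>m e) S) = of_nat e * S $$ (0, 0)"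
  using assms by (simp add: mtr_def kron_def)

lemma diag_block_dim1:
  assumes "\<And>i. i < n \<Longrightarrow> f i \<in> carrier_mat (Suc 0) (Suc 0)"
  shows "diag_block_mat (map f [0..<n]) = mat n n (\<lambda>(r, c). if r = c then f r $$ (0, 0) else 0)"
  using assms
proof (induction n)
  case (Suc n)
  let ?D = "mat n n (\<lambda>(r, c). if r = c then f r $$ (0, 0) else 0)"
  have f: "f n \<in> carrier_mat (Suc 0) (Suc 0)" using Suc.prems by simp
  have "diag_block_mat (map f [0..<Suc n]) = four_block_mat ?D (0\<^sub>m n (Suc 0)) (0\<^sub>m (Suc 0) n) (f n)"
    using Suc carrier_matD[OF f] by (simp add: diag_block_mat_last Let_def)
  also have "\<dots> = mat (Suc n) (Suc n) (\<lambda>(r, c). if r = c then f r $$ (0, 0) else 0)"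
    by (rule eq_matI) (use f in \<open>auto simp: less_Suc_eq\<close>)
  finally show ?case .
qed auto

section \<open>Representations\<close>

lemma alg_repsD:
  assumes "\<sigma> \<in> alg_reps R d \<iota>"
  shows "a \<in> carrier R \<Longrightarrow> \<sigma> a \<in> carrier_mat d d"
    "a \<in> carrier R \<Longrightarrow> b \<in> carrier R \<Longrightarrow> \<sigma> (a \<oplus>\<^bsub>R\<^esub> b) = \<sigma> a + \<sigma> b"
    "a \<in> carrier R \<Longrightarrow> b \<in> carrier R \<Longrightarrow> \<sigma> (a \<otimes>\<^bsub>R\<^esub> b) = \<sigma> a * \<sigma> b"
    "\<sigma> \<one>\<^bsub>R\<^esub> = 1\<^sub>m d"
    "a \<in> carrier R \<Longrightarrow> \<sigma> (c \<odot>\<^bsub>R\<^esub> a) = \<iota> c \<cdot>\<^sub>m \<sigma> a"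
    "\<sigma> \<in> extensional (carrier R)"
  using assms unfolding alg_reps_def Ring.ring_hom_def ring_mat_def by auto

lemma alg_repsI:
  assumes "\<And>a. a \<in> carrier R \<Longrightarrow> \<sigma> a \<in> carrier_mat d d"
    "\<And>a b. a \<in> carrier R \<Longrightarrow> b \<in> carrier R \<Longrightarrow> \<sigma> (a \<oplus>\<^bsub>R\<^esub> b) = \<sigma> a + \<sigma> b"
    "\<And>a b. a \<in> carrier R \<Longrightarrow> b \<in> carrier R \<Longrightarrow> \<sigma> (a \<otimes>\<^bsub>R\<^esub> b) = \<sigma> a * \<sigma> b"
    "\<sigma> \<one>\<^bsub>R\<^esub> = 1\<^sub>m d"
    "\<And>c a. a \<in> carrier R \<Longrightarrow> \<sigma> (c \<odot>\<^bsub>R\<^esub> a) = \<iota> c \<cdot>\<^sub>m \<sigma> a"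
    "\<sigma> \<in> extensional (carrier R)"
  shows "\<sigma> \<in> alg_reps R d \<iota>"
  using assms unfolding alg_reps_def Ring.ring_hom_def ring_mat_def by auto

lemma alg_reps_pow:
  assumes "Group.monoid R" "\<sigma> \<in> alg_reps R d \<iota>" "a \<in> carrier R"
  shows "\<sigma> (a [^]\<^bsub>R\<^esub> (k::nat)) = \<sigma> a ^\<^sub>m k"
proof -
  interpret Group.monoid R by fact
  have d: "dim_row (\<sigma> a) = d" using alg_repsD(1)[OF assms(2,3)] by simp
  show ?thesis
    by (induction k) (use assms d in \<open>auto simp: alg_repsD\<close>)
qed

lemma isotypicD:
  assumes "isotypic R n \<phi> m d e \<sigma> g g'"
  shows "\<phi> \<in> alg_reps R n id" "i < m \<Longrightarrow> e i > 0" "i < m \<Longrightarrow> simple_rep R (d i) (\<sigma> i)"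
    "i < m \<Longrightarrow> j < m \<Longrightarrow> i \<noteq> j \<Longrightarrow> \<not> rep_iso R (\<sigma> i) (\<sigma> j)"
    "a \<in> carrier R \<Longrightarrow> similar_mat_wit (\<phi> a)
        (diag_block_mat (map (\<lambda>i. kron (1\<^sub>m (e i)) (\<sigma> i a)) [0..<m])) g g'"
  using assms unfolding isotypic_def by auto

lemma simple_repD:
  assumes "simple_rep R d \<sigma>"
  shows "\<sigma> \<in> alg_reps R d id" "d > 0"
    "VectorSpace.subspace class_ring W (module_vec TYPE(complex) d) \<Longrightarrow>
      (\<And>a v. a \<in> carrier R \<Longrightarrow> v \<in> W \<Longrightarrow> \<sigma> a *\<^sub>v v \<in> W) \<Longrightarrow> W = {0\<^sub>v d} \<or> W = carrier_vec d"
  using assms unfolding simple_rep_def by blast+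

lemma isotypic_simple_carrier:
  assumes iso: "isotypic R n \<phi> m d e \<sigma> g g'" and a: "a \<in> carrier R" and i: "i < m"
  shows "\<sigma> i a \<in> carrier_mat (d i) (d i)" "dim_row (\<sigma> i a) = d i" "dim_col (\<sigma> i a) = d i"
  using alg_repsD(1)[OF simple_repD(1)[OF isotypicD(3)[OF iso i]] a] by auto

lemma isotypic_block_carrier:
  assumes iso: "isotypic R n \<phi> m d e \<sigma> g g'" and a: "a \<in> carrier R"
    and A: "A \<in> set (map (\<lambda>i. kron (1\<^sub>m (e i)) (\<sigma> i a)) [0..<m])"
  shows "dim_row A = dim_col A"
  using A isotypic_simple_carrier[OF iso a] by (auto simp: kron_def)

lemma isotypic_dim:
  assumes iso: "isotypic R n \<phi> m d e \<sigma> g g'" and a: "a \<in> carrier R"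
  shows "n = (\<Sum>i<m. e i * d i)"
proof -
  let ?As = "map (\<lambda>i. kron (1\<^sub>m (e i)) (\<sigma> i a)) [0..<m]"
  have \<phi>: "\<phi> a \<in> carrier_mat n n" using alg_repsD(1)[OF isotypicD(1)[OF iso] a] .
  have "dim_row (diag_block_mat ?As) = n"
    using similar_mat_witD2(5)[OF \<phi> isotypicD(5)[OF iso a]] by simp
  then have "n = sum_list (map dim_row ?As)" by (simp add: dim_diag_block_mat)
  also have "map dim_row ?As = map (\<lambda>i. e i * d i) [0..<m]"
    using isotypic_simple_carrier[OF iso a] by (auto simp: kron_def)
  finally show ?thesis by (simp add: interv_sum_list_conv_sum_set_nat lessThan_atLeast0)
qed

text \<open>A scalar matrix is unchanged by conjugation, so its diagonal blocks are the same scalar.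
  This passes the central character of \<phi> on to each simple summand.\<close>

lemma isotypic_scalarD:
  assumes iso: "isotypic R n \<phi> m d e \<sigma> g g'" and a: "a \<in> carrier R"
    and c: "\<phi> a = c \<cdot>\<^sub>m 1\<^sub>m n" and i: "i < m"
  shows "\<sigma> i a = c \<cdot>\<^sub>m 1\<^sub>m (d i)"
proof -
  let ?As = "map (\<lambda>i. kron (1\<^sub>m (e i)) (\<sigma> i a)) [0..<m]"
  have \<phi>: "\<phi> a \<in> carrier_mat n n" using alg_repsD(1)[OF isotypicD(1)[OF iso] a] .
  have sim: "similar_mat_wit (diag_block_mat ?As) (\<phi> a) g' g"
    by (rule similar_mat_wit_sym[OF isotypicD(5)[OF iso a]])
  have D: "diag_block_mat ?As \<in> carrier_mat n n"
    using similar_mat_witD2(5)[OF \<phi> isotypicD(5)[OF iso a]] .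
  note s = similar_mat_witD2[OF D sim]
  have "diag_block_mat ?As = g' * (c \<cdot>\<^sub>m 1\<^sub>m n) * g" using s(3) c by simp
  also have "\<dots> = c \<cdot>\<^sub>m (g' * g)"
    using s(6) mult_smult_distrib[OF s(6) one_carrier_mat] mult_smult_assoc_mat[OF s(6) s(7)] by simp
  also have "\<dots> = c \<cdot>\<^sub>m 1\<^sub>m n" using s(1) by simp
  finally have eq: "diag_block_mat ?As = c \<cdot>\<^sub>m 1\<^sub>m n" .
  let ?A = "kron (1\<^sub>m (e i)) (\<sigma> i a)"
  have \<sigma>: "\<sigma> i a \<in> carrier_mat (d i) (d i)"
    using alg_repsD(1)[OF simple_repD(1)[OF isotypicD(3)[OF iso i]] a] .
  have "?A \<in> set ?As" using i by simp
  then have "?A = c \<cdot>\<^sub>m 1\<^sub>m (dim_row ?A)"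
    using diag_block_scalarD[OF isotypic_block_carrier[OF iso a] eq] by blast
  then show ?thesis
    using kron_one_scalarD[OF \<sigma> isotypicD(2)[OF iso i]] kron_one_carrier[OF \<sigma>, of "e i"] by auto
qed

lemma isotypic_trace:
  assumes iso: "isotypic R n \<phi> m d e \<sigma> g g'" and a: "a \<in> carrier R"
    and d: "\<And>i. i < m \<Longrightarrow> d i = 1"
  shows "(\<Sum>i<n. \<phi> a $$ (i, i)) = (\<Sum>i<m. of_nat (e i) * \<sigma> i a $$ (0, 0))"
proof -
  let ?As = "map (\<lambda>i. kron (1\<^sub>m (e i)) (\<sigma> i a)) [0..<m]"
  have \<phi>: "\<phi> a \<in> carrier_mat n n" using alg_repsD(1)[OF isotypicD(1)[OF iso] a] .
  note s = similar_mat_witD2[OF \<phi> isotypicD(5)[OF iso a]]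
  have \<sigma>: "\<sigma> i a \<in> carrier_mat 1 1" if "i < m" for i
    using alg_repsD(1)[OF simple_repD(1)[OF isotypicD(3)[OF iso that]] a] d[OF that] by simp
  have "(\<Sum>i<n. \<phi> a $$ (i, i)) = mtr (\<phi> a)" using \<phi> by (simp add: mtr_def)
  also have "\<dots> = mtr (diag_block_mat ?As)"
    using mtr_conj[OF s(6) s(5) s(7) s(2)] s(3) by simp
  also have "\<dots> = sum_list (map mtr ?As)"
    by (rule mtr_diag_block) (rule isotypic_block_carrier[OF iso a])
  also have "map mtr ?As = map (\<lambda>i. of_nat (e i) * \<sigma> i a $$ (0, 0)) [0..<m]"
    using mtr_kron_one_dim1[OF \<sigma>] by auto
  finally show ?thesis by (simp add: interv_sum_list_conv_sum_set_nat lessThan_atLeast0)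
qed

section \<open>Quantum polynomial algebras in three variables\<close>

lemma smult_mat_vec:
  fixes A :: "complex mat"
  assumes "A \<in> carrier_mat nr nc" "v \<in> carrier_vec nc"
  shows "(c \<cdot>\<^sub>m A) *\<^sub>v v = c \<cdot>\<^sub>v (A *\<^sub>v v)"
  by (rule eq_vecI) (use assms in auto)

section \<open>Roots of unity and the commutation form of the monomials\<close>

lemma primitive_powi_eq_1_iff:
  assumes "primitive_root_of_unity n \<alpha>" "n > 0"
  shows "\<alpha> powi x = 1 \<longleftrightarrow> int n dvd x"
proof -
  have \<alpha>: "\<alpha> \<noteq> 0" "\<alpha> ^ n = 1" using assms by (auto simp: primitive_root_of_unity_def power_0_left split: if_splits)
  have "\<alpha> powi x = \<alpha> powi (int n * (x div int n) + x mod int n)" by simp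
  also have "\<dots> = (\<alpha> powi int n) powi (x div int n) * \<alpha> powi (x mod int n)"
    by (subst power_int_add) (use \<alpha> in \<open>auto simp: power_int_mult\<close>)
  also have "\<dots> = \<alpha> ^ nat (x mod int n)"
    using \<alpha> assms by (simp add: power_int_def)
  finally have eq: "\<alpha> powi x = \<alpha> ^ nat (x mod int n)" .
  have "nat (x mod int n) < n" using assms(2) by (simp add: nat_less_iff)
  then have "\<alpha> ^ nat (x mod int n) = 1 \<longleftrightarrow> nat (x mod int n) = 0"
    using assms(1) unfolding primitive_root_of_unity_def by (metis gr0I power_0)
  then show ?thesis using eq assms(2) by (simp add: dvd_eq_mod_eq_0 nat_eq_iff)
qed

lemma primitive_root_inj:
  assumes "primitive_root_of_unity n \<alpha>" "n > 0" "r < n" "c < n" "\<alpha> ^ r = \<alpha> ^ c"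
  shows "r = c"
proof -
  have \<alpha>: "\<alpha> \<noteq> 0" using assms by (auto simp: primitive_root_of_unity_def power_0_left split: if_splits)
  have "\<alpha> powi (int r - int c) = \<alpha> ^ r / \<alpha> ^ c" using \<alpha> by (simp add: power_int_diff)
  then have "\<alpha> powi (int r - int c) = 1" using assms(5) \<alpha> by simp
  then have "int n dvd int r - int c" using primitive_powi_eq_1_iff[OF assms(1,2)] by blast
  then show ?thesis using dvd_imp_le_int[of "int r - int c" "int n"] assms(3,4) by fastforce
qed

lemma sgl_000: "sgl (0, 0, 0) 1 = (1 :: tpoly)"
  by (metis single_one zero_prod_def)

text \<open>With \<open>yw = \<alpha>wy\<close>, \<open>uw = \<alpha>^(-1)wu\<close> and
  \<open>uy = \<alpha>yu\<close>, the exponent counts what is picked up when \<open>y^j u^k\<close>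
  passes \<open>w^(i' - (s-1)k')\<close> and then \<open>u^k\<close> passes
  \<open>y^j'\<close>.\<close>

definition bich :: "complex \<Rightarrow> int \<Rightarrow> tri \<Rightarrow> tri \<Rightarrow> complex" where
  "bich \<alpha> s p q = (case p of (i, j, k) \<Rightarrow> case q of (i', j', k') \<Rightarrow>
     \<alpha> powi ((int j - int k) * (int i' - (s - 1) * int k') + int k * int j'))"

lemma bich_eq: "bich \<alpha> s (i, j, k) (i', j', k') =
    \<alpha> powi ((int j - int k) * (int i' - (s - 1) * int k') + int k * int j')"
  by (simp add: bich_def)

lemma bicharacter_bich:
  assumes "\<alpha> \<noteq> 0"
  shows "bicharacter (bich \<alpha> s)"
proof
  fix p q r :: tri
  show "bich \<alpha> s (p + q) r = bich \<alpha> s p r * bich \<alpha> s q r"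
    using assms by (cases p; cases q; cases r) (simp add: bich_eq power_int_add[symmetric] algebra_simps)
  show "bich \<alpha> s p (q + r) = bich \<alpha> s p q * bich \<alpha> s p r"
    using assms by (cases p; cases q; cases r) (simp add: bich_eq power_int_add[symmetric] algebra_simps)
  show "bich \<alpha> s p q \<noteq> 0"
    using assms by (cases p; cases q) (simp add: bich_eq)
qed

text \<open>The commutator of two monomials is \<alpha> to a 2 by 2 determinant in the linear forms
  \<open>j - k\<close> and \<open>i - s k\<close>; its radical modulo \<open>n\<close> is the set
  where both forms vanish.\<close>

lemma bich_Cset_iff:
  assumes prim: "primitive_root_of_unity n \<alpha>" and n: "n > 0"
  shows "(i, j, k) \<in> bicharacter.Cset (bich \<alpha> s) \<longleftrightarrow> int n dvd int j - int k \<and> int n dvd int i - s * int k"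
proof -
  have \<alpha>: "\<alpha> \<noteq> 0"
    using prim n by (auto simp: primitive_root_of_unity_def power_0_left split: if_splits)
  interpret bicharacter "bich \<alpha> s" by (rule bicharacter_bich[OF \<alpha>])
  have E: "bich \<alpha> s (i, j, k) (i', j', k') = bich \<alpha> s (i', j', k') (i, j, k) \<longleftrightarrow>
      int n dvd (int j - int k) * (int i' - s * int k') - (int j' - int k') * (int i - s * int k)"
    for i' j' k'
  proof -
    have "bich \<alpha> s (i, j, k) (i', j', k') = bich \<alpha> s (i', j', k') (i, j, k) \<longleftrightarrow>
        bich \<alpha> s (i, j, k) (i', j', k') / bich \<alpha> s (i', j', k') (i, j, k) = 1" by simp
    also have "bich \<alpha> s (i, j, k) (i', j', k') / bich \<alpha> s (i', j', k') (i, j, k) =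
      \<alpha> powi ((int j - int k) * (int i' - s * int k') - (int j' - int k') * (int i - s * int k))"
      using \<alpha> by (simp add: bich_eq power_int_diff[symmetric] algebra_simps)
    finally show ?thesis by (simp add: primitive_powi_eq_1_iff[OF prim n])
  qed
  show ?thesis
  proof
    assume "(i, j, k) \<in> Cset"
    then have "bich \<alpha> s (i, j, k) q = bich \<alpha> s q (i, j, k)" for q unfolding Cset_def by blast
    \<comment> \<open>Commutation with \<open>W\<close> isolates the first form and commutation with
      \<open>Y\<close> the second.\<close>
    from this[of "(1, 0, 0)"] this[of "(0, 1, 0)"]
    show "int n dvd int j - int k \<and> int n dvd int i - s * int k"
      unfolding E by (simp add: dvd_diff_commute)
  next
    assume h: "int n dvd int j - int k \<and> int n dvd int i - s * int k"
    then show "(i, j, k) \<in> Cset" unfolding Cset_def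
      using E by (auto intro!: dvd_diff dvd_mult dvd_mult2)
  qed
qed

text \<open>
  In terms of generators: \<open>YW = \<alpha>WY\<close>, \<open>YU = \<alpha>\<^bsup>-s\<^esup>UY\<close> and \<open>UW = \<alpha>\<^bsup>-1\<^esup>WU\<close>. The algebra \<open>A\<close> itself is the
  case \<open>s = 1\<close>, the charts of the blowup are the case \<open>s = 2\<close>; the basis element with index
  \<open>(i, j, k)\<close> stands for \<open>w\<^bsup>i-(s-1)k\<^esup>y\<^bsup>j\<^esup>u\<^bsup>k\<^esup>\<close>, where \<open>w, y, u\<close> are the generators of \<open>A\<close>.
\<close>

locale quantum_space = coord_algebra "bich \<alpha> s" R \<kappa>
  for \<alpha> :: complex and s :: int and R :: "(complex, 'r) module" and \<kappa> :: "tpoly \<Rightarrow> 'r" +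
  fixes n :: nat and tr :: "'r \<Rightarrow> 'r"
  assumes n3: "n \<ge> 3" and odd_n: "odd n" and prim: "primitive_root_of_unity n \<alpha>"
    and s12: "s = 1 \<or> s = 2"
    and tr_kap: "tr (\<kappa> f) = \<kappa> (scal (of_nat n) (proj_centre f))"
begin

declare sgl_000 [simp]

lemma n_pos [simp]: "n > 0" using n3 by simp

lemma \<alpha>_nz [simp]: "\<alpha> \<noteq> 0"
  using prim n3 by (auto simp: primitive_root_of_unity_def power_0_left split: if_splits)

lemma \<alpha>_pow_n [simp]: "\<alpha> ^ n = 1"
  using prim by (simp add: primitive_root_of_unity_def)

lemma powi_eq_1_iff: "\<alpha> powi x = 1 \<longleftrightarrow> int n dvd x"
  by (rule primitive_powi_eq_1_iff[OF prim n_pos])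

lemma Cset_iff: "(i, j, k) \<in> Cset \<longleftrightarrow> int n dvd int j - int k \<and> int n dvd int i - s * int k"
  by (rule bich_Cset_iff[OF prim n_pos])

text \<open>Orthogonality of the characters of a cyclic group, as a geometric sum with ratio
  \<open>\<alpha>^j\<close>.\<close>

lemma power_sum: "(\<Sum>k<n. (\<mu> * \<alpha> ^ k) ^ j) = (if n dvd j then of_nat n * \<mu> ^ j else 0)"
proof -
  have eq: "(\<Sum>k<n. (\<mu> * \<alpha> ^ k) ^ j) = \<mu> ^ j * (\<Sum>k<n. (\<alpha> ^ j) ^ k)"
    by (simp add: power_mult_distrib sum_distrib_left power_mult[symmetric] mult.commute)
  show ?thesis
  proof (cases "n dvd j")
    case True
    then obtain q where "j = n * q" by (rule dvdE)
    then have "\<alpha> ^ j = 1" by (simp add: power_mult)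
    then show ?thesis using True by (simp add: eq)
  next
    case False
    have "\<alpha> ^ j \<noteq> 1" using powi_eq_1_iff[of "int j"] False by simp
    moreover have "(\<alpha> ^ j) ^ n = 1" by (metis \<alpha>_pow_n mult.commute power_mult power_one)
    ultimately show ?thesis using False by (simp add: eq geometric_sum)
  qed
qed

definition W :: 'r where "W = \<kappa> (sgl (1, 0, 0) 1)"
definition Y :: 'r where "Y = \<kappa> (sgl (0, 1, 0) 1)"
definition U :: 'r where "U = \<kappa> (sgl (0, 0, 1) 1)"

lemma gens_closed [simp]: "W \<in> carrier R" "Y \<in> carrier R" "U \<in> carrier R"
  by (simp_all add: W_def Y_def U_def)

lemma W_pow: "W [^]\<^bsub>R\<^esub> k = \<kappa> (sgl (k, 0, 0) 1)"
  by (induction k) (simp_all add: kap_one kap_mult W_def bich_eq)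

lemma Y_pow: "Y [^]\<^bsub>R\<^esub> k = \<kappa> (sgl (0, k, 0) 1)"
  by (induction k) (simp_all add: kap_one kap_mult Y_def bich_eq)

text \<open>For \<open>s = 2\<close> the powers of \<open>uw^(-1)\<close> agree with the basis
  elements \<open>w^(-k)u^k\<close> only up to a power of \<alpha>, so the scalar is left
  unspecified.\<close>

lemma U_pow: "\<exists>c. c \<noteq> 0 \<and> U [^]\<^bsub>R\<^esub> k = \<kappa> (sgl (0, 0, k) c)"
proof (induction k)
  case 0
  show ?case by (rule exI[of _ 1]) (simp add: kap_one)
next
  case (Suc k)
  then obtain c where c: "c \<noteq> 0" "U [^]\<^bsub>R\<^esub> k = \<kappa> (sgl (0, 0, k) c)" by blast
  then show ?case
    by (intro exI[of _ "c * bich \<alpha> s (0, 0, k) (0, 0, 1)"]) (simp add: U_def kap_mult)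
qed

lemma smult_closed [simp]: "a \<in> carrier R \<Longrightarrow> c \<odot>\<^bsub>R\<^esub> a \<in> carrier R"
  by (auto elim!: carrierE simp: kap_smult)

lemma Y_W: "Y \<otimes>\<^bsub>R\<^esub> W = \<alpha> \<odot>\<^bsub>R\<^esub> (W \<otimes>\<^bsub>R\<^esub> Y)"
  by (simp add: W_def Y_def kap_mult kap_smult bich_eq)

lemma W_Y: "W \<otimes>\<^bsub>R\<^esub> Y = (1 / \<alpha>) \<odot>\<^bsub>R\<^esub> (Y \<otimes>\<^bsub>R\<^esub> W)"
  by (simp add: W_def Y_def kap_mult kap_smult bich_eq)

lemma Y_U: "Y \<otimes>\<^bsub>R\<^esub> U = (\<alpha> powi (- s)) \<odot>\<^bsub>R\<^esub> (U \<otimes>\<^bsub>R\<^esub> Y)"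
  by (simp add: U_def Y_def kap_mult kap_smult bich_eq power_int_add[symmetric] power_int_diff
    power_int_minus divide_simps)

lemma U_Y: "U \<otimes>\<^bsub>R\<^esub> Y = (\<alpha> powi s) \<odot>\<^bsub>R\<^esub> (Y \<otimes>\<^bsub>R\<^esub> U)"
  by (simp add: U_def Y_def kap_mult kap_smult bich_eq power_int_diff
    power_int_minus divide_simps)

lemma U_W: "U \<otimes>\<^bsub>R\<^esub> W = (1 / \<alpha>) \<odot>\<^bsub>R\<^esub> (W \<otimes>\<^bsub>R\<^esub> U)"
  by (simp add: W_def U_def kap_mult kap_smult bich_eq power_int_minus divide_simps)

lemma W_U: "W \<otimes>\<^bsub>R\<^esub> U = \<alpha> \<odot>\<^bsub>R\<^esub> (U \<otimes>\<^bsub>R\<^esub> W)"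
  by (simp add: W_def U_def kap_mult kap_smult bich_eq power_int_minus divide_simps)

lemma one_smult: "a \<in> carrier R \<Longrightarrow> 1 \<odot>\<^bsub>R\<^esub> a = a"
  by (auto elim!: carrierE simp: kap_smult)

text \<open>Each basis element is a nonzero multiple of some \<open>W^i Y^j U^k\<close>, so the
  three elements generate. Values of characters, derivations and invariance of subspaces can
  therefore be checked on \<open>W\<close>, \<open>Y\<close>, \<open>U\<close>.\<close>

lemma gen_induct [consumes 1, case_names one W Y U add mult smult]:
  assumes "a \<in> carrier R" and P1: "P \<one>\<^bsub>R\<^esub>" and PW: "P W" and PY: "P Y" and PU: "P U"
    and Padd: "\<And>a b. a \<in> carrier R \<Longrightarrow> b \<in> carrier R \<Longrightarrow> P a \<Longrightarrow> P b \<Longrightarrow> P (a \<oplus>\<^bsub>R\<^esub> b)"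
    and Pmult: "\<And>a b. a \<in> carrier R \<Longrightarrow> b \<in> carrier R \<Longrightarrow> P a \<Longrightarrow> P b \<Longrightarrow> P (a \<otimes>\<^bsub>R\<^esub> b)"
    and Psmult: "\<And>c a. a \<in> carrier R \<Longrightarrow> P a \<Longrightarrow> P (c \<odot>\<^bsub>R\<^esub> a)"
  shows "P a"
proof -
  have pow: "P (x [^]\<^bsub>R\<^esub> k)" if "P x" "x \<in> carrier R" for x and k :: nat
    by (induction k) (use that P1 Pmult in auto)
  have monomial: "P (\<kappa> (sgl (i, j, k) c))" for i j k c
  proof -
    obtain u where u: "u \<noteq> 0" "U [^]\<^bsub>R\<^esub> k = \<kappa> (sgl (0, 0, k) u)" using U_pow by blast
    let ?v = "u * bich \<alpha> s (i, 0, 0) (0, j, 0) * bich \<alpha> s (i, j, 0) (0, 0, k)"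
    have "P (W [^]\<^bsub>R\<^esub> i \<otimes>\<^bsub>R\<^esub> Y [^]\<^bsub>R\<^esub> j \<otimes>\<^bsub>R\<^esub> U [^]\<^bsub>R\<^esub> k)"
      by (intro Pmult pow PW PY PU) auto
    also have "W [^]\<^bsub>R\<^esub> i \<otimes>\<^bsub>R\<^esub> Y [^]\<^bsub>R\<^esub> j \<otimes>\<^bsub>R\<^esub> U [^]\<^bsub>R\<^esub> k = \<kappa> (sgl (i, j, k) ?v)"
      by (simp add: W_pow Y_pow u kap_mult ac_simps)
    finally have "P ((c / ?v) \<odot>\<^bsub>R\<^esub> \<kappa> (sgl (i, j, k) ?v))" by (intro Psmult) auto
    moreover have "c / ?v * ?v = c" using u(1) by simp
    ultimately show ?thesis unfolding kap_smult scal_sgl by simp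
  qed
  obtain f where f: "a = \<kappa> f" using assms(1) by (rule carrierE)
  have "P (\<kappa> f)"
  proof (induction f rule: poly_mapping_additive_induct)
    case (single p c)
    then show ?case using monomial by (cases p) auto
  next
    case (add f g)
    then show ?case using Padd[of "\<kappa> f" "\<kappa> g"] by (simp add: kap_add)
  qed
  then show ?thesis by (simp add: f)
qed

subsection \<open>The characters killing \<open>W\<close> and \<open>U\<close>\<close>

definition ev :: "complex \<Rightarrow> 'r \<Rightarrow> complex" where
  "ev \<mu> a = lin (\<lambda>(i, j, k). if i = 0 \<and> k = 0 then \<mu> ^ j else 0) (crd a)"

lemma ev_sgl: "ev \<mu> (\<kappa> (sgl (i, j, k) c)) = (if i = 0 \<and> k = 0 then c * \<mu> ^ j else 0)"
  by (simp add: ev_def)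

lemma ev_gens [simp]: "ev \<mu> W = 0" "ev \<mu> Y = \<mu>" "ev \<mu> U = 0"
  by (simp_all add: W_def Y_def U_def ev_sgl)

lemma ev_one [simp]: "ev \<mu> \<one>\<^bsub>R\<^esub> = 1"
  using ev_sgl[of \<mu> 0 0 0 1] by (simp add: kap_one)

lemma ev_add: "a \<in> carrier R \<Longrightarrow> b \<in> carrier R \<Longrightarrow> ev \<mu> (a \<oplus>\<^bsub>R\<^esub> b) = ev \<mu> a + ev \<mu> b"
  by (auto elim!: carrierE simp: kap_add ev_def)

lemma ev_smult: "a \<in> carrier R \<Longrightarrow> ev \<mu> (c \<odot>\<^bsub>R\<^esub> a) = c * ev \<mu> a"
  by (auto elim!: carrierE simp: kap_smult ev_def)

text \<open>The monomials involving \<open>W\<close> or \<open>U\<close> span an ideal, and among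
  the powers of \<open>Y\<close> the twist is trivial.\<close>

lemma ev_mult:
  assumes "a \<in> carrier R" "b \<in> carrier R"
  shows "ev \<mu> (a \<otimes>\<^bsub>R\<^esub> b) = ev \<mu> a * ev \<mu> b"
proof -
  let ?h = "\<lambda>(i, j, k). if i = 0 \<and> k = 0 then \<mu> ^ j else 0"
  have "lin ?h (tmult (bich \<alpha> s) f g) = lin ?h f * lin ?h g" for f g
  proof (induction f rule: poly_mapping_additive_induct)
    case (single p x)
    show ?case
    proof (induction g rule: poly_mapping_additive_induct)
      case (single q y)
      show ?case by (cases p; cases q) (auto simp: bich_eq power_add)
    qed (simp add: tmult_add_right algebra_simps)
  qed (simp add: tmult_add_left algebra_simps)
  then show ?thesis using assms by (auto elim!: carrierE simp: kap_mult ev_def)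
qed

lemma rep_eq_ev:
  assumes \<sigma>: "\<sigma> \<in> alg_reps R d id" and W: "\<sigma> W = 0\<^sub>m d d" and U: "\<sigma> U = 0\<^sub>m d d"
    and Y: "\<sigma> Y = \<mu> \<cdot>\<^sub>m 1\<^sub>m d" and a: "a \<in> carrier R"
  shows "\<sigma> a = ev \<mu> a \<cdot>\<^sub>m 1\<^sub>m d"
  using a
proof (induction rule: gen_induct)
  case one
  show ?case using alg_repsD(4)[OF \<sigma>] by (auto intro!: eq_matI)
next
  case W
  show ?case using assms by (auto intro!: eq_matI)
next
  case U
  show ?case using assms by (auto intro!: eq_matI)
next
  case Y
  show ?case using assms by simp
next
  case (add a b)
  then show ?case using alg_repsD(2)[OF \<sigma>, of a b] by (auto intro!: eq_matI simp: ev_add algebra_simps)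
next
  case (mult a b)
  have "(x \<cdot>\<^sub>m 1\<^sub>m d) * (y \<cdot>\<^sub>m 1\<^sub>m d) = (x * y) \<cdot>\<^sub>m 1\<^sub>m d" for x y :: complex
    using mult_smult_assoc_mat[of "1\<^sub>m d" d d "y \<cdot>\<^sub>m 1\<^sub>m d" d x] by (auto intro!: eq_matI)
  then show ?case using alg_repsD(3)[OF \<sigma>, of a b] mult by (simp add: ev_mult)
next
  case (smult c a)
  then show ?case using alg_repsD(5)[OF \<sigma>, of a c] by (auto intro!: eq_matI simp: ev_smult)
qed

lemma rep_invariantI:
  assumes \<sigma>: "\<sigma> \<in> alg_reps R d id" and K: "K \<subseteq> carrier_vec d"
    and Kadd: "\<And>v w. v \<in> K \<Longrightarrow> w \<in> K \<Longrightarrow> v + w \<in> K" and Ksmult: "\<And>c v. v \<in> K \<Longrightarrow> c \<cdot>\<^sub>v v \<in> K"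
    and gens: "\<And>G v. G \<in> {W, Y, U} \<Longrightarrow> v \<in> K \<Longrightarrow> \<sigma> G *\<^sub>v v \<in> K"
    and a: "a \<in> carrier R" and v: "v \<in> K"
  shows "\<sigma> a *\<^sub>v v \<in> K"
proof -
  note rep = alg_repsD[OF \<sigma>]
  have "\<forall>v\<in>K. \<sigma> a *\<^sub>v v \<in> K"
    using a
  proof (induction rule: gen_induct)
    case (add a b)
    show ?case
    proof
      fix v assume v: "v \<in> K"
      then have vd: "v \<in> carrier_vec d" using K by blast
      have "\<sigma> (a \<oplus>\<^bsub>R\<^esub> b) *\<^sub>v v = \<sigma> a *\<^sub>v v + \<sigma> b *\<^sub>v v"
        unfolding rep(2)[OF add(1,2)] by (rule add_mult_distrib_mat_vec[OF rep(1) rep(1) vd]) (use add in auto)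
      then show "\<sigma> (a \<oplus>\<^bsub>R\<^esub> b) *\<^sub>v v \<in> K" using add v Kadd by simp
    qed
  next
    case (mult a b)
    show ?case
    proof
      fix v assume v: "v \<in> K"
      then have vd: "v \<in> carrier_vec d" using K by blast
      have "\<sigma> (a \<otimes>\<^bsub>R\<^esub> b) *\<^sub>v v = \<sigma> a *\<^sub>v (\<sigma> b *\<^sub>v v)"
        unfolding rep(3)[OF mult(1,2)] by (rule assoc_mult_mat_vec[OF rep(1) rep(1) vd]) (use mult in auto)
      then show "\<sigma> (a \<otimes>\<^bsub>R\<^esub> b) *\<^sub>v v \<in> K" using mult v by auto
    qed
  next
    case (smult c a)
    show ?case
    proof
      fix v assume v: "v \<in> K"
      then have vd: "v \<in> carrier_vec d" using K by blast
      have "\<sigma> (c \<odot>\<^bsub>R\<^esub> a) *\<^sub>v v = c \<cdot>\<^sub>v (\<sigma> a *\<^sub>v v)"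
        using smult_mat_vec[OF rep(1)[OF smult(1)] vd] rep(5)[OF smult(1)] by simp
      then show "\<sigma> (c \<odot>\<^bsub>R\<^esub> a) *\<^sub>v v \<in> K" using smult v Ksmult by simp
    qed
  next
    case one
    then show ?case using rep(4) K by auto
  next
    case W
    show ?case using gens[of W] by auto
  next
    case Y
    show ?case using gens[of Y] by auto
  next
    case U
    show ?case using gens[of U] by auto
  qed
  then show ?thesis using v by blast
qed

subsection \<open>Simple representations with nilpotent \<open>W\<close> and \<open>U\<close>\<close>

text \<open>The kernel of an element that commutes with the generators up to scalars is a
  subrepresentation, hence zero or everything; a nilpotent operator on a nonzero space has nonzero
  kernel.\<close>

lemma simple_normal_nilpotent:
  assumes simple: "simple_rep R d \<sigma>" and N: "N \<in> carrier R"
    and normal: "\<And>G. G \<in> {W, Y, U} \<Longrightarrow> \<exists>c. N \<otimes>\<^bsub>R\<^esub> G = c \<odot>\<^bsub>R\<^esub> (G \<otimes>\<^bsub>R\<^esub> N)"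
    and nil: "\<sigma> N ^\<^sub>m k = 0\<^sub>m d d"
  shows "\<sigma> N = 0\<^sub>m d d"
proof -
  note \<sigma> = simple_repD(1)[OF simple]
  note rep = alg_repsD[OF \<sigma>]
  have dN: "\<sigma> N \<in> carrier_mat d d" by (rule rep(1)[OF N])
  define K where "K = {v \<in> carrier_vec d. \<sigma> N *\<^sub>v v = 0\<^sub>v d}"
  have zero: "\<sigma> N *\<^sub>v 0\<^sub>v d = 0\<^sub>v d" using dN by (intro eq_vecI) auto
  have sub: "VectorSpace.subspace class_ring K (module_vec TYPE(complex) d)"
    by (rule vec_subspaceI)
      (use dN zero in \<open>auto simp: K_def mult_add_distrib_mat_vec mult_mat_vec\<close>)
  have gen: "\<sigma> G *\<^sub>v v \<in> K" if G: "G \<in> {W, Y, U}" and v: "v \<in> K" for G v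
  proof -
    have vd: "v \<in> carrier_vec d" "\<sigma> N *\<^sub>v v = 0\<^sub>v d" using v by (simp_all add: K_def)
    have GR: "G \<in> carrier R" using G by auto
    have dG: "\<sigma> G \<in> carrier_mat d d" by (rule rep(1)[OF GR])
    obtain c where c: "N \<otimes>\<^bsub>R\<^esub> G = c \<odot>\<^bsub>R\<^esub> (G \<otimes>\<^bsub>R\<^esub> N)" using normal[OF G] by blast
    have "\<sigma> N * \<sigma> G = c \<cdot>\<^sub>m (\<sigma> G * \<sigma> N)"
      using rep(3)[OF N GR] rep(3)[OF GR N] rep(5)[of "G \<otimes>\<^bsub>R\<^esub> N" c] c N GR by simp
    then have "\<sigma> N *\<^sub>v (\<sigma> G *\<^sub>v v) = (c \<cdot>\<^sub>m (\<sigma> G * \<sigma> N)) *\<^sub>v v"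
      using assoc_mult_mat_vec[OF dN dG vd(1)] by simp
    also have "\<dots> = c \<cdot>\<^sub>v (\<sigma> G *\<^sub>v (\<sigma> N *\<^sub>v v))"
      using smult_mat_vec[OF mult_carrier_mat[OF dG dN] vd(1)] assoc_mult_mat_vec[OF dG dN vd(1)] by simp
    also have "\<dots> = 0\<^sub>v d" unfolding vd(2) using dG by (intro eq_vecI) auto
    finally show ?thesis using dG vd by (auto simp: K_def)
  qed
  have "K = {0\<^sub>v d} \<or> K = carrier_vec d"
    by (rule simple_repD(3)[OF simple sub], rule rep_invariantI[OF \<sigma> _ _ _ gen])
      (use dN in \<open>auto simp: K_def mult_add_distrib_mat_vec mult_mat_vec\<close>)
  moreover have False if K: "K = {0\<^sub>v d}"
  proof -
    have pow0: "v = 0\<^sub>v d" if "\<sigma> N ^\<^sub>m j *\<^sub>v v = 0\<^sub>v d" "v \<in> carrier_vec d" for v j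
      using that
    proof (induction j arbitrary: v)
      case 0
      then show ?case using dN by simp
    next
      case (Suc j)
      have "\<sigma> N ^\<^sub>m Suc j *\<^sub>v v = \<sigma> N ^\<^sub>m j *\<^sub>v (\<sigma> N *\<^sub>v v)"
        using assoc_mult_mat_vec[OF pow_carrier_mat[OF dN] dN Suc.prems(2)] by simp
      then have "\<sigma> N *\<^sub>v v = 0\<^sub>v d" using Suc dN by (metis mult_mat_vec_carrier)
      then show ?case using K Suc.prems(2) unfolding K_def by blast
    qed
    have "\<sigma> N ^\<^sub>m k *\<^sub>v unit_vec d 0 = 0\<^sub>v d" unfolding nil by (intro eq_vecI) auto
    then have "(unit_vec d 0 :: complex vec) = 0\<^sub>v d" by (rule pow0) simp
    then show False using simple_repD(2)[OF simple] by (metis index_unit_vec(1) index_zero_vec(1) zero_neq_one)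
  qed
  ultimately have "K = carrier_vec d" by blast
  then show ?thesis using dN by (intro eq_mat_by_vecI[of _ d d]) (auto simp: K_def zero_mult_vec)
qed

end

section \<open>The structure of semisimple representations\<close>

lemma subspaceD:
  assumes "VectorSpace.subspace class_ring W (module_vec TYPE(complex) d)"
  shows "W \<subseteq> carrier_vec d" "0\<^sub>v d \<in> W" "v \<in> W \<Longrightarrow> w \<in> W \<Longrightarrow> v + w \<in> W" "v \<in> W \<Longrightarrow> c \<cdot>\<^sub>v v \<in> W"
proof -
  interpret submodule class_ring W "module_vec TYPE(complex) d"
    using assms by (simp add: VectorSpace.subspace_def)
  show "W \<subseteq> carrier_vec d" "0\<^sub>v d \<in> W" "v \<in> W \<Longrightarrow> w \<in> W \<Longrightarrow> v + w \<in> W" "v \<in> W \<Longrightarrow> c \<cdot>\<^sub>v v \<in> W"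
    using subset zero_closed m_closed[of v w] smult_closed[of c v] by (auto simp: module_vec_def)
qed

lemma simple_rep_conj:
  assumes simple: "simple_rep R n \<sigma>" and \<phi>: "\<phi> \<in> alg_reps R n id"
    and g: "g \<in> carrier_mat n n" "g' \<in> carrier_mat n n" "g * g' = 1\<^sub>m n" "g' * g = 1\<^sub>m n"
    and eq: "\<And>a. a \<in> carrier R \<Longrightarrow> \<phi> a = g * \<sigma> a * g'"
  shows "simple_rep R n \<phi>"
  unfolding simple_rep_def
proof (intro conjI allI impI)
  show "n > 0" by (rule simple_repD(2)[OF simple])
  fix V
  assume V: "VectorSpace.subspace class_ring V (module_vec TYPE(complex) n) \<and>
    (\<forall>a\<in>carrier R. \<forall>v\<in>V. \<phi> a *\<^sub>v v \<in> V)"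
  note sub = subspaceD[OF conjunct1[OF V]]
  have gg: "g *\<^sub>v (g' *\<^sub>v v) = v" "g' *\<^sub>v (g *\<^sub>v v) = v" if "v \<in> carrier_vec n" for v
    using assoc_mult_mat_vec[OF g(1,2) that] assoc_mult_mat_vec[OF g(2,1) that] g(3,4) that by simp_all
  define V' where "V' = {v \<in> carrier_vec n. g *\<^sub>v v \<in> V}"
  have "g *\<^sub>v 0\<^sub>v n = 0\<^sub>v n" using g by (intro eq_vecI) auto
  then have "VectorSpace.subspace class_ring V' (module_vec TYPE(complex) n)"
    using sub g by (intro vec_subspaceI) (auto simp: V'_def mult_add_distrib_mat_vec mult_mat_vec)
  moreover have "\<sigma> a *\<^sub>v v \<in> V'" if a: "a \<in> carrier R" and v: "v \<in> V'" for a v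
  proof -
    have \<sigma>: "\<sigma> a \<in> carrier_mat n n" using alg_repsD(1)[OF simple_repD(1)[OF simple] a] .
    have vd: "v \<in> carrier_vec n" "g *\<^sub>v v \<in> V" using v by (auto simp: V'_def)
    have "\<phi> a *\<^sub>v (g *\<^sub>v v) = (g * \<sigma> a) *\<^sub>v (g' *\<^sub>v (g *\<^sub>v v))"
      unfolding eq[OF a] by (rule assoc_mult_mat_vec[of _ n n _ n]) (use g \<sigma> vd in auto)
    also have "\<dots> = g *\<^sub>v (\<sigma> a *\<^sub>v v)"
      using gg(2)[OF vd(1)] assoc_mult_mat_vec[OF g(1) \<sigma> vd(1)] by simp
    finally have "g *\<^sub>v (\<sigma> a *\<^sub>v v) \<in> V" using V a vd(2) by metis
    then show ?thesis using vd(1) \<sigma> by (simp add: V'_def)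
  qed
  ultimately have "V' = {0\<^sub>v n} \<or> V' = carrier_vec n" by (rule simple_repD(3)[OF simple])
  then show "V = {0\<^sub>v n} \<or> V = carrier_vec n"
  proof
    assume V0: "V' = {0\<^sub>v n}"
    have "v = 0\<^sub>v n" if "v \<in> V" for v
    proof -
      have vd: "v \<in> carrier_vec n" using that sub by blast
      then have "g' *\<^sub>v v \<in> V'" using gg(1)[OF vd] that g by (auto simp: V'_def)
      then have "g' *\<^sub>v v = 0\<^sub>v n" using V0 by blast
      then have "v = g *\<^sub>v 0\<^sub>v n" using gg(1)[OF vd] by simp
      also have "\<dots> = 0\<^sub>v n" using g by (intro eq_vecI) auto
      finally show ?thesis .
    qed
    then show ?thesis using sub by blast
  next
    assume V1: "V' = carrier_vec n"
    have "v \<in> V" if vd: "v \<in> carrier_vec n" for v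
    proof -
      have "g' *\<^sub>v v \<in> V'" unfolding V1 using g vd by simp
      then show ?thesis using gg(1)[OF vd] by (simp add: V'_def)
    qed
    then show ?thesis using sub by blast
  qed
qed (rule \<phi>)

context quantum_space
begin

text \<open>Once \<open>W\<close> and \<open>U\<close> act by zero, only \<open>Y\<close> acts, and
  over the complex numbers it has an eigenvector.\<close>

lemma simple_dim1:
  assumes simple: "simple_rep R d \<sigma>" and W0: "\<sigma> W = 0\<^sub>m d d" and U0: "\<sigma> U = 0\<^sub>m d d"
  shows "d = 1" "\<exists>\<mu>. \<forall>a\<in>carrier R. \<sigma> a = ev \<mu> a \<cdot>\<^sub>m 1\<^sub>m 1"
proof -
  note \<sigma> = simple_repD(1)[OF simple] and d0 = simple_repD(2)[OF simple]
  have dY: "\<sigma> Y \<in> carrier_mat d d" by (rule alg_repsD(1)[OF \<sigma>]) simp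
  obtain \<mu> v where v: "eigenvector (\<sigma> Y) v \<mu>"
    using spectrum_non_empty[OF dY d0] by (auto simp: spectrum_def eigenvalue_def)
  \<comment> \<open>An eigenspace of \<open>Y\<close> is invariant and nonzero, so it is the whole
    space.\<close>
  define E where "E = {v \<in> carrier_vec d. \<sigma> Y *\<^sub>v v = \<mu> \<cdot>\<^sub>v v}"
  have "\<sigma> Y *\<^sub>v 0\<^sub>v d = \<mu> \<cdot>\<^sub>v 0\<^sub>v d" using dY by (intro eq_vecI) auto
  then have E0: "0\<^sub>v d \<in> E" by (simp add: E_def)
  have Eadd: "v + w \<in> E" if "v \<in> E" "w \<in> E" for v w
    using that dY by (auto simp: E_def mult_add_distrib_mat_vec smult_add_distrib_vec)
  have Esmult: "c \<cdot>\<^sub>v v \<in> E" if "v \<in> E" for v c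
    using that dY by (auto simp: E_def mult_mat_vec smult_smult_assoc mult.commute)
  have Egen: "\<sigma> G *\<^sub>v v \<in> E" if "G \<in> {W, Y, U}" "v \<in> E" for G v
  proof -
    have vd: "v \<in> carrier_vec d" "\<sigma> Y *\<^sub>v v = \<mu> \<cdot>\<^sub>v v" using that by (auto simp: E_def)
    show ?thesis using that(1)
    proof (elim insertE emptyE)
      assume "G = Y"
      then show ?thesis using Esmult[OF that(2), of \<mu>] vd by simp
    qed (use W0 U0 E0 zero_mult_vec[OF vd(1)] in auto)
  qed
  have "E = {0\<^sub>v d} \<or> E = carrier_vec d"
  proof (rule simple_repD(3)[OF simple])
    show "VectorSpace.subspace class_ring E (module_vec TYPE(complex) d)"
      by (rule vec_subspaceI[OF _ E0 Eadd Esmult]) (auto simp: E_def)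
    fix a v assume "a \<in> carrier R" "v \<in> E"
    then show "\<sigma> a *\<^sub>v v \<in> E"
      by (intro rep_invariantI[OF \<sigma> _ Eadd Esmult Egen]) (auto simp: E_def)
  qed
  moreover have "v \<in> E" "v \<noteq> 0\<^sub>v d" using v dY by (auto simp: E_def eigenvector_def)
  ultimately have E: "E = carrier_vec d" by auto
  have Y\<mu>: "\<sigma> Y = \<mu> \<cdot>\<^sub>m 1\<^sub>m d"
  proof (rule eq_mat_by_vecI[OF dY])
    fix v :: "complex vec" assume "v \<in> carrier_vec d"
    then show "\<sigma> Y *\<^sub>v v = (\<mu> \<cdot>\<^sub>m 1\<^sub>m d) *\<^sub>v v"
      using E smult_mat_vec[of "1\<^sub>m d" d d v \<mu>] by (auto simp: E_def)
  qed simp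
  note ev = rep_eq_ev[OF \<sigma> W0 U0 Y\<mu>]
  \<comment> \<open>Now every element acts by a scalar, so even the line through the first unit
    vector is invariant; simplicity forces it to fill the space.\<close>
  define L where "L = {v \<in> carrier_vec d. \<forall>i<d. i \<noteq> 0 \<longrightarrow> v $ i = (0::complex)}"
  have "L = {0\<^sub>v d} \<or> L = carrier_vec d"
  proof (rule simple_repD(3)[OF simple])
    show "VectorSpace.subspace class_ring L (module_vec TYPE(complex) d)"
      by (rule vec_subspaceI) (auto simp: L_def)
    fix a v assume av: "a \<in> carrier R" "v \<in> L"
    then have "\<sigma> a *\<^sub>v v = ev \<mu> a \<cdot>\<^sub>v v"
      using ev[OF av(1)] smult_mat_vec[of "1\<^sub>m d" d d v "ev \<mu> a"] by (auto simp: L_def)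
    then show "\<sigma> a *\<^sub>v v \<in> L" using av by (auto simp: L_def)
  qed
  moreover have "L \<noteq> {0\<^sub>v d}"
  proof
    assume "L = {0\<^sub>v d}"
    moreover have "unit_vec d 0 \<in> L" by (auto simp: L_def)
    ultimately have "(unit_vec d 0 :: complex vec) = 0\<^sub>v d" by blast
    then show False using d0 by (metis index_unit_vec(1) index_zero_vec(1) zero_neq_one)
  qed
  ultimately have L: "L = carrier_vec d" by blast
  show d1: "d = 1"
  proof (rule ccontr)
    assume "d \<noteq> 1"
    then have d2: "d \<ge> 2" using d0 by simp
    have "(unit_vec d 1 :: complex vec) \<in> L" unfolding L by simp
    then have "\<forall>i<d. i \<noteq> 0 \<longrightarrow> unit_vec d 1 $ i = (0::complex)" by (simp add: L_def)
    then have "unit_vec d 1 $ 1 = (0::complex)" using d2 by (metis Suc_1 Suc_le_lessD zero_neq_one)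
    then show False using d2 by simp
  qed
  show "\<exists>\<mu>. \<forall>a\<in>carrier R. \<sigma> a = ev \<mu> a \<cdot>\<^sub>m 1\<^sub>m 1" using ev d1 by blast
qed

section \<open>Decomposition of a semisimple representation into characters\<close>

lemma tr_noncentral_pow:
  assumes "0 < j" "j < n"
  shows "tr (Y [^]\<^bsub>R\<^esub> j) = \<kappa> 0"
proof -
  have "\<not> int n dvd int j" using assms by (auto dest: dvd_imp_le)
  then show ?thesis by (simp add: Y_pow tr_kap proj_centre_sgl Cset_iff)
qed

lemma rep_zero:
  assumes "\<sigma> \<in> alg_reps R d id"
  shows "\<sigma> (\<kappa> 0) = 0\<^sub>m d d"
proof -
  have "\<sigma> (0 \<odot>\<^bsub>R\<^esub> \<kappa> 0) = id 0 \<cdot>\<^sub>m \<sigma> (\<kappa> 0)" by (rule alg_repsD(5)[OF assms]) simp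
  then have "\<sigma> (\<kappa> 0) = 0 \<cdot>\<^sub>m \<sigma> (\<kappa> 0)" by (simp add: kap_smult)
  also have "\<dots> = 0\<^sub>m d d" using alg_repsD(1)[OF assms, of "\<kappa> 0"] by (intro eq_matI) auto
  finally show ?thesis .
qed

lemma monoid_R: "Group.monoid R" ..

lemma isotypic_structure:
  assumes trep: "\<phi> \<in> trep R tr n id" and iso: "isotypic R n \<phi> m d e \<sigma> g g'"
    and W0: "\<phi> (W [^]\<^bsub>R\<^esub> n) = 0 \<cdot>\<^sub>m 1\<^sub>m n" and U0: "\<phi> (U [^]\<^bsub>R\<^esub> n) = 0 \<cdot>\<^sub>m 1\<^sub>m n"
    and Y\<beta>: "\<phi> (Y [^]\<^bsub>R\<^esub> n) = \<beta> \<cdot>\<^sub>m 1\<^sub>m n" and \<beta>: "\<beta> \<noteq> 0"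
  obtains \<mu> where "m = n" "\<And>i. i < n \<Longrightarrow> d i = 1" "\<And>i. i < n \<Longrightarrow> e i = 1" "inj_on \<mu> {..<n}"
    "\<And>i. i < n \<Longrightarrow> \<mu> i ^ n = \<beta>" "\<And>i a. i < n \<Longrightarrow> a \<in> carrier R \<Longrightarrow> \<sigma> i a = ev (\<mu> i) a \<cdot>\<^sub>m 1\<^sub>m 1"
proof -
  have simple: "simple_rep R (d i) (\<sigma> i)" if "i < m" for i by (rule isotypicD(3)[OF iso that])
  \<comment> \<open>\<open>W\<close> and \<open>U\<close> commute with all generators up to scalars,
    and their \<open>n\<close>-th powers act by zero on every summand.\<close>
  have kill: "\<sigma> i G = 0\<^sub>m (d i) (d i)" if i: "i < m" and G: "G \<in> {W, U}" for i G
  proof (rule simple_normal_nilpotent[OF simple[OF i]])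
    show GR: "G \<in> carrier R" using G by auto
    have "\<sigma> i (G [^]\<^bsub>R\<^esub> n) = 0 \<cdot>\<^sub>m 1\<^sub>m (d i)"
      using isotypic_scalarD[OF iso _ W0 i] isotypic_scalarD[OF iso _ U0 i] G by auto
    also have "\<dots> = 0\<^sub>m (d i) (d i)" by (intro eq_matI) auto
    finally show "\<sigma> i G ^\<^sub>m n = 0\<^sub>m (d i) (d i)"
      using alg_reps_pow[OF monoid_R simple_repD(1)[OF simple[OF i]] GR, of n] by simp
    have refl: "\<exists>c. a = c \<odot>\<^bsub>R\<^esub> a" if "a \<in> carrier R" for a
      using one_smult[OF that] by metis
    show "\<exists>c. G \<otimes>\<^bsub>R\<^esub> G' = c \<odot>\<^bsub>R\<^esub> (G' \<otimes>\<^bsub>R\<^esub> G)" if "G' \<in> {W, Y, U}" for G'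
      using G that W_Y W_U U_W U_Y refl[of "W \<otimes>\<^bsub>R\<^esub> W"] refl[of "U \<otimes>\<^bsub>R\<^esub> U"] by auto
  qed
  have d1: "d i = 1" if "i < m" for i
    using simple_dim1(1)[OF simple[OF that]] kill[OF that] by blast
  have "\<exists>\<mu>. \<forall>a\<in>carrier R. \<sigma> i a = ev \<mu> a \<cdot>\<^sub>m 1\<^sub>m 1" if "i < m" for i
    using simple_dim1(2)[OF simple[OF that]] kill[OF that] by blast
  then obtain \<mu> where \<mu>: "\<And>i a. i < m \<Longrightarrow> a \<in> carrier R \<Longrightarrow> \<sigma> i a = ev (\<mu> i) a \<cdot>\<^sub>m 1\<^sub>m 1" by metis
  have evY: "ev x (Y [^]\<^bsub>R\<^esub> j) = x ^ j" for x j by (simp add: Y_pow ev_sgl)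
  have \<mu>n: "\<mu> i ^ n = \<beta>" if i: "i < m" for i
  proof -
    have "\<mu> i ^ n \<cdot>\<^sub>m 1\<^sub>m 1 = \<beta> \<cdot>\<^sub>m (1\<^sub>m 1 :: complex mat)"
      using isotypic_scalarD[OF iso _ Y\<beta> i] \<mu>[OF i, of "Y [^]\<^bsub>R\<^esub> n"] d1[OF i] by (simp add: evY)
    then have "(\<mu> i ^ n \<cdot>\<^sub>m 1\<^sub>m 1) $$ (0, 0) = (\<beta> \<cdot>\<^sub>m (1\<^sub>m 1 :: complex mat)) $$ (0, 0)" by simp
    then show ?thesis by simp
  qed
  have \<mu>0: "\<mu> i \<noteq> 0" if "i < m" for i using \<mu>n[OF that] \<beta> by (auto simp: zero_power)
  \<comment> \<open>Equal eigenvalues would make two summands equal as representations, against the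
    pairwise non-isomorphism in \<open>isotypic\<close>.\<close>
  have inj: "inj_on \<mu> {..<m}"
  proof (rule inj_onI, rule ccontr)
    fix i j assume ij: "i \<in> {..<m}" "j \<in> {..<m}" "\<mu> i = \<mu> j" "i \<noteq> j"
    have "similar_mat_wit (\<sigma> i a) (\<sigma> j a) (1\<^sub>m 1) (1\<^sub>m 1)" if "a \<in> carrier R" for a
      using ij \<mu>[of i a] \<mu>[of j a] that by (intro similar_mat_witI[of _ _ 1]) auto
    then have "rep_iso R (\<sigma> i) (\<sigma> j)" unfolding rep_iso_def by blast
    then show False using isotypicD(4)[OF iso] ij by auto
  qed
  have trY: "(\<Sum>i<n. \<phi> (Y [^]\<^bsub>R\<^esub> j) $$ (i, i)) = (\<Sum>i<m. of_nat (e i) * \<mu> i ^ j)" for j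
  proof -
    have "(\<Sum>i<n. \<phi> (Y [^]\<^bsub>R\<^esub> j) $$ (i, i)) = (\<Sum>i<m. of_nat (e i) * \<sigma> i (Y [^]\<^bsub>R\<^esub> j) $$ (0, 0))"
      by (rule isotypic_trace[OF iso _ d1]) auto
    also have "\<dots> = (\<Sum>i<m. of_nat (e i) * \<mu> i ^ j)"
      by (rule sum.cong) (auto simp: \<mu> evY)
    finally show ?thesis .
  qed
  have tr0: "(\<Sum>i<m. of_nat (e i) * \<mu> i ^ j) = 0" if j: "0 < j" "j < n" for j
  proof -
    have "\<phi> (tr (Y [^]\<^bsub>R\<^esub> j)) = (\<Sum>i<n. \<phi> (Y [^]\<^bsub>R\<^esub> j) $$ (i, i)) \<cdot>\<^sub>m 1\<^sub>m n"
      using trep by (auto simp: trep_def)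
    then have "(\<Sum>i<m. of_nat (e i) * \<mu> i ^ j) \<cdot>\<^sub>m 1\<^sub>m n = (0\<^sub>m n n :: complex mat)"
      unfolding tr_noncentral_pow[OF j] trY rep_zero[OF isotypicD(1)[OF iso]] by simp
    then have "((\<Sum>i<m. of_nat (e i) * \<mu> i ^ j) \<cdot>\<^sub>m 1\<^sub>m n) $$ (0, 0) = (0\<^sub>m n n :: complex mat) $$ (0, 0)" by simp
    then show ?thesis by simp
  qed
  have esum: "(\<Sum>i<m. e i) = n"
    using isotypic_dim[OF iso one_closed] d1 by simp
  \<comment> \<open>Fourier inversion: in the sum over \<open>j\<close>, only \<open>j = 0\<close>
    survives on account of the vanishing traces, giving \<open>n\<close>; on the other hand, all
    ratios \<open>\<mu> i / \<mu> k\<close> are \<open>n\<close>-th roots of unity, so orthogonality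
    gives \<open>n e k\<close>.\<close>
  have e1: "e k = 1" if k: "k < m" for k
  proof -
    have "(\<Sum>j<n. (\<Sum>i<m. of_nat (e i) * \<mu> i ^ j) / \<mu> k ^ j) = (\<Sum>j<n. if j = 0 then of_nat n else 0)"
      by (intro sum.cong refl) (use tr0 esum in \<open>auto simp flip: of_nat_sum\<close>)
    also have "\<dots> = of_nat n" by simp
    finally have 1: "(\<Sum>j<n. (\<Sum>i<m. of_nat (e i) * \<mu> i ^ j) / \<mu> k ^ j) = of_nat n" .
    have "(\<Sum>j<n. (\<Sum>i<m. of_nat (e i) * \<mu> i ^ j) / \<mu> k ^ j) = (\<Sum>j<n. \<Sum>i<m. of_nat (e i) * (\<mu> i / \<mu> k) ^ j)"
      by (simp add: sum_divide_distrib power_divide)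
    also have "\<dots> = (\<Sum>i<m. of_nat (e i) * (\<Sum>j<n. (\<mu> i / \<mu> k) ^ j))"
      by (subst sum.swap) (simp add: sum_distrib_left)
    also have "\<dots> = (\<Sum>i<m. if i = k then of_nat (e k) * of_nat n else 0)"
    proof (intro sum.cong refl)
      fix i assume i: "i \<in> {..<m}"
      show "of_nat (e i) * (\<Sum>j<n. (\<mu> i / \<mu> k) ^ j) = (if i = k then of_nat (e k) * of_nat n else 0)"
      proof (cases "i = k")
        case True
        then show ?thesis using \<mu>0[OF k] by simp
      next
        case False
        then have "\<mu> i \<noteq> \<mu> k" using inj i k by (auto dest: inj_onD)
        then have "\<mu> i / \<mu> k \<noteq> 1" using \<mu>0[OF k] by simp
        moreover have "(\<mu> i / \<mu> k) ^ n = 1" using \<mu>n i k \<beta> by (simp add: power_divide)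
        ultimately show ?thesis using False geometric_sum[of "\<mu> i / \<mu> k" n] by simp
      qed
    qed
    also have "\<dots> = of_nat (e k) * of_nat n" using k by simp
    finally have "of_nat (e k) * of_nat n = (of_nat n :: complex)" using 1 by simp
    then show ?thesis using n_pos by simp
  qed
  have mn: "m = n" using esum e1 by simp
  show ?thesis by (rule that[of \<mu>]) (use mn d1 e1 inj \<mu>n \<mu> in auto)
qed

definition Dg :: "complex \<Rightarrow> 'r \<Rightarrow> complex mat" where
  "Dg \<mu> a = mat n n (\<lambda>(r, c). if r = c then ev (\<mu> * \<alpha> ^ r) a else 0)"

lemma Dg_carrier [simp]: "Dg \<mu> a \<in> carrier_mat n n"
  by (simp add: Dg_def)

text \<open>The \<open>n\<close> distinct eigenvalues are all the roots of
  \<open>X^n = \<beta>\<close>, so they can be listed as \<open>\<mu>\<alpha>^r\<close>; the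
  reordering is absorbed into the base change matrix.\<close>

lemma diagonal_form:
  assumes trep: "\<phi> \<in> trep R tr n id" and ss: "semisimple_rep R n \<phi>"
    and W0: "\<phi> (W [^]\<^bsub>R\<^esub> n) = 0 \<cdot>\<^sub>m 1\<^sub>m n" and U0: "\<phi> (U [^]\<^bsub>R\<^esub> n) = 0 \<cdot>\<^sub>m 1\<^sub>m n"
    and Y\<beta>: "\<phi> (Y [^]\<^bsub>R\<^esub> n) = \<beta> \<cdot>\<^sub>m 1\<^sub>m n" and \<beta>: "\<beta> \<noteq> 0"
  obtains g g' \<mu> where "g \<in> carrier_mat n n" "g' \<in> carrier_mat n n" "g * g' = 1\<^sub>m n" "g' * g = 1\<^sub>m n"
    "\<mu> ^ n = \<beta>" "\<And>a. a \<in> carrier R \<Longrightarrow> \<phi> a = g * Dg \<mu> a * g'"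
proof -
  obtain m d e \<sigma> g g' where iso: "isotypic R n \<phi> m d e \<sigma> g g'"
    using ss by (auto simp: semisimple_rep_def)
  obtain \<mu> where m: "m = n" and d: "\<And>i. i < n \<Longrightarrow> d i = 1" and e: "\<And>i. i < n \<Longrightarrow> e i = 1"
    and inj: "inj_on \<mu> {..<n}" and \<mu>n: "\<And>i. i < n \<Longrightarrow> \<mu> i ^ n = \<beta>"
    and \<mu>: "\<And>i a. i < n \<Longrightarrow> a \<in> carrier R \<Longrightarrow> \<sigma> i a = ev (\<mu> i) a \<cdot>\<^sub>m 1\<^sub>m 1"
    using isotypic_structure[OF trep iso W0 U0 Y\<beta> \<beta>] by blast
  have \<mu>0: "\<mu> i \<noteq> 0" if "i < n" for i using \<mu>n[OF that] \<beta> by (auto simp: zero_power)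
  let ?q = "\<lambda>i. \<mu> i / \<mu> 0"
  have "inj_on ?q {..<n}" using inj \<mu>0[of 0] by (auto simp: inj_on_def)
  then have "card (?q ` {..<n}) = n" by (simp add: card_image)
  moreover have "?q ` {..<n} \<subseteq> {z. z ^ n = 1}" using \<mu>n \<beta> by (auto simp: power_divide)
  \<comment> \<open>The \<open>n\<close> distinct ratios exhaust the \<open>n\<close>-th roots of
    unity by counting.\<close>
  ultimately have roots: "?q ` {..<n} = {z. z ^ n = 1}"
    using finite_roots_unity[of n] n3 card_roots_unity_eq[OF n_pos] by (intro card_subset_eq) auto
  have "\<exists>i<n. \<mu> i = \<mu> 0 * \<alpha> ^ t" for t
  proof -
    have "(\<alpha> ^ t) ^ n = 1" by (metis \<alpha>_pow_n mult.commute power_mult power_one)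
    then have "\<alpha> ^ t \<in> ?q ` {..<n}" using roots by simp
    then show ?thesis using \<mu>0[of 0] by (auto simp: field_simps)
  qed
  then obtain \<pi> where \<pi>: "\<And>t. \<pi> t < n" "\<And>t. \<mu> (\<pi> t) = \<mu> 0 * \<alpha> ^ t" by metis
  have "inj_on \<pi> {..<n}"
  proof (rule inj_onI)
    fix r c assume rc: "r \<in> {..<n}" "c \<in> {..<n}" "\<pi> r = \<pi> c"
    then have "\<alpha> ^ r = \<alpha> ^ c" using \<pi>(2)[of r] \<pi>(2)[of c] \<mu>0[of 0] by simp
    then show "r = c" using primitive_root_inj[OF prim n_pos] rc by auto
  qed
  moreover have "\<pi> ` {..<n} \<subseteq> {..<n}" using \<pi>(1) by auto
  ultimately have bij: "bij_betw \<pi> {..<n} {..<n}"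
    unfolding bij_betw_def using endo_inj_surj[of "{..<n}" \<pi>] by blast
  have reindex: "(\<Sum>k<n. h (\<pi> k)) = (\<Sum>k<n. h k)" for h :: "nat \<Rightarrow> complex"
    by (rule sum.reindex_bij_betw[OF bij])
  have s: "similar_mat_wit (\<phi> a) (mat n n (\<lambda>(r, c). if r = c then ev (\<mu> r) a else 0)) g g'"
    if a: "a \<in> carrier R" for a
  proof -
    have "diag_block_mat (map (\<lambda>i. kron (1\<^sub>m (e i)) (\<sigma> i a)) [0..<m])
      = diag_block_mat (map (\<lambda>i. ev (\<mu> i) a \<cdot>\<^sub>m 1\<^sub>m 1) [0..<n])"
      by (intro arg_cong[of _ _ diag_block_mat]) (auto simp: m e kron_one_one \<mu> a)
    also have "\<dots> = mat n n (\<lambda>(r, c). if r = c then ev (\<mu> r) a else 0)"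
      by (subst diag_block_dim1) auto
    finally show ?thesis using isotypicD(5)[OF iso a] by simp
  qed
  note s1 = similar_mat_witD2[OF alg_repsD(1)[OF isotypicD(1)[OF iso] one_closed] s[OF one_closed]]
  \<comment> \<open>Columns of \<open>g\<close> and rows of \<open>g'\<close> are permuted so that
    position \<open>r\<close> carries the eigenvalue \<open>\<mu> 0 * \<alpha>^r\<close>.\<close>
  define G where "G = mat n n (\<lambda>(r, c). g $$ (r, \<pi> c))"
  define G' where "G' = mat n n (\<lambda>(r, c). g' $$ (\<pi> r, c))"
  have gg: "(\<Sum>k<n. g $$ (r, k) * g' $$ (k, c)) = (if r = c then 1 else 0)"
    "(\<Sum>k<n. g' $$ (r, k) * g $$ (k, c)) = (if r = c then 1 else 0)" if "r < n" "c < n" for r c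
    using arg_cong[OF s1(1), of "\<lambda>M. M $$ (r, c)"] arg_cong[OF s1(2), of "\<lambda>M. M $$ (r, c)"] s1(6,7) that
    by (simp_all add: scalar_prod_def lessThan_atLeast0)
  have "G * G' = 1\<^sub>m n"
  proof (rule eq_matI)
    fix r c assume "r < dim_row (1\<^sub>m n)" "c < dim_col (1\<^sub>m n)"
    then show "(G * G') $$ (r, c) = 1\<^sub>m n $$ (r, c)"
      using reindex[of "\<lambda>k. g $$ (r, k) * g' $$ (k, c)"] gg(1)[of r c]
      by (simp add: G_def G'_def scalar_prod_def lessThan_atLeast0)
  qed (auto simp: G_def G'_def)
  moreover have "G' * G = 1\<^sub>m n"
  proof (rule eq_matI)
    fix r c assume rc: "r < dim_row (1\<^sub>m n)" "c < dim_col (1\<^sub>m n)"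
    then have "\<pi> r = \<pi> c \<longleftrightarrow> r = c" using bij by (auto simp: bij_betw_def inj_on_def)
    then show "(G' * G) $$ (r, c) = 1\<^sub>m n $$ (r, c)"
      using gg(2)[OF \<pi>(1) \<pi>(1), of r c] rc
      by (simp add: G_def G'_def scalar_prod_def lessThan_atLeast0)
  qed (auto simp: G_def G'_def)
  moreover have "\<phi> a = G * Dg (\<mu> 0) a * G'" if a: "a \<in> carrier R" for a
  proof -
    have \<phi>: "\<phi> a \<in> carrier_mat n n" by (rule alg_repsD(1)[OF isotypicD(1)[OF iso] a])
    note sa = similar_mat_witD2[OF \<phi> s[OF a]]
    show ?thesis
    proof (rule eq_matI)
      fix r c assume "r < dim_row (G * Dg (\<mu> 0) a * G')" "c < dim_col (G * Dg (\<mu> 0) a * G')"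
      then have rc: "r < n" "c < n" by (auto simp: G_def G'_def)
      have "(G * Dg (\<mu> 0) a * G') $$ (r, c) = (\<Sum>k<n. G $$ (r, k) * ev (\<mu> 0 * \<alpha> ^ k) a * G' $$ (k, c))"
        unfolding Dg_def by (rule diag_conj_index) (use rc in \<open>auto simp: G_def G'_def\<close>)
      also have "\<dots> = (\<Sum>k<n. g $$ (r, \<pi> k) * ev (\<mu> (\<pi> k)) a * g' $$ (\<pi> k, c))"
        by (rule sum.cong) (use rc in \<open>auto simp: G_def G'_def \<pi>\<close>)
      also have "\<dots> = (\<Sum>k<n. g $$ (r, k) * ev (\<mu> k) a * g' $$ (k, c))"
        by (rule reindex)
      also have "\<dots> = \<phi> a $$ (r, c)"
        unfolding sa(3) by (rule diag_conj_index[symmetric]) (use sa rc in auto)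
      finally show "\<phi> a $$ (r, c) = (G * Dg (\<mu> 0) a * G') $$ (r, c)" by simp
    qed (use \<phi> in \<open>auto simp: G_def G'_def\<close>)
  qed
  ultimately show ?thesis using that[of G G' "\<mu> 0"] \<mu>n[of 0] by (auto simp: G_def G'_def)
qed

definition char_rep :: "complex \<Rightarrow> 'r \<Rightarrow> complex mat" where
  "char_rep \<mu> = (\<lambda>a\<in>carrier R. ev \<mu> a \<cdot>\<^sub>m 1\<^sub>m 1)"

lemma simple_char_rep: "simple_rep R 1 (char_rep \<mu>)"
  unfolding simple_rep_def
proof (intro conjI allI impI)
  show "char_rep \<mu> \<in> alg_reps R 1 id"
  proof (rule alg_repsI)
    fix a b assume "a \<in> carrier R" "b \<in> carrier R"
    then show "char_rep \<mu> (a \<otimes>\<^bsub>R\<^esub> b) = char_rep \<mu> a * char_rep \<mu> b"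
      by (auto intro!: eq_matI simp: char_rep_def ev_mult scalar_prod_def)
  qed (auto intro!: eq_matI simp: char_rep_def ev_add ev_smult algebra_simps)
  fix V
  assume V: "VectorSpace.subspace class_ring V (module_vec TYPE(complex) 1) \<and>
    (\<forall>a\<in>carrier R. \<forall>v\<in>V. char_rep \<mu> a *\<^sub>v v \<in> V)"
  note sub = subspaceD[OF conjunct1[OF V]]
  show "V = {0\<^sub>v 1} \<or> V = carrier_vec 1"
  proof (cases "V = {0\<^sub>v 1}")
    case False
    then obtain v where v: "v \<in> V" "v \<noteq> 0\<^sub>v 1" using sub(2) by blast
    then have vd: "v \<in> carrier_vec 1" using sub(1) by blast
    have v0: "v $ 0 \<noteq> 0"
    proof
      assume "v $ 0 = 0"
      then have "v = 0\<^sub>v 1" using vd by (intro eq_vecI) auto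
      then show False using v by simp
    qed
    have "w \<in> V" if w: "w \<in> carrier_vec 1" for w
    proof -
      have "w = (w $ 0 / v $ 0) \<cdot>\<^sub>v v" using w vd v0 by (intro eq_vecI) auto
      then show ?thesis using sub(4)[OF v(1)] by metis
    qed
    then show ?thesis using sub(1) by blast
  qed simp
qed simp

text \<open>The eigenvalues \<open>\<mu>\<alpha>^i\<close> of \<open>Y\<close> are distinct for
  \<open>i < n\<close>, and similar matrices of size one are equal; so the characters are pairwise
  non-isomorphic.\<close>

lemma isotypic_diagonal:
  assumes \<phi>: "\<phi> \<in> alg_reps R n id" and \<mu>: "\<mu> \<noteq> 0"
    and g: "g \<in> carrier_mat n n" "g' \<in> carrier_mat n n" "g * g' = 1\<^sub>m n" "g' * g = 1\<^sub>m n"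
    and eq: "\<And>a. a \<in> carrier R \<Longrightarrow> \<phi> a = g * Dg \<mu> a * g'"
  shows "isotypic R n \<phi> n (\<lambda>_. 1) (\<lambda>_. 1) (\<lambda>i. char_rep (\<mu> * \<alpha> ^ i)) g g'"
  unfolding isotypic_def
proof (intro conjI allI impI ballI)
  show "\<phi> \<in> alg_reps R n id" by fact
  show "simple_rep R 1 (char_rep (\<mu> * \<alpha> ^ i))" for i by (rule simple_char_rep)
  show "\<not> rep_iso R (char_rep (\<mu> * \<alpha> ^ i)) (char_rep (\<mu> * \<alpha> ^ j))" if ij: "i < n" "j < n" "i \<noteq> j" for i j
  proof
    assume "rep_iso R (char_rep (\<mu> * \<alpha> ^ i)) (char_rep (\<mu> * \<alpha> ^ j))"
    then obtain P Q where "similar_mat_wit (char_rep (\<mu> * \<alpha> ^ i) Y) (char_rep (\<mu> * \<alpha> ^ j) Y) P Q"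
      unfolding rep_iso_def by (meson gens_closed)
    then have sim: "similar_mat_wit ((\<mu> * \<alpha> ^ i) \<cdot>\<^sub>m 1\<^sub>m 1) ((\<mu> * \<alpha> ^ j) \<cdot>\<^sub>m 1\<^sub>m 1) P Q"
      by (simp add: char_rep_def)
    have c: "(\<mu> * \<alpha> ^ i) \<cdot>\<^sub>m 1\<^sub>m 1 \<in> carrier_mat 1 1" by simp
    note s = similar_mat_witD2[OF c sim]
    have "(\<mu> * \<alpha> ^ i) \<cdot>\<^sub>m 1\<^sub>m 1 = (\<mu> * \<alpha> ^ j) \<cdot>\<^sub>m (1\<^sub>m 1 :: complex mat)"
      using s(3) mult_smult_distrib[OF s(6) one_carrier_mat, of "\<mu> * \<alpha> ^ j"]
        mult_smult_assoc_mat[OF s(6,7), of "\<mu> * \<alpha> ^ j"] s(1,6) by simp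
    then have "((\<mu> * \<alpha> ^ i) \<cdot>\<^sub>m 1\<^sub>m 1) $$ (0, 0) = ((\<mu> * \<alpha> ^ j) \<cdot>\<^sub>m (1\<^sub>m 1 :: complex mat)) $$ (0, 0)" by simp
    then have "\<alpha> ^ i = \<alpha> ^ j" using \<mu> by simp
    then show False using primitive_root_inj[OF prim n_pos] ij by blast
  qed
  fix a assume a: "a \<in> carrier R"
  have "diag_block_mat (map (\<lambda>i. kron (1\<^sub>m 1) (char_rep (\<mu> * \<alpha> ^ i) a)) [0..<n]) = Dg \<mu> a"
    unfolding Dg_def by (subst diag_block_dim1) (use a in \<open>auto simp: kron_one_one char_rep_def\<close>)
  then show "similar_mat_wit (\<phi> a) (diag_block_mat (map (\<lambda>i. kron (1\<^sub>m 1) (char_rep (\<mu> * \<alpha> ^ i) a)) [0..<n])) g g'"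
    using g eq[OF a] by (intro similar_mat_witI[of _ _ n]) auto
qed simp

text \<open>By \<open>isotypic_structure\<close> every isotypic decomposition has \<open>n\<close>
  summands of multiplicity one, so the definite description is well defined.\<close>

lemma mult_square_sum_eq:
  assumes trep: "\<phi> \<in> trep R tr n id" and ss: "semisimple_rep R n \<phi>"
    and W0: "\<phi> (W [^]\<^bsub>R\<^esub> n) = 0 \<cdot>\<^sub>m 1\<^sub>m n" and U0: "\<phi> (U [^]\<^bsub>R\<^esub> n) = 0 \<cdot>\<^sub>m 1\<^sub>m n"
    and Y\<beta>: "\<phi> (Y [^]\<^bsub>R\<^esub> n) = \<beta> \<cdot>\<^sub>m 1\<^sub>m n" and \<beta>: "\<beta> \<noteq> 0"
  shows "mult_square_sum R n \<phi> = n"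
proof -
  have sq: "(\<Sum>i<m. (e i)^2) = n" if iso: "isotypic R n \<phi> m d e \<sigma> g g'" for m d e \<sigma> g g'
  proof -
    obtain \<mu> where "m = n" "\<And>i. i < n \<Longrightarrow> e i = 1"
      using isotypic_structure[OF trep iso W0 U0 Y\<beta> \<beta>] by blast
    then show ?thesis by simp
  qed
  obtain m d e \<sigma> g g' where iso: "isotypic R n \<phi> m d e \<sigma> g g'"
    using ss by (auto simp: semisimple_rep_def)
  show ?thesis unfolding mult_square_sum_def
  proof (rule the_equality)
    show "\<exists>m d e \<sigma> g g'. isotypic R n \<phi> m d e \<sigma> g g' \<and> n = (\<Sum>i<m. (e i)^2)"
      using iso sq[OF iso] by metis
  next
    fix q assume "\<exists>m d e \<sigma> g g'. isotypic R n \<phi> m d e \<sigma> g g' \<and> q = (\<Sum>i<m. (e i)^2)"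
    then show "q = n" using sq by metis
  qed
qed

text \<open>On the centre \<open>tr\<close> is multiplication by \<open>n\<close>, so trace
  preservation equates \<open>n \<phi> c\<close> with a scalar matrix.\<close>

lemma trep_central_scalar:
  assumes trep: "\<phi> \<in> trep R tr n id" and c: "c \<in> centre R"
  shows "\<phi> c = \<phi> c $$ (0, 0) \<cdot>\<^sub>m 1\<^sub>m n"
proof -
  note \<phi> = alg_repsD[of \<phi> R n id]
  have rep: "\<phi> \<in> alg_reps R n id" using trep by (simp add: trep_def)
  obtain f where f: "c = \<kappa> f" "f \<in> Zset" using c by (auto simp: centre_eq)
  have "proj_centre f = f"
  proof -
    have "proj_centre f = plin (\<lambda>p. sgl p 1) f"
      unfolding proj_centre_def using f(2) by (intro plin_cong) (auto simp: Zset_def)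
    then show ?thesis by (simp add: plin_sgl_id)
  qed
  then have "tr c = of_nat n \<odot>\<^bsub>R\<^esub> c" by (simp add: f tr_kap kap_smult)
  then have "of_nat n \<cdot>\<^sub>m \<phi> c = (\<Sum>i<n. \<phi> c $$ (i, i)) \<cdot>\<^sub>m 1\<^sub>m n"
  proof -
    have "\<phi> (tr c) = (\<Sum>i<n. \<phi> c $$ (i, i)) \<cdot>\<^sub>m 1\<^sub>m n" using trep f by (simp add: trep_def)
    then show ?thesis using \<open>tr c = of_nat n \<odot>\<^bsub>R\<^esub> c\<close> \<phi>(5)[OF rep, of c "of_nat n"] f by simp
  qed
  then have E: "of_nat n * \<phi> c $$ (i, j) = ((\<Sum>i<n. \<phi> c $$ (i, i)) \<cdot>\<^sub>m 1\<^sub>m n) $$ (i, j)"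
    if "i < n" "j < n" for i j
    using arg_cong[of _ _ "\<lambda>M. M $$ (i, j)"] that \<phi>(1)[OF rep, of c] f
    by (metis carrier_matD index_smult_mat(1) kap_closed)
  show ?thesis
  proof (rule eq_matI)
    fix i j assume "i < dim_row (\<phi> c $$ (0, 0) \<cdot>\<^sub>m 1\<^sub>m n)" "j < dim_col (\<phi> c $$ (0, 0) \<cdot>\<^sub>m 1\<^sub>m n)"
    then have ij: "i < n" "j < n" by auto
    have "of_nat n * \<phi> c $$ (i, j) = of_nat n * (\<phi> c $$ (0, 0) \<cdot>\<^sub>m 1\<^sub>m n) $$ (i, j)"
      using E[OF ij] E[of 0 0] ij by (cases "i = j") auto
    then show "\<phi> c $$ (i, j) = (\<phi> c $$ (0, 0) \<cdot>\<^sub>m 1\<^sub>m n) $$ (i, j)" using n3 by simp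
  qed (use \<phi>(1)[OF rep, of c] f in auto)
qed

lemma pow_in_centre [simp]: "W [^]\<^bsub>R\<^esub> n \<in> centre R" "Y [^]\<^bsub>R\<^esub> n \<in> centre R" "U [^]\<^bsub>R\<^esub> n \<in> centre R"
  using U_pow[of n] by (auto simp: W_pow Y_pow Cset_iff)

text \<open>Otherwise every summand has dimension at least \<open>n\<close>, which leaves room for
  only one summand of multiplicity one, and \<phi> would be simple.\<close>

lemma nonsimple_kills_U:
  assumes trep: "\<phi> \<in> trep R tr n id" and ss: "semisimple_rep R n \<phi>" and ns: "\<not> simple_rep R n \<phi>"
    and Y\<beta>: "\<phi> (Y [^]\<^bsub>R\<^esub> n) = \<beta> \<cdot>\<^sub>m 1\<^sub>m n" and \<beta>: "\<beta> \<noteq> 0"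
  shows "\<phi> (U [^]\<^bsub>R\<^esub> n) = 0 \<cdot>\<^sub>m 1\<^sub>m n"
proof -
  define \<gamma> where "\<gamma> = \<phi> (U [^]\<^bsub>R\<^esub> n) $$ (0, 0)"
  have U\<gamma>: "\<phi> (U [^]\<^bsub>R\<^esub> n) = \<gamma> \<cdot>\<^sub>m 1\<^sub>m n"
    unfolding \<gamma>_def by (rule trep_central_scalar[OF trep]) simp
  have "\<gamma> = 0"
  proof (rule ccontr)
    assume \<gamma>: "\<gamma> \<noteq> 0"
    obtain m d e \<sigma> g g' where iso: "isotypic R n \<phi> m d e \<sigma> g g'"
      using ss by (auto simp: semisimple_rep_def)
    have dim: "n = (\<Sum>i<m. e i * d i)" by (rule isotypic_dim[OF iso one_closed])
    have big: "n \<le> d i" if i: "i < m" for i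
    proof -
      note \<sigma> = simple_repD(1)[OF isotypicD(3)[OF iso i]] and d0 = simple_repD(2)[OF isotypicD(3)[OF iso i]]
      have Yc: "\<sigma> i Y \<in> carrier_mat (d i) (d i)" and Uc: "\<sigma> i U \<in> carrier_mat (d i) (d i)"
        using alg_repsD(1)[OF \<sigma>] by simp_all
      \<comment> \<open>A matrix with a power that is a nonzero scalar matrix is invertible.\<close>
      have nz: "det M \<noteq> 0" if M: "M \<in> carrier_mat (d i) (d i)" "M ^\<^sub>m n = c \<cdot>\<^sub>m 1\<^sub>m (d i)" "c \<noteq> 0" for M and c :: complex
      proof
        assume "det M = 0"
        obtain k where k: "n = Suc k" using n_pos by (cases n) auto
        have "det (M ^\<^sub>m n) = det (M ^\<^sub>m k) * det M"
          unfolding k using det_mult[OF pow_carrier_mat[OF M(1)] M(1)] by simp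
        then have "det (c \<cdot>\<^sub>m 1\<^sub>m (d i)) = 0" using M(2) \<open>det M = 0\<close> by simp
        then show False using M(3) by simp
      qed
      have "det (\<sigma> i Y) \<noteq> 0"
        by (rule nz[OF Yc _ \<beta>]) (use isotypic_scalarD[OF iso _ Y\<beta> i] alg_reps_pow[OF monoid_R \<sigma>] in auto)
      moreover have "det (\<sigma> i U) \<noteq> 0"
        by (rule nz[OF Uc _ \<gamma>]) (use isotypic_scalarD[OF iso _ U\<gamma> i] alg_reps_pow[OF monoid_R \<sigma>] in auto)
      \<comment> \<open>Determinants of \<open>YU = \<alpha>^(-s) UY\<close>: the determinants of
        \<open>Y\<close> and \<open>U\<close> cancel and \<open>\<alpha>^(-s d) = 1\<close> remains,
        where \<open>d\<close> is the dimension of the summand.\<close>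
      moreover have "det (\<sigma> i Y * \<sigma> i U) = det ((\<alpha> powi (- s)) \<cdot>\<^sub>m (\<sigma> i U * \<sigma> i Y))"
        using arg_cong[OF Y_U, of "\<sigma> i"] alg_repsD(3,5)[OF \<sigma>] by simp
      then have "det (\<sigma> i Y) * det (\<sigma> i U) = (\<alpha> powi (- s)) ^ d i * (det (\<sigma> i U) * det (\<sigma> i Y))"
        using det_mult[OF Yc Uc] det_mult[OF Uc Yc] Uc Yc by simp
      ultimately have "(\<alpha> powi (- s)) ^ d i = 1" by simp
      then have "\<alpha> powi (- s * int (d i)) = 1" unfolding power_int_mult by simp
      then have dv: "int n dvd s * int (d i)" unfolding powi_eq_1_iff by simp
      \<comment> \<open>The place where oddness enters: for \<open>s = 2\<close> the divisibility
        passes from \<open>s d\<close> to \<open>d\<close> only because \<open>n\<close> is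
        odd.\<close>
      have "coprime (int n) s" using s12 odd_n by auto
      then have "int n dvd int (d i)" using dv by (simp add: coprime_dvd_mult_right_iff)
      then show ?thesis using d0 by (simp add: dvd_imp_le)
    qed
    have "m > 0" using dim n_pos by (cases m) auto
    have e0: "e i > 0" if "i < m" for i by (rule isotypicD(2)[OF iso that])
    have m1: "m = Suc 0"
    proof (rule ccontr)
      assume "m \<noteq> Suc 0"
      then have m2: "2 \<le> m" using \<open>m > 0\<close> by simp
      have "2 * n \<le> m * n" using m2 by simp
      also have "\<dots> = (\<Sum>i<m. n)" by simp
      also have "\<dots> \<le> (\<Sum>i<m. e i * d i)"
      proof (rule sum_mono)
        fix i assume "i \<in> {..<m}"
        then show "n \<le> e i * d i" using big[of i] e0[of i] by (metis lessThan_iff mult_le_mono mult_1 Suc_leI One_nat_def)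
      qed
      finally show False using dim n_pos by simp
    qed
    have ed: "n = e 0 * d 0" using dim m1 by simp
    have "e 0 * n \<le> e 0 * d 0" using big[of 0] m1 by simp
    then have e1: "e 0 = Suc 0" using ed e0[of 0] m1 n_pos by simp
    then have d0: "d 0 = n" using ed by simp
    have eq: "\<phi> a = g * \<sigma> 0 a * g'" and gc: "g \<in> carrier_mat n n" "g' \<in> carrier_mat n n" "g * g' = 1\<^sub>m n" "g' * g = 1\<^sub>m n"
      if a: "a \<in> carrier R" for a
    proof -
      have "diag_block_mat (map (\<lambda>i. kron (1\<^sub>m (e i)) (\<sigma> i a)) [0..<m]) = \<sigma> 0 a"
        by (simp add: m1 e1 kron_one_one del: diag_block_mat.simps)
      then have "similar_mat_wit (\<phi> a) (\<sigma> 0 a) g g'" using isotypicD(5)[OF iso a] by simp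
      note similar_mat_witD2[OF alg_repsD(1)[OF isotypicD(1)[OF iso] a] this]
      then show "\<phi> a = g * \<sigma> 0 a * g'" "g \<in> carrier_mat n n" "g' \<in> carrier_mat n n" "g * g' = 1\<^sub>m n" "g' * g = 1\<^sub>m n"
        by blast+
    qed
    have "simple_rep R n \<phi>"
      by (rule simple_rep_conj[of R n "\<sigma> 0", OF _ isotypicD(1)[OF iso] gc[OF one_closed] eq])
        (use isotypicD(3)[OF iso, of 0] m1 d0 in auto)
    then show False using ns by simp
  qed
  then show ?thesis using U\<gamma> by simp
qed

end

section \<open>Quotient spaces, quiver representations and tangent spaces\<close>

lemma vectorspaceI:
  fixes V :: "(complex, 'v) module"
  assumes "\<And>x y. x \<in> carrier V \<Longrightarrow> y \<in> carrier V \<Longrightarrow> x \<oplus>\<^bsub>V\<^esub> y \<in> carrier V"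
    and "\<zero>\<^bsub>V\<^esub> \<in> carrier V"
    and "\<And>x y z. x \<in> carrier V \<Longrightarrow> y \<in> carrier V \<Longrightarrow> z \<in> carrier V \<Longrightarrow>
      (x \<oplus>\<^bsub>V\<^esub> y) \<oplus>\<^bsub>V\<^esub> z = x \<oplus>\<^bsub>V\<^esub> (y \<oplus>\<^bsub>V\<^esub> z)"
    and "\<And>x y. x \<in> carrier V \<Longrightarrow> y \<in> carrier V \<Longrightarrow> x \<oplus>\<^bsub>V\<^esub> y = y \<oplus>\<^bsub>V\<^esub> x"
    and "\<And>x. x \<in> carrier V \<Longrightarrow> \<zero>\<^bsub>V\<^esub> \<oplus>\<^bsub>V\<^esub> x = x"
    and "\<And>c x. x \<in> carrier V \<Longrightarrow> c \<odot>\<^bsub>V\<^esub> x \<in> carrier V"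
    and distr: "\<And>c d x. x \<in> carrier V \<Longrightarrow> (c + d) \<odot>\<^bsub>V\<^esub> x = c \<odot>\<^bsub>V\<^esub> x \<oplus>\<^bsub>V\<^esub> d \<odot>\<^bsub>V\<^esub> x"
    and "\<And>c x y. x \<in> carrier V \<Longrightarrow> y \<in> carrier V \<Longrightarrow>
      c \<odot>\<^bsub>V\<^esub> (x \<oplus>\<^bsub>V\<^esub> y) = c \<odot>\<^bsub>V\<^esub> x \<oplus>\<^bsub>V\<^esub> c \<odot>\<^bsub>V\<^esub> y"
    and "\<And>c d x. x \<in> carrier V \<Longrightarrow> (c * d) \<odot>\<^bsub>V\<^esub> x = c \<odot>\<^bsub>V\<^esub> (d \<odot>\<^bsub>V\<^esub> x)"
    and one: "\<And>x. x \<in> carrier V \<Longrightarrow> 1 \<odot>\<^bsub>V\<^esub> x = x"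
    and zero: "\<And>x. x \<in> carrier V \<Longrightarrow> 0 \<odot>\<^bsub>V\<^esub> x = \<zero>\<^bsub>V\<^esub>"
  shows "vectorspace class_ring V"
proof -
  have "abelian_group V"
  proof (rule abelian_groupI)
    fix x assume x: "x \<in> carrier V"
    have "(- 1) \<odot>\<^bsub>V\<^esub> x \<oplus>\<^bsub>V\<^esub> x = (- 1 + 1) \<odot>\<^bsub>V\<^esub> x" unfolding distr[OF x] one[OF x] ..
    then show "\<exists>y\<in>carrier V. y \<oplus>\<^bsub>V\<^esub> x = \<zero>\<^bsub>V\<^esub>" using zero[OF x] assms(6) x by auto
  qed (use assms in auto)
  then have "Module.module class_ring V"
    by (rule moduleI[OF class_cring.is_cring]) (use assms in auto)
  then show ?thesis unfolding vectorspace_def using class_field by blast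
qed

lemma vectorspaceD:
  fixes V :: "(complex, 'v) module"
  assumes "vectorspace class_ring V"
  shows "\<And>x y. x \<in> carrier V \<Longrightarrow> y \<in> carrier V \<Longrightarrow> x \<oplus>\<^bsub>V\<^esub> y \<in> carrier V"
    and "\<zero>\<^bsub>V\<^esub> \<in> carrier V"
    and "\<And>x y z. x \<in> carrier V \<Longrightarrow> y \<in> carrier V \<Longrightarrow> z \<in> carrier V \<Longrightarrow>
      (x \<oplus>\<^bsub>V\<^esub> y) \<oplus>\<^bsub>V\<^esub> z = x \<oplus>\<^bsub>V\<^esub> (y \<oplus>\<^bsub>V\<^esub> z)"
    and "\<And>x y. x \<in> carrier V \<Longrightarrow> y \<in> carrier V \<Longrightarrow> x \<oplus>\<^bsub>V\<^esub> y = y \<oplus>\<^bsub>V\<^esub> x"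
    and "\<And>x. x \<in> carrier V \<Longrightarrow> \<zero>\<^bsub>V\<^esub> \<oplus>\<^bsub>V\<^esub> x = x"
    and "\<And>x. x \<in> carrier V \<Longrightarrow> x \<oplus>\<^bsub>V\<^esub> \<zero>\<^bsub>V\<^esub> = x"
    and "\<And>c x. x \<in> carrier V \<Longrightarrow> c \<odot>\<^bsub>V\<^esub> x \<in> carrier V"
    and "\<And>c d x. x \<in> carrier V \<Longrightarrow> (c + d) \<odot>\<^bsub>V\<^esub> x = c \<odot>\<^bsub>V\<^esub> x \<oplus>\<^bsub>V\<^esub> d \<odot>\<^bsub>V\<^esub> x"
    and "\<And>c x y. x \<in> carrier V \<Longrightarrow> y \<in> carrier V \<Longrightarrow>
      c \<odot>\<^bsub>V\<^esub> (x \<oplus>\<^bsub>V\<^esub> y) = c \<odot>\<^bsub>V\<^esub> x \<oplus>\<^bsub>V\<^esub> c \<odot>\<^bsub>V\<^esub> y"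
    and "\<And>c d x. x \<in> carrier V \<Longrightarrow> (c * d) \<odot>\<^bsub>V\<^esub> x = c \<odot>\<^bsub>V\<^esub> (d \<odot>\<^bsub>V\<^esub> x)"
    and "\<And>x. x \<in> carrier V \<Longrightarrow> 1 \<odot>\<^bsub>V\<^esub> x = x"
    and "\<And>x. x \<in> carrier V \<Longrightarrow> 0 \<odot>\<^bsub>V\<^esub> x = \<zero>\<^bsub>V\<^esub>"
    and "\<And>x y. x \<in> carrier V \<Longrightarrow> y \<in> carrier V \<Longrightarrow> x \<oplus>\<^bsub>V\<^esub> (-1) \<odot>\<^bsub>V\<^esub> y = \<zero>\<^bsub>V\<^esub> \<Longrightarrow> x = y"
proof -
  interpret vectorspace class_ring V by fact
  show c0: "0 \<odot>\<^bsub>V\<^esub> x = \<zero>\<^bsub>V\<^esub>" if "x \<in> carrier V" for x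
    using smult_l_null[OF that] by (simp add: class_ring_simps)
  show ld: "(c + d) \<odot>\<^bsub>V\<^esub> x = c \<odot>\<^bsub>V\<^esub> x \<oplus>\<^bsub>V\<^esub> d \<odot>\<^bsub>V\<^esub> x" if "x \<in> carrier V" for c d x
    using smult_l_distr[of c d x] that by simp
  show one: "1 \<odot>\<^bsub>V\<^esub> x = x" if "x \<in> carrier V" for x
    using smult_one[OF that] by simp
  show "x = y" if "x \<in> carrier V" "y \<in> carrier V" "x \<oplus>\<^bsub>V\<^esub> (-1) \<odot>\<^bsub>V\<^esub> y = \<zero>\<^bsub>V\<^esub>" for x y
  proof -
    have cl: "(-1) \<odot>\<^bsub>V\<^esub> y \<in> carrier V" using smult_closed[of "-1" y] that by simp
    have "(-1) \<odot>\<^bsub>V\<^esub> y \<oplus>\<^bsub>V\<^esub> y = \<zero>\<^bsub>V\<^esub>"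
      using ld[of y "-1" 1] one[of y] c0[of y] that by simp
    then have "x = x \<oplus>\<^bsub>V\<^esub> ((-1) \<odot>\<^bsub>V\<^esub> y \<oplus>\<^bsub>V\<^esub> y)" using that by simp
    also have "\<dots> = (x \<oplus>\<^bsub>V\<^esub> (-1) \<odot>\<^bsub>V\<^esub> y) \<oplus>\<^bsub>V\<^esub> y" by (rule a_assoc[symmetric]) (use that cl in auto)
    finally show ?thesis using that by simp
  qed
  show "c \<odot>\<^bsub>V\<^esub> x \<in> carrier V" if "x \<in> carrier V" for c x
    using smult_closed[of c x] that by simp
  show "c \<odot>\<^bsub>V\<^esub> (x \<oplus>\<^bsub>V\<^esub> y) = c \<odot>\<^bsub>V\<^esub> x \<oplus>\<^bsub>V\<^esub> c \<odot>\<^bsub>V\<^esub> y"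
    if "x \<in> carrier V" "y \<in> carrier V" for c x y
    using smult_r_distr[of c x y] that by simp
  show "(c * d) \<odot>\<^bsub>V\<^esub> x = c \<odot>\<^bsub>V\<^esub> (d \<odot>\<^bsub>V\<^esub> x)" if "x \<in> carrier V" for c d x
    using smult_assoc1[of c d x] that by simp
  show "(x \<oplus>\<^bsub>V\<^esub> y) \<oplus>\<^bsub>V\<^esub> z = x \<oplus>\<^bsub>V\<^esub> (y \<oplus>\<^bsub>V\<^esub> z)"
    if "x \<in> carrier V" "y \<in> carrier V" "z \<in> carrier V" for x y z
    by (rule a_assoc[OF that])
  show "x \<oplus>\<^bsub>V\<^esub> y = y \<oplus>\<^bsub>V\<^esub> x" if "x \<in> carrier V" "y \<in> carrier V" for x y
    by (rule a_comm[OF that])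
  show "x \<oplus>\<^bsub>V\<^esub> y \<in> carrier V" if "x \<in> carrier V" "y \<in> carrier V" for x y
    using that by simp
  show "\<zero>\<^bsub>V\<^esub> \<in> carrier V" by simp
  show "\<zero>\<^bsub>V\<^esub> \<oplus>\<^bsub>V\<^esub> x = x" "x \<oplus>\<^bsub>V\<^esub> \<zero>\<^bsub>V\<^esub> = x" if "x \<in> carrier V" for x
    using that by simp_all
qed

lemma vectorspace_dim_eq:
  fixes V :: "(complex, 'v) module" and Q :: "(complex, 'q) module"
  assumes V: "vectorspace class_ring V" and Q: "vectorspace class_ring Q"
    and f: "f \<in> carrier V \<rightarrow> carrier Q"
    and add: "\<And>x y. x \<in> carrier V \<Longrightarrow> y \<in> carrier V \<Longrightarrow> f (x \<oplus>\<^bsub>V\<^esub> y) = f x \<oplus>\<^bsub>Q\<^esub> f y"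
    and smult: "\<And>c x. x \<in> carrier V \<Longrightarrow> f (c \<odot>\<^bsub>V\<^esub> x) = c \<odot>\<^bsub>Q\<^esub> f x"
    and bij: "bij_betw f (carrier V) (carrier Q)" and finV: "vectorspace.fin_dim class_ring V"
  shows "vectorspace.dim class_ring Q = vectorspace.dim class_ring V" "vectorspace.fin_dim class_ring Q"
proof -
  have lm: "linear_map class_ring V Q f"
    unfolding linear_map_def mod_hom_def mod_hom_axioms_def LinearCombinations.module_hom_def
    using V Q f add smult by (auto simp: vectorspace_def)
  then interpret linear_map class_ring V Q f .
  have 1: "inj_on f (carrier V)" "f ` carrier V = carrier Q" using bij by (auto simp: bij_betw_def)
  show "vectorspace.dim class_ring Q = vectorspace.dim class_ring V"
    using dim_eq[OF finV 1] by simp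
  show "vectorspace.fin_dim class_ring Q"
    by (rule surj_fin_dim[OF finV 1(2)])
qed

lemma vectorspace_transport:
  fixes V :: "(complex, 'v) module" and Q :: "(complex, 'q) module"
  assumes V: "vectorspace class_ring V"
    and c: "carrier Q = f ` carrier V"
    and add: "\<And>x y. x \<in> carrier V \<Longrightarrow> y \<in> carrier V \<Longrightarrow> f x \<oplus>\<^bsub>Q\<^esub> f y = f (x \<oplus>\<^bsub>V\<^esub> y)"
    and smult: "\<And>c x. x \<in> carrier V \<Longrightarrow> c \<odot>\<^bsub>Q\<^esub> f x = f (c \<odot>\<^bsub>V\<^esub> x)"
    and zero: "\<zero>\<^bsub>Q\<^esub> = f \<zero>\<^bsub>V\<^esub>"
  shows "vectorspace class_ring Q"
proof (rule vectorspaceI)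
  note VD = vectorspaceD[OF V]
  show "(x \<oplus>\<^bsub>Q\<^esub> y) \<oplus>\<^bsub>Q\<^esub> z = x \<oplus>\<^bsub>Q\<^esub> (y \<oplus>\<^bsub>Q\<^esub> z)"
    if "x \<in> carrier Q" "y \<in> carrier Q" "z \<in> carrier Q" for x y z
    using that by (auto simp: c add VD(1) VD(3))
  show "x \<oplus>\<^bsub>Q\<^esub> y = y \<oplus>\<^bsub>Q\<^esub> x" if "x \<in> carrier Q" "y \<in> carrier Q" for x y
    using that VD(4) by (auto simp: c add)
qed (auto simp: c add smult zero vectorspaceD(1,2,5-12)[OF V])

text \<open>The first isomorphism theorem. The record \<open>T\<close> carries only a vector space
  structure, so the cosets of the kernel are treated directly as the fibres of
  \<open>\<Phi>\<close>.\<close>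

lemma quotient_space_iso:
  fixes T :: "(complex, 't) module" and V :: "(complex, 'v) module"
  assumes T: "vectorspace class_ring T" and V: "vectorspace class_ring V"
    and \<Phi>: "\<Phi> \<in> carrier T \<rightarrow> carrier V"
    and \<Phi>add: "\<And>x y. x \<in> carrier T \<Longrightarrow> y \<in> carrier T \<Longrightarrow> \<Phi> (x \<oplus>\<^bsub>T\<^esub> y) = \<Phi> x \<oplus>\<^bsub>V\<^esub> \<Phi> y"
    and \<Phi>smult: "\<And>c x. x \<in> carrier T \<Longrightarrow> \<Phi> (c \<odot>\<^bsub>T\<^esub> x) = c \<odot>\<^bsub>V\<^esub> \<Phi> x"
    and surj: "\<And>v. v \<in> carrier V \<Longrightarrow> \<exists>x\<in>carrier T. \<Phi> x = v"
    and J: "J = {x \<in> carrier T. \<Phi> x = \<zero>\<^bsub>V\<^esub>}"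
  shows "vectorspace class_ring (quotient_by T J)"
    and "\<exists>\<Psi>\<in>LinearCombinations.module_hom class_ring (quotient_by T J) V.
      bij_betw \<Psi> (carrier (quotient_by T J)) (carrier V) \<and> (\<forall>x\<in>carrier T. \<Psi> (J +>\<^bsub>T\<^esub> x) = \<Phi> x)"
    and "vectorspace.fin_dim class_ring V \<Longrightarrow>
      vectorspace.dim class_ring (quotient_by T J) = vectorspace.dim class_ring V"
proof -
  note TD = vectorspaceD[OF T] and VD = vectorspaceD[OF V]
  note TS = vectorspaceD(1,2,5-7,9,11,12)[OF T] and VS = vectorspaceD(1,2,5-7,9,11,12)[OF V]
  define fib where "fib v = {x \<in> carrier T. \<Phi> x = v}" for v
  have \<Phi>c: "\<Phi> x \<in> carrier V" if "x \<in> carrier T" for x using \<Phi> that by blast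
  have coset: "J +>\<^bsub>T\<^esub> x = fib (\<Phi> x)" if x: "x \<in> carrier T" for x
  proof
    show "J +>\<^bsub>T\<^esub> x \<subseteq> fib (\<Phi> x)"
      using x by (auto simp: a_r_coset_def' J fib_def TS \<Phi>add VS \<Phi>c)
    show "fib (\<Phi> x) \<subseteq> J +>\<^bsub>T\<^esub> x"
    proof
      fix y assume "y \<in> fib (\<Phi> x)"
      then have y: "y \<in> carrier T" "\<Phi> y = \<Phi> x" by (auto simp: fib_def)
      let ?h = "y \<oplus>\<^bsub>T\<^esub> (-1) \<odot>\<^bsub>T\<^esub> x"
      have "\<Phi> ?h = (1 + (-1)) \<odot>\<^bsub>V\<^esub> \<Phi> x"
        unfolding VD(8)[OF \<Phi>c[OF x]] using x y by (simp add: \<Phi>add \<Phi>smult TS VS \<Phi>c)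
      then have "?h \<in> J" using x y by (simp add: J TS VS \<Phi>c)
      moreover have "?h \<oplus>\<^bsub>T\<^esub> x = y"
      proof -
        have "?h \<oplus>\<^bsub>T\<^esub> x = y \<oplus>\<^bsub>T\<^esub> ((-1) \<odot>\<^bsub>T\<^esub> x \<oplus>\<^bsub>T\<^esub> x)"
          by (rule TD(3)) (use x y TD(7) in auto)
        also have "(-1) \<odot>\<^bsub>T\<^esub> x \<oplus>\<^bsub>T\<^esub> x = (-1 + 1) \<odot>\<^bsub>T\<^esub> x"
          unfolding TD(8)[OF x] TD(11)[OF x] ..
        finally show ?thesis using x y by (simp add: TS)
      qed
      ultimately show "y \<in> J +>\<^bsub>T\<^esub> x" by (force simp: a_r_coset_def')
    qed
  qed
  have carrier_q: "carrier (quotient_by T J) = fib ` carrier V"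
  proof -
    have "carrier (quotient_by T J) = (\<lambda>x. J +>\<^bsub>T\<^esub> x) ` carrier T"
      by (auto simp: quotient_by_def ring.defs FactRing_def A_RCOSETS_def')
    also have "\<dots> = (\<lambda>x. fib (\<Phi> x)) ` carrier T" using coset by auto
    also have "\<dots> = fib ` carrier V" using surj \<Phi>c by (auto simp: image_iff)
    finally show ?thesis .
  qed
  have add_q: "fib v \<oplus>\<^bsub>quotient_by T J\<^esub> fib w = fib (v \<oplus>\<^bsub>V\<^esub> w)"
    if vw: "v \<in> carrier V" "w \<in> carrier V" for v w
  proof -
    have "fib v \<oplus>\<^bsub>quotient_by T J\<^esub> fib w = fib v <+>\<^bsub>T\<^esub> fib w"
      by (simp add: quotient_by_def ring.defs FactRing_def)
    also have "\<dots> = fib (v \<oplus>\<^bsub>V\<^esub> w)"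
    proof
      show "fib v <+>\<^bsub>T\<^esub> fib w \<subseteq> fib (v \<oplus>\<^bsub>V\<^esub> w)"
        by (auto simp: set_add_def' fib_def TS \<Phi>add)
      show "fib (v \<oplus>\<^bsub>V\<^esub> w) \<subseteq> fib v <+>\<^bsub>T\<^esub> fib w"
      proof
        fix z assume z: "z \<in> fib (v \<oplus>\<^bsub>V\<^esub> w)"
        obtain x y where xy: "x \<in> carrier T" "\<Phi> x = v" "y \<in> carrier T" "\<Phi> y = w"
          using surj vw by metis
        then have "z \<in> J +>\<^bsub>T\<^esub> (x \<oplus>\<^bsub>T\<^esub> y)" using z coset[of "x \<oplus>\<^bsub>T\<^esub> y"] by (simp add: \<Phi>add TS)
        then obtain h where h: "h \<in> J" "z = h \<oplus>\<^bsub>T\<^esub> (x \<oplus>\<^bsub>T\<^esub> y)" by (auto simp: a_r_coset_def')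
        then have "z = (h \<oplus>\<^bsub>T\<^esub> x) \<oplus>\<^bsub>T\<^esub> y"
          using TD(3)[of h x y] xy by (simp add: J)
        moreover have "h \<oplus>\<^bsub>T\<^esub> x \<in> fib v" using h xy vw by (auto simp: J fib_def TS VS \<Phi>add)
        moreover have "y \<in> fib w" using xy by (simp add: fib_def)
        ultimately show "z \<in> fib v <+>\<^bsub>T\<^esub> fib w" by (auto simp: set_add_def')
      qed
    qed
    finally show ?thesis .
  qed
  have smult_q: "c \<odot>\<^bsub>quotient_by T J\<^esub> fib v = fib (c \<odot>\<^bsub>V\<^esub> v)" if v: "v \<in> carrier V" for c v
  proof -
    have "c \<odot>\<^bsub>quotient_by T J\<^esub> fib v = (\<Union>a\<in>fib v. J +>\<^bsub>T\<^esub> (c \<odot>\<^bsub>T\<^esub> a))"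
      by (simp add: quotient_by_def ring.defs module.defs)
    also have "\<dots> = (\<Union>a\<in>fib v. fib (c \<odot>\<^bsub>V\<^esub> v))"
      by (intro SUP_cong refl) (auto simp: fib_def[of v] coset TS \<Phi>smult)
    also have "\<dots> = fib (c \<odot>\<^bsub>V\<^esub> v)" using surj[OF v] by (auto simp: fib_def)
    finally show ?thesis .
  qed
  have zero_q: "\<zero>\<^bsub>quotient_by T J\<^esub> = fib \<zero>\<^bsub>V\<^esub>"
    by (simp add: quotient_by_def ring.defs FactRing_def fib_def J)
  show vs: "vectorspace class_ring (quotient_by T J)"
    by (rule vectorspace_transport[OF V carrier_q add_q smult_q zero_q])
  have ne: "fib v \<noteq> {}" if "v \<in> carrier V" for v using surj[OF that] by (auto simp: fib_def)
  \<comment> \<open>\<open>\<Phi>\<close> is constant on each fibre, so any representative will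
    do.\<close>
  define \<Psi> where "\<Psi> C = \<Phi> (SOME x. x \<in> C)" for C
  have \<Psi>fib: "\<Psi> (fib v) = v" if "v \<in> carrier V" for v
    using someI_ex[of "\<lambda>x. x \<in> fib v"] ne[OF that] by (auto simp: \<Psi>_def fib_def)
  show "\<exists>\<Psi>\<in>LinearCombinations.module_hom class_ring (quotient_by T J) V.
      bij_betw \<Psi> (carrier (quotient_by T J)) (carrier V) \<and> (\<forall>x\<in>carrier T. \<Psi> (J +>\<^bsub>T\<^esub> x) = \<Phi> x)"
  proof (intro bexI[of _ \<Psi>] conjI ballI)
    show "\<Psi> \<in> LinearCombinations.module_hom class_ring (quotient_by T J) V"
      by (auto simp: LinearCombinations.module_hom_def carrier_q \<Psi>fib add_q smult_q VS)
    show "bij_betw \<Psi> (carrier (quotient_by T J)) (carrier V)"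
      unfolding carrier_q by (rule bij_betw_byWitness[of _ fib]) (auto simp: \<Psi>fib)
    show "\<Psi> (J +>\<^bsub>T\<^esub> x) = \<Phi> x" if "x \<in> carrier T" for x
      using that by (simp add: coset \<Psi>fib \<Phi>c)
  qed
  show "vectorspace.dim class_ring (quotient_by T J) = vectorspace.dim class_ring V"
    if fin: "vectorspace.fin_dim class_ring V"
  proof (rule vectorspace_dim_eq(1)[OF V vs _ _ _ _ fin])
    show "bij_betw fib (carrier V) (carrier (quotient_by T J))"
      unfolding carrier_q by (rule bij_betw_imageI) (auto intro: inj_on_inverseI[of _ \<Psi>] simp: \<Psi>fib)
  qed (auto simp: carrier_q add_q smult_q)
qed

lemma quiver_reps_sel:
  "carrier (quiver_reps Q \<alpha>) = (\<Pi>\<^sub>E a\<in>arcs Q. carrier_mat (\<alpha> (head Q a)) (\<alpha> (tail Q a)))"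
  "V \<oplus>\<^bsub>quiver_reps Q \<alpha>\<^esub> V' = (\<lambda>a\<in>arcs Q. V a + V' a)"
  "c \<odot>\<^bsub>quiver_reps Q \<alpha>\<^esub> V = (\<lambda>a\<in>arcs Q. c \<cdot>\<^sub>m V a)"
  "\<zero>\<^bsub>quiver_reps Q \<alpha>\<^esub> = (\<lambda>a\<in>arcs Q. 0\<^sub>m (\<alpha> (head Q a)) (\<alpha> (tail Q a)))"
  by (simp_all add: quiver_reps_def)

text \<open>With one-dimensional vertices a representation is one complex number per arrow; an
  enumeration of the arrows identifies the space with coordinate vectors.\<close>

lemma quiver_reps_dim:
  fixes Q :: "(nat, 'q) pre_digraph"
  assumes finQ: "finite (arcs Q)"
  shows "vectorspace class_ring (quiver_reps Q (\<lambda>_. 1))"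
    and "vectorspace.fin_dim class_ring (quiver_reps Q (\<lambda>_. 1))"
    and "vectorspace.dim class_ring (quiver_reps Q (\<lambda>_. 1)) = card (arcs Q)"
proof -
  define N where "N = card (arcs Q)"
  let ?V = "module_vec TYPE(complex) N"
  interpret vec_space "TYPE(complex)" N .
  obtain h where h: "bij_betw h (arcs Q) {..<N}"
    using ex_bij_betw_finite_nat[OF finQ] by (auto simp: N_def lessThan_atLeast0)
  define f where "f v = (\<lambda>a\<in>arcs Q. mat 1 1 (\<lambda>_. v $ h a))" for v :: "complex vec"
  have hN: "h a < N" if "a \<in> arcs Q" for a using h that by (auto simp: bij_betw_def)
  have carrier_f: "carrier (quiver_reps Q (\<lambda>_. 1)) = f ` carrier ?V"
  proof
    show "f ` carrier ?V \<subseteq> carrier (quiver_reps Q (\<lambda>_. 1))"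
      by (auto simp: f_def quiver_reps_sel)
    show "carrier (quiver_reps Q (\<lambda>_. 1)) \<subseteq> f ` carrier ?V"
    proof
      fix x assume x: "x \<in> carrier (quiver_reps Q (\<lambda>_. 1))"
      define v where "v = vec N (\<lambda>i. x (the_inv_into (arcs Q) h i) $$ (0, 0))"
      have "f v = x"
      proof (rule extensionalityI[of _ "arcs Q"])
        fix a assume a: "a \<in> arcs Q"
        have "the_inv_into (arcs Q) h (h a) = a"
          using h a by (simp add: bij_betw_def the_inv_into_f_f)
        moreover have "x a \<in> carrier_mat 1 1" using x a by (auto simp: quiver_reps_sel PiE_iff)
        ultimately show "f v a = x a" using a hN[OF a]
          by (intro eq_matI) (auto simp: f_def v_def)
      qed (use x in \<open>auto simp: f_def quiver_reps_sel PiE_iff\<close>)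
      moreover have "v \<in> carrier ?V" by (simp add: v_def module_vec_def)
      ultimately show "x \<in> f ` carrier ?V" by blast
    qed
  qed
  have add_f: "f v \<oplus>\<^bsub>quiver_reps Q (\<lambda>_. 1)\<^esub> f w = f (v \<oplus>\<^bsub>?V\<^esub> w)"
    if "v \<in> carrier ?V" "w \<in> carrier ?V" for v w
    using that hN by (auto simp: f_def quiver_reps_sel module_vec_def intro!: restrict_ext eq_matI)
  have smult_f: "c \<odot>\<^bsub>quiver_reps Q (\<lambda>_. 1)\<^esub> f v = f (c \<odot>\<^bsub>?V\<^esub> v)" if "v \<in> carrier ?V" for c v
    using that hN by (auto simp: f_def quiver_reps_sel module_vec_def intro!: restrict_ext eq_matI)
  have zero_f: "\<zero>\<^bsub>quiver_reps Q (\<lambda>_. 1)\<^esub> = f \<zero>\<^bsub>?V\<^esub>"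
    using hN by (auto simp: f_def quiver_reps_sel module_vec_def intro!: restrict_ext eq_matI)
  show vs: "vectorspace class_ring (quiver_reps Q (\<lambda>_. 1))"
    by (rule vectorspace_transport[OF vec_vs carrier_f add_f smult_f zero_f])
  have inj: "inj_on f (carrier ?V)"
  proof (rule inj_onI)
    fix v w assume vw: "v \<in> carrier ?V" "w \<in> carrier ?V" "f v = f w"
    show "v = w"
    proof (rule eq_vecI)
      fix i assume "i < dim_vec w"
      then have "i < N" using vw by (simp add: module_vec_def)
      then have "i \<in> h ` arcs Q" using h by (auto simp: bij_betw_def)
      then obtain a where a: "a \<in> arcs Q" "h a = i" by blast
      have "f v a $$ (0, 0) = f w a $$ (0, 0)" using vw by simp
      then show "v $ i = w $ i" using a by (simp add: f_def)
    qed (use vw in \<open>auto simp: module_vec_def\<close>)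
  qed
  have bij: "bij_betw f (carrier ?V) (carrier (quiver_reps Q (\<lambda>_. 1)))"
    using inj carrier_f by (simp add: bij_betw_def)
  show "vectorspace.fin_dim class_ring (quiver_reps Q (\<lambda>_. 1))"
    by (rule vectorspace_dim_eq(2)[OF vec_vs vs _ _ _ bij fin_dim])
      (use carrier_f add_f smult_f in auto)
  have "vectorspace.dim class_ring (quiver_reps Q (\<lambda>_. 1)) = vectorspace.dim class_ring ?V"
    by (rule vectorspace_dim_eq(1)[OF vec_vs vs _ _ _ bij fin_dim])
      (use carrier_f add_f smult_f in auto)
  then show "vectorspace.dim class_ring (quiver_reps Q (\<lambda>_. 1)) = card (arcs Q)"
    using dim_is_n by (simp add: N_def)
qed

subsection \<open>Tangent vectors as derivations\<close>

lemma dual_sum: "(\<Sum>i\<in>A. Dual (f i) (g i)) = Dual (sum f A) (sum g A)"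
  by (induction A rule: infinite_finite_induct) (auto simp: zero_dual_def plus_dual_def)

lemma dual_mat_sel [simp]:
  "dual_mat n A B \<in> carrier_mat n n" "dim_row (dual_mat n A B) = n" "dim_col (dual_mat n A B) = n"
  "i < n \<Longrightarrow> j < n \<Longrightarrow> dual_mat n A B $$ (i, j) = Dual (A $$ (i, j)) (B $$ (i, j))"
  by (auto simp: dual_mat_def)

lemma dual_mat_eq_iff:
  assumes "A \<in> carrier_mat n n" "B \<in> carrier_mat n n" "A' \<in> carrier_mat n n" "B' \<in> carrier_mat n n"
  shows "dual_mat n A B = dual_mat n A' B' \<longleftrightarrow> A = A' \<and> B = B'"
proof
  assume h: "dual_mat n A B = dual_mat n A' B'"
  have "Dual (A $$ (i, j)) (B $$ (i, j)) = Dual (A' $$ (i, j)) (B' $$ (i, j))" if "i < n" "j < n" for i j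
    using arg_cong[OF h, of "\<lambda>M. M $$ (i, j)"] that by simp
  then show "A = A' \<and> B = B'" using assms by (auto intro!: eq_matI)
qed auto

lemma dual_mat_add:
  assumes "A \<in> carrier_mat n n" "B \<in> carrier_mat n n" "A' \<in> carrier_mat n n" "B' \<in> carrier_mat n n"
  shows "dual_mat n A B + dual_mat n A' B' = dual_mat n (A + A') (B + B')"
  by (rule eq_matI) (use assms in \<open>auto simp: plus_dual_def\<close>)

lemma dual_mat_smult:
  assumes "A \<in> carrier_mat n n" "B \<in> carrier_mat n n"
  shows "Dual c 0 \<cdot>\<^sub>m dual_mat n A B = dual_mat n (c \<cdot>\<^sub>m A) (c \<cdot>\<^sub>m B)"
  by (rule eq_matI) (use assms in \<open>auto simp: times_dual_def\<close>)

lemma dual_mat_mult: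
  assumes "A \<in> carrier_mat n n" "B \<in> carrier_mat n n" "A' \<in> carrier_mat n n" "B' \<in> carrier_mat n n"
  shows "dual_mat n A B * dual_mat n A' B' = dual_mat n (A * A') (A * B' + B * A')"
  by (rule eq_matI)
    (use assms in \<open>auto simp: scalar_prod_def times_dual_def dual_sum sum.distrib\<close>)

lemma dual_mat_scalar:
  "Dual x y \<cdot>\<^sub>m 1\<^sub>m n = dual_mat n (x \<cdot>\<^sub>m 1\<^sub>m n) (y \<cdot>\<^sub>m 1\<^sub>m n)"
  by (rule eq_matI) (auto simp: times_dual_def one_dual_def zero_dual_def)

definition is_tangent ::
  "(complex, 'r) module \<Rightarrow> ('r \<Rightarrow> 'r) \<Rightarrow> nat \<Rightarrow> ('r \<Rightarrow> complex mat) \<Rightarrow> ('r \<Rightarrow> complex mat) \<Rightarrow> bool" where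
  "is_tangent R tr n \<phi> D \<longleftrightarrow> D \<in> extensional (carrier R) \<and>
     (\<forall>a\<in>carrier R. D a \<in> carrier_mat n n) \<and>
     (\<forall>a\<in>carrier R. \<forall>b\<in>carrier R. D (a \<oplus>\<^bsub>R\<^esub> b) = D a + D b) \<and>
     (\<forall>c. \<forall>a\<in>carrier R. D (c \<odot>\<^bsub>R\<^esub> a) = c \<cdot>\<^sub>m D a) \<and>
     (\<forall>a\<in>carrier R. \<forall>b\<in>carrier R. D (a \<otimes>\<^bsub>R\<^esub> b) = \<phi> a * D b + D a * \<phi> b) \<and>
     (\<forall>a\<in>carrier R. D (tr a) = (\<Sum>i<n. D a $$ (i, i)) \<cdot>\<^sub>m 1\<^sub>m n)"

text \<open>The conditions on \<open>\<phi> + \<epsilon>D\<close> are split into the two components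
  of the dual numbers: the standard parts hold because \<phi> is a point, and the \<epsilon>-parts
  are those collected in \<open>is_tangent\<close>.\<close>

lemma tangent_iff:
  assumes R: "ring R" and smc: "\<And>c a. a \<in> carrier R \<Longrightarrow> c \<odot>\<^bsub>R\<^esub> a \<in> carrier R"
    and trc: "\<And>a. a \<in> carrier R \<Longrightarrow> tr a \<in> carrier R" and \<phi>: "\<phi> \<in> trep R tr n id"
  shows "D \<in> carrier (tangent_space R tr n \<phi>) \<longleftrightarrow> is_tangent R tr n \<phi> D"
proof -
  interpret ring R by fact
  have rep: "\<phi> \<in> alg_reps R n id" and \<phi>tr: "\<And>a. a \<in> carrier R \<Longrightarrow> \<phi> (tr a) = (\<Sum>i<n. \<phi> a $$ (i, i)) \<cdot>\<^sub>m 1\<^sub>m n"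
    using \<phi> by (auto simp: trep_def)
  note r = alg_repsD[OF rep]
  let ?P = "\<lambda>a\<in>carrier R. dual_mat n (\<phi> a) (D a)"
  show ?thesis
  proof (cases "D \<in> carrier R \<rightarrow>\<^sub>E carrier_mat n n")
    case False
    then show ?thesis by (auto simp: tangent_space_def is_tangent_def PiE_def)
  next
    case True
    then have Dc: "\<And>a. a \<in> carrier R \<Longrightarrow> D a \<in> carrier_mat n n" and De: "D \<in> extensional (carrier R)"
      by (auto simp: PiE_def)
    have add: "?P (a \<oplus>\<^bsub>R\<^esub> b) = ?P a + ?P b \<longleftrightarrow> D (a \<oplus>\<^bsub>R\<^esub> b) = D a + D b"
      if "a \<in> carrier R" "b \<in> carrier R" for a b
      using that by (simp add: dual_mat_add dual_mat_eq_iff r(1,2) Dc)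
    have mult: "?P (a \<otimes>\<^bsub>R\<^esub> b) = ?P a * ?P b \<longleftrightarrow> D (a \<otimes>\<^bsub>R\<^esub> b) = \<phi> a * D b + D a * \<phi> b"
      if ab: "a \<in> carrier R" "b \<in> carrier R" for a b
    proof -
      have "\<phi> a * D b + D a * \<phi> b \<in> carrier_mat n n"
        by (intro add_carrier_mat mult_carrier_mat[of _ n n]) (use ab r(1) Dc in auto)
      then show ?thesis
        using ab by (simp add: dual_mat_mult dual_mat_eq_iff r(1,3) Dc mult_carrier_mat[OF r(1) r(1)])
    qed
    have smult: "?P (c \<odot>\<^bsub>R\<^esub> a) = Dual c 0 \<cdot>\<^sub>m ?P a \<longleftrightarrow> D (c \<odot>\<^bsub>R\<^esub> a) = c \<cdot>\<^sub>m D a"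
      if "a \<in> carrier R" for a c
      using that by (simp add: dual_mat_smult dual_mat_eq_iff r(1,5) Dc smc)
    have trace: "?P (tr a) = (\<Sum>i<n. ?P a $$ (i, i)) \<cdot>\<^sub>m 1\<^sub>m n \<longleftrightarrow> D (tr a) = (\<Sum>i<n. D a $$ (i, i)) \<cdot>\<^sub>m 1\<^sub>m n"
      if "a \<in> carrier R" for a
    proof -
      have "(\<Sum>i<n. ?P a $$ (i, i)) = Dual (\<Sum>i<n. \<phi> a $$ (i, i)) (\<Sum>i<n. D a $$ (i, i))"
        using that by (simp add: dual_sum[symmetric])
      then show ?thesis
        using that by (simp add: dual_mat_scalar dual_mat_eq_iff r(1) Dc trc \<phi>tr)
    qed
    \<comment> \<open>The Leibniz rule at \<open>1 = 1 * 1\<close> gives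
      \<open>D 1 = D 1 + D 1\<close>, hence \<open>D 1 = 0\<close>.\<close>
    have one: "?P \<one>\<^bsub>R\<^esub> = 1\<^sub>m n" if "D (\<one>\<^bsub>R\<^esub> \<otimes>\<^bsub>R\<^esub> \<one>\<^bsub>R\<^esub>) = \<phi> \<one>\<^bsub>R\<^esub> * D \<one>\<^bsub>R\<^esub> + D \<one>\<^bsub>R\<^esub> * \<phi> \<one>\<^bsub>R\<^esub>"
    proof -
      have "D \<one>\<^bsub>R\<^esub> = D \<one>\<^bsub>R\<^esub> + D \<one>\<^bsub>R\<^esub>" using that r(4) Dc[OF one_closed] by simp
      then have "D \<one>\<^bsub>R\<^esub> $$ (i, j) = D \<one>\<^bsub>R\<^esub> $$ (i, j) + D \<one>\<^bsub>R\<^esub> $$ (i, j)" if "i < n" "j < n" for i j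
        using Dc[OF one_closed] that by (metis carrier_matD index_add_mat(1))
      then show ?thesis
        by (intro eq_matI) (auto simp: r(4) one_dual_def zero_dual_def)
    qed
    have "D \<in> carrier (tangent_space R tr n \<phi>) \<longleftrightarrow> ?P \<in> trep R tr n (\<lambda>c. Dual c 0)"
      using True by (simp add: tangent_space_def)
    also have "\<dots> \<longleftrightarrow> is_tangent R tr n \<phi> D"
    proof
      assume h: "?P \<in> trep R tr n (\<lambda>c. Dual c 0)"
      then have h': "?P \<in> alg_reps R n (\<lambda>c. Dual c 0)"
        "\<And>a. a \<in> carrier R \<Longrightarrow> ?P (tr a) = (\<Sum>i<n. ?P a $$ (i, i)) \<cdot>\<^sub>m 1\<^sub>m n"
        unfolding trep_def by blast+
      show "is_tangent R tr n \<phi> D" unfolding is_tangent_def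
      proof (intro conjI ballI allI)
        show "D (a \<oplus>\<^bsub>R\<^esub> b) = D a + D b" if ab: "a \<in> carrier R" "b \<in> carrier R" for a b
          using add[OF ab] alg_repsD(2)[OF h'(1) ab] by blast
        show "D (a \<otimes>\<^bsub>R\<^esub> b) = \<phi> a * D b + D a * \<phi> b" if ab: "a \<in> carrier R" "b \<in> carrier R" for a b
          using mult[OF ab] alg_repsD(3)[OF h'(1) ab] by blast
        show "D (c \<odot>\<^bsub>R\<^esub> a) = c \<cdot>\<^sub>m D a" if a: "a \<in> carrier R" for c a
          using smult[OF a] alg_repsD(5)[OF h'(1) a] by blast
        show "D (tr a) = (\<Sum>i<n. D a $$ (i, i)) \<cdot>\<^sub>m 1\<^sub>m n" if a: "a \<in> carrier R" for a
          using trace[OF a] h'(2)[OF a] by blast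
      qed (use De Dc in auto)
    next
      assume h: "is_tangent R tr n \<phi> D"
      have "?P \<in> alg_reps R n (\<lambda>c. Dual c 0)"
      proof (rule alg_repsI)
        show "?P \<one>\<^bsub>R\<^esub> = 1\<^sub>m n" by (rule one) (use h in \<open>auto simp: is_tangent_def simp del: r_one l_one\<close>)
        show "?P (a \<oplus>\<^bsub>R\<^esub> b) = ?P a + ?P b" if "a \<in> carrier R" "b \<in> carrier R" for a b
          using add[OF that] h that unfolding is_tangent_def by blast
        show "?P (a \<otimes>\<^bsub>R\<^esub> b) = ?P a * ?P b" if "a \<in> carrier R" "b \<in> carrier R" for a b
          using mult[OF that] h that unfolding is_tangent_def by blast
        show "?P (c \<odot>\<^bsub>R\<^esub> a) = Dual c 0 \<cdot>\<^sub>m ?P a" if "a \<in> carrier R" for c a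
          using smult[OF that] h that unfolding is_tangent_def by blast
      qed auto
      moreover have "?P (tr a) = (\<Sum>i<n. ?P a $$ (i, i)) \<cdot>\<^sub>m 1\<^sub>m n" if "a \<in> carrier R" for a
        using trace[OF that] h that unfolding is_tangent_def by blast
      ultimately show "?P \<in> trep R tr n (\<lambda>c. Dual c 0)" unfolding trep_def by blast
    qed
    finally show ?thesis .
  qed
qed

lemma tangent_space_sel:
  "D \<oplus>\<^bsub>tangent_space R tr n \<phi>\<^esub> E = (\<lambda>a\<in>carrier R. D a + E a)"
  "c \<odot>\<^bsub>tangent_space R tr n \<phi>\<^esub> D = (\<lambda>a\<in>carrier R. c \<cdot>\<^sub>m D a)"
  "\<zero>\<^bsub>tangent_space R tr n \<phi>\<^esub> = (\<lambda>a\<in>carrier R. 0\<^sub>m n n)"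
  by (simp_all add: tangent_space_def)

section \<open>The local structure at a diagonal representation\<close>

text \<open>For \<open>s = 2\<close> this is \<open>cyclic_quiver n v\<close>; \<open>s = 1\<close> occurs for the algebra \<open>A\<close> itself.\<close>

definition step_quiver :: "nat \<Rightarrow> nat \<Rightarrow> nat \<Rightarrow> (nat, nat \<times> nat) pre_digraph" where
  "step_quiver s n v = \<lparr>
     verts = {..<n},
     arcs = {0, 1} \<times> {..<n} \<union> {(2, v)},
     tail = snd,
     head = (\<lambda>(k, i). if k = 0 then (i + 1) mod n else if k = 1 then (i + n - s) mod n else i)\<rparr>"

lemma step_quiver_2: "step_quiver 2 n v = cyclic_quiver n v"
  by (simp add: step_quiver_def cyclic_quiver_def)

lemma step_quiver_card: "card (arcs (step_quiver s n v)) = 2 * n + 1"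
proof -
  have "card ({0, 1 :: nat} \<times> {..<n} \<union> {(2, v)}) = card ({0, 1 :: nat} \<times> {..<n}) + 1"
    by (subst card_Un_disjoint) auto
  then show ?thesis by (simp add: step_quiver_def card_cartesian_product)
qed

context quantum_space
begin

lemma tr_closed: "a \<in> carrier R \<Longrightarrow> tr a \<in> carrier R"
  by (auto elim!: carrierE simp: tr_kap)

text \<open>The matrix entries of a tangent vector at a diagonal representation are maps of this kind.\<close>

definition point_der :: "complex \<Rightarrow> complex \<Rightarrow> ('r \<Rightarrow> complex) \<Rightarrow> bool" where
  "point_der y x \<delta> \<longleftrightarrow>
     (\<forall>a\<in>carrier R. \<forall>b\<in>carrier R. \<delta> (a \<oplus>\<^bsub>R\<^esub> b) = \<delta> a + \<delta> b) \<and>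
     (\<forall>c. \<forall>a\<in>carrier R. \<delta> (c \<odot>\<^bsub>R\<^esub> a) = c * \<delta> a) \<and>
     (\<forall>a\<in>carrier R. \<forall>b\<in>carrier R. \<delta> (a \<otimes>\<^bsub>R\<^esub> b) = \<delta> a * ev x b + ev y a * \<delta> b)"

lemma point_derD:
  assumes "point_der y x \<delta>"
  shows "a \<in> carrier R \<Longrightarrow> b \<in> carrier R \<Longrightarrow> \<delta> (a \<oplus>\<^bsub>R\<^esub> b) = \<delta> a + \<delta> b"
    "a \<in> carrier R \<Longrightarrow> \<delta> (c \<odot>\<^bsub>R\<^esub> a) = c * \<delta> a"
    "a \<in> carrier R \<Longrightarrow> b \<in> carrier R \<Longrightarrow> \<delta> (a \<otimes>\<^bsub>R\<^esub> b) = \<delta> a * ev x b + ev y a * \<delta> b"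
  using assms unfolding point_der_def by blast+

lemma point_der_one:
  assumes "point_der y x \<delta>"
  shows "\<delta> \<one>\<^bsub>R\<^esub> = 0"
  using point_derD(3)[OF assms one_closed one_closed] by simp

lemma point_der_eqI:
  assumes "point_der y x \<delta>" "point_der y x \<delta>'" "\<delta> W = \<delta>' W" "\<delta> Y = \<delta>' Y" "\<delta> U = \<delta>' U" "a \<in> carrier R"
  shows "\<delta> a = \<delta>' a"
  using assms(6)
  by (induction rule: gen_induct)
    (use assms in \<open>auto simp: point_der_one[OF assms(1)] point_der_one[OF assms(2)]
      point_derD[OF assms(1)] point_derD[OF assms(2)]\<close>)

text \<open>Both sides of the Leibniz rule are bilinear, so it suffices to know it on pairs of
  monomials; the hypothesis is that rule for the values \<open>h\<close>.\<close>

lemma point_derI: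
  fixes h :: "tri \<Rightarrow> complex"
  assumes "\<And>i j k i' j' k'. bich \<alpha> s (i, j, k) (i', j', k') * h (i + i', j + j', k + k') =
    h (i, j, k) * (if i' = 0 \<and> k' = 0 then x ^ j' else 0) + (if i = 0 \<and> k = 0 then y ^ j else 0) * h (i', j', k')"
  shows "point_der y x (\<lambda>a. lin h (crd a))"
proof -
  let ?e = "\<lambda>\<mu> (i, j, k). if i = 0 \<and> k = 0 then \<mu> ^ j else (0 :: complex)"
  have "lin h (tmult (bich \<alpha> s) f g) = lin h f * lin (?e x) g + lin (?e y) f * lin h g" for f g
  proof (induction f rule: poly_mapping_additive_induct)
    case (single p c)
    show ?case
    proof (induction g rule: poly_mapping_additive_induct)
      case (single q d)
      obtain i j k i' j' k' where pq: "p = (i, j, k)" "q = (i', j', k')" by (cases p; cases q)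
      have "lin h (tmult (bich \<alpha> s) (sgl p c) (sgl q d)) =
          c * d * (bich \<alpha> s (i, j, k) (i', j', k') * h (i + i', j + j', k + k'))"
        by (simp add: pq)
      also have "\<dots> = c * h p * (d * ?e x q) + c * ?e y p * (d * h q)"
        unfolding assms by (simp add: pq algebra_simps)
      finally show ?case by simp
    qed (simp add: tmult_add_right algebra_simps)
  qed (simp add: tmult_add_left algebra_simps)
  then show ?thesis unfolding point_der_def
    by (auto elim!: carrierE simp: kap_add kap_mult kap_smult ev_def)
qed

text \<open>Forced by \<open>\<delta>(W) = 1\<close> and
  \<open>\<delta>(Y) = \<delta>(U) = 0\<close>: on \<open>W Y^j\<close> the rule leaves the value
  \<open>x^j\<close> of the right factor.\<close>

definition derW :: "complex \<Rightarrow> 'r \<Rightarrow> complex" where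
  "derW x a = lin (\<lambda>(i, j, k). if i = 1 \<and> k = 0 then x ^ j else 0) (crd a)"

text \<open>The basis element with index \<open>(0, j, 1)\<close> is
  \<open>\<alpha>^(-j) U Y^j\<close>; with \<open>\<delta>(U) = 1\<close> and
  \<open>\<delta>(Y) = 0\<close> its value is \<open>(x / \<alpha>)^j\<close>.\<close>

definition derU :: "complex \<Rightarrow> 'r \<Rightarrow> complex" where
  "derU x a = lin (\<lambda>(i, j, k). if i = 0 \<and> k = 1 then (x / \<alpha>) ^ j else 0) (crd a)"

text \<open>The Euler derivation \<open>Y d/dY\<close> at the character \<open>x\<close>. Normalised
  to the value \<open>x\<close> at \<open>Y\<close>, it has the same coefficient at all eigenvalues
  when the trace is preserved.\<close>

definition derY :: "complex \<Rightarrow> 'r \<Rightarrow> complex" where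
  "derY x a = lin (\<lambda>(i, j, k). if i = 0 \<and> k = 0 then of_nat j * x ^ j else 0) (crd a)"

lemma point_der_derW:
  assumes "y = \<alpha> * x"
  shows "point_der y x (derW x)"
  unfolding derW_def[abs_def]
  by (rule point_derI) (auto simp: bich_eq assms power_add power_mult_distrib)

lemma point_der_derU:
  assumes "y = \<alpha> powi (- s) * x"
  shows "point_der y x (derU x)"
  unfolding derU_def[abs_def]
proof (rule point_derI)
  fix i j k i' j' k' :: nat
  have 1: "\<alpha> ^ j' * (x / \<alpha>) ^ j' = x ^ j'"
    by (simp add: power_divide)
  have 2: "\<alpha> powi (- (int j * (s - 1))) * (x / \<alpha>) ^ j = y ^ j"
  proof -
    have "\<alpha> powi (- (int j * (s - 1))) = (\<alpha> powi (1 - s)) ^ j"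
      by (simp add: power_int_mult[symmetric] algebra_simps flip: power_int_of_nat)
    also have "\<alpha> powi (1 - s) = \<alpha> * \<alpha> powi (- s)"
      using power_int_add[of \<alpha> 1 "- s"] by simp
    finally show ?thesis by (simp add: assms power_mult_distrib power_divide)
  qed
  show "bich \<alpha> s (i, j, k) (i', j', k') *
      (case (i + i', j + j', k + k') of (i, j, k) \<Rightarrow> if i = 0 \<and> k = 1 then (x / \<alpha>) ^ j else 0) =
      (case (i, j, k) of (i, j, k) \<Rightarrow> if i = 0 \<and> k = 1 then (x / \<alpha>) ^ j else 0) *
      (if i' = 0 \<and> k' = 0 then x ^ j' else 0) +
      (if i = 0 \<and> k = 0 then y ^ j else 0) *
      (case (i', j', k') of (i, j, k) \<Rightarrow> if i = 0 \<and> k = 1 then (x / \<alpha>) ^ j else 0)"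
  \<comment> \<open>Both sides vanish unless no \<open>W\<close> occurs and exactly one of the two
    factors contains a single \<open>U\<close>; the two remaining cases are settled by the
    identities above.\<close>
  proof (cases "i + i' = 0 \<and> k + k' = 1")
    case True
    then consider "i = 0" "i' = 0" "k = 1" "k' = 0" | "i = 0" "i' = 0" "k = 0" "k' = 1" by linarith
    then show ?thesis
    proof cases
      case 1
      have "bich \<alpha> s (i, j, k) (i', j', k') = \<alpha> ^ j'" by (simp add: bich_eq \<open>i = 0\<close> \<open>i' = 0\<close> \<open>k = 1\<close> \<open>k' = 0\<close>)
      then show ?thesis using 1 \<open>\<alpha> ^ j' * (x / \<alpha>) ^ j' = x ^ j'\<close> by (simp add: power_add)
    next
      case 2
      have "bich \<alpha> s (i, j, k) (i', j', k') = \<alpha> powi (- (int j * (s - 1)))" using 2 by (simp add: bich_eq algebra_simps)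
      then show ?thesis using 2 \<open>\<alpha> powi (- (int j * (s - 1))) * (x / \<alpha>) ^ j = y ^ j\<close>
        by (simp add: power_add)
    qed
  qed auto
qed

lemma point_der_derY: "point_der x x (derY x)"
  unfolding derY_def[abs_def]
  by (rule point_derI) (auto simp: bich_eq power_add algebra_simps)

lemma der_gens [simp]:
  "derW x W = 1" "derW x Y = 0" "derW x U = 0"
  "derU x W = 0" "derU x Y = 0" "derU x U = 1"
  "derY x W = 0" "derY x Y = x" "derY x U = 0"
  by (simp_all add: derW_def derU_def derY_def W_def Y_def U_def)

lemma point_der_cmult: "point_der y x \<delta> \<Longrightarrow> point_der y x (\<lambda>a. c * \<delta> a)"
  by (auto simp: point_der_def algebra_simps)

lemma point_der_add: "point_der y x \<delta> \<Longrightarrow> point_der y x \<delta>' \<Longrightarrow> point_der y x (\<lambda>a. \<delta> a + \<delta>' a)"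
  by (auto simp: point_der_def algebra_simps)

lemma point_der_zero: "point_der y x (\<lambda>a. 0)"
  by (auto simp: point_der_def)

lemma point_der_inner: "point_der y x (\<lambda>a. c * (ev x a - ev y a))"
  by (auto simp: point_der_def ev_add ev_smult ev_mult algebra_simps)

lemma lin_cong: "(\<And>p. p \<in> supp f \<Longrightarrow> h p = h' p) \<Longrightarrow> lin h f = lin h' f"
  by (simp add: lin_def)

text \<open>The only central monomials that \<open>ev\<close> sees are the powers of
  \<open>Y^n\<close>.\<close>

lemma ev_central:
  assumes "c \<in> centre R" "x ^ n = y ^ n"
  shows "ev x c = ev y c"
proof -
  obtain f where f: "c = \<kappa> f" "f \<in> Zset" using assms(1) by (auto simp: centre_eq)
  have "lin (\<lambda>(i, j, k). if i = 0 \<and> k = 0 then x ^ j else 0) f = lin (\<lambda>(i, j, k). if i = 0 \<and> k = 0 then y ^ j else 0) f"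
  proof (rule lin_cong)
    fix p assume p: "p \<in> supp f"
    obtain i j k where ijk: "p = (i, j, k)" by (cases p)
    have C: "(i, j, k) \<in> Cset" using f(2) p ijk by (auto simp: Zset_def)
    show "(case p of (i, j, k) \<Rightarrow> if i = 0 \<and> k = 0 then x ^ j else 0) =
      (case p of (i, j, k) \<Rightarrow> if i = 0 \<and> k = 0 then y ^ j else 0)"
    proof (cases "i = 0 \<and> k = 0")
      case True
      then have "n dvd j" using C by (simp add: Cset_iff)
      then obtain q where "j = n * q" by (rule dvdE)
      then show ?thesis using assms(2) by (simp add: ijk power_mult)
    qed (auto simp: ijk)
  qed
  then show ?thesis by (simp add: f ev_def)
qed

end

locale diagonal_point = quantum_space \<alpha> s R \<kappa> n tr
  for \<alpha> s and R :: "(complex, 'r) module" and \<kappa> n tr +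
  fixes \<phi> :: "'r \<Rightarrow> complex mat" and g g' :: "complex mat" and \<mu> :: complex
  assumes \<phi>_trep: "\<phi> \<in> trep R tr n id" and \<mu>_nz: "\<mu> \<noteq> 0"
    and g: "g \<in> carrier_mat n n" and g': "g' \<in> carrier_mat n n"
    and gg': "g * g' = 1\<^sub>m n" and g'g: "g' * g = 1\<^sub>m n"
    and \<phi>_eq: "a \<in> carrier R \<Longrightarrow> \<phi> a = g * Dg \<mu> a * g'"
begin

section \<open>Eigenvalues of \<open>Y\<close> and steps around the cycle\<close>

definition lam :: "nat \<Rightarrow> complex" where "lam r = \<mu> * \<alpha> ^ r"

lemma lam_nz [simp]: "lam r \<noteq> 0"
  by (simp add: lam_def \<mu>_nz)

lemma lam_pow_n: "lam r ^ n = \<mu> ^ n"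
  by (metis \<alpha>_pow_n lam_def mult.commute mult.right_neutral power_mult power_mult_distrib power_one)

lemma lam_eq_iff: "r < n \<Longrightarrow> c < n \<Longrightarrow> lam r = lam c \<longleftrightarrow> r = c"
  using primitive_root_inj[OF prim n_pos, of r c] by (auto simp: lam_def \<mu>_nz)

lemma \<alpha>_pow_mod: "\<alpha> ^ (r mod n) = \<alpha> ^ r"
proof -
  have "\<alpha> ^ r = \<alpha> ^ (n * (r div n) + r mod n)" by simp
  also have "\<dots> = \<alpha> ^ (r mod n)" by (simp only: power_add power_mult \<alpha>_pow_n power_one mult_1)
  finally show ?thesis by simp
qed

lemma lam_step_W: "r < n \<Longrightarrow> c < n \<Longrightarrow> lam r = \<alpha> * lam c \<longleftrightarrow> r = (c + 1) mod n"
proof -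
  assume rc: "r < n" "c < n"
  have "lam ((c + 1) mod n) = \<alpha> * lam c" by (simp only: lam_def \<alpha>_pow_mod) simp
  then show ?thesis using lam_eq_iff[of r "(c + 1) mod n"] rc by simp
qed

lemma lam_step_U: "r < n \<Longrightarrow> c < n \<Longrightarrow> lam r = \<alpha> powi (- s) * lam c \<longleftrightarrow> r = (c + n - nat s) mod n"
proof -
  assume rc: "r < n" "c < n"
  \<comment> \<open>Adding \<open>n\<close> before subtracting makes the subtraction of natural
    numbers exact.\<close>
  have s: "nat s \<le> c + n" "int (nat s) = s" using s12 n3 by auto
  have "\<alpha> ^ (c + n - nat s) = \<alpha> powi (int (c + n) - s)"
    using s by (metis of_nat_diff power_int_of_nat)
  also have "\<dots> = \<alpha> powi (- s) * \<alpha> ^ c"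
    by (simp add: power_int_diff power_int_minus divide_inverse power_add mult.commute
      flip: of_nat_add del: of_nat_add)
  finally have "lam ((c + n - nat s) mod n) = \<alpha> powi (- s) * lam c"
    by (simp only: lam_def \<alpha>_pow_mod) simp
  then show ?thesis using lam_eq_iff[of r "(c + n - nat s) mod n"] rc by simp
qed

text \<open>A step by \<open>1\<close> or by \<open>-s\<close> never returns to its starting vertex
  since \<open>n \<ge> 3\<close>; hence diagonal entries of tangent vectors vanish at
  \<open>W\<close> and \<open>U\<close>.\<close>

lemma step_neq: "r < n \<Longrightarrow> r \<noteq> (r + 1) mod n" "r < n \<Longrightarrow> r \<noteq> (r + n - nat s) mod n"
proof -
  assume r: "r < n"
  show "r \<noteq> (r + 1) mod n"
  proof
    assume "r = (r + 1) mod n"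
    then have "lam r = \<alpha> * lam r" using lam_step_W[OF r r] by blast
    then have "\<alpha> ^ 1 = \<alpha> ^ 0" by simp
    then show False using primitive_root_inj[OF prim n_pos, of 1 0] n3 by simp
  qed
  show "r \<noteq> (r + n - nat s) mod n"
  proof
    assume "r = (r + n - nat s) mod n"
    then have "lam r = \<alpha> powi (- s) * lam r" using lam_step_U[OF r r] by blast
    then have "\<alpha> powi (- s) = 1" by simp
    then have "int n dvd s" using powi_eq_1_iff[of "- s"] by simp
    then show False using s12 n3 by (auto dest: zdvd_imp_le)
  qed
qed

lemma rep: "\<phi> \<in> alg_reps R n id"
  using \<phi>_trep by (simp add: trep_def)

lemmas \<phi>D = alg_repsD[OF rep]

lemma Dg_mult_index:
  assumes "N \<in> carrier_mat n n" "r < n" "c < n"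
  shows "(Dg \<mu> a * N) $$ (r, c) = ev (lam r) a * N $$ (r, c)"
    "(N * Dg \<mu> a) $$ (r, c) = N $$ (r, c) * ev (lam c) a"
  unfolding Dg_def lam_def by (rule diag_mult_index[OF assms])+

section \<open>Tangent vectors in an eigenbasis of \<open>Y\<close>\<close>

abbreviation T where "T \<equiv> tangent_space R tr n \<phi>"

definition coo :: "('r \<Rightarrow> complex mat) \<Rightarrow> nat \<Rightarrow> nat \<Rightarrow> 'r \<Rightarrow> complex" where
  "coo D r c a = (g' * D a * g) $$ (r, c)"

definition mk :: "(nat \<Rightarrow> nat \<Rightarrow> 'r \<Rightarrow> complex) \<Rightarrow> 'r \<Rightarrow> complex mat" where
  "mk E = (\<lambda>a\<in>carrier R. g * mat n n (\<lambda>(r, c). E r c a) * g')"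

text \<open>Tangency expressed entry by entry in the eigenbasis; \<open>mk\<close> and
  \<open>coo\<close> are the mutually inverse passages between such entries and tangent
  vectors.\<close>

definition is_entry_der :: "(nat \<Rightarrow> nat \<Rightarrow> 'r \<Rightarrow> complex) \<Rightarrow> bool" where
  "is_entry_der E \<longleftrightarrow> (\<forall>r<n. \<forall>c<n. point_der (lam r) (lam c) (E r c)) \<and>
     (\<forall>a\<in>carrier R. \<forall>r<n. \<forall>c<n. E r c (tr a) = (if r = c then (\<Sum>k<n. E k k a) else 0))"

lemma conj_cancel:
  assumes "M \<in> carrier_mat n n"
  shows "g * (g' * M * g) * g' = M" "g' * (g * M * g') * g = M"
proof -
  have "g * (g' * M * g) * g' = (g * g') * M * (g * g')"
    using assms g g' by (simp add: assoc_mult_mat[of _ n n _ n _ n])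
  then show "g * (g' * M * g) * g' = M" using assms gg' by simp
  have "g' * (g * M * g') * g = (g' * g) * M * (g' * g)"
    using assms g g' by (simp add: assoc_mult_mat[of _ n n _ n _ n])
  then show "g' * (g * M * g') * g = M" using assms g'g by simp
qed

lemma mult_conj:
  assumes "M \<in> carrier_mat n n" "N \<in> carrier_mat n n"
  shows "(g * M * g') * (g * N * g') = g * (M * N) * g'"
proof -
  have "(g * M * g') * (g * N * g') = g * (M * ((g' * g) * (N * g')))"
    using assms g g' by (simp add: assoc_mult_mat[of _ n n _ n _ n])
  also have "\<dots> = g * (M * N) * g'"
    using assms g g' g'g by (simp add: assoc_mult_mat[of _ n n _ n _ n])
  finally show ?thesis .
qed

lemma add_conj:
  assumes "M \<in> carrier_mat n n" "N \<in> carrier_mat n n"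
  shows "g * M * g' + g * N * g' = g * (M + N) * g'"
  using assms g g' by (simp add: add_mult_distrib_mat[of _ n n] mult_add_distrib_mat[of _ n n _ n])

lemma smult_conj:
  assumes "M \<in> carrier_mat n n"
  shows "c \<cdot>\<^sub>m (g * M * g') = g * (c \<cdot>\<^sub>m M) * g'"
  using assms g g' mult_smult_distrib[OF g assms, of c] mult_smult_assoc_mat[of "g * M" n n g' n c] by simp

lemma scalar_conj: "g * (c \<cdot>\<^sub>m 1\<^sub>m n) * g' = c \<cdot>\<^sub>m 1\<^sub>m n"
  using smult_conj[of "1\<^sub>m n" c] g g' gg' by simp

lemma coo_mk: "a \<in> carrier R \<Longrightarrow> r < n \<Longrightarrow> c < n \<Longrightarrow> coo (mk E) r c a = E r c a"
  by (simp add: coo_def mk_def conj_cancel)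

lemma trace_mk: "a \<in> carrier R \<Longrightarrow> (\<Sum>i<n. mk E a $$ (i, i)) = (\<Sum>k<n. E k k a)"
proof -
  assume a: "a \<in> carrier R"
  let ?M = "mat n n (\<lambda>(r, c). E r c a)"
  have "(\<Sum>i<n. mk E a $$ (i, i)) = mtr (g * ?M * g')" using a g by (simp add: mk_def mtr_def)
  also have "\<dots> = mtr ?M" by (rule mtr_conj) (use g g' g'g in auto)
  finally show ?thesis by (simp add: mtr_def)
qed

text \<open>Since \<phi> is diagonal in the eigenbasis, the Leibniz rule decouples: the entry
  \<open>(r, c)\<close> only involves the characters at \<open>lam r\<close> and
  \<open>lam c\<close>. Sums, scalars and the trace are compatible with conjugation by
  \<open>g\<close>.\<close>

lemma mk_tangent:
  assumes "is_entry_der E"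
  shows "mk E \<in> carrier T"
proof -
  have E: "point_der (lam r) (lam c) (E r c)" if "r < n" "c < n" for r c
    using assms that by (simp add: is_entry_der_def)
  have Etr: "E r c (tr a) = (if r = c then (\<Sum>k<n. E k k a) else 0)" if "a \<in> carrier R" "r < n" "c < n" for r c a
    using assms that by (simp add: is_entry_der_def)
  let ?M = "\<lambda>a. mat n n (\<lambda>(r, c). E r c a)"
  have "is_tangent R tr n \<phi> (mk E)" unfolding is_tangent_def
  proof (intro conjI ballI allI)
    show "mk E \<in> extensional (carrier R)" by (simp add: mk_def)
    show "mk E a \<in> carrier_mat n n" if "a \<in> carrier R" for a
      using that g g' by (auto simp: mk_def intro!: mult_carrier_mat[of _ n n])
    show "mk E (a \<oplus>\<^bsub>R\<^esub> b) = mk E a + mk E b" if ab: "a \<in> carrier R" "b \<in> carrier R" for a b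
    proof -
      have "?M (a \<oplus>\<^bsub>R\<^esub> b) = ?M a + ?M b"
        by (rule eq_matI) (use ab in \<open>auto simp: point_derD(1)[OF E]\<close>)
      then show ?thesis using ab by (simp add: mk_def add_conj)
    qed
    show "mk E (c \<odot>\<^bsub>R\<^esub> a) = c \<cdot>\<^sub>m mk E a" if a: "a \<in> carrier R" for c a
    proof -
      have "?M (c \<odot>\<^bsub>R\<^esub> a) = c \<cdot>\<^sub>m ?M a"
        by (rule eq_matI) (use a in \<open>auto simp: point_derD(2)[OF E]\<close>)
      then show ?thesis using a by (simp add: mk_def smult_conj)
    qed
    show "mk E (a \<otimes>\<^bsub>R\<^esub> b) = \<phi> a * mk E b + mk E a * \<phi> b" if ab: "a \<in> carrier R" "b \<in> carrier R" for a b
    proof -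
      have "?M (a \<otimes>\<^bsub>R\<^esub> b) = Dg \<mu> a * ?M b + ?M a * Dg \<mu> b"
      proof (rule eq_matI)
        fix r c assume "r < dim_row (Dg \<mu> a * ?M b + ?M a * Dg \<mu> b)" "c < dim_col (Dg \<mu> a * ?M b + ?M a * Dg \<mu> b)"
        then have rc: "r < n" "c < n" by (auto simp: Dg_def)
        have "(Dg \<mu> a * ?M b) $$ (r, c) = ev (lam r) a * E r c b"
          using Dg_mult_index(1)[OF _ rc, of "?M b" a] rc by simp
        moreover have "(?M a * Dg \<mu> b) $$ (r, c) = E r c a * ev (lam c) b"
          using Dg_mult_index(2)[OF _ rc, of "?M a" b] rc by simp
        moreover have "(Dg \<mu> a * ?M b + ?M a * Dg \<mu> b) $$ (r, c) = (Dg \<mu> a * ?M b) $$ (r, c) + (?M a * Dg \<mu> b) $$ (r, c)"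
          by (rule index_add_mat(1)) (use rc in \<open>auto simp: Dg_def\<close>)
        ultimately show "?M (a \<otimes>\<^bsub>R\<^esub> b) $$ (r, c) = (Dg \<mu> a * ?M b + ?M a * Dg \<mu> b) $$ (r, c)"
          using rc point_derD(3)[OF E[OF rc] ab] by simp
      qed (auto simp: Dg_def)
      then show ?thesis
        using ab add_conj[of "Dg \<mu> a * ?M b" "?M a * Dg \<mu> b"]
          mult_carrier_mat[OF Dg_carrier, of "?M b" n \<mu> a] mult_carrier_mat[OF _ Dg_carrier, of "?M a" n \<mu> b]
        by (simp add: mk_def \<phi>_eq mult_conj)
    qed
    show "mk E (tr a) = (\<Sum>i<n. mk E a $$ (i, i)) \<cdot>\<^sub>m 1\<^sub>m n" if a: "a \<in> carrier R" for a
    proof -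
      have "?M (tr a) = (\<Sum>k<n. E k k a) \<cdot>\<^sub>m 1\<^sub>m n"
        by (rule eq_matI) (use a in \<open>auto simp: Etr\<close>)
      then show ?thesis unfolding trace_mk[OF a] using a by (simp add: mk_def tr_closed scalar_conj)
    qed
  qed
  then show ?thesis using tangent_iff[OF ring_R smult_closed tr_closed \<phi>_trep] by blast
qed

lemma tangentD:
  assumes "D \<in> carrier T"
  shows "is_tangent R tr n \<phi> D"
  using assms tangent_iff[OF ring_R smult_closed tr_closed \<phi>_trep] by blast

lemma tangent_coo:
  assumes D: "D \<in> carrier T"
  shows "is_entry_der (coo D)" "mk (coo D) = D"
proof -
  have Dc: "D a \<in> carrier_mat n n" if "a \<in> carrier R" for a
    using tangentD[OF D] that by (simp add: is_tangent_def)
  show mk: "mk (coo D) = D"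
  proof (rule extensionalityI[of _ "carrier R"])
    fix a assume a: "a \<in> carrier R"
    have "mat n n (\<lambda>(r, c). coo D r c a) = g' * D a * g"
      by (rule eq_matI) (use g g' in \<open>auto simp: coo_def\<close>)
    then show "mk (coo D) a = D a" using a Dc by (simp add: mk_def conj_cancel)
  qed (use tangentD[OF D] in \<open>auto simp: mk_def is_tangent_def\<close>)
  show "is_entry_der (coo D)" unfolding is_entry_der_def
  proof (intro conjI allI impI ballI)
    fix r c assume rc: "r < n" "c < n"
    let ?N = "\<lambda>a. g' * D a * g"
    have N: "?N a \<in> carrier_mat n n" for a using g g' by auto
    have DN: "D a = g * ?N a * g'" if "a \<in> carrier R" for a using conj_cancel(1)[OF Dc[OF that]] by simp
    have unconj: "g' * (g * M * g') * g = M" if "M \<in> carrier_mat n n" for M by (rule conj_cancel(2)[OF that])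
    show "point_der (lam r) (lam c) (coo D r c)" unfolding point_der_def
    proof (intro conjI ballI allI)
      show "coo D r c (a \<oplus>\<^bsub>R\<^esub> b) = coo D r c a + coo D r c b" if ab: "a \<in> carrier R" "b \<in> carrier R" for a b
      proof -
        have "D (a \<oplus>\<^bsub>R\<^esub> b) = D a + D b" using tangentD[OF D] ab by (simp add: is_tangent_def)
        also have "\<dots> = g * (?N a + ?N b) * g'"
          by (rule trans[OF arg_cong2[where f = "(+)", OF DN[OF ab(1)] DN[OF ab(2)]] add_conj[OF N N]])
        finally have "?N (a \<oplus>\<^bsub>R\<^esub> b) = ?N a + ?N b" using unconj[of "?N a + ?N b"] N by simp
        then show ?thesis using rc carrier_matD[OF N[of b]] by (simp add: coo_def)
      qed
      show "coo D r c (x \<odot>\<^bsub>R\<^esub> a) = x * coo D r c a" if a: "a \<in> carrier R" for x a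
      proof -
        have "D (x \<odot>\<^bsub>R\<^esub> a) = x \<cdot>\<^sub>m D a" using tangentD[OF D] a by (simp add: is_tangent_def)
        also have "\<dots> = g * (x \<cdot>\<^sub>m ?N a) * g'"
          by (rule trans[OF arg_cong[where f = "\<lambda>M. x \<cdot>\<^sub>m M", OF DN[OF a]] smult_conj[OF N]])
        finally have "?N (x \<odot>\<^bsub>R\<^esub> a) = x \<cdot>\<^sub>m ?N a" using unconj[of "x \<cdot>\<^sub>m ?N a"] N by simp
        then show ?thesis using rc carrier_matD[OF N[of a]] by (simp add: coo_def)
      qed
      show "coo D r c (a \<otimes>\<^bsub>R\<^esub> b) = coo D r c a * ev (lam c) b + ev (lam r) a * coo D r c b"
        if ab: "a \<in> carrier R" "b \<in> carrier R" for a b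
      proof -
        have "D (a \<otimes>\<^bsub>R\<^esub> b) = \<phi> a * D b + D a * \<phi> b" using tangentD[OF D] ab by (simp add: is_tangent_def)
        also have "\<dots> = g * (Dg \<mu> a * ?N b + ?N a * Dg \<mu> b) * g'"
        proof -
          have 1: "\<phi> a * D b = g * (Dg \<mu> a * ?N b) * g'"
            by (rule trans[OF arg_cong2[where f = "(*)", OF \<phi>_eq[OF ab(1)] DN[OF ab(2)]] mult_conj[OF Dg_carrier N]])
          have 2: "D a * \<phi> b = g * (?N a * Dg \<mu> b) * g'"
            by (rule trans[OF arg_cong2[where f = "(*)", OF DN[OF ab(1)] \<phi>_eq[OF ab(2)]] mult_conj[OF N Dg_carrier]])
          show ?thesis unfolding 1 2
            by (rule add_conj[OF mult_carrier_mat[OF Dg_carrier N] mult_carrier_mat[OF N Dg_carrier]])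
        qed
        finally have "?N (a \<otimes>\<^bsub>R\<^esub> b) = Dg \<mu> a * ?N b + ?N a * Dg \<mu> b"
          using unconj[of "Dg \<mu> a * ?N b + ?N a * Dg \<mu> b"] mult_carrier_mat[OF N Dg_carrier, of a \<mu> b]
            mult_carrier_mat[OF Dg_carrier N, of \<mu> a b] by simp
        moreover have "(Dg \<mu> a * ?N b) $$ (r, c) = ev (lam r) a * ?N b $$ (r, c)"
          by (rule Dg_mult_index(1)[OF N rc])
        moreover have "(?N a * Dg \<mu> b) $$ (r, c) = ?N a $$ (r, c) * ev (lam c) b"
          by (rule Dg_mult_index(2)[OF N rc])
        moreover have "(Dg \<mu> a * ?N b + ?N a * Dg \<mu> b) $$ (r, c) = (Dg \<mu> a * ?N b) $$ (r, c) + (?N a * Dg \<mu> b) $$ (r, c)"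
          by (rule index_add_mat(1)) (use rc N Dg_carrier g g' in \<open>auto simp: Dg_def\<close>)
        ultimately show ?thesis by (simp only: coo_def) (simp only: add.commute)
      qed
    qed
  next
    fix a r c assume a: "a \<in> carrier R" and rc: "r < n" "c < n"
    have "D (tr a) = (\<Sum>i<n. D a $$ (i, i)) \<cdot>\<^sub>m 1\<^sub>m n" using tangentD[OF D] a by (simp add: is_tangent_def)
    moreover have "(\<Sum>i<n. D a $$ (i, i)) = (\<Sum>k<n. coo D k k a)" using trace_mk[OF a, of "coo D"] mk by simp
    ultimately have "g' * D (tr a) * g = g' * (g * ((\<Sum>k<n. coo D k k a) \<cdot>\<^sub>m 1\<^sub>m n) * g') * g"
      by (simp add: scalar_conj)
    also have "\<dots> = (\<Sum>k<n. coo D k k a) \<cdot>\<^sub>m 1\<^sub>m n" by (rule conj_cancel) simp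
    finally show "coo D r c (tr a) = (if r = c then (\<Sum>k<n. coo D k k a) else 0)"
      using rc by (simp add: coo_def)
  qed
qed

end

lemma kron_dim1: "M \<in> carrier_mat 1 1 \<Longrightarrow> kron M (1\<^sub>m (Suc 0)) = (M :: complex mat)"
  by (rule eq_matI) (auto simp: kron_def)

lemma mult_mat_dim1:
  fixes A B :: "complex mat"
  assumes "A \<in> carrier_mat 1 1" "B \<in> carrier_mat 1 1"
  shows "A * B = mat 1 1 (\<lambda>_. A $$ (0, 0) * B $$ (0, 0))"
  by (rule eq_matI) (use assms in \<open>auto simp: scalar_prod_def\<close>)

lemma lin_zero: "(\<And>p. p \<in> supp f \<Longrightarrow> h p = 0) \<Longrightarrow> lin h f = 0"
  by (simp add: lin_def)

context quantum_space
begin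

lemma tr_in_centre: "a \<in> carrier R \<Longrightarrow> tr a \<in> centre R"
  by (auto elim!: carrierE simp: tr_kap)

text \<open>A central exponent of the form \<open>(1, j, 0)\<close> would require \<open>n\<close>
  to divide \<open>1\<close>. As traces are central, \<open>derW\<close> contributes nothing to the
  trace condition; \<open>derU\<close> behaves alike since \<open>n\<close> does not divide
  \<open>s\<close>.\<close>

lemma derW_central: "c \<in> centre R \<Longrightarrow> derW x c = 0"
proof -
  assume "c \<in> centre R"
  then obtain f where f: "c = \<kappa> f" "supp f \<subseteq> Cset" by (auto simp: centre_eq Zset_def)
  have "(1, j, 0) \<notin> Cset" for j using n3 by (auto simp: Cset_iff dest: zdvd_imp_le)
  then show ?thesis unfolding derW_def f crd_kap using f(2) by (intro lin_zero) auto
qed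

lemma derU_central: "c \<in> centre R \<Longrightarrow> derU x c = 0"
proof -
  assume "c \<in> centre R"
  then obtain f where f: "c = \<kappa> f" "supp f \<subseteq> Cset" by (auto simp: centre_eq Zset_def)
  have "(0, j, 1) \<notin> Cset" for j using n3 s12 by (auto simp: Cset_iff dest: zdvd_imp_le)
  then show ?thesis unfolding derU_def f crd_kap using f(2) by (intro lin_zero) auto
qed

end

context diagonal_point
begin

text \<open>The power sums of the eigenvalues vanish unless \<open>n\<close> divides the exponent,
  which is exactly when the monomial survives the reduced trace. So equal multiples of the Euler
  derivations on the diagonal preserve the trace.\<close>

lemma derY_trace:
  assumes a: "a \<in> carrier R"
  shows "derY (lam r) (tr a) = (\<Sum>k<n. derY (lam k) a)"
proof -
  obtain f where f: "a = \<kappa> f" using a by (rule carrierE)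
  have power: "(\<Sum>k<n. lam k ^ j) = (if n dvd j then of_nat n * lam r ^ j else 0)" for j
    using power_sum[of \<mu> j] by (auto simp: lam_def[symmetric] power_mult lam_pow_n elim!: dvdE)
  let ?h = "\<lambda>x (i, j, k). if i = 0 \<and> k = 0 then of_nat j * x ^ j else (0 :: complex)"
  have "lin (?h (lam r)) (scal (of_nat n) (proj_centre f)) = (\<Sum>k<n. lin (?h (lam k)) f)"
  proof (induction f rule: poly_mapping_additive_induct)
    case (single p c)
    obtain i j k where p: "p = (i, j, k)" by (cases p)
    show ?case
    proof (cases "i = 0 \<and> k = 0")
      case True
      have "(\<Sum>k<n. lin (?h (lam k)) (sgl p c)) = c * of_nat j * (\<Sum>k<n. lam k ^ j)"
        by (simp add: p True sum_distrib_left mult.assoc)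
      then show ?thesis unfolding power by (simp add: p True proj_centre_sgl Cset_iff)
    next
      case False
      then show ?thesis by (auto simp: p proj_centre_sgl)
    qed
  next
    case (add f g)
    then show ?case by (simp add: scal_add sum.distrib)
  qed
  then show ?thesis by (simp add: f tr_kap derY_def)
qed

text \<open>Applying \<delta> to \<open>YW = \<alpha>WY\<close> gives
  \<open>(lam r - \<alpha> lam c) \<delta>(W) = 0\<close>, and the factor vanishes only one step
  around the cycle.\<close>

lemma entry_W:
  assumes E: "point_der (lam r) (lam c) \<delta>" and rc: "r < n" "c < n" "r \<noteq> (c + 1) mod n"
  shows "\<delta> W = 0"
proof -
  have "\<delta> (Y \<otimes>\<^bsub>R\<^esub> W) = \<alpha> * \<delta> (W \<otimes>\<^bsub>R\<^esub> Y)" unfolding Y_W by (rule point_derD(2)[OF E]) simp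
  then have "lam r * \<delta> W = \<alpha> * lam c * \<delta> W" by (simp add: point_derD(3)[OF E])
  then show ?thesis using lam_step_W[OF rc(1,2)] rc(3) by auto
qed

text \<open>As for \<open>W\<close>, with the relation \<open>YU = \<alpha>^(-s) UY\<close>.\<close>

lemma entry_U:
  assumes E: "point_der (lam r) (lam c) \<delta>" and rc: "r < n" "c < n" "r \<noteq> (c + n - nat s) mod n"
  shows "\<delta> U = 0"
proof -
  have "\<delta> (Y \<otimes>\<^bsub>R\<^esub> U) = \<alpha> powi (- s) * \<delta> (U \<otimes>\<^bsub>R\<^esub> Y)" unfolding Y_U by (rule point_derD(2)[OF E]) simp
  then have "lam r * \<delta> U = \<alpha> powi (- s) * lam c * \<delta> U" by (simp add: point_derD(3)[OF E])
  then show ?thesis using lam_step_U[OF rc(1,2)] rc(3) by auto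
qed

text \<open>The trace condition at \<open>Y^n\<close>, where \<open>tr\<close> is multiplication by
  \<open>n\<close>, forces all diagonal entries to agree there. Up to a constant factor the value at
  \<open>Y^n\<close> is \<open>E k k Y / lam k\<close>.\<close>

lemma entry_Y:
  assumes E: "is_entry_der E" and r: "r < n" and v: "v < n"
  shows "E r r Y * lam v = E v v Y * lam r"
proof -
  have der: "point_der (lam k) (lam k) (E k k)" if "k < n" for k using E that by (simp add: is_entry_der_def)
  \<comment> \<open>A diagonal entry vanishes at \<open>W\<close> and \<open>U\<close>, so it is a
    multiple of the Euler derivation.\<close>
  have E_eq: "E k k a = E k k Y / lam k * derY (lam k) a" if k: "k < n" and a: "a \<in> carrier R" for k a
    by (rule point_der_eqI[OF der[OF k] point_der_cmult[OF point_der_derY] _ _ _ a])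
      (use entry_W[OF der[OF k] k k] entry_U[OF der[OF k] k k] step_neq[OF k] in auto)
  have "derY (lam k) (Y [^]\<^bsub>R\<^esub> n) = of_nat n * \<mu> ^ n" for k by (simp add: derY_def Y_pow lam_pow_n)
  then have Yn: "E k k (Y [^]\<^bsub>R\<^esub> n) = E k k Y / lam k * (of_nat n * \<mu> ^ n)" if "k < n" for k
    using E_eq[OF that, of "Y [^]\<^bsub>R\<^esub> n"] by simp
  have "tr (Y [^]\<^bsub>R\<^esub> n) = of_nat n \<odot>\<^bsub>R\<^esub> Y [^]\<^bsub>R\<^esub> n"
    by (simp add: Y_pow tr_kap proj_centre_sgl Cset_iff kap_smult)
  then have "of_nat n * E k k (Y [^]\<^bsub>R\<^esub> n) = (\<Sum>k<n. E k k (Y [^]\<^bsub>R\<^esub> n))" if "k < n" for k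
  proof -
    have "E k k (tr (Y [^]\<^bsub>R\<^esub> n)) = (\<Sum>k<n. E k k (Y [^]\<^bsub>R\<^esub> n))"
      using E that nat_pow_closed[OF gens_closed(2), of n] unfolding is_entry_der_def by auto
    then show ?thesis
      using \<open>tr (Y [^]\<^bsub>R\<^esub> n) = of_nat n \<odot>\<^bsub>R\<^esub> Y [^]\<^bsub>R\<^esub> n\<close>
        point_derD(2)[OF der[OF that], of "Y [^]\<^bsub>R\<^esub> n" "of_nat n"] by simp
  qed
  from this[OF r] this[OF v]
  have "of_nat n * E r r (Y [^]\<^bsub>R\<^esub> n) = of_nat n * E v v (Y [^]\<^bsub>R\<^esub> n)" by simp
  then have "E r r (Y [^]\<^bsub>R\<^esub> n) = E v v (Y [^]\<^bsub>R\<^esub> n)" using n3 by simp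
  then show ?thesis unfolding Yn[OF r] Yn[OF v] using \<mu>_nz n3 by (simp add: field_simps)
qed

section \<open>Linear structure of the tangent space and the orbit directions\<close>

lemma mk_cong: "(\<And>a r c. a \<in> carrier R \<Longrightarrow> r < n \<Longrightarrow> c < n \<Longrightarrow> E r c a = E' r c a) \<Longrightarrow> mk E = mk E'"
  unfolding mk_def
proof (intro restrict_ext)
  fix a assume E: "\<And>a r c. a \<in> carrier R \<Longrightarrow> r < n \<Longrightarrow> c < n \<Longrightarrow> E r c a = E' r c a" and a: "a \<in> carrier R"
  have "mat n n (\<lambda>(r, c). E r c a) = mat n n (\<lambda>(r, c). E' r c a)" by (rule eq_matI) (use E a in auto)
  then show "g * mat n n (\<lambda>(r, c). E r c a) * g' = g * mat n n (\<lambda>(r, c). E' r c a) * g'" by simp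
qed

lemma mk_add: "(\<lambda>a\<in>carrier R. mk E a + mk E' a) = mk (\<lambda>r c a. E r c a + E' r c a)"
  unfolding mk_def
proof (intro restrict_ext)
  fix a assume a: "a \<in> carrier R"
  have "mat n n (\<lambda>(r, c). E r c a + E' r c a) = mat n n (\<lambda>(r, c). E r c a) + mat n n (\<lambda>(r, c). E' r c a)"
    by (rule eq_matI) auto
  then show "(\<lambda>a\<in>carrier R. g * mat n n (\<lambda>(r, c). E r c a) * g') a + (\<lambda>a\<in>carrier R. g * mat n n (\<lambda>(r, c). E' r c a) * g') a
    = g * mat n n (\<lambda>(r, c). E r c a + E' r c a) * g'" using a by (simp add: add_conj)
qed

lemma mk_smult: "(\<lambda>a\<in>carrier R. x \<cdot>\<^sub>m mk E a) = mk (\<lambda>r c a. x * E r c a)"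
  unfolding mk_def
proof (intro restrict_ext)
  fix a assume a: "a \<in> carrier R"
  have "mat n n (\<lambda>(r, c). x * E r c a) = x \<cdot>\<^sub>m mat n n (\<lambda>(r, c). E r c a)"
    by (rule eq_matI) auto
  then show "x \<cdot>\<^sub>m (\<lambda>a\<in>carrier R. g * mat n n (\<lambda>(r, c). E r c a) * g') a
    = g * mat n n (\<lambda>(r, c). x * E r c a) * g'" using a by (simp add: smult_conj)
qed

lemma mk_zero: "(\<lambda>a\<in>carrier R. 0\<^sub>m n n) = mk (\<lambda>r c a. 0)"
  unfolding mk_def
proof (intro restrict_ext)
  fix a
  have "mat n n (\<lambda>(r, c). 0) = (0 \<cdot>\<^sub>m 1\<^sub>m n :: complex mat)" by (rule eq_matI) auto
  then have "g * mat n n (\<lambda>(r, c). 0) * g' = 0 \<cdot>\<^sub>m 1\<^sub>m n" by (simp only: scalar_conj)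
  also have "\<dots> = 0\<^sub>m n n" by (rule eq_matI) auto
  finally show "0\<^sub>m n n = g * mat n n (\<lambda>(r, c). 0) * g'" by simp
qed

lemma entry_der_add: "is_entry_der E \<Longrightarrow> is_entry_der E' \<Longrightarrow> is_entry_der (\<lambda>r c a. E r c a + E' r c a)"
  by (simp add: is_entry_der_def point_der_add sum.distrib)

lemma entry_der_smult: "is_entry_der E \<Longrightarrow> is_entry_der (\<lambda>r c a. x * E r c a)"
  by (simp add: is_entry_der_def point_der_cmult sum_distrib_left)

lemma entry_der_zero: "is_entry_der (\<lambda>r c a. 0)"
  by (simp add: is_entry_der_def point_der_zero)

lemma T_add: "D \<in> carrier T \<Longrightarrow> D' \<in> carrier T \<Longrightarrow> D \<oplus>\<^bsub>T\<^esub> D' = mk (\<lambda>r c a. coo D r c a + coo D' r c a)"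
  using mk_add[of "coo D" "coo D'"] by (simp add: tangent_space_sel tangent_coo)

lemma T_smult: "D \<in> carrier T \<Longrightarrow> x \<odot>\<^bsub>T\<^esub> D = mk (\<lambda>r c a. x * coo D r c a)"
  using mk_smult[of x "coo D"] by (simp add: tangent_space_sel tangent_coo)

lemma T_carrier_mat: "D \<in> carrier T \<Longrightarrow> a \<in> carrier R \<Longrightarrow> D a \<in> carrier_mat n n"
  using tangentD by (auto simp: is_tangent_def)

lemma T_extensional: "D \<in> carrier T \<Longrightarrow> D \<in> extensional (carrier R)"
  using tangentD by (auto simp: is_tangent_def)

lemma tangent_vectorspace: "vectorspace class_ring T"
proof (rule vectorspaceI)
  show "D \<oplus>\<^bsub>T\<^esub> D' \<in> carrier T" if "D \<in> carrier T" "D' \<in> carrier T" for D D'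
    unfolding T_add[OF that] using that by (intro mk_tangent entry_der_add tangent_coo)
  show "x \<odot>\<^bsub>T\<^esub> D \<in> carrier T" if "D \<in> carrier T" for x D
    unfolding T_smult[OF that] using that by (intro mk_tangent entry_der_smult tangent_coo)
  show "\<zero>\<^bsub>T\<^esub> \<in> carrier T"
    unfolding tangent_space_sel mk_zero by (rule mk_tangent[OF entry_der_zero])
  show "\<zero>\<^bsub>T\<^esub> \<oplus>\<^bsub>T\<^esub> D = D" if D: "D \<in> carrier T" for D
    by (rule extensionalityI[of _ "carrier R"])
      (use T_carrier_mat[OF D] T_extensional[OF D] in \<open>auto simp: tangent_space_sel\<close>)
  show "1 \<odot>\<^bsub>T\<^esub> D = D" if D: "D \<in> carrier T" for D
    by (rule extensionalityI[of _ "carrier R"])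
      (use T_carrier_mat[OF D] T_extensional[OF D] in \<open>auto simp: tangent_space_sel intro!: eq_matI\<close>)
  show "0 \<odot>\<^bsub>T\<^esub> D = \<zero>\<^bsub>T\<^esub>" if D: "D \<in> carrier T" for D
  proof -
    have "0 \<cdot>\<^sub>m D a = 0\<^sub>m n n" if a: "a \<in> carrier R" for a
      using T_carrier_mat[OF D a] by (intro eq_matI) auto
    then show ?thesis by (auto simp: tangent_space_sel intro!: restrict_ext)
  qed
  show "(D \<oplus>\<^bsub>T\<^esub> D') \<oplus>\<^bsub>T\<^esub> D'' = D \<oplus>\<^bsub>T\<^esub> (D' \<oplus>\<^bsub>T\<^esub> D'')"
    if D: "D \<in> carrier T" "D' \<in> carrier T" "D'' \<in> carrier T" for D D' D''
  proof -
    have "D a + D' a + D'' a = D a + (D' a + D'' a)" if a: "a \<in> carrier R" for a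
      by (rule assoc_add_mat[OF T_carrier_mat[OF D(1) a] T_carrier_mat[OF D(2) a] T_carrier_mat[OF D(3) a]])
    then show ?thesis by (auto simp: tangent_space_sel intro!: restrict_ext)
  qed
  show "D \<oplus>\<^bsub>T\<^esub> D' = D' \<oplus>\<^bsub>T\<^esub> D" if D: "D \<in> carrier T" "D' \<in> carrier T" for D D'
  proof -
    have "D a + D' a = D' a + D a" if a: "a \<in> carrier R" for a
      by (rule comm_add_mat[OF T_carrier_mat[OF D(1) a] T_carrier_mat[OF D(2) a]])
    then show ?thesis by (auto simp: tangent_space_sel intro!: restrict_ext)
  qed
  show "(x + y) \<odot>\<^bsub>T\<^esub> D = x \<odot>\<^bsub>T\<^esub> D \<oplus>\<^bsub>T\<^esub> y \<odot>\<^bsub>T\<^esub> D" if D: "D \<in> carrier T" for x y D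
  proof -
    have "(x + y) \<cdot>\<^sub>m D a = x \<cdot>\<^sub>m D a + y \<cdot>\<^sub>m D a" if a: "a \<in> carrier R" for a
      using T_carrier_mat[OF D a] by (intro eq_matI) (auto simp: algebra_simps)
    then show ?thesis by (auto simp: tangent_space_sel intro!: restrict_ext)
  qed
  show "x \<odot>\<^bsub>T\<^esub> (D \<oplus>\<^bsub>T\<^esub> D') = x \<odot>\<^bsub>T\<^esub> D \<oplus>\<^bsub>T\<^esub> x \<odot>\<^bsub>T\<^esub> D'" if D: "D \<in> carrier T" "D' \<in> carrier T" for x D D'
  proof -
    have "x \<cdot>\<^sub>m (D a + D' a) = x \<cdot>\<^sub>m D a + x \<cdot>\<^sub>m D' a" if a: "a \<in> carrier R" for a
      using T_carrier_mat[OF D(1) a] T_carrier_mat[OF D(2) a] by (intro eq_matI) (auto simp: algebra_simps)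
    then show ?thesis by (auto simp: tangent_space_sel intro!: restrict_ext)
  qed
  show "(x * y) \<odot>\<^bsub>T\<^esub> D = x \<odot>\<^bsub>T\<^esub> (y \<odot>\<^bsub>T\<^esub> D)" if D: "D \<in> carrier T" for x y D
  proof -
    have "(x * y) \<cdot>\<^sub>m D a = x \<cdot>\<^sub>m (y \<cdot>\<^sub>m D a)" if a: "a \<in> carrier R" for a
      using T_carrier_mat[OF D a] by (intro eq_matI) (auto simp: algebra_simps)
    then show ?thesis by (auto simp: tangent_space_sel intro!: restrict_ext)
  qed
qed

definition inner_entry :: "(nat \<Rightarrow> nat \<Rightarrow> complex) \<Rightarrow> nat \<Rightarrow> nat \<Rightarrow> 'r \<Rightarrow> complex" where
  "inner_entry X r c a = X r c * (ev (lam c) a - ev (lam r) a)"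

text \<open>In the eigenbasis a commutator with the diagonal matrix of \<open>a\<close> multiplies
  the entry \<open>(r, c)\<close> by the difference of the two characters.\<close>

lemma orbit_tangent_eq: "orbit_tangent R n \<phi> = range (\<lambda>X. mk (inner_entry X))"
proof -
  have comm: "(\<lambda>a\<in>carrier R. (g * M * g') * \<phi> a - \<phi> a * (g * M * g')) = mk (inner_entry (\<lambda>r c. M $$ (r, c)))"
    if M: "M \<in> carrier_mat n n" for M
    unfolding mk_def
  proof (intro restrict_ext)
    fix a assume a: "a \<in> carrier R"
    have c: "M * Dg \<mu> a \<in> carrier_mat n n" "Dg \<mu> a * M \<in> carrier_mat n n"
      using M mult_carrier_mat[OF _ Dg_carrier] mult_carrier_mat[OF Dg_carrier] by blast+
    have "(g * M * g') * \<phi> a - \<phi> a * (g * M * g') = g * (M * Dg \<mu> a) * g' - g * (Dg \<mu> a * M) * g'"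
      unfolding \<phi>_eq[OF a] mult_conj[OF M Dg_carrier] mult_conj[OF Dg_carrier M] ..
    also have "\<dots> = g * (M * Dg \<mu> a - Dg \<mu> a * M) * g'"
      using c g g' by (simp add: minus_mult_distrib_mat[of _ n n] mult_minus_distrib_mat[of _ n n _ n])
    also have "M * Dg \<mu> a - Dg \<mu> a * M = mat n n (\<lambda>(r, c). inner_entry (\<lambda>r c. M $$ (r, c)) r c a)"
    proof (rule eq_matI)
      fix r c assume "r < dim_row (mat n n (\<lambda>(r, c). inner_entry (\<lambda>r c. M $$ (r, c)) r c a))"
        "c < dim_col (mat n n (\<lambda>(r, c). inner_entry (\<lambda>r c. M $$ (r, c)) r c a))"
      then have rc: "r < n" "c < n" by auto
      have "(M * Dg \<mu> a - Dg \<mu> a * M) $$ (r, c) = (M * Dg \<mu> a) $$ (r, c) - (Dg \<mu> a * M) $$ (r, c)"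
        by (rule index_minus_mat(1)) (use rc carrier_matD[OF \<open>Dg \<mu> a * M \<in> carrier_mat n n\<close>] in auto)
      then show "(M * Dg \<mu> a - Dg \<mu> a * M) $$ (r, c) = mat n n (\<lambda>(r, c). inner_entry (\<lambda>r c. M $$ (r, c)) r c a) $$ (r, c)"
        using rc Dg_mult_index[OF M rc] by (simp add: inner_entry_def algebra_simps)
    qed (use M in \<open>auto simp: Dg_def\<close>)
    finally show "(g * M * g') * \<phi> a - \<phi> a * (g * M * g') =
      g * mat n n (\<lambda>(r, c). inner_entry (\<lambda>r c. M $$ (r, c)) r c a) * g'" .
  qed
  show ?thesis
  proof
    show "orbit_tangent R n \<phi> \<subseteq> range (\<lambda>X. mk (inner_entry X))"
    proof
      fix D assume "D \<in> orbit_tangent R n \<phi>"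
      then obtain \<xi> where \<xi>: "\<xi> \<in> carrier_mat n n" "D = (\<lambda>a\<in>carrier R. \<xi> * \<phi> a - \<phi> a * \<xi>)"
        by (auto simp: orbit_tangent_def)
      have "g' * \<xi> * g \<in> carrier_mat n n" using \<xi> g g' by auto
      then have "D = mk (inner_entry (\<lambda>r c. (g' * \<xi> * g) $$ (r, c)))"
        using comm[of "g' * \<xi> * g"] conj_cancel(1)[OF \<xi>(1)] \<xi>(2) by simp
      then show "D \<in> range (\<lambda>X. mk (inner_entry X))" by blast
    qed
    show "range (\<lambda>X. mk (inner_entry X)) \<subseteq> orbit_tangent R n \<phi>"
    proof
      fix D assume "D \<in> range (\<lambda>X. mk (inner_entry X))"
      then obtain X where X: "D = mk (inner_entry X)" by blast
      let ?M = "mat n n (\<lambda>(r, c). X r c)"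
      have "mk (inner_entry X) = mk (inner_entry (\<lambda>r c. ?M $$ (r, c)))"
        by (rule mk_cong) (simp add: inner_entry_def)
      then have "D = (\<lambda>a\<in>carrier R. (g * ?M * g') * \<phi> a - \<phi> a * (g * ?M * g'))"
        using comm[of ?M] X by simp
      moreover have "g * ?M * g' \<in> carrier_mat n n" using g g' by auto
      ultimately show "D \<in> orbit_tangent R n \<phi>" unfolding orbit_tangent_def by blast
    qed
  qed
qed

text \<open>All the characters involved agree on the centre, so inner entries vanish on traces; on
  the diagonal they vanish altogether.\<close>

lemma inner_entry_der: "is_entry_der (inner_entry X)"
  unfolding is_entry_der_def
proof (intro conjI allI impI ballI)
  show "point_der (lam r) (lam c) (inner_entry X r c)" for r c
    unfolding inner_entry_def[abs_def] by (rule point_der_inner)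
  fix a r c assume "a \<in> carrier R"
  then have "ev (lam c) (tr a) = ev (lam r) (tr a)"
    by (intro ev_central tr_in_centre) (simp_all add: lam_pow_n)
  then show "inner_entry X r c (tr a) = (if r = c then (\<Sum>k<n. inner_entry X k k a) else 0)"
    by (simp add: inner_entry_def)
qed

section \<open>The normal space as a space of quiver representations\<close>

abbreviation Q where "Q \<equiv> step_quiver (nat s) n"

definition gen :: "nat \<Rightarrow> 'r" where
  "gen k = (if k = 0 then W else if k = 1 then U else Y)"

text \<open>The label of an arrow selects the generator, and its ends select the matrix position at
  which the tangent vector is read. The loop reads \<open>Y\<close> at \<open>(v, v)\<close>; by
  \<open>entry_Y\<close> this determines the whole diagonal, so any vertex may carry the
  loop.\<close>

definition Phi :: "nat \<Rightarrow> ('r \<Rightarrow> complex mat) \<Rightarrow> nat \<times> nat \<Rightarrow> complex mat" where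
  "Phi v D = (\<lambda>q\<in>arcs (Q v). mat 1 1 (\<lambda>_. coo D (head (Q v) q) (tail (Q v) q) (gen (fst q))))"

lemma Q_sel:
  "arcs (Q v) = {0, 1} \<times> {..<n} \<union> {(2, v)}" "tail (Q v) q = snd q"
  "head (Q v) (0, i) = (i + 1) mod n" "head (Q v) (1, i) = (i + n - nat s) mod n" "head (Q v) (2, i) = i"
  "head (Q v) (Suc 0, i) = (i + n - nat s) mod n"
  by (simp_all add: step_quiver_def)

lemma Q_range: "v < n \<Longrightarrow> q \<in> arcs (Q v) \<Longrightarrow> head (Q v) q < n \<and> tail (Q v) q < n"
  by (auto simp: step_quiver_def)

lemma gen_closed [simp]: "gen k \<in> carrier R"
  by (simp add: gen_def)

lemma Phi_zero_iff: "Phi v D = \<zero>\<^bsub>quiver_reps (Q v) (\<lambda>_. 1)\<^esub> \<longleftrightarrow>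
    (\<forall>q\<in>arcs (Q v). coo D (head (Q v) q) (tail (Q v) q) (gen (fst q)) = 0)"
proof -
  have "mat 1 1 (\<lambda>_. x) = (0\<^sub>m 1 1 :: complex mat) \<longleftrightarrow> x = 0" for x
  proof
    assume "mat 1 1 (\<lambda>_. x) = (0\<^sub>m 1 1 :: complex mat)"
    then have "mat 1 1 (\<lambda>_. x) $$ (0, 0) = (0\<^sub>m 1 1 :: complex mat) $$ (0, 0)" by simp
    then show "x = 0" by simp
  qed (auto intro: eq_matI)
  then show ?thesis unfolding Phi_def quiver_reps_sel restrict_def fun_eq_iff by auto
qed

text \<open>When all readings vanish, \<open>D\<close> is zero at \<open>W\<close> and
  \<open>U\<close> and has zero diagonal at \<open>Y\<close>; what remains are off-diagonal entries
  at \<open>Y\<close>, and those are inner.\<close>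

lemma orbit_kernel:
  assumes v: "v < n"
  shows "orbit_tangent R n \<phi> = {D \<in> carrier T. Phi v D = \<zero>\<^bsub>quiver_reps (Q v) (\<lambda>_. 1)\<^esub>}"
proof
  show "orbit_tangent R n \<phi> \<subseteq> {D \<in> carrier T. Phi v D = \<zero>\<^bsub>quiver_reps (Q v) (\<lambda>_. 1)\<^esub>}"
  proof
    fix D assume "D \<in> orbit_tangent R n \<phi>"
    then obtain X where D: "D = mk (inner_entry X)" by (auto simp: orbit_tangent_eq)
    have "coo D (head (Q v) q) (tail (Q v) q) (gen (fst q)) = 0" if q: "q \<in> arcs (Q v)" for q
    proof -
      have "coo D (head (Q v) q) (tail (Q v) q) (gen (fst q)) = inner_entry X (head (Q v) q) (tail (Q v) q) (gen (fst q))"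
        unfolding D by (rule coo_mk) (use Q_range[OF v q] in auto)
      also have "\<dots> = 0" using q by (auto simp: Q_sel inner_entry_def gen_def)
      finally show ?thesis .
    qed
    then show "D \<in> {D \<in> carrier T. Phi v D = \<zero>\<^bsub>quiver_reps (Q v) (\<lambda>_. 1)\<^esub>}"
      unfolding Phi_zero_iff using D mk_tangent[OF inner_entry_der] by auto
  qed
  show "{D \<in> carrier T. Phi v D = \<zero>\<^bsub>quiver_reps (Q v) (\<lambda>_. 1)\<^esub>} \<subseteq> orbit_tangent R n \<phi>"
  proof
    fix D assume "D \<in> {D \<in> carrier T. Phi v D = \<zero>\<^bsub>quiver_reps (Q v) (\<lambda>_. 1)\<^esub>}"
    then have D: "D \<in> carrier T"
      and z: "\<And>q. q \<in> arcs (Q v) \<Longrightarrow> coo D (head (Q v) q) (tail (Q v) q) (gen (fst q)) = 0"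
      unfolding Phi_zero_iff by auto
    have E: "is_entry_der (coo D)" by (rule tangent_coo[OF D])
    have der: "point_der (lam r) (lam c) (coo D r c)" if "r < n" "c < n" for r c
      using E that by (simp add: is_entry_der_def)
    have W0: "coo D r c W = 0" if rc: "r < n" "c < n" for r c
      using entry_W[OF der[OF rc] rc] z[of "(0, c)"] rc by (cases "r = (c + 1) mod n") (auto simp: Q_sel gen_def)
    have U0: "coo D r c U = 0" if rc: "r < n" "c < n" for r c
      using entry_U[OF der[OF rc] rc] z[of "(1, c)"] rc by (cases "r = (c + n - nat s) mod n") (auto simp: Q_sel gen_def)
    have "coo D v v Y = 0" using z[of "(2, v)"] by (simp add: Q_sel gen_def)
    then have Y0: "coo D r r Y = 0" if "r < n" for r using entry_Y[OF E that v] by simp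
    \<comment> \<open>Solves \<open>X r c * (lam c - lam r) = coo D r c Y\<close>; the denominator
      is nonzero off the diagonal since the eigenvalues are distinct.\<close>
    define X where "X r c = (if r = c then 0 else coo D r c Y / (lam c - lam r))" for r c
    have "coo D r c a = inner_entry X r c a" if a: "a \<in> carrier R" and rc: "r < n" "c < n" for a r c
    proof (rule point_der_eqI[OF der[OF rc] _ _ _ _ a])
      show "point_der (lam r) (lam c) (inner_entry X r c)"
        unfolding inner_entry_def[abs_def] by (rule point_der_inner)
      show "coo D r c Y = inner_entry X r c Y"
        using Y0[OF rc(1)] lam_eq_iff[OF rc] by (auto simp: inner_entry_def X_def)
    qed (use W0[OF rc] U0[OF rc] in \<open>auto simp: inner_entry_def\<close>)
    then have "mk (coo D) = mk (inner_entry X)" by (rule mk_cong)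
    then show "D \<in> orbit_tangent R n \<phi>" using tangent_coo(2)[OF D] by (auto simp: orbit_tangent_eq)
  qed
qed

text \<open>A preimage is assembled from the three standard derivations. Each takes a nonzero value
  at one generator only, so the three kinds of arrows are read off independently.\<close>

lemma Phi_surj:
  assumes v: "v < n" and V: "V \<in> carrier (quiver_reps (Q v) (\<lambda>_. 1))"
  shows "\<exists>D\<in>carrier T. Phi v D = V"
proof -
  define x where "x q = V q $$ (0, 0)" for q
  \<comment> \<open>The division by \<open>lam v\<close> normalises the loop, because
    \<open>derY (lam v)\<close> has the value \<open>lam v\<close> at \<open>Y\<close>.\<close>
  define E where "E r c a =
    (if r = (c + 1) mod n then x (0, c) else 0) * derW (lam c) a +
    (if r = (c + n - nat s) mod n then x (1, c) else 0) * derU (lam c) a +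
    (if r = c then x (2, v) / lam v else 0) * derY (lam r) a" for r c a
  have E: "is_entry_der E" unfolding is_entry_der_def
  proof (intro conjI allI impI ballI)
    fix r c assume rc: "r < n" "c < n"
    have 1: "point_der (lam r) (lam c) (\<lambda>a. (if r = (c + 1) mod n then x (0, c) else 0) * derW (lam c) a)"
      using point_der_cmult[OF point_der_derW] point_der_zero lam_step_W[OF rc] by auto
    have 2: "point_der (lam r) (lam c) (\<lambda>a. (if r = (c + n - nat s) mod n then x (1, c) else 0) * derU (lam c) a)"
      using point_der_cmult[OF point_der_derU] point_der_zero lam_step_U[OF rc] by auto
    have 3: "point_der (lam r) (lam c) (\<lambda>a. (if r = c then x (2, v) / lam v else 0) * derY (lam r) a)"
      using point_der_cmult[OF point_der_derY[of "lam r"], of "x (2, v) / lam v"] point_der_zero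
      by (cases "r = c") auto
    show "point_der (lam r) (lam c) (E r c)"
      unfolding E_def[abs_def] by (intro point_der_add 1 2 3)
  next
    fix a r c assume a: "a \<in> carrier R" and rc: "r < n" "c < n"
    have "E k k a = x (2, v) / lam v * derY (lam k) a" if "k < n" for k
      using step_neq[OF that] by (simp add: E_def)
    then have "(\<Sum>k<n. E k k a) = x (2, v) / lam v * (\<Sum>k<n. derY (lam k) a)"
      by (simp add: sum_distrib_left)
    moreover have "E r c (tr a) = (if r = c then x (2, v) / lam v else 0) * derY (lam r) (tr a)"
      by (simp add: E_def derW_central derU_central tr_in_centre a)
    ultimately show "E r c (tr a) = (if r = c then (\<Sum>k<n. E k k a) else 0)"
      using derY_trace[OF a] by simp
  qed
  have "Phi v (mk E) = V"
  proof (rule extensionalityI[of _ "arcs (Q v)"])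
    fix q assume q: "q \<in> arcs (Q v)"
    have "coo (mk E) (head (Q v) q) (tail (Q v) q) (gen (fst q)) = E (head (Q v) q) (tail (Q v) q) (gen (fst q))"
      by (rule coo_mk) (use Q_range[OF v q] in auto)
    also have "\<dots> = x q" using q by (auto simp: Q_sel E_def gen_def)
    finally have "Phi v (mk E) q = mat 1 1 (\<lambda>_. x q)" using q by (simp add: Phi_def)
    also have "\<dots> = V q" using V q by (intro eq_matI) (auto simp: x_def quiver_reps_sel PiE_iff)
    finally show "Phi v (mk E) q = V q" .
  qed (use V in \<open>auto simp: Phi_def quiver_reps_sel PiE_iff\<close>)
  then show ?thesis using mk_tangent[OF E] by blast
qed

lemma finite_arcs: "finite (arcs (Q v))"
  by (simp add: Q_sel)

lemma
  assumes v: "v < n"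
  shows Psi_exists: "\<exists>\<Psi>\<in>LinearCombinations.module_hom class_ring (ext_tr R tr n \<phi>) (quiver_reps (Q v) (\<lambda>_. 1)).
      bij_betw \<Psi> (carrier (ext_tr R tr n \<phi>)) (carrier (quiver_reps (Q v) (\<lambda>_. 1))) \<and>
      (\<forall>D\<in>carrier T. \<Psi> (orbit_tangent R n \<phi> +>\<^bsub>T\<^esub> D) = Phi v D)"
    and ext_dim: "vectorspace.dim class_ring (ext_tr R tr n \<phi>) = 2 * n + 1"
proof -
  have \<Phi>: "Phi v \<in> carrier T \<rightarrow> carrier (quiver_reps (Q v) (\<lambda>_. 1))"
    by (auto simp: Phi_def quiver_reps_sel)
  have add: "Phi v (D \<oplus>\<^bsub>T\<^esub> D') = Phi v D \<oplus>\<^bsub>quiver_reps (Q v) (\<lambda>_. 1)\<^esub> Phi v D'"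
    if D: "D \<in> carrier T" "D' \<in> carrier T" for D D'
    unfolding T_add[OF D] Phi_def quiver_reps_sel
    by (intro restrict_ext eq_matI) (use Q_range[OF v] in \<open>auto simp: coo_mk\<close>)
  have smult: "Phi v (c \<odot>\<^bsub>T\<^esub> D) = c \<odot>\<^bsub>quiver_reps (Q v) (\<lambda>_. 1)\<^esub> Phi v D"
    if D: "D \<in> carrier T" for c D
    unfolding T_smult[OF D] Phi_def quiver_reps_sel
    by (intro restrict_ext eq_matI) (use Q_range[OF v] in \<open>auto simp: coo_mk\<close>)
  show "\<exists>\<Psi>\<in>LinearCombinations.module_hom class_ring (ext_tr R tr n \<phi>) (quiver_reps (Q v) (\<lambda>_. 1)).
      bij_betw \<Psi> (carrier (ext_tr R tr n \<phi>)) (carrier (quiver_reps (Q v) (\<lambda>_. 1))) \<and>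
      (\<forall>D\<in>carrier T. \<Psi> (orbit_tangent R n \<phi> +>\<^bsub>T\<^esub> D) = Phi v D)"
    unfolding ext_tr_def
    by (rule quotient_space_iso(2)[OF tangent_vectorspace quiver_reps_dim(1)[OF finite_arcs] \<Phi>];
        (rule add smult Phi_surj[OF v] orbit_kernel[OF v]; assumption)?)
  have "vectorspace.dim class_ring (ext_tr R tr n \<phi>) = vectorspace.dim class_ring (quiver_reps (Q v) (\<lambda>_. 1))"
    unfolding ext_tr_def
    by (rule quotient_space_iso(3)[OF tangent_vectorspace quiver_reps_dim(1)[OF finite_arcs] \<Phi> _ _ _ _
          quiver_reps_dim(2)[OF finite_arcs]];
        (rule add smult Phi_surj[OF v] orbit_kernel[OF v]; assumption)?)
  then show "vectorspace.dim class_ring (ext_tr R tr n \<phi>) = 2 * n + 1"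
    using quiver_reps_dim(3)[OF finite_arcs, of v] step_quiver_card[of "nat s" n v] by simp
qed

text \<open>In the eigenbasis the stabiliser is a torus, which multiplies the entry
  \<open>(r, c)\<close> by \<open>h r\<close> times the inverse of \<open>h c\<close>: the action on
  an arrow from \<open>c\<close> to \<open>r\<close>.\<close>

lemma Phi_equivariant:
  assumes v: "v < n" and D: "D \<in> carrier T"
    and h: "\<And>i. i < n \<Longrightarrow> h i \<in> carrier_mat 1 1" "\<And>i. i < n \<Longrightarrow> h' i \<in> carrier_mat 1 1"
      "\<And>i. i < n \<Longrightarrow> h i * h' i = 1\<^sub>m 1"
  defines "D' \<equiv> \<lambda>a\<in>carrier R. stab_elem n (\<lambda>_. 1) g g' h * D a * stab_elem n (\<lambda>_. 1) g g' h'"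
  shows "D' \<in> carrier T"
    and "Phi v D' = (\<lambda>q\<in>arcs (Q v). h (head (Q v) q) * Phi v D q * h' (tail (Q v) q))"
proof -
  define x where "x i = h i $$ (0, 0)" for i
  define x' where "x' i = h' i $$ (0, 0)" for i
  have xx': "x i * x' i = 1" if "i < n" for i
    using arg_cong[OF h(3)[OF that], of "\<lambda>M. M $$ (0, 0)"] mult_mat_dim1[OF h(1)[OF that] h(2)[OF that]]
    by (simp add: x_def x'_def)
  let ?diag = "\<lambda>f. mat n n (\<lambda>(r, c). if r = c then f r else (0 :: complex))"
  have stab: "stab_elem n (\<lambda>_. 1) g g' h = g * ?diag x * g'" "stab_elem n (\<lambda>_. 1) g g' h' = g * ?diag x' * g'"
  proof -
    have "map (\<lambda>i. kron (h i) (1\<^sub>m 1)) [0..<n] = map h [0..<n]" "map (\<lambda>i. kron (h' i) (1\<^sub>m 1)) [0..<n] = map h' [0..<n]"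
      using h kron_dim1 by auto
    moreover have "diag_block_mat (map h [0..<n]) = ?diag x" "diag_block_mat (map h' [0..<n]) = ?diag x'"
      using diag_block_dim1[of n h] diag_block_dim1[of n h'] h by (auto simp: x_def x'_def)
    ultimately show "stab_elem n (\<lambda>_. 1) g g' h = g * ?diag x * g'" "stab_elem n (\<lambda>_. 1) g g' h' = g * ?diag x' * g'"
      unfolding stab_elem_def by (simp_all only:)
  qed
  let ?E = "\<lambda>r c a. x r * x' c * coo D r c a"
  have D'_eq: "D' = mk ?E" unfolding D'_def mk_def
  proof (intro restrict_ext)
    fix a assume a: "a \<in> carrier R"
    define N where "N = mat n n (\<lambda>(r, c). coo D r c a)"
    have N: "N \<in> carrier_mat n n" by (simp add: N_def)
    have Da: "D a = g * N * g'" using fun_cong[OF tangent_coo(2)[OF D], of a] a by (simp add: mk_def N_def)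
    have d: "?diag f \<in> carrier_mat n n" for f by simp
    have 1: "(g * ?diag x * g') * (g * N * g') = g * (?diag x * N) * g'" by (rule mult_conj[OF d N])
    have 2: "g * (?diag x * N) * g' * (g * ?diag x' * g') = g * (?diag x * N * ?diag x') * g'"
      by (rule mult_conj[OF mult_carrier_mat[OF d N] d])
    have 3: "?diag x * N * ?diag x' = mat n n (\<lambda>(r, c). ?E r c a)"
    proof (rule eq_matI)
      fix r c assume "r < dim_row (mat n n (\<lambda>(r, c). ?E r c a))" "c < dim_col (mat n n (\<lambda>(r, c). ?E r c a))"
      then have rc: "r < n" "c < n" by auto
      have "(?diag x * N * ?diag x') $$ (r, c) = (?diag x * N) $$ (r, c) * x' c"
        by (rule diag_mult_index(2)[OF mult_carrier_mat[OF d N] rc])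
      also have "(?diag x * N) $$ (r, c) = x r * N $$ (r, c)" by (rule diag_mult_index(1)[OF N rc])
      finally show "(?diag x * N * ?diag x') $$ (r, c) = mat n n (\<lambda>(r, c). ?E r c a) $$ (r, c)"
        using rc by (simp add: N_def)
    qed auto
    show "stab_elem n (\<lambda>_. 1) g g' h * D a * stab_elem n (\<lambda>_. 1) g g' h' = g * mat n n (\<lambda>(r, c). ?E r c a) * g'"
      unfolding stab Da 1 2 3 ..
  qed
  have E: "is_entry_der (coo D)" by (rule tangent_coo[OF D])
  have "is_entry_der ?E" unfolding is_entry_der_def
  proof (intro conjI allI impI ballI)
    show "point_der (lam r) (lam c) (?E r c)" if "r < n" "c < n" for r c
      using E that by (intro point_der_cmult) (simp add: is_entry_der_def)
    fix a r c assume a: "a \<in> carrier R" and rc: "r < n" "c < n"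
    \<comment> \<open>Diagonal entries are fixed by the torus, so the trace condition
      persists.\<close>
    have "(\<Sum>k<n. ?E k k a) = (\<Sum>k<n. coo D k k a)" by (rule sum.cong) (auto simp: xx')
    then show "?E r c (tr a) = (if r = c then (\<Sum>k<n. ?E k k a) else 0)"
      using E a rc xx'[OF rc(1)] by (auto simp: is_entry_der_def)
  qed
  then show "D' \<in> carrier T" unfolding D'_eq by (rule mk_tangent)
  show "Phi v D' = (\<lambda>q\<in>arcs (Q v). h (head (Q v) q) * Phi v D q * h' (tail (Q v) q))"
    unfolding Phi_def D'_eq
  proof (intro restrict_ext)
    fix q assume q: "q \<in> arcs (Q v)"
    let ?r = "head (Q v) q" and ?c = "tail (Q v) q"
    have rc: "?r < n" "?c < n" using Q_range[OF v q] by auto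
    have "mat 1 1 (\<lambda>_. coo (mk ?E) ?r ?c (gen (fst q))) = mat 1 1 (\<lambda>_. x ?r * coo D ?r ?c (gen (fst q)) * x' ?c)"
      using coo_mk[OF gen_closed rc] by (simp add: ac_simps)
    also have "\<dots> = h ?r * mat 1 1 (\<lambda>_. coo D ?r ?c (gen (fst q))) * h' ?c"
    proof -
      have "h ?r * mat 1 1 (\<lambda>_. coo D ?r ?c (gen (fst q))) = mat 1 1 (\<lambda>_. x ?r * coo D ?r ?c (gen (fst q)))"
        using mult_mat_dim1[OF h(1)[OF rc(1)], of "mat 1 1 (\<lambda>_. coo D ?r ?c (gen (fst q)))"] by (simp add: x_def)
      then show ?thesis
        using mult_mat_dim1[OF _ h(2)[OF rc(2)], of "mat 1 1 (\<lambda>_. x ?r * coo D ?r ?c (gen (fst q)))"] by (simp add: x'_def)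
    qed
    finally show "mat 1 1 (\<lambda>_. coo (mk ?E) ?r ?c (gen (fst q))) =
      h ?r * (\<lambda>q\<in>arcs (Q v). mat 1 1 (\<lambda>_. coo D (head (Q v) q) (tail (Q v) q) (gen (fst q)))) q * h' ?c"
      using q by simp
  qed
qed

lemma fin_digraph_Q: "v < n \<Longrightarrow> fin_digraph (Q v)"
  by unfold_locales (auto simp: step_quiver_def)

lemma local_quiver:
  assumes v: "v < n"
  shows "local_quiver_setting R tr n \<phi> (Q v) (\<lambda>_. 1)"
proof -
  obtain \<Psi> where \<Psi>: "\<Psi> \<in> LinearCombinations.module_hom class_ring (ext_tr R tr n \<phi>) (quiver_reps (Q v) (\<lambda>_. 1))"
      "bij_betw \<Psi> (carrier (ext_tr R tr n \<phi>)) (carrier (quiver_reps (Q v) (\<lambda>_. 1)))"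
    and \<Psi>\<Phi>: "\<And>D. D \<in> carrier T \<Longrightarrow> \<Psi> (orbit_tangent R n \<phi> +>\<^bsub>T\<^esub> D) = Phi v D"
    using Psi_exists[OF v] by blast
  have iso: "isotypic R n \<phi> n (\<lambda>_. 1) (\<lambda>_. 1) (\<lambda>i. char_rep (\<mu> * \<alpha> ^ i)) g g'"
    by (rule isotypic_diagonal[OF rep \<mu>_nz g g' gg' g'g \<phi>_eq])
  have verts: "verts (Q v) = {..<n}" by (simp add: step_quiver_def)
  show ?thesis unfolding local_quiver_setting_def
  proof (intro conjI exI bexI[OF _ \<Psi>(1)] allI impI ballI)
    show "fin_digraph (Q v)" by (rule fin_digraph_Q[OF v])
    show "verts (Q v) = {..<n}" by fact
    show "isotypic R n \<phi> n (\<lambda>_. 1) (\<lambda>_. 1) (\<lambda>i. char_rep (\<mu> * \<alpha> ^ i)) g g'" by fact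
    show "bij_betw \<Psi> (carrier (ext_tr R tr n \<phi>)) (carrier (quiver_reps (Q v) (\<lambda>_. 1)))" by fact
    fix h h' :: "nat \<Rightarrow> complex mat" and D
    assume hh: "\<forall>i<n. {h i, h' i} \<subseteq> carrier_mat 1 1 \<and> h i * h' i = 1\<^sub>m 1 \<and> h' i * h i = 1\<^sub>m 1"
      and D: "D \<in> carrier T"
    have h: "\<And>i. i < n \<Longrightarrow> h i \<in> carrier_mat 1 1" "\<And>i. i < n \<Longrightarrow> h' i \<in> carrier_mat 1 1"
      "\<And>i. i < n \<Longrightarrow> h i * h' i = 1\<^sub>m 1" using hh by auto
    note eq = Phi_equivariant[OF v D h]
    show "\<Psi> (orbit_tangent R n \<phi> +>\<^bsub>T\<^esub> (\<lambda>a\<in>carrier R. stab_elem n (\<lambda>_. 1) g g' h * D a * stab_elem n (\<lambda>_. 1) g g' h')) =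
      (\<lambda>a\<in>arcs (Q v). h (head (Q v) a) * \<Psi> (orbit_tangent R n \<phi> +>\<^bsub>T\<^esub> D) a * h' (tail (Q v) a))"
      using \<Psi>\<Phi>[OF eq(1)] eq(2) \<Psi>\<Phi>[OF D] by simp
  qed
qed

end

context quantum_space
begin

lemma local_structure:
  assumes trep: "\<phi> \<in> trep R tr n id" and ss: "semisimple_rep R n \<phi>"
    and W0: "\<phi> (W [^]\<^bsub>R\<^esub> n) = 0 \<cdot>\<^sub>m 1\<^sub>m n" and U0: "\<phi> (U [^]\<^bsub>R\<^esub> n) = 0 \<cdot>\<^sub>m 1\<^sub>m n"
    and Y\<beta>: "\<phi> (Y [^]\<^bsub>R\<^esub> n) = \<beta> \<cdot>\<^sub>m 1\<^sub>m n" and \<beta>: "\<beta> \<noteq> 0"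
  shows "v < n \<Longrightarrow> local_quiver_setting R tr n \<phi> (step_quiver (nat s) n v) (\<lambda>_. 1)"
    and "defect R tr n \<phi> = int n - 1"
proof -
  obtain g g' \<mu> where g: "g \<in> carrier_mat n n" "g' \<in> carrier_mat n n" "g * g' = 1\<^sub>m n" "g' * g = 1\<^sub>m n"
    and \<mu>: "\<mu> ^ n = \<beta>" and eq: "\<And>a. a \<in> carrier R \<Longrightarrow> \<phi> a = g * Dg \<mu> a * g'"
    using diagonal_form[OF assms] by blast
  have "\<mu> \<noteq> 0" using \<mu> \<beta> n3 by (auto simp: zero_power)
  then interpret diagonal_point \<alpha> s R \<kappa> n tr \<phi> g g' \<mu>
    by unfold_locales (use trep g eq in auto)
  show "local_quiver_setting R tr n \<phi> (step_quiver (nat s) n v) (\<lambda>_. 1)" if "v < n"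
    by (rule local_quiver[OF that])
  \<comment> \<open>The arithmetic is \<open>(2n + 1) + (n^2 - n) - (n^2 + 2)\<close>.\<close>
  show "defect R tr n \<phi> = int n - 1"
    unfolding defect_def mult_square_sum_eq[OF assms] ext_dim[OF n_pos] by simp
qed

text \<open>All semisimple representations over such a point have the same defect, which gives
  uniqueness; the given \<phi> supplies existence.\<close>

lemma defect_at_eq:
  assumes trep: "\<phi> \<in> trep R tr n id" and ss: "semisimple_rep R n \<phi>" and over: "lies_over R n \<phi> p"
    and p: "p (W [^]\<^bsub>R\<^esub> n) = 0" "p (U [^]\<^bsub>R\<^esub> n) = 0" "p (Y [^]\<^bsub>R\<^esub> n) \<noteq> 0"
  shows "defect_at R tr n p = int n - 1"
proof -
  have val: "defect R tr n \<phi>' = int n - 1"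
    if "\<phi>' \<in> trep R tr n id" "semisimple_rep R n \<phi>'" "lies_over R n \<phi>' p" for \<phi>'
    by (rule local_structure(2)[OF that(1,2) _ _ _ p(3)]) (use that(3) p in \<open>auto simp: lies_over_def\<close>)
  show ?thesis unfolding defect_at_def
  proof (rule the_equality)
    show "\<exists>\<phi>\<in>trep R tr n id. semisimple_rep R n \<phi> \<and> lies_over R n \<phi> p \<and> int n - 1 = defect R tr n \<phi>"
      using trep ss over val[OF trep ss over] by (intro bexI[of _ \<phi>]) auto
  qed (use val in blast)
qed

end

section \<open>Normal forms in the quantum polynomial algebra\<close>

lemma ring_free_algebra: "ring (free_algebra :: (complex, 'g free_monoid \<Rightarrow>\<^sub>0 complex) module)"
proof (rule ringI)
  show "abelian_group (free_algebra :: (complex, 'g free_monoid \<Rightarrow>\<^sub>0 complex) module)"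
  proof (rule abelian_groupI)
    fix x :: "'g free_monoid \<Rightarrow>\<^sub>0 complex"
    show "\<exists>y\<in>carrier free_algebra. y \<oplus>\<^bsub>free_algebra\<^esub> x = \<zero>\<^bsub>free_algebra\<^esub>"
      by (intro bexI[of _ "- x"]) (simp_all add: free_algebra_def)
  qed (simp_all add: free_algebra_def add.assoc add.commute)
  show "Group.monoid (free_algebra :: (complex, 'g free_monoid \<Rightarrow>\<^sub>0 complex) module)"
    by (rule monoidI) (simp_all add: free_algebra_def mult.assoc)
qed (simp_all add: free_algebra_def distrib_left distrib_right)

lemma free_algebra_sel [simp]:
  "carrier free_algebra = UNIV" "f \<oplus>\<^bsub>free_algebra\<^esub> g = f + g" "f \<otimes>\<^bsub>free_algebra\<^esub> g = f * g"
  "\<zero>\<^bsub>free_algebra\<^esub> = 0" "\<one>\<^bsub>free_algebra\<^esub> = 1" "c \<odot>\<^bsub>free_algebra\<^esub> f = scal c f"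
  by (simp_all add: free_algebra_def sgl_0_mult)

lemma free_algebra_ideal_iff:
  fixes I :: "('g free_monoid \<Rightarrow>\<^sub>0 complex) set"
  shows "ideal I free_algebra \<longleftrightarrow> 0 \<in> I \<and> (\<forall>f\<in>I. \<forall>g\<in>I. f + g \<in> I) \<and> (\<forall>f\<in>I. \<forall>h. h * f \<in> I \<and> f * h \<in> I)"
proof
  assume "ideal I free_algebra"
  then interpret ideal I free_algebra .
  show "0 \<in> I \<and> (\<forall>f\<in>I. \<forall>g\<in>I. f + g \<in> I) \<and> (\<forall>f\<in>I. \<forall>h. h * f \<in> I \<and> f * h \<in> I)"
    using additive_subgroup.zero_closed[OF additive_subgroup_axioms]
      additive_subgroup.a_closed[OF additive_subgroup_axioms] I_l_closed I_r_closed by auto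
next
  assume h: "0 \<in> I \<and> (\<forall>f\<in>I. \<forall>g\<in>I. f + g \<in> I) \<and> (\<forall>f\<in>I. \<forall>h. h * f \<in> I \<and> f * h \<in> I)"
  interpret ring "free_algebra :: (complex, 'g free_monoid \<Rightarrow>\<^sub>0 complex) module" by (rule ring_free_algebra)
  have inv: "\<ominus>\<^bsub>free_algebra\<^esub> f = - f" for f :: "'g free_monoid \<Rightarrow>\<^sub>0 complex"
    by (rule minus_equality) auto
  show "ideal I free_algebra"
  proof (rule idealI[OF ring_free_algebra])
    show "subgroup I (add_monoid free_algebra)"
    proof (rule subgroup.intro)
      fix f assume f: "f \<in> I"
      have "- 1 * f \<in> I" using h f by blast
      then show "inv\<^bsub>add_monoid free_algebra\<^esub> f \<in> I" using inv[of f] by (simp add: a_inv_def)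
    qed (use h in auto)
  qed (use h in auto)
qed

lemma scal_mult_left: "scal c f * g = scal c (f * g)" for f :: "'g free_monoid \<Rightarrow>\<^sub>0 complex"
  by (simp add: sgl_0_mult[symmetric] mult.assoc)

lemma sgl_0_comm: "f * sgl 0 c = scal c f" for f :: "'g free_monoid \<Rightarrow>\<^sub>0 complex"
  by (induction f rule: poly_mapping_additive_induct)
    (simp_all add: distrib_right scal_add mult_single mult.commute)

lemma scal_mult_right: "f * scal c g = scal c (f * g)" for f :: "'g free_monoid \<Rightarrow>\<^sub>0 complex"
  by (metis mult.assoc sgl_0_comm sgl_0_mult)

lemma scal_minus: "scal (- 1) f = - f"
  by (rule poly_mapping_eqI) simp

section \<open>Congruence modulo the defining relations\<close>

context
  fixes \<rho> :: complex
begin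

lemma q_ideal_ideal: "ideal (q_ideal \<rho>) free_algebra"
  unfolding q_ideal_def by (rule ring.genideal_ideal[OF ring_free_algebra]) simp

lemma q_ideal_closed:
  "0 \<in> q_ideal \<rho>" "f \<in> q_ideal \<rho> \<Longrightarrow> g \<in> q_ideal \<rho> \<Longrightarrow> f + g \<in> q_ideal \<rho>"
  "f \<in> q_ideal \<rho> \<Longrightarrow> h * f \<in> q_ideal \<rho>" "f \<in> q_ideal \<rho> \<Longrightarrow> f * h \<in> q_ideal \<rho>"
  "f \<in> q_ideal \<rho> \<Longrightarrow> scal c f \<in> q_ideal \<rho>"
  using q_ideal_ideal unfolding free_algebra_ideal_iff by (auto simp: sgl_0_mult[symmetric])

definition qcong :: "(gen free_monoid \<Rightarrow>\<^sub>0 complex) \<Rightarrow> (gen free_monoid \<Rightarrow>\<^sub>0 complex) \<Rightarrow> bool" (infix \<open>\<approx>\<close> 50) where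
  "f \<approx> g \<longleftrightarrow> f - g \<in> q_ideal \<rho>"

lemma qcong_refl [simp]: "f \<approx> f"
  by (simp add: qcong_def q_ideal_closed)

lemma qcong_sym: "f \<approx> g \<Longrightarrow> g \<approx> f"
  using q_ideal_closed(5)[of "f - g" "- 1"] by (simp add: qcong_def scal_minus)

lemma qcong_trans [trans]: "f \<approx> g \<Longrightarrow> g \<approx> h \<Longrightarrow> f \<approx> h"
  using q_ideal_closed(2)[of "f - g" "g - h"] by (simp add: qcong_def)

lemma qcong_add: "f \<approx> g \<Longrightarrow> f' \<approx> g' \<Longrightarrow> f + f' \<approx> g + g'"
  using q_ideal_closed(2)[of "f - g" "f' - g'"] by (simp add: qcong_def algebra_simps)

lemma qcong_scal: "f \<approx> g \<Longrightarrow> scal c f \<approx> scal c g"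
  using q_ideal_closed(3)[of "f - g" "sgl 0 c"] by (simp add: qcong_def right_diff_distrib sgl_0_mult)

lemma qcong_mult_left: "f \<approx> g \<Longrightarrow> h * f \<approx> h * g"
  using q_ideal_closed(3)[of "f - g" h] by (simp add: qcong_def algebra_simps)

lemma qcong_mult_right: "f \<approx> g \<Longrightarrow> f * h \<approx> g * h"
  using q_ideal_closed(4)[of "f - g" h] by (simp add: qcong_def algebra_simps)

lemma qcong_commute_pow:
  assumes "a * b \<approx> scal c (b * a)"
  shows "a * b ^ i \<approx> scal (c ^ i) (b ^ i * a)"
proof (induction i)
  case (Suc i)
  have "a * b ^ Suc i = (a * b) * b ^ i" by (simp add: mult.assoc)
  also have "\<dots> \<approx> scal c (b * a) * b ^ i" by (rule qcong_mult_right[OF assms])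
  also have "scal c (b * a) * b ^ i = scal c (b * (a * b ^ i))" by (simp add: scal_mult_left mult.assoc)
  also have "\<dots> \<approx> scal c (b * scal (c ^ i) (b ^ i * a))" by (intro qcong_scal qcong_mult_left Suc)
  also have "\<dots> = scal (c ^ Suc i) (b ^ Suc i * a)" by (simp add: scal_mult_right mult.assoc)
  finally show ?case .
qed simp

lemma qcong_swap:
  assumes "f \<approx> scal c g" "c \<noteq> 0"
  shows "g \<approx> scal (1 / c) f"
  using qcong_scal[OF qcong_sym[OF assms(1)], of "1 / c"] assms(2) by simp

lemma q_relations_cong:
  "fvar gx * fvar gy \<approx> scal \<rho> (fvar gy * fvar gx)"
  "fvar gy * fvar gz \<approx> scal \<rho> (fvar gz * fvar gy)"
  "fvar gz * fvar gx \<approx> scal \<rho> (fvar gx * fvar gz)"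
proof -
  have "q_relations \<rho> \<subseteq> q_ideal \<rho>"
    unfolding q_ideal_def by (rule ring.genideal_self[OF ring_free_algebra]) simp
  then show "fvar gx * fvar gy \<approx> scal \<rho> (fvar gy * fvar gx)"
    "fvar gy * fvar gz \<approx> scal \<rho> (fvar gz * fvar gy)"
    "fvar gz * fvar gx \<approx> scal \<rho> (fvar gx * fvar gz)"
    by (auto simp: qcong_def q_relations_def)
qed

definition cls :: "(gen free_monoid \<Rightarrow>\<^sub>0 complex) \<Rightarrow> qpoly" where
  "cls f = q_ideal \<rho> +>\<^bsub>free_algebra\<^esub> f"

lemma mem_cls_iff: "g \<in> cls f \<longleftrightarrow> g \<approx> f"
proof
  assume "g \<approx> f"
  then have "g - f \<in> q_ideal \<rho>" "g = (g - f) + f" by (simp_all add: qcong_def)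
  then show "g \<in> cls f" unfolding cls_def a_r_coset_def' free_algebra_sel by blast
qed (auto simp: cls_def a_r_coset_def' qcong_def)

lemma cls_eq_iff: "cls f = cls g \<longleftrightarrow> f \<approx> g"
proof
  assume "cls f = cls g"
  then show "f \<approx> g" using mem_cls_iff[of f f] by (simp add: mem_cls_iff)
next
  assume "f \<approx> g"
  then have "h \<approx> f \<longleftrightarrow> h \<approx> g" for h using qcong_trans qcong_sym by metis
  then show "cls f = cls g" by (simp add: set_eq_iff mem_cls_iff)
qed

lemma q_alg_sel:
  "carrier (q_alg \<rho>) = range cls"
  "cls f \<oplus>\<^bsub>q_alg \<rho>\<^esub> cls g = cls (f + g)" "cls f \<otimes>\<^bsub>q_alg \<rho>\<^esub> cls g = cls (f * g)"
  "\<zero>\<^bsub>q_alg \<rho>\<^esub> = cls 0" "\<one>\<^bsub>q_alg \<rho>\<^esub> = cls 1" "c \<odot>\<^bsub>q_alg \<rho>\<^esub> cls f = cls (scal c f)"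
proof -
  interpret ideal "q_ideal \<rho>" "free_algebra :: (complex, gen free_monoid \<Rightarrow>\<^sub>0 complex) module" by (rule q_ideal_ideal)
  show "carrier (q_alg \<rho>) = range cls"
    by (auto simp: q_alg_def quotient_by_def ring.defs FactRing_def A_RCOSETS_def' cls_def)
  show "cls f \<oplus>\<^bsub>q_alg \<rho>\<^esub> cls g = cls (f + g)"
    using a_rcos_sum[of f g] by (simp add: q_alg_def quotient_by_def ring.defs FactRing_def cls_def)
  show "cls f \<otimes>\<^bsub>q_alg \<rho>\<^esub> cls g = cls (f * g)"
    using rcoset_mult_add[of f g] by (simp add: q_alg_def quotient_by_def ring.defs FactRing_def cls_def)
  have "cls 0 = q_ideal \<rho>" by (auto simp: mem_cls_iff qcong_def)
  then show "\<zero>\<^bsub>q_alg \<rho>\<^esub> = cls 0" by (simp add: q_alg_def quotient_by_def ring.defs FactRing_def)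
  show "\<one>\<^bsub>q_alg \<rho>\<^esub> = cls 1" by (simp add: q_alg_def quotient_by_def ring.defs FactRing_def cls_def)
  have "c \<odot>\<^bsub>q_alg \<rho>\<^esub> cls f = (\<Union>a\<in>cls f. cls (scal c a))"
    by (simp add: q_alg_def quotient_by_def ring.defs module.defs cls_def)
  also have "\<dots> = (\<Union>a\<in>cls f. cls (scal c f))"
    by (intro SUP_cong refl) (simp add: mem_cls_iff cls_eq_iff qcong_scal)
  also have "\<dots> = cls (scal c f)" using mem_cls_iff[of f f] by auto
  finally show "c \<odot>\<^bsub>q_alg \<rho>\<^esub> cls f = cls (scal c f)" .
qed

end

text \<open>
  The roles of \<open>x\<close> and \<open>z\<close> can be exchanged: in the monomial basis \<open>w\<^sup>iy\<^sup>ju\<^sup>k\<close>, the pair \<open>(w, u)\<close> is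
  \<open>(x, z)\<close> or \<open>(z, x)\<close>, and correspondingly \<open>\<alpha>\<close> is \<open>1/\<rho>\<close> or \<open>\<rho>\<close>.
\<close>

locale pbw =
  fixes \<rho> \<alpha> :: complex and gw gu :: gen
  assumes rho_nz: "\<rho> \<noteq> 0"
    and orient: "gw = gx \<and> gu = gz \<and> \<alpha> = 1 / \<rho> \<or> gw = gz \<and> gu = gx \<and> \<alpha> = \<rho>"
begin

abbreviation qc (infix \<open>\<approx>\<close> 50) where "f \<approx> g \<equiv> qcong \<rho> f g"

lemma alpha_nz [simp]: "\<alpha> \<noteq> 0" using orient rho_nz by auto

lemma gw_gu [simp]: "gw \<noteq> gu" "gw \<noteq> gy" "gu \<noteq> gy" "gy \<noteq> gw" "gy \<noteq> gu" "gu \<noteq> gw"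
  using orient by auto

sublocale bicharacter "bich \<alpha> 1" by (rule bicharacter_bich) simp

lemma rel_yw: "fvar gy * fvar gw \<approx> scal \<alpha> (fvar gw * fvar gy)"
  using orient q_relations_cong[of \<rho>] qcong_swap[OF q_relations_cong(1) rho_nz] by auto

lemma rel_uy: "fvar gu * fvar gy \<approx> scal \<alpha> (fvar gy * fvar gu)"
  using orient q_relations_cong[of \<rho>] qcong_swap[OF q_relations_cong(2) rho_nz] by auto

lemma rel_uw: "fvar gu * fvar gw \<approx> scal (1 / \<alpha>) (fvar gw * fvar gu)"
  using orient q_relations_cong[of \<rho>] qcong_swap[OF q_relations_cong(3) rho_nz] by auto

definition expo :: "gen \<Rightarrow> tri" where
  "expo g = (if g = gw then (1, 0, 0) else if g = gy then (0, 1, 0) else (0, 0, 1))"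

primrec cnt :: "gen list \<Rightarrow> tri" where
  "cnt [] = 0"
| "cnt (g # l) = expo g + cnt l"

text \<open>The scalar produced when a word is brought to normal order, its letters being absorbed
  one at a time from the left.\<close>

primrec cf :: "gen list \<Rightarrow> complex" where
  "cf [] = 1"
| "cf (g # l) = bich \<alpha> 1 (expo g) (cnt l) * cf l"

lemma cnt_append: "cnt (l @ l') = cnt l + cnt l'"
  by (induction l) (auto simp: add.assoc)

lemma cf_append: "cf (l @ l') = cf l * cf l' * bich \<alpha> 1 (cnt l) (cnt l')"
  by (induction l) (auto simp: cnt_append chi_add_left chi_add_right)

text \<open>The algebra homomorphism from the free algebra to the twisted monoid algebra that sends
  each generator to its monomial. It separates the normal words.\<close>

definition eval_free :: "(gen free_monoid \<Rightarrow>\<^sub>0 complex) \<Rightarrow> tpoly" where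
  "eval_free f = plin (\<lambda>l. sgl (cnt (letters l)) (cf (letters l))) f"

lemma eval_free_mult: "eval_free (f * g) = tmult (bich \<alpha> 1) (eval_free f) (eval_free g)"
proof (induction f rule: poly_mapping_additive_induct)
  case (single l a)
  show ?case
  proof (induction g rule: poly_mapping_additive_induct)
    case (single l' b)
    show ?case
      by (simp add: eval_free_def mult_single plus_free_monoid_def cnt_append cf_append ac_simps)
  next
    case (add f g)
    then show ?case by (simp add: eval_free_def distrib_left tmult_add_right)
  qed
next
  case (add f g)
  then show ?case by (simp add: eval_free_def distrib_right tmult_add_left)
qed

lemma eval_free_add: "eval_free (f + g) = eval_free f + eval_free g"
  by (simp add: eval_free_def)

lemma eval_free_scal: "eval_free (scal c f) = scal c (eval_free f)"
  by (simp add: eval_free_def)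

lemma eval_free_fvar: "eval_free (fvar g) = sgl (expo g) 1"
  by (simp add: eval_free_def fvar_def)

definition nword :: "tri \<Rightarrow> gen free_monoid \<Rightarrow>\<^sub>0 complex" where
  "nword p = (case p of (i, j, k) \<Rightarrow> fvar gw ^ i * fvar gy ^ j * fvar gu ^ k)"

definition nform :: "tpoly \<Rightarrow> gen free_monoid \<Rightarrow>\<^sub>0 complex" where
  "nform h = plin nword h"

lemma eval_free_one: "eval_free 1 = 1"
  unfolding single_one[symmetric] eval_free_def plin_sgl zero_free_monoid_def by simp

lemma eval_free_pow: "expo g \<in> {(1, 0, 0), (0, 1, 0), (0, 0, 1)} \<Longrightarrow>
    eval_free (fvar g ^ i) = sgl (i * fst (expo g), i * fst (snd (expo g)), i * snd (snd (expo g))) 1"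
  by (induction i) (auto simp: eval_free_one eval_free_mult eval_free_fvar bich_eq sgl_000)

lemma eval_nword: "eval_free (nword p) = sgl p 1"
proof -
  obtain i j k where p: "p = (i, j, k)" by (cases p)
  have "expo gw = (1, 0, 0)" "expo gy = (0, 1, 0)" "expo gu = (0, 0, 1)" by (simp_all add: expo_def)
  then show ?thesis
    using eval_free_pow[of gw i] eval_free_pow[of gy j] eval_free_pow[of gu k]
    by (simp add: p nword_def eval_free_mult bich_eq)
qed

lemma eval_nform: "eval_free (nform h) = h"
  by (induction h rule: poly_mapping_additive_induct)
    (simp_all add: nform_def eval_free_scal eval_nword eval_free_add)

text \<open>The kernel of \<open>eval_free\<close> is an ideal containing the relations. This is the
  independence half of the normal form theorem.\<close>

lemma eval_free_cong: "f \<approx> g \<Longrightarrow> eval_free f = eval_free g"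
proof -
  assume fg: "f \<approx> g"
  let ?K = "{f. eval_free f = 0}"
  have minus: "eval_free (f - g) = eval_free f - eval_free g" for f g
    using eval_free_add[of "f - g" g] by (simp add: algebra_simps)
  have "ideal ?K free_algebra"
    unfolding free_algebra_ideal_iff by (auto simp: eval_free_add eval_free_mult) (simp add: eval_free_def)
  moreover have "q_relations \<rho> \<subseteq> ?K"
    using orient rho_nz
    by (auto simp: q_relations_def minus eval_free_mult eval_free_scal eval_free_fvar expo_def bich_eq
        power_int_minus)
  ultimately have "q_ideal \<rho> \<subseteq> ?K"
    unfolding q_ideal_def by (rule ring.genideal_minimal[OF ring_free_algebra])
  then show ?thesis using fg minus[of f g] by (auto simp: qcong_def)
qed

text \<open>The relations suffice to move one generator into place inside a normal word, with the
  scalar predicted by \<open>bich\<close>. By induction on words this is the spanning half of the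
  normal form theorem.\<close>

lemma gen_nword: "fvar g * nword p \<approx> scal (bich \<alpha> 1 (expo g) p) (nword (expo g + p))"
proof -
  obtain i j k where p: "p = (i, j, k)" by (cases p)
  let ?w = "fvar gw" and ?y = "fvar gy" and ?u = "fvar gu"
  consider "g = gw" | "g = gy" | "g = gu" using orient by (cases g) auto
  then show ?thesis
  proof cases
    case 1
    then show ?thesis by (simp add: p expo_def nword_def bich_eq mult.assoc)
  next
    case 2
    have "?y * (?w ^ i * ?y ^ j * ?u ^ k) = (?y * ?w ^ i) * (?y ^ j * ?u ^ k)" by (simp add: mult.assoc)
    also have "\<dots> \<approx> scal (\<alpha> ^ i) (?w ^ i * ?y) * (?y ^ j * ?u ^ k)"
      by (rule qcong_mult_right[OF qcong_commute_pow[OF rel_yw]])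
    also have "\<dots> = scal (\<alpha> ^ i) (?w ^ i * ?y ^ Suc j * ?u ^ k)" by (simp add: scal_mult_left mult.assoc)
    finally show ?thesis using 2 by (simp add: p expo_def nword_def bich_eq)
  next
    case 3
    have "?u * (?w ^ i * ?y ^ j * ?u ^ k) = (?u * ?w ^ i) * (?y ^ j * ?u ^ k)" by (simp add: mult.assoc)
    also have "\<dots> \<approx> scal ((1 / \<alpha>) ^ i) (?w ^ i * ?u) * (?y ^ j * ?u ^ k)"
      by (rule qcong_mult_right[OF qcong_commute_pow[OF rel_uw]])
    also have "\<dots> = scal ((1 / \<alpha>) ^ i) (?w ^ i * ((?u * ?y ^ j) * ?u ^ k))" by (simp add: scal_mult_left mult.assoc)
    also have "\<dots> \<approx> scal ((1 / \<alpha>) ^ i) (?w ^ i * (scal (\<alpha> ^ j) (?y ^ j * ?u) * ?u ^ k))"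
      by (intro qcong_scal qcong_mult_left qcong_mult_right qcong_commute_pow rel_uy)
    also have "\<dots> = scal ((1 / \<alpha>) ^ i * \<alpha> ^ j) (?w ^ i * ?y ^ j * ?u ^ Suc k)"
      by (simp add: scal_mult_left scal_mult_right mult.assoc)
    also have "(1 / \<alpha>) ^ i * \<alpha> ^ j = bich \<alpha> 1 (expo g) p"
      using 3 by (simp add: p expo_def bich_eq power_int_diff power_divide divide_inverse power_inverse)
    finally show ?thesis using 3 by (simp add: p expo_def nword_def)
  qed
qed

lemma word_nform: "sgl (Word l) 1 \<approx> scal (cf l) (nword (cnt l))"
proof (induction l)
  case Nil
  have "sgl (Word []) 1 = (1 :: gen free_monoid \<Rightarrow>\<^sub>0 complex)" by (metis single_one zero_free_monoid_def)
  then show ?case by (simp add: nword_def zero_prod_def)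
next
  case (Cons g l)
  have "sgl (Word (g # l)) 1 = fvar g * sgl (Word l) 1"
    by (simp add: fvar_def mult_single plus_free_monoid_def)
  also have "\<dots> \<approx> fvar g * scal (cf l) (nword (cnt l))" by (rule qcong_mult_left[OF Cons])
  also have "\<dots> = scal (cf l) (fvar g * nword (cnt l))" by (rule scal_mult_right)
  also have "\<dots> \<approx> scal (cf l) (scal (bich \<alpha> 1 (expo g) (cnt l)) (nword (expo g + cnt l)))"
    by (rule qcong_scal[OF gen_nword])
  finally show ?case by (simp add: mult.commute)
qed

lemma nform_eval: "nform (eval_free f) \<approx> f"
proof (induction f rule: poly_mapping_additive_induct)
  case (single l c)
  have "scal c (sgl l 1) \<approx> scal c (scal (cf (letters l)) (nword (cnt (letters l))))"
    using qcong_scal[OF word_nform[of "letters l"]] by simp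
  then have "scal c (scal (cf (letters l)) (nword (cnt (letters l)))) \<approx> sgl l c"
    using qcong_sym by fastforce
  then show ?case by (simp add: nform_def eval_free_def)
next
  case (add f g)
  then show ?case using qcong_add by (simp add: nform_def eval_free_def)
qed

definition qk :: "tpoly \<Rightarrow> qpoly" where
  "qk h = cls \<rho> (nform h)"

lemma cls_eq_qk: "cls \<rho> f = qk (eval_free f)"
  unfolding qk_def cls_eq_iff by (rule qcong_sym[OF nform_eval])

text \<open>Injectivity of \<open>qk\<close> comes from \<open>eval_free_cong\<close>, surjectivity
  from \<open>nform_eval\<close>.\<close>

sublocale coord_algebra "bich \<alpha> 1" "q_alg \<rho>" qk
proof
  have "qk h = qk h' \<longleftrightarrow> h = h'" for h h'
    using eval_free_cong[of "nform h" "nform h'"] by (auto simp: qk_def cls_eq_iff eval_nform)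
  moreover have "range qk = carrier (q_alg \<rho>)"
    unfolding q_alg_sel using cls_eq_qk by (auto simp: qk_def)
  ultimately show "bij_betw qk UNIV (carrier (q_alg \<rho>))" by (auto simp: bij_betw_def inj_def)
  show "qk f \<oplus>\<^bsub>q_alg \<rho>\<^esub> qk g = qk (f + g)" for f g
    by (simp add: qk_def q_alg_sel nform_def)
  show "qk f \<otimes>\<^bsub>q_alg \<rho>\<^esub> qk g = qk (tmult (bich \<alpha> 1) f g)" for f g
    using cls_eq_qk[of "nform f * nform g"] by (simp add: qk_def q_alg_sel eval_free_mult eval_nform)
  show "c \<odot>\<^bsub>q_alg \<rho>\<^esub> qk f = qk (scal c f)" for c f
    by (simp add: qk_def q_alg_sel nform_def)
  show "\<zero>\<^bsub>q_alg \<rho>\<^esub> = qk 0" by (simp add: qk_def q_alg_sel nform_def)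
  show "\<one>\<^bsub>q_alg \<rho>\<^esub> = qk 1" using cls_eq_qk[of 1] by (simp add: q_alg_sel eval_free_one)
qed

lemma q_var_qk: "q_var \<rho> gw = qk (sgl (1, 0, 0) 1)" "q_var \<rho> gy = qk (sgl (0, 1, 0) 1)"
  "q_var \<rho> gu = qk (sgl (0, 0, 1) 1)"
  using cls_eq_qk[of "fvar gw"] cls_eq_qk[of "fvar gy"] cls_eq_qk[of "fvar gu"]
  by (simp_all add: q_var_def cls_def eval_free_fvar expo_def)

lemma Cset_q_iff:
  assumes "primitive_root_of_unity n \<alpha>" "n > 0"
  shows "(i, j, k) \<in> Cset \<longleftrightarrow> int n dvd int j - int k \<and> int n dvd int i - int k"
  using bich_Cset_iff[OF assms, of i j k 1] by simp

text \<open>Subtracting \<open>k\<close> from all three exponents is a central change, so the class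
  of \<open>(i, j, k)\<close> is determined by \<open>i - k\<close> and \<open>j - k\<close> modulo
  \<open>n\<close>.\<close>

lemma frac_basis_cover:
  assumes prim: "primitive_root_of_unity n \<alpha>" and n: "n > 0"
  shows "\<exists>t<n\<^sup>2. \<exists>c\<in>Cset. p + (n, n, 0) = c + (t div n, t mod n, 0)"
proof -
  let ?u = "\<lambda>t. (t div n, t mod n, 0)"
  note C = Cset_q_iff[OF prim n]
  obtain i j k where p: "p = (i, j, k)" by (cases p)
  \<comment> \<open>Residues in \<open>{0..<n}\<close>. The shift by \<open>(n, n, 0)\<close>
    ensures that \<open>i + n - i0\<close> and \<open>j + n - j0\<close> are honest natural
    subtractions.\<close>
  define i0 where "i0 = nat ((int i - int k) mod int n)"
  define j0 where "j0 = nat ((int j - int k) mod int n)"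
  have i0: "int i0 = (int i - int k) mod int n" and j0: "int j0 = (int j - int k) mod int n"
    using n by (simp_all add: i0_def j0_def)
  have lt: "i0 < n" "j0 < n" using n by (simp_all add: i0_def j0_def nat_less_iff)
  let ?t = "i0 * n + j0"
  have "?t < n\<^sup>2"
  proof -
    have "?t < i0 * n + n" using lt by simp
    also have "\<dots> = (i0 + 1) * n" by simp
    also have "\<dots> \<le> n * n" using lt by (intro mult_le_mono1) simp
    finally show ?thesis by (simp add: power2_eq_square)
  qed
  moreover have "?u ?t = (i0, j0, 0)" using lt n by simp
  moreover have "(i + n - i0, j + n - j0, k) \<in> Cset"
  proof -
    have "int n dvd int (i + n - i0) - int k"
    proof -
      have "int (i + n - i0) - int k = (int i - int k) - (int i - int k) mod int n + int n"
        using lt i0 by (simp add: of_nat_diff)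
      then show ?thesis by (simp add: minus_mod_eq_mult_div)
    qed
    moreover have "int n dvd int (j + n - j0) - int k"
    proof -
      have "int (j + n - j0) - int k = (int j - int k) - (int j - int k) mod int n + int n"
        using lt j0 by (simp add: of_nat_diff)
      then show ?thesis by (simp add: minus_mod_eq_mult_div)
    qed
    ultimately show ?thesis by (simp add: C)
  qed
  moreover have "p + (n, n, 0) = (i + n - i0, j + n - j0, k) + (i0, j0, 0)" using lt by (simp add: p)
  ultimately show ?thesis by metis
qed

text \<open>The third exponents agree, so the residues differ by multiples of \<open>n\<close> while
  both lie in \<open>{0..<n}\<close>.\<close>

lemma frac_basis_disjoint:
  assumes prim: "primitive_root_of_unity n \<alpha>" and n: "n > 0"
    and c: "c \<in> Cset" "c' \<in> Cset" and t: "t < n\<^sup>2" "t' < n\<^sup>2"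
    and eq: "c + (t div n, t mod n, 0) = c' + (t' div n, t' mod n, 0)"
  shows "t = t'"
proof -
  note C = Cset_q_iff[OF prim n]
  obtain i j k i' j' k' where cc: "c = (i, j, k)" "c' = (i', j', k')" by (cases c; cases c')
  define a b a' b' where ab: "a = t div n" "b = t mod n" "a' = t' div n" "b' = t' mod n"
  have eqs: "i + a = i' + a'" "j + b = j' + b'" "k = k'" using eq by (simp_all add: cc ab)
  have small: "a < n" "a' < n" "b < n" "b' < n"
    using t n by (simp_all add: ab less_mult_imp_div_less power2_eq_square)
  have dv: "int n dvd int j - int k" "int n dvd int i - int k" "int n dvd int j' - int k" "int n dvd int i' - int k"
    using c eqs(3) by (simp_all add: cc C)
  have "int a - int a' = (int i' - int k) - (int i - int k)" "int b - int b' = (int j' - int k) - (int j - int k)"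
    using eqs by linarith+
  then have d: "int n dvd int a - int a'" "int n dvd int b - int b'"
    using dvd_diff[OF dv(4) dv(2)] dvd_diff[OF dv(3) dv(1)] by metis+
  have close: "x = y" if "int n dvd int x - int y" "x < n" "y < n" for x y
    using dvd_imp_le_int[of "int x - int y" "int n"] that by fastforce
  have "t div n = t' div n" "t mod n = t' mod n"
    using close[OF d(1) small(1,2)] close[OF d(2) small(3,4)] by (simp_all only: ab)
  then show ?thesis by (metis div_mult_mod_eq)
qed

text \<open>The definite description is evaluated only for \<open>A\<close>; the traces on the
  charts are induced from this one by localisation.\<close>

lemma reduced_trace_qk:
  assumes prim: "primitive_root_of_unity n \<alpha>" and n: "n > 0"
  shows "reduced_trace (q_alg \<rho>) n (qk f) = qk (scal (of_nat n) (proj_centre f))"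
proof (rule reduced_trace_kap[OF n, of "(n, n, 0)" "\<lambda>t. (t div n, t mod n, 0)"])
  show "(n, n, 0) \<in> Cset" using Cset_q_iff[OF prim n] by simp
qed (rule frac_basis_cover[OF prim n] frac_basis_disjoint[OF prim n]; assumption?)+

end

lemma supp_induct [consumes 1, case_names zero single add]:
  fixes f :: "'k \<Rightarrow>\<^sub>0 complex"
  assumes "supp f \<subseteq> S" and "P 0" and single: "\<And>p c. p \<in> S \<Longrightarrow> P (sgl p c)"
    and add: "\<And>f g. P f \<Longrightarrow> P g \<Longrightarrow> P (f + g)"
  shows "P f"
proof -
  have "P (\<Sum>p\<in>A. scal (coef f p) (sgl p 1))" if "A \<subseteq> supp f" for A
    using finite_subset[OF that finite_keys] that
  proof (induction A rule: finite_induct)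
    case (insert p A)
    then show ?case using assms(1) single[of p] add by auto
  qed (use \<open>P 0\<close> in simp)
  then have "P (plin (\<lambda>p. sgl p 1) f)" by (simp add: plin_def)
  then show ?thesis by (simp only: plin_sgl_id)
qed

lemma primitive_root_inverse:
  assumes "primitive_root_of_unity n \<alpha>"
  shows "primitive_root_of_unity n (1 / \<alpha>)"
  using assms by (auto simp: primitive_root_of_unity_def power_divide)

context quantum_space
begin

subsection \<open>The standard diagonal representation\<close>

lemma Dg_mult:
  assumes "a \<in> carrier R" "b \<in> carrier R"
  shows "Dg \<mu> (a \<otimes>\<^bsub>R\<^esub> b) = Dg \<mu> a * Dg \<mu> b"
proof (rule eq_matI)
  fix r c assume "r < dim_row (Dg \<mu> a * Dg \<mu> b)" "c < dim_col (Dg \<mu> a * Dg \<mu> b)"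
  then have rc: "r < n" "c < n" by (auto simp: Dg_def)
  have "(Dg \<mu> a * Dg \<mu> b) $$ (r, c) = ev (\<mu> * \<alpha> ^ r) a * Dg \<mu> b $$ (r, c)"
    unfolding Dg_def[of \<mu> a] by (rule diag_mult_index(1)[OF Dg_carrier rc])
  then show "Dg \<mu> (a \<otimes>\<^bsub>R\<^esub> b) $$ (r, c) = (Dg \<mu> a * Dg \<mu> b) $$ (r, c)"
    using rc assms by (simp add: Dg_def ev_mult)
qed (auto simp: Dg_def)

text \<open>Summed over the eigenvalues, a power \<open>Y^j\<close> survives exactly when it is
  central; this makes \<open>diag_rep\<close> trace preserving.\<close>

lemma ev_trace:
  assumes a: "a \<in> carrier R"
  shows "ev \<mu> (tr a) = (\<Sum>k<n. ev (\<mu> * \<alpha> ^ k) a)"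
proof -
  obtain f where f: "a = \<kappa> f" using a by (rule carrierE)
  let ?h = "\<lambda>x (i, j, k). if i = 0 \<and> k = 0 then x ^ j else (0 :: complex)"
  have "lin (?h \<mu>) (scal (of_nat n) (proj_centre f)) = (\<Sum>k<n. lin (?h (\<mu> * \<alpha> ^ k)) f)"
  proof (induction f rule: poly_mapping_additive_induct)
    case (single p c)
    obtain i j k where p: "p = (i, j, k)" by (cases p)
    show ?case
    proof (cases "i = 0 \<and> k = 0")
      case True
      have "(\<Sum>k<n. lin (?h (\<mu> * \<alpha> ^ k)) (sgl p c)) = c * (\<Sum>k<n. (\<mu> * \<alpha> ^ k) ^ j)"
        by (simp add: p True sum_distrib_left)
      then show ?thesis unfolding power_sum by (simp add: p True proj_centre_sgl Cset_iff)
    next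
      case False
      then show ?thesis by (auto simp: p proj_centre_sgl)
    qed
  next
    case (add f g)
    then show ?case by (simp add: scal_add sum.distrib)
  qed
  then show ?thesis by (simp add: f tr_kap ev_def)
qed

text \<open>The witness for the existence part of \<open>defect_at\<close> at the point of
  \<open>A\<close>.\<close>

definition diag_rep :: "complex \<Rightarrow> 'r \<Rightarrow> complex mat" where
  "diag_rep \<mu> = (\<lambda>a\<in>carrier R. Dg \<mu> a)"

lemma ev_central_shift: "c \<in> centre R \<Longrightarrow> ev (\<mu> * \<alpha> ^ k) c = ev \<mu> c"
proof (rule ev_central)
  have "(\<alpha> ^ k) ^ n = 1" by (metis \<alpha>_pow_n mult.commute power_mult power_one)
  then show "(\<mu> * \<alpha> ^ k) ^ n = \<mu> ^ n" by (simp add: power_mult_distrib)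
qed

lemma Dg_central: "c \<in> centre R \<Longrightarrow> Dg \<mu> c = ev \<mu> c \<cdot>\<^sub>m 1\<^sub>m n"
  by (rule eq_matI) (auto simp: Dg_def ev_central_shift)

lemma diag_rep_trep: "diag_rep \<mu> \<in> trep R tr n id"
proof -
  have "diag_rep \<mu> \<in> alg_reps R n id"
  proof (rule alg_repsI)
    show "diag_rep \<mu> (a \<otimes>\<^bsub>R\<^esub> b) = diag_rep \<mu> a * diag_rep \<mu> b" if "a \<in> carrier R" "b \<in> carrier R" for a b
      using that by (simp add: diag_rep_def Dg_mult)
    show "diag_rep \<mu> \<one>\<^bsub>R\<^esub> = 1\<^sub>m n" by (rule eq_matI) (auto simp: diag_rep_def Dg_def)
  qed (auto simp: diag_rep_def Dg_def ev_add ev_smult intro!: eq_matI)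
  moreover have "diag_rep \<mu> (tr a) = (\<Sum>i<n. diag_rep \<mu> a $$ (i, i)) \<cdot>\<^sub>m 1\<^sub>m n" if a: "a \<in> carrier R" for a
  proof -
    have "(\<Sum>i<n. diag_rep \<mu> a $$ (i, i)) = (\<Sum>i<n. ev (\<mu> * \<alpha> ^ i) a)"
      by (rule sum.cong) (use a in \<open>auto simp: diag_rep_def Dg_def\<close>)
    then show ?thesis
      using a by (simp add: diag_rep_def tr_closed Dg_central tr_in_centre ev_trace)
  qed
  ultimately show ?thesis by (simp add: trep_def)
qed

lemma diag_rep_semisimple:
  assumes "\<mu> \<noteq> 0"
  shows "semisimple_rep R n (diag_rep \<mu>)"
proof -
  have "diag_rep \<mu> a = 1\<^sub>m n * Dg \<mu> a * 1\<^sub>m n" if "a \<in> carrier R" for a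
    using that by (simp add: diag_rep_def left_mult_one_mat[OF Dg_carrier] right_mult_one_mat[OF Dg_carrier])
  then have "isotypic R n (diag_rep \<mu>) n (\<lambda>_. 1) (\<lambda>_. 1) (\<lambda>i. char_rep (\<mu> * \<alpha> ^ i)) (1\<^sub>m n) (1\<^sub>m n)"
    by (intro isotypic_diagonal) (use diag_rep_trep assms in \<open>auto simp: trep_def\<close>)
  then show ?thesis unfolding semisimple_rep_def by blast
qed

section \<open>Characters of the centre\<close>

definition point :: "complex \<Rightarrow> 'r \<Rightarrow> complex" where
  "point \<mu> = (\<lambda>c\<in>centre R. ev \<mu> c)"

lemma diag_rep_over: "lies_over R n (diag_rep \<mu>) (point \<mu>)"
  by (auto simp: lies_over_def diag_rep_def point_def Dg_central centre_def)

lemma centre_closed: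
  "c \<in> centre R \<Longrightarrow> d \<in> centre R \<Longrightarrow> c \<otimes>\<^bsub>R\<^esub> d \<in> centre R"
  "c \<in> centre R \<Longrightarrow> d \<in> centre R \<Longrightarrow> c \<oplus>\<^bsub>R\<^esub> d \<in> centre R"
  "c \<in> centre R \<Longrightarrow> x \<odot>\<^bsub>R\<^esub> c \<in> centre R" "\<one>\<^bsub>R\<^esub> \<in> centre R" "c \<in> centre R \<Longrightarrow> c \<in> carrier R"
  by (auto simp: centre_eq kap_mult kap_add kap_smult kap_one)

lemma point_maxZ: "point \<mu> \<in> maxZ R"
  unfolding maxZ_def
proof (intro CollectI conjI allI ballI)
  show "point \<mu> \<in> Ring.ring_hom (R\<lparr>carrier := centre R\<rparr>) class_ring"
    by (auto simp: Ring.ring_hom_def point_def centre_closed ev_mult ev_add)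
qed (auto simp: point_def centre_closed ev_smult)

lemma monomial_pow: "\<exists>d. \<kappa> (sgl (i, j, k) 1) [^]\<^bsub>R\<^esub> (m :: nat) = \<kappa> (sgl (m * i, m * j, m * k) d)"
proof (induction m)
  case (Suc m)
  then obtain d where "\<kappa> (sgl (i, j, k) 1) [^]\<^bsub>R\<^esub> m = \<kappa> (sgl (m * i, m * j, m * k) d)" by blast
  then show ?case by (auto simp: kap_mult add.commute)
qed (auto simp: kap_one intro: exI[of _ 1])

text \<open>It suffices to treat central monomials. Those without \<open>W\<close> and
  \<open>U\<close> are powers of \<open>Y^n\<close>; for the others the \<open>n\<close>-th power
  has value zero, and \<complex> has no nilpotents.\<close>

lemma maxZ_unique:
  assumes p: "p \<in> maxZ R" and vals: "p (W [^]\<^bsub>R\<^esub> n) = 0" "p (U [^]\<^bsub>R\<^esub> n) = 0" "p (Y [^]\<^bsub>R\<^esub> n) = \<mu> ^ n"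
  shows "p = point \<mu>"
proof (rule extensionalityI[of _ "centre R"])
  have hom: "p \<in> Ring.ring_hom (R\<lparr>carrier := centre R\<rparr>) class_ring"
    and smult: "\<And>c a. a \<in> centre R \<Longrightarrow> p (c \<odot>\<^bsub>R\<^esub> a) = c * p a"
    using p by (auto simp: maxZ_def)
  have mult: "p (a \<otimes>\<^bsub>R\<^esub> b) = p a * p b" and padd: "p (a \<oplus>\<^bsub>R\<^esub> b) = p a + p b"
    if "a \<in> centre R" "b \<in> centre R" for a b
    using hom that by (auto simp: Ring.ring_hom_def)
  have one: "p \<one>\<^bsub>R\<^esub> = 1" using hom by (auto simp: Ring.ring_hom_def)
  have pow_c: "a [^]\<^bsub>R\<^esub> (m :: nat) \<in> centre R" if "a \<in> centre R" for a m
    by (induction m) (auto simp: centre_closed that)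
  have pow: "p (a [^]\<^bsub>R\<^esub> (m :: nat)) = p a ^ m" if "a \<in> centre R" for a m
    by (induction m) (auto simp: one mult that pow_c)
  have mono: "p (\<kappa> (sgl q c)) = ev \<mu> (\<kappa> (sgl q c))" if q: "q \<in> Cset" for q c
  proof -
    obtain i j k where ijk: "q = (i, j, k)" by (cases q)
    let ?M = "\<kappa> (sgl (i, j, k) 1)"
    have M: "?M \<in> centre R" using q ijk by simp
    have "p ?M = ev \<mu> ?M"
    proof (cases "i = 0 \<and> k = 0")
      case True
      then have "n dvd j" using q ijk by (simp add: Cset_iff)
      then obtain m where m: "j = n * m" by (rule dvdE)
      have "?M = (Y [^]\<^bsub>R\<^esub> n) [^]\<^bsub>R\<^esub> m" using True m nat_pow_pow[OF gens_closed(2), of n m] by (simp add: Y_pow)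
      then have "p ?M = (\<mu> ^ n) ^ m" using pow[of "Y [^]\<^bsub>R\<^esub> n" m] vals(3) by simp
      then show ?thesis using True by (simp add: m ev_sgl power_mult)
    next
      case False
      obtain d where d: "?M [^]\<^bsub>R\<^esub> n = \<kappa> (sgl (n * i, n * j, n * k) d)" using monomial_pow by blast
      \<comment> \<open>The \<open>n\<close>-th power of the monomial is a scalar multiple of this
        product of powers of the three known central elements, and the product contains
        \<open>W^n\<close> or \<open>U^n\<close>.\<close>
      let ?P = "(W [^]\<^bsub>R\<^esub> n) [^]\<^bsub>R\<^esub> i \<otimes>\<^bsub>R\<^esub> (Y [^]\<^bsub>R\<^esub> n) [^]\<^bsub>R\<^esub> j \<otimes>\<^bsub>R\<^esub> (U [^]\<^bsub>R\<^esub> n) [^]\<^bsub>R\<^esub> k"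
      obtain u where u: "u \<noteq> 0" "U [^]\<^bsub>R\<^esub> (n * k) = \<kappa> (sgl (0, 0, n * k) u)" using U_pow by blast
      have "\<exists>e. e \<noteq> 0 \<and> ?P = \<kappa> (sgl (n * i, n * j, n * k) e)"
        using u by (auto simp: nat_pow_pow W_pow[of "n * i"] Y_pow[of "n * j"] kap_mult
            intro!: exI[of _ "bich \<alpha> s (n * i, 0, 0) (0, n * j, 0) * u * bich \<alpha> s (n * i, n * j, 0) (0, 0, n * k)"])
      then obtain e where e: "e \<noteq> 0" "?P = \<kappa> (sgl (n * i, n * j, n * k) e)" by blast
      have Pc: "?P \<in> centre R"
        by (intro centre_closed(1) pow_c[OF pow_in_centre(1)] pow_c[OF pow_in_centre(2)] pow_c[OF pow_in_centre(3)])
      have "p ?P = p (W [^]\<^bsub>R\<^esub> n) ^ i * p (Y [^]\<^bsub>R\<^esub> n) ^ j * p (U [^]\<^bsub>R\<^esub> n) ^ k"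
        by (simp add: mult pow pow_c centre_closed)
      then have "p ?P = 0" using False vals by (auto simp: zero_power)
      moreover have "?M [^]\<^bsub>R\<^esub> n = (d / e) \<odot>\<^bsub>R\<^esub> ?P" using e(1) by (simp add: d e(2) kap_smult)
      ultimately have "p ?M ^ n = 0" using smult[OF Pc] pow[OF M, of n] by simp
      then show ?thesis using False by (auto simp: ev_sgl)
    qed
    moreover have "\<kappa> (sgl q c) = c \<odot>\<^bsub>R\<^esub> ?M" by (simp add: ijk kap_smult)
    ultimately show ?thesis using smult[OF M] M by (simp add: ev_smult)
  qed
  fix c assume c: "c \<in> centre R"
  then obtain f where f: "c = \<kappa> f" "supp f \<subseteq> Cset" by (auto simp: centre_eq Zset_def)
  have "f \<in> Zset \<and> p (\<kappa> f) = ev \<mu> (\<kappa> f)"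
    using f(2)
  proof (induction f rule: supp_induct)
    case zero
    have "p (\<kappa> (sgl 0 0)) = ev \<mu> (\<kappa> (sgl 0 0))" by (rule mono) simp
    then show ?case by simp
  next
    case (single q c)
    then show ?case by (simp add: mono)
  next
    case (add f g)
    then show ?case using padd[of "\<kappa> f" "\<kappa> g"] ev_add[of "\<kappa> f" "\<kappa> g" \<mu>]
      by (simp add: kap_add)
  qed
  then show "p c = point \<mu> c" using c f by (simp add: point_def)
qed (use p in \<open>auto simp: maxZ_def point_def PiE_def\<close>)

end

locale qpoly = pbw \<rho> \<alpha> gw gu for \<rho> \<alpha> gw gu +
  fixes n :: nat
  assumes n_ge_3: "n \<ge> 3" and n_odd: "odd n" and rho_prim: "primitive_root_of_unity n \<rho>"
begin

lemma alpha_prim: "primitive_root_of_unity n \<alpha>"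
  using orient rho_prim primitive_root_inverse[OF rho_prim] by auto

sublocale quantum_space \<alpha> 1 "q_alg \<rho>" qk n "reduced_trace (q_alg \<rho>) n"
  by unfold_locales (use n_ge_3 n_odd alpha_prim reduced_trace_qk[OF alpha_prim] in auto)

lemma gens_eq: "W = q_var \<rho> gw" "Y = q_var \<rho> gy" "U = q_var \<rho> gu"
  by (simp_all add: W_def Y_def U_def q_var_qk)

lemma point_values:
  "point b (W [^]\<^bsub>q_alg \<rho>\<^esub> n) = 0" "point b (Y [^]\<^bsub>q_alg \<rho>\<^esub> n) = b ^ n" "point b (U [^]\<^bsub>q_alg \<rho>\<^esub> n) = 0"
proof -
  obtain u where "U [^]\<^bsub>q_alg \<rho>\<^esub> n = qk (sgl (0, 0, n) u)" using U_pow by blast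
  then show "point b (W [^]\<^bsub>q_alg \<rho>\<^esub> n) = 0" "point b (Y [^]\<^bsub>q_alg \<rho>\<^esub> n) = b ^ n" "point b (U [^]\<^bsub>q_alg \<rho>\<^esub> n) = 0"
    using pow_in_centre n_ge_3 by (auto simp: point_def W_pow Y_pow ev_sgl)
qed

text \<open>Existence is provided by the central character of \<open>diag_rep\<close>, uniqueness by
  \<open>maxZ_unique\<close>, which uses only the values at the three \<open>n\<close>-th
  powers.\<close>

lemma q_point_eq: "q_point \<rho> n 0 (b ^ n) 0 0 = point b"
  unfolding q_point_def
proof (rule the_equality)
  \<comment> \<open>Depending on the orientation the product \<open>xyz\<close> is
    \<open>WYU\<close> or \<open>UYW\<close>; both are central and have value zero.\<close>
  have xz: "q_var \<rho> gx = W \<and> q_var \<rho> gz = U \<or> q_var \<rho> gx = U \<and> q_var \<rho> gz = W"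
    using orient gens_eq by auto
  have "(1, 1, 1) \<in> Cset" by (simp add: Cset_iff)
  then have c: "W \<otimes>\<^bsub>q_alg \<rho>\<^esub> Y \<otimes>\<^bsub>q_alg \<rho>\<^esub> U \<in> centre (q_alg \<rho>)" "U \<otimes>\<^bsub>q_alg \<rho>\<^esub> Y \<otimes>\<^bsub>q_alg \<rho>\<^esub> W \<in> centre (q_alg \<rho>)"
    by (simp_all add: W_def Y_def U_def kap_mult)
  have "point b (W \<otimes>\<^bsub>q_alg \<rho>\<^esub> Y \<otimes>\<^bsub>q_alg \<rho>\<^esub> U) = 0" "point b (U \<otimes>\<^bsub>q_alg \<rho>\<^esub> Y \<otimes>\<^bsub>q_alg \<rho>\<^esub> W) = 0"
    using c by (simp_all add: point_def ev_mult)
  then show "point b \<in> maxZ (q_alg \<rho>) \<and> point b (q_var \<rho> gx [^]\<^bsub>q_alg \<rho>\<^esub> n) = 0 \<and>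
    point b (q_var \<rho> gy [^]\<^bsub>q_alg \<rho>\<^esub> n) = b ^ n \<and> point b (q_var \<rho> gz [^]\<^bsub>q_alg \<rho>\<^esub> n) = 0 \<and>
    point b (q_var \<rho> gx \<otimes>\<^bsub>q_alg \<rho>\<^esub> q_var \<rho> gy \<otimes>\<^bsub>q_alg \<rho>\<^esub> q_var \<rho> gz) = 0"
    using xz point_values point_maxZ gens_eq(2) by auto
  fix p
  assume "p \<in> maxZ (q_alg \<rho>) \<and> p (q_var \<rho> gx [^]\<^bsub>q_alg \<rho>\<^esub> n) = 0 \<and>
    p (q_var \<rho> gy [^]\<^bsub>q_alg \<rho>\<^esub> n) = b ^ n \<and> p (q_var \<rho> gz [^]\<^bsub>q_alg \<rho>\<^esub> n) = 0 \<and>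
    p (q_var \<rho> gx \<otimes>\<^bsub>q_alg \<rho>\<^esub> q_var \<rho> gy \<otimes>\<^bsub>q_alg \<rho>\<^esub> q_var \<rho> gz) = 0"
  then show "p = point b" using xz gens_eq(2) by (intro maxZ_unique) auto
qed

lemma defect_at_q_alg:
  assumes "b \<noteq> 0"
  shows "defect_at (q_alg \<rho>) (reduced_trace (q_alg \<rho>) n) n (q_point \<rho> n 0 (b ^ n) 0 0) = int n - 1"
  unfolding q_point_eq
  by (rule defect_at_eq[OF diag_rep_trep diag_rep_semisimple[OF assms] diag_rep_over])
    (use assms in \<open>auto simp: point_values\<close>)

end

section \<open>The charts of the blowup\<close>

definition wu_deg :: "tri \<Rightarrow> nat" where
  "wu_deg p = (case p of (i, j, k) \<Rightarrow> i + k)"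

text \<open>In coordinates this is the ideal power \<open>I^m\<close>, by
  \<open>ideal_power_eq\<close> below.\<close>

definition fil :: "nat \<Rightarrow> tpoly set" where
  "fil m = {f. \<forall>p\<in>supp f. m \<le> wu_deg p}"

lemma wu_deg_eq [simp]: "wu_deg (i, j, k) = i + k"
  by (simp add: wu_deg_def)

lemma fil_zero [simp]: "0 \<in> fil m" "f \<in> fil 0"
  by (simp_all add: fil_def)

lemma fil_sgl: "m \<le> wu_deg p \<Longrightarrow> sgl p c \<in> fil m"
  by (simp add: fil_def)

lemma fil_add: "f \<in> fil m \<Longrightarrow> g \<in> fil m \<Longrightarrow> f + g \<in> fil m"
  using keys_add[of f g] by (auto simp: fil_def)

lemma fil_tmult: "f \<in> fil a \<Longrightarrow> g \<in> fil b \<Longrightarrow> tmult \<chi> f g \<in> fil (a + b)"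
  using supp_tmult[of \<chi> f g] by (fastforce simp: fil_def intro: add_mono)

lemma tmult_plin_right: "tmult \<chi> h (plin b g) = plin (\<lambda>q. tmult \<chi> h (b q)) g"
  by (induction g rule: poly_mapping_additive_induct) (simp_all add: tmult_add_right tmult_scal_right)

lemma tmult_plin: "tmult \<chi> (plin a f) (plin b g) = plin (\<lambda>p. plin (\<lambda>q. tmult \<chi> (a p) (b q)) g) f"
  by (induction f rule: poly_mapping_additive_induct)
    (simp_all add: tmult_add_left tmult_scal_left tmult_plin_right plin_add_fun plin_scal_fun)

text \<open>
  An element of the chart is written in the basis \<open>w\<^bsup>i-k\<^esup>y\<^bsup>j\<^esup>u\<^bsup>k\<^esup>\<close>. It has denominator \<open>w\<^bsup>d\<^esup>\<close> if
  multiplication by \<open>w\<^bsup>d\<^esup>\<close> leaves no negative exponents, and \<open>numer\<close> is the resulting element of \<open>A\<close>.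
\<close>

definition denom :: "nat \<Rightarrow> tpoly \<Rightarrow> bool" where
  "denom d f \<longleftrightarrow> (\<forall>(i, j, k)\<in>supp f. k \<le> i + d)"

definition numer :: "nat \<Rightarrow> tpoly \<Rightarrow> tpoly" where
  "numer d = plin (\<lambda>(i, j, k). sgl (i + d - k, j, k) 1)"

text \<open>Division by \<open>w^d\<close>: the inverse of \<open>numer d\<close> on
  \<open>fil d\<close>.\<close>

definition denumer :: "nat \<Rightarrow> tpoly \<Rightarrow> tpoly" where
  "denumer d = plin (\<lambda>(i, j, k). sgl (i + k - d, j, k) 1)"

lemma numer_add: "numer d (f + g) = numer d f + numer d g"
  by (simp add: numer_def)

lemma numer_scal: "numer d (scal c f) = scal c (numer d f)"
  by (simp add: numer_def)

lemma denom_add: "denom d f \<Longrightarrow> denom d g \<Longrightarrow> denom d (f + g)"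
  using keys_add[of f g] by (auto simp: denom_def)

lemma denom_scal: "denom d f \<Longrightarrow> denom d (scal c f)"
  using supp_scal_subset[of c f] by (auto simp: denom_def)

lemma denom_mono: "denom d f \<Longrightarrow> d \<le> e \<Longrightarrow> denom e f"
  by (fastforce simp: denom_def)

lemma denom_tmult: "denom d f \<Longrightarrow> denom e g \<Longrightarrow> denom (d + e) (tmult \<chi> f g)"
  using supp_tmult[of \<chi> f g] by (fastforce simp: denom_def)

lemma ex_denom: "\<exists>d. denom d f"
proof -
  have "denom (\<Sum>p\<in>supp f. snd (snd p)) f" unfolding denom_def
  proof (safe)
    fix i j k assume "(i, j, k) \<in> supp f"
    then have "snd (snd (i, j, k)) \<le> (\<Sum>p\<in>supp f. snd (snd p))" by (intro member_le_sum) auto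
    then show "k \<le> i + (\<Sum>p\<in>supp f. snd (snd p))" by simp
  qed
  then show ?thesis ..
qed

lemma numer_fil: "denom d f \<Longrightarrow> numer d f \<in> fil d"
  using supp_plin[of "\<lambda>(i, j, k). sgl (i + d - k, j, k) 1" f]
  by (fastforce simp: fil_def numer_def denom_def)

lemma denumer_numer:
  assumes "denom d f"
  shows "denumer d (numer d f) = f"
proof -
  have "denumer d (numer d f) = plin (\<lambda>p. sgl p 1) f"
    unfolding denumer_def numer_def plin_plin
    by (rule plin_cong) (use assms in \<open>auto simp: denom_def\<close>)
  then show ?thesis by (simp add: plin_sgl_id)
qed

lemma numer_inj: "denom d f \<Longrightarrow> denom d g \<Longrightarrow> numer d f = numer d g \<Longrightarrow> f = g"
  by (metis denumer_numer)

lemma numer_denumer: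
  assumes "h \<in> fil d"
  shows "numer d (denumer d h) = h"
proof -
  have "numer d (denumer d h) = plin (\<lambda>p. sgl p 1) h"
    unfolding denumer_def numer_def plin_plin
    by (rule plin_cong) (use assms in \<open>auto simp: fil_def\<close>)
  then show ?thesis by (simp add: plin_sgl_id)
qed

lemma denom_denumer: "h \<in> fil d \<Longrightarrow> denom d (denumer d h)"
  using supp_plin[of "\<lambda>(i, j, k). sgl (i + k - d, j, k) 1" h]
  by (fastforce simp: fil_def denumer_def denom_def)

text \<open>A power of \<open>w\<close> on the left is already in normal position, so it enters
  without a twist and merely enlarges the denominator.\<close>

lemma W_numer:
  assumes "denom d f"
  shows "tmult (bich \<alpha> s) (sgl (e, 0, 0) 1) (numer d f) = numer (d + e) f"
  unfolding numer_def tmult_plin_right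
proof (rule plin_cong)
  fix p assume p: "p \<in> supp f"
  obtain i j k where ijk: "p = (i, j, k)" by (cases p)
  have "k \<le> i + d" using assms p by (auto simp: denom_def ijk)
  then have "e + (i + d - k) = i + (d + e) - k" by arith
  then show "tmult (bich \<alpha> s) (sgl (e, 0, 0) 1) (case p of (i, j, k) \<Rightarrow> sgl (i + d - k, j, k) 1) =
      (case p of (i, j, k) \<Rightarrow> sgl (i + (d + e) - k, j, k) 1)"
    by (simp add: ijk bich_eq)
qed

text \<open>This is \<open>(w^d f)(w^(nl) g) = w^(d+nl) fg\<close>, which needs
  \<open>w^(nl)\<close> to commute with \<open>f\<close>; so the right denominator is a multiple of
  \<open>n\<close>. It turns the product of \<open>A\<close> into that of the chart.\<close>

lemma numer_tmult:
  assumes \<alpha>: "\<alpha> \<noteq> 0" "\<alpha> ^ n = 1" and f: "denom d f" and g: "denom (n * l) g"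
  shows "tmult (bich \<alpha> 1) (numer d f) (numer (n * l) g) = numer (d + n * l) (tmult (bich \<alpha> 2) f g)"
proof -
  have "tmult (bich \<alpha> 1) (numer d f) (numer (n * l) g) =
    plin (\<lambda>p. plin (\<lambda>q. numer (d + n * l) (sgl (p + q) (bich \<alpha> 2 p q))) g) f"
    unfolding numer_def[of d] numer_def[of "n * l"] tmult_plin
  proof (intro plin_cong)
    fix p q assume pq: "p \<in> supp f" "q \<in> supp g"
    obtain i j k i' j' k' where ijk: "p = (i, j, k)" "q = (i', j', k')" by (cases p; cases q)
    have le: "k \<le> i + d" "k' \<le> i' + n * l" using pq f g by (auto simp: denom_def ijk)
    have exps: "i + d - k + (i' + n * l - k') = i + i' + (d + n * l) - (k + k')" using le by arith
    have one: "\<alpha> powi (int n * x) = 1" for x using \<alpha>(2) by (simp add: power_int_mult)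
    \<comment> \<open>The change of the exponent of \<alpha> caused by the right denominator is a
      multiple of \<open>n\<close>.\<close>
    have e: "(int j - int k) * int (i' + n * l - k') + int k * int j' =
        ((int j - int k) * (int i' - int k') + int k * int j') + int n * ((int j - int k) * int l)"
      using le(2) by (simp add: of_nat_diff algebra_simps)
    have "bich \<alpha> 1 (i + d - k, j, k) (i' + n * l - k', j', k') =
        \<alpha> powi ((int j - int k) * int (i' + n * l - k') + int k * int j')" by (simp add: bich_eq)
    also have "\<dots> = bich \<alpha> 2 p q"
      unfolding e using \<alpha>(1) by (simp add: power_int_add one ijk bich_eq)
    finally show "tmult (bich \<alpha> 1) (case p of (i, j, k) \<Rightarrow> sgl (i + d - k, j, k) 1)
        (case q of (i, j, k) \<Rightarrow> sgl (i + n * l - k, j, k) 1) = numer (d + n * l) (sgl (p + q) (bich \<alpha> 2 p q))"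
      using exps by (simp add: ijk numer_def)
  qed
  then show ?thesis by (simp add: tmult_def numer_def plin_plin)
qed

context qpoly
begin

abbreviation tmult1 (infixl \<open>\<star>\<close> 70) where "f \<star> g \<equiv> tmult (bich \<alpha> 1) f g"

section \<open>Powers of the ideal \<open>(x, z)\<close>\<close>

abbreviation J :: "qpoly set" where "J \<equiv> xz_ideal \<rho>"

text \<open>A factor \<open>w\<close> is taken off the front if there is one. Otherwise a factor
  \<open>u\<close> is moved to the front, at the cost of a nonzero scalar.\<close>

lemma monomial_split:
  assumes "Suc m \<le> wu_deg p"
  shows "\<exists>G\<in>{W, U}. \<exists>f\<in>fil m. qk (sgl p c) = G \<otimes>\<^bsub>q_alg \<rho>\<^esub> qk f"
proof -
  obtain i j k where p: "p = (i, j, k)" by (cases p)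
  show ?thesis
  proof (cases i)
    case 0
    then obtain k' where k: "k = Suc k'" using assms p by (cases k) auto
    have "qk (sgl p c) = U \<otimes>\<^bsub>q_alg \<rho>\<^esub> qk (sgl (0, j, k') (c / bich \<alpha> 1 (0, 0, 1) (0, j, k')))"
      by (simp add: p 0 k U_def kap_mult)
    moreover have "sgl (0, j, k') d \<in> fil m" for d using assms by (intro fil_sgl) (simp add: p 0 k)
    ultimately show ?thesis by blast
  next
    case (Suc i')
    have "qk (sgl p c) = W \<otimes>\<^bsub>q_alg \<rho>\<^esub> qk (sgl (i', j, k) c)"
      by (simp add: p Suc W_def kap_mult bich_eq)
    moreover have "sgl (i', j, k) c \<in> fil m" using assms by (intro fil_sgl) (simp add: p Suc)
    ultimately show ?thesis by blast
  qed
qed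

lemma xz_ideal_gens: "xz_ideal \<rho> = genideal (q_alg \<rho>) {W, U}"
  using orient gens_eq by (auto simp: xz_ideal_def insert_commute)

lemma fil_one_ideal: "ideal (qk ` fil 1) (q_alg \<rho>)"
proof (rule idealI[OF ring_R])
  show "subgroup (qk ` fil 1) (add_monoid (q_alg \<rho>))"
  proof (rule subgroup.intro)
    fix x assume "x \<in> qk ` fil 1"
    then obtain f where f: "x = qk f" "f \<in> fil 1" by blast
    have "\<ominus>\<^bsub>q_alg \<rho>\<^esub> qk f = qk (- f)" by (rule minus_equality) (simp_all add: kap_add kap_zero)
    moreover have "- f \<in> fil 1" using f(2) by (simp add: fil_def)
    ultimately show "inv\<^bsub>add_monoid (q_alg \<rho>)\<^esub> x \<in> qk ` fil 1" by (auto simp: f a_inv_def)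
  qed (auto simp: kap_add kap_zero fil_add)
qed (use fil_tmult[of _ 0 _ 1] fil_tmult[of _ 1 _ 0] in \<open>auto elim!: carrierE simp: kap_mult\<close>)

lemma xz_ideal_eq: "J = qk ` fil 1"
proof
  show "J \<subseteq> qk ` fil 1" unfolding xz_ideal_gens
    by (rule genideal_minimal[OF fil_one_ideal]) (auto simp: W_def U_def intro!: imageI fil_sgl)
  interpret J: ideal J "q_alg \<rho>" unfolding xz_ideal_gens by (rule genideal_ideal) auto
  have gens: "{W, U} \<subseteq> J" unfolding xz_ideal_gens by (rule genideal_self) auto
  show "qk ` fil 1 \<subseteq> J"
  proof safe
    fix f assume "f \<in> fil 1"
    then have "supp f \<subseteq> {p. Suc 0 \<le> wu_deg p}" by (auto simp: fil_def)
    then show "qk f \<in> J"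
    proof (induction f rule: supp_induct)
      case zero
      show ?case using J.zero_closed by (simp add: kap_zero)
    next
      case (single p c)
      then obtain G f where "G \<in> {W, U}" "qk (sgl p c) = G \<otimes>\<^bsub>q_alg \<rho>\<^esub> qk f"
        using monomial_split[of 0 p c] by blast
      then show ?case using gens J.I_r_closed[of G "qk f"] by auto
    next
      case (add f g)
      then show ?case using J.a_closed[of "qk f" "qk g"] by (simp add: kap_add)
    qed
  qed
qed

text \<open>Degrees in \<open>w\<close> and \<open>u\<close> add under multiplication, which bounds
  the power from above; \<open>monomial_split\<close> peels off one generator of the ideal for the
  converse.\<close>

lemma ideal_power_eq: "ideal_power (q_alg \<rho>) J m = qk ` fil m"
proof (induction m)
  case 0
  show ?case by (auto simp: carrier_eq)
next
  case (Suc m)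
  show ?case unfolding ideal_power.simps Suc
  proof
    show "ideal_prod (q_alg \<rho>) J (qk ` fil m) \<subseteq> qk ` fil (Suc m)"
    proof
      fix x assume "x \<in> ideal_prod (q_alg \<rho>) J (qk ` fil m)"
      then show "x \<in> qk ` fil (Suc m)"
      proof (induction rule: ideal_prod.induct)
        case (prod i j)
        then show ?case using fil_tmult[of _ 1 _ m] by (auto simp: xz_ideal_eq kap_mult)
      next
        case (sum s1 s2)
        then show ?case by (auto simp: kap_add fil_add)
      qed
    qed
    have gens: "{W, U} \<subseteq> J" unfolding xz_ideal_gens by (rule genideal_self) auto
    show "qk ` fil (Suc m) \<subseteq> ideal_prod (q_alg \<rho>) J (qk ` fil m)"
    proof safe
      fix f assume "f \<in> fil (Suc m)"
      then have "supp f \<subseteq> {p. Suc m \<le> wu_deg p}" by (auto simp: fil_def)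
      then show "qk f \<in> ideal_prod (q_alg \<rho>) J (qk ` fil m)"
      proof (induction f rule: supp_induct)
        case zero
        have "qk 0 \<otimes>\<^bsub>q_alg \<rho>\<^esub> qk 0 \<in> ideal_prod (q_alg \<rho>) J (qk ` fil m)"
          by (rule ideal_prod.prod) (auto simp: xz_ideal_eq)
        then show ?case by (simp add: kap_mult)
      next
        case (single p c)
        then obtain G f where G: "G \<in> {W, U}" "f \<in> fil m" "qk (sgl p c) = G \<otimes>\<^bsub>q_alg \<rho>\<^esub> qk f"
          using monomial_split[of m p c] by blast
        show ?case unfolding G(3) by (rule ideal_prod.prod) (use G gens in auto)
      next
        case (add f g)
        then show ?case using ideal_prod.sum[of "qk f" "q_alg \<rho>" J "qk ` fil m" "qk g"] by (simp add: kap_add)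
      qed
    qed
  qed
qed

subsection \<open>The Rees algebra\<close>

abbreviation B :: "(complex, nat \<Rightarrow> qpoly) module" where "B \<equiv> B_alg \<rho>"

text \<open>The homogeneous element \<open>a t^d\<close>.\<close>

definition mon :: "qpoly \<Rightarrow> nat \<Rightarrow> nat \<Rightarrow> qpoly" where
  "mon a d = (\<lambda>m. if m = d then a else \<zero>\<^bsub>q_alg \<rho>\<^esub>)"

lemma mon_eq_iff [simp]: "mon a d = mon a' d \<longleftrightarrow> a = a'"
  by (metis mon_def)

lemma mon_up [simp]: "a \<in> carrier (q_alg \<rho>) \<Longrightarrow> mon a d \<in> up (q_alg \<rho>)"
  by (auto simp: mon_def intro!: exI[of _ d])

lemma monom_UP: "a \<in> carrier (q_alg \<rho>) \<Longrightarrow> up_ring.monom (UP (q_alg \<rho>)) a d = mon a d"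
  by (simp add: UP_def mon_def)

lemma carrier_B: "f \<in> carrier B \<longleftrightarrow> f \<in> up (q_alg \<rho>) \<and> (\<forall>k. f k \<in> qk ` fil k)"
  by (simp add: rees_def ideal_power_eq UP_def)

lemma carrier_B_coeff: "f \<in> carrier B \<Longrightarrow> \<exists>h\<in>fil k. f k = qk h"
  unfolding carrier_B by blast

lemma mon_B: "f \<in> fil d \<Longrightarrow> mon (qk f) d \<in> carrier B"
  unfolding carrier_B by (intro conjI allI mon_up kap_closed) (simp add: mon_def kap_zero)

lemma mon_component: "rees_component (q_alg \<rho>) J d = {mon (qk f) d | f. f \<in> fil d}"
proof safe
  fix f assume "f \<in> rees_component (q_alg \<rho>) J d"
  then have f: "f \<in> carrier B" "\<And>k. k \<noteq> d \<Longrightarrow> f k = \<zero>\<^bsub>q_alg \<rho>\<^esub>" by (auto simp: rees_component_def)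
  obtain h where h: "f d = qk h" "h \<in> fil d" using carrier_B_coeff[OF f(1)] by blast
  have "f = mon (qk h) d" using f(2) h by (auto simp: mon_def fun_eq_iff)
  then show "\<exists>h. f = mon (qk h) d \<and> h \<in> fil d" using h by blast
qed (use mon_B in \<open>auto simp: rees_component_def mon_def\<close>)

lemma mon_mult_fun:
  assumes a: "a \<in> carrier (q_alg \<rho>)" and f: "f \<in> up (q_alg \<rho>)"
  shows "(mon a d \<otimes>\<^bsub>B\<^esub> f) m = (if d \<le> m then a \<otimes>\<^bsub>q_alg \<rho>\<^esub> f (m - d) else \<zero>\<^bsub>q_alg \<rho>\<^esub>)"
proof -
  have fc: "f i \<in> carrier (q_alg \<rho>)" for i using f by auto
  have "(mon a d \<otimes>\<^bsub>B\<^esub> f) m = (\<Oplus>\<^bsub>q_alg \<rho>\<^esub>i\<in>{..m}. mon a d i \<otimes>\<^bsub>q_alg \<rho>\<^esub> f (m - i))"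
    using a f by (simp add: rees_def UP_def)
  also have "\<dots> = (\<Oplus>\<^bsub>q_alg \<rho>\<^esub>i\<in>{..m}. if d = i then a \<otimes>\<^bsub>q_alg \<rho>\<^esub> f (m - i) else \<zero>\<^bsub>q_alg \<rho>\<^esub>)"
    by (rule finsum_cong') (use a fc in \<open>auto simp: mon_def\<close>)
  also have "\<dots> = (if d \<le> m then a \<otimes>\<^bsub>q_alg \<rho>\<^esub> f (m - d) else \<zero>\<^bsub>q_alg \<rho>\<^esub>)"
  proof (cases "d \<le> m")
    case True
    then show ?thesis using finsum_singleton[of d "{..m}" "\<lambda>i. a \<otimes>\<^bsub>q_alg \<rho>\<^esub> f (m - i)"] a fc by simp
  next
    case False
    then have "(\<Oplus>\<^bsub>q_alg \<rho>\<^esub>i\<in>{..m}. if d = i then a \<otimes>\<^bsub>q_alg \<rho>\<^esub> f (m - i) else \<zero>\<^bsub>q_alg \<rho>\<^esub>) =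
      (\<Oplus>\<^bsub>q_alg \<rho>\<^esub>i\<in>{..m}. \<zero>\<^bsub>q_alg \<rho>\<^esub>)" by (intro finsum_cong') auto
    then show ?thesis using False by simp
  qed
  finally show ?thesis .
qed

lemma mon_mult: "mon (qk f) d \<otimes>\<^bsub>B\<^esub> mon (qk g) e = mon (qk (f \<star> g)) (d + e)"
proof
  fix m
  show "(mon (qk f) d \<otimes>\<^bsub>B\<^esub> mon (qk g) e) m = mon (qk (f \<star> g)) (d + e) m"
    by (simp add: mon_mult_fun) (auto simp: mon_def kap_mult)
qed

lemma B_pow: "x [^]\<^bsub>B\<^esub> (0 :: nat) = \<one>\<^bsub>B\<^esub>" "x [^]\<^bsub>B\<^esub> Suc k = x [^]\<^bsub>B\<^esub> k \<otimes>\<^bsub>B\<^esub> x"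
  by (simp_all add: nat_pow_def)

lemma one_B: "\<one>\<^bsub>B\<^esub> = mon (qk 1) 0"
  by (auto simp: rees_def UP_def mon_def kap_one fun_eq_iff)

lemma zero_B: "\<zero>\<^bsub>B\<^esub> = mon (qk 0) 0"
  by (auto simp: rees_def UP_def mon_def kap_zero fun_eq_iff)

lemma mon_add: "mon (qk f) d \<oplus>\<^bsub>B\<^esub> mon (qk g) d = mon (qk (f + g)) d"
  using mon_up[of "qk f" d] mon_up[of "qk g" d]
  by (auto simp: rees_def UP_def fun_eq_iff) (auto simp: mon_def kap_add kap_zero)

lemma mon_smult: "c \<odot>\<^bsub>B\<^esub> mon (qk f) d = mon (qk (scal c f)) d"
  by (auto simp: rees_def mon_def kap_smult kap_zero fun_eq_iff)

lemma mon_W_pow: "mon W 1 [^]\<^bsub>B\<^esub> (k :: nat) = mon (qk (sgl (k, 0, 0) 1)) k"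
  by (induction k) (simp_all add: B_pow one_B W_def mon_mult bich_eq)

abbreviation chart_s :: "nat \<Rightarrow> qpoly" where "chart_s \<equiv> chart_elem \<rho> n gw"

lemma chart_s_pow: "chart_s [^]\<^bsub>B\<^esub> k = mon (qk (sgl (n * k, 0, 0) 1)) (n * k)"
proof -
  have "chart_s = mon (qk (sgl (n, 0, 0) 1)) n"
    using mon_W_pow[of n] by (simp add: chart_elem_def gens_eq(1)[symmetric] monom_UP)
  then show ?thesis by (induction k) (simp_all add: B_pow one_B mon_mult bich_eq add.commute)
qed

subsection \<open>Coordinates on the chart\<close>

text \<open>The fraction with chart coordinates \<open>f\<close>, described by all its
  representatives: \<open>numer (n * N) f\<close> is \<open>w^(nN) f\<close>, and any
  \<open>N\<close> large enough to clear the denominators is allowed.\<close>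

definition cl :: "tpoly \<Rightarrow> ((nat \<Rightarrow> qpoly) \<times> nat) set" where
  "cl f = {(mon (qk (numer (n * N) f)) (n * N), N) | N. denom (n * N) f}"

lemma sgl_W_add: "sgl (a + b, 0, 0) 1 = (sgl (a, 0, 0) 1 \<star> sgl (b, 0, 0) 1 :: tpoly)"
  by (simp add: bich_eq)

text \<open>Cross-multiplying two fractions shows that any representative is determined by its
  denominator, because powers of \<open>w\<close> can be cancelled.\<close>

lemma fraction_numer:
  assumes f: "denom (n * k) f"
  shows "fraction B chart_s (mon (qk (numer (n * k) f)) (n * k)) k = cl f"
proof (intro equalityI subsetI)
  fix x assume "x \<in> cl f"
  then obtain N where x: "x = (mon (qk (numer (n * N) f)) (n * N), N)" and N: "denom (n * N) f"
    by (auto simp: cl_def)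
  \<comment> \<open>Two representatives of the listed form are equivalent with the auxiliary
    exponent zero.\<close>
  have "chart_s [^]\<^bsub>B\<^esub> (0 + N) \<otimes>\<^bsub>B\<^esub> mon (qk (numer (n * k) f)) (n * k) =
      chart_s [^]\<^bsub>B\<^esub> (0 + k) \<otimes>\<^bsub>B\<^esub> mon (qk (numer (n * N) f)) (n * N)"
    by (simp add: chart_s_pow mon_mult W_numer[OF f] W_numer[OF N] add.commute)
  then show "x \<in> fraction B chart_s (mon (qk (numer (n * k) f)) (n * k)) k"
    using mon_B[OF numer_fil[OF N]] unfolding fraction_def x by blast
next
  fix x assume "x \<in> fraction B chart_s (mon (qk (numer (n * k) f)) (n * k)) k"
  then obtain b N m where x: "x = (b, N)" and b: "b \<in> carrier B"
    and eq: "chart_s [^]\<^bsub>B\<^esub> (m + N) \<otimes>\<^bsub>B\<^esub> mon (qk (numer (n * k) f)) (n * k) = chart_s [^]\<^bsub>B\<^esub> (m + k) \<otimes>\<^bsub>B\<^esub> b"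
    by (auto simp: fraction_def)
  let ?X = "\<lambda>d. sgl (d, 0, 0) 1 :: tpoly"
  have Xnz: "?X d \<noteq> 0" for d by simp
  have "(chart_s [^]\<^bsub>B\<^esub> (m + k) \<otimes>\<^bsub>B\<^esub> b) (n * (m + k) + i) = qk (?X (n * (m + k))) \<otimes>\<^bsub>q_alg \<rho>\<^esub> b i" for i
    using b by (simp add: chart_s_pow mon_mult_fun carrier_B)
  then have coeff: "qk (?X (n * (m + k))) \<otimes>\<^bsub>q_alg \<rho>\<^esub> b i =
      mon (qk (?X (n * (m + N)) \<star> numer (n * k) f)) (n * (m + N) + n * k) (n * (m + k) + i)" for i
    unfolding eq[symmetric] by (simp add: chart_s_pow mon_mult)
  obtain g where g: "b (n * N) = qk g" "g \<in> fil (n * N)" using carrier_B_coeff[OF b] by blast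
  \<comment> \<open>The left side of \<open>eq\<close> is homogeneous and multiplication by a power
    of the chart element only shifts degrees, so \<open>b\<close> must be homogeneous of degree
    \<open>n * N\<close>.\<close>
  have "b i = \<zero>\<^bsub>q_alg \<rho>\<^esub>" if i: "i \<noteq> n * N" for i
  proof -
    obtain h where h: "b i = qk h" using carrier_B_coeff[OF b] by blast
    have "n * (m + k) + i \<noteq> n * (m + N) + n * k" using i by (auto simp: distrib_left)
    then have "?X (n * (m + k)) \<star> h = 0"
      using coeff[of i] by (simp add: mon_def h kap_mult kap_zero)
    then show ?thesis using tm_eq_0_iff Xnz by (metis h kap_zero)
  qed
  then have bg: "b = mon (qk g) (n * N)" using g by (auto simp: mon_def fun_eq_iff)
  have "n * (m + k) + n * N = n * (m + N) + n * k" by (simp add: distrib_left)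
  then have "?X (n * (m + k)) \<star> g = ?X (n * (m + N)) \<star> numer (n * k) f"
    using coeff[of "n * N"] by (simp add: mon_def g kap_mult)
  then have "?X (n * m) \<star> (?X (n * k) \<star> g) = ?X (n * m) \<star> (?X (n * N) \<star> numer (n * k) f)"
    unfolding distrib_left sgl_W_add tm_assoc .
  then have "?X (n * k) \<star> g = ?X (n * N) \<star> numer (n * k) f" by (rule tm_cancel) simp
  then have "numer (n * N + n * k) (denumer (n * N) g) = numer (n * k + n * N) f"
    using W_numer[OF f, of \<alpha> 1 "n * N"] W_numer[OF denom_denumer[OF g(2)], of \<alpha> 1 "n * k"]
    by (simp only: numer_denumer[OF g(2)])
  then have "numer (n * N + n * k) (denumer (n * N) g) = numer (n * N + n * k) f" by (simp only: add.commute)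
  then have "denumer (n * N) g = f"
    by (rule numer_inj[rotated 2]) (use denom_mono[OF f] denom_mono[OF denom_denumer[OF g(2)]] in auto)
  then have "denom (n * N) f" "g = numer (n * N) f"
    using denom_denumer[OF g(2)] numer_denumer[OF g(2)] by auto
  then show "x \<in> cl f" unfolding x bg cl_def by blast
qed

lemma ex_denom_n: "\<exists>N. denom (n * N) f"
proof -
  obtain d where "denom d f" using ex_denom by blast
  then have "denom (n * d) f" by (rule denom_mono) (use n_ge_3 in simp)
  then show ?thesis ..
qed

lemma cl_nonempty: "cl f \<noteq> {}"
  using ex_denom_n[of f] by (auto simp: cl_def)

text \<open>The operations of \<open>loc_deg0\<close> are unions over representatives; such a union
  collapses once the result does not depend on the representative, as the set of representatives is
  nonempty.\<close>

lemma cl_UN: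
  assumes "\<And>N. denom (n * N) f \<Longrightarrow> h (mon (qk (numer (n * N) f)) (n * N)) N = c"
  shows "(\<Union>(b, k)\<in>cl f. h b k) = c"
proof -
  have "(\<Union>(b, k)\<in>cl f. h b k) = (\<Union>x\<in>cl f. c)"
    by (rule SUP_cong) (use assms in \<open>auto simp: cl_def\<close>)
  then show ?thesis using cl_nonempty[of f] by simp
qed

lemma cl_inj: "cl f = cl g \<Longrightarrow> f = g"
proof -
  assume eq: "cl f = cl g"
  obtain N where N: "denom (n * N) f" using ex_denom_n by blast
  then have "(mon (qk (numer (n * N) f)) (n * N), N) \<in> cl g" unfolding eq[symmetric] by (auto simp: cl_def)
  then have "denom (n * N) g" "numer (n * N) f = numer (n * N) g" by (auto simp: cl_def)
  then show "f = g" using numer_inj N by blast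
qed

abbreviation C :: "(complex, ((nat \<Rightarrow> qpoly) \<times> nat) set) module" where "C \<equiv> chart_alg \<rho> n gw"

lemma carrier_C: "carrier C = range cl"
proof -
  have "carrier C = {fraction B chart_s (mon (qk h) (n * k)) k | h k. h \<in> fil (n * k)}"
    by (auto simp: chart_alg_def loc_deg0_def mon_component)
  also have "\<dots> = range cl"
  proof safe
    fix h k assume h: "h \<in> fil (n * k)"
    have "fraction B chart_s (mon (qk (numer (n * k) (denumer (n * k) h))) (n * k)) k = cl (denumer (n * k) h)"
      by (rule fraction_numer[OF denom_denumer[OF h]])
    then show "fraction B chart_s (mon (qk h) (n * k)) k \<in> range cl" by (simp add: numer_denumer[OF h])
  next
    fix f
    obtain N where N: "denom (n * N) f" using ex_denom_n by blast
    show "\<exists>h k. cl f = fraction B chart_s (mon (qk h) (n * k)) k \<and> h \<in> fil (n * k)"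
      using fraction_numer[OF N] numer_fil[OF N] by metis
  qed
  finally show ?thesis .
qed

lemma cl_mult: "cl f \<otimes>\<^bsub>C\<^esub> cl g = cl (tmult (bich \<alpha> 2) f g)"
proof -
  have "fraction B chart_s (mon (qk (numer (n * k) f)) (n * k) \<otimes>\<^bsub>B\<^esub> mon (qk (numer (n * l) g)) (n * l)) (k + l) =
      cl (tmult (bich \<alpha> 2) f g)" if "denom (n * k) f" "denom (n * l) g" for k l
    using fraction_numer[of "k + l" "tmult (bich \<alpha> 2) f g"] denom_tmult[OF that]
      numer_tmult[OF \<alpha>_nz \<alpha>_pow_n that] by (simp add: mon_mult distrib_left)
  then show ?thesis by (auto simp: chart_alg_def loc_deg0_def intro!: cl_UN)
qed

lemma cl_add: "cl f \<oplus>\<^bsub>C\<^esub> cl g = cl (f + g)"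
proof -
  have "fraction B chart_s ((chart_s [^]\<^bsub>B\<^esub> l \<otimes>\<^bsub>B\<^esub> mon (qk (numer (n * k) f)) (n * k)) \<oplus>\<^bsub>B\<^esub>
      (chart_s [^]\<^bsub>B\<^esub> k \<otimes>\<^bsub>B\<^esub> mon (qk (numer (n * l) g)) (n * l))) (k + l) = cl (f + g)"
    if k: "denom (n * k) f" and l: "denom (n * l) g" for k l
  proof -
    have "chart_s [^]\<^bsub>B\<^esub> l \<otimes>\<^bsub>B\<^esub> mon (qk (numer (n * k) f)) (n * k) = mon (qk (numer (n * (k + l)) f)) (n * (k + l))"
      "chart_s [^]\<^bsub>B\<^esub> k \<otimes>\<^bsub>B\<^esub> mon (qk (numer (n * l) g)) (n * l) = mon (qk (numer (n * (k + l)) g)) (n * (k + l))"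
      by (simp_all add: chart_s_pow mon_mult W_numer[OF k] W_numer[OF l] distrib_left add.commute)
    then show ?thesis
      using fraction_numer[of "k + l" "f + g"] denom_add[of "n * (k + l)" f g] denom_mono[OF k] denom_mono[OF l]
      by (simp add: mon_add numer_add)
  qed
  then show ?thesis by (auto simp: chart_alg_def loc_deg0_def intro!: cl_UN)
qed

lemma cl_smult: "c \<odot>\<^bsub>C\<^esub> cl f = cl (scal c f)"
proof -
  have "fraction B chart_s (c \<odot>\<^bsub>B\<^esub> mon (qk (numer (n * k) f)) (n * k)) k = cl (scal c f)"
    if "denom (n * k) f" for k
    using fraction_numer[OF denom_scal[OF that, of c]] by (simp add: mon_smult numer_scal)
  then show ?thesis by (auto simp: chart_alg_def loc_deg0_def intro!: cl_UN)
qed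

lemma fraction_zero_denom: "denom 0 f \<Longrightarrow> fraction B chart_s (mon (qk (numer 0 f)) 0) 0 = cl f"
  using fraction_numer[of 0 f] by simp

lemma numer_one: "denom 0 1" "numer 0 1 = 1"
  using sgl_000 unfolding denom_def numer_def single_one[symmetric] plin_sgl by (auto simp: zero_prod_def)

lemma chart_coord: "coord_algebra (bich \<alpha> 2) C cl"
proof -
  interpret C: bicharacter "bich \<alpha> 2" by (rule bicharacter_bich) simp
  show ?thesis
  proof
    show "bij_betw cl UNIV (carrier C)" using cl_inj by (auto simp: bij_betw_def carrier_C inj_def)
    show "\<zero>\<^bsub>C\<^esub> = cl 0" using fraction_zero_denom[of 0]
      by (simp add: chart_alg_def loc_deg0_def zero_B numer_def denom_def)
    show "\<one>\<^bsub>C\<^esub> = cl 1" using fraction_zero_denom[of 1] numer_one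
      by (simp add: chart_alg_def loc_deg0_def one_B)
  qed (simp_all add: cl_mult cl_add cl_smult)
qed

text \<open>Multiplication by the central \<open>w^(nN)\<close> does not affect centrality: modulo
  \<open>n\<close>, the condition \<open>i + nN - k = k\<close> in \<open>A\<close> is the condition
  \<open>i = 2k\<close> in the chart.\<close>

lemma numer_proj_centre:
  assumes "denom (n * N) f"
  shows "proj_centre (numer (n * N) f) = numer (n * N) (coord_algebra.proj_centre (bich \<alpha> 2) f)"
proof -
  interpret C: coord_algebra "bich \<alpha> 2" C cl by (rule chart_coord)
  show ?thesis
    unfolding proj_centre_def C.proj_centre_def numer_def plin_plin
  proof (rule plin_cong)
    fix p assume p: "p \<in> supp f"
    obtain i j k where ijk: "p = (i, j, k)" by (cases p)
    have le: "k \<le> i + n * N" using assms p by (auto simp: denom_def ijk)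
    have "int (i + n * N - k) - int k = (int i - 2 * int k) + int n * int N"
      using le by (simp add: of_nat_diff)
    then have "int n dvd int (i + n * N - k) - int k \<longleftrightarrow> int n dvd int i - 2 * int k"
      by (simp only: dvd_add_left_iff[OF dvd_triv_left])
    then have "(i + n * N - k, j, k) \<in> Cset \<longleftrightarrow> (i, j, k) \<in> C.Cset"
      using bich_Cset_iff[OF alpha_prim n_pos, of i j k 2] by (simp add: Cset_iff)
    then show "plin (\<lambda>p. if p \<in> Cset then sgl p 1 else 0) (case p of (i, j, k) \<Rightarrow> sgl (i + n * N - k, j, k) 1) =
        plin (\<lambda>(i, j, k). sgl (i + n * N - k, j, k) 1) (if p \<in> C.Cset then sgl p 1 else 0)"
      by (simp add: ijk)
  qed
qed

text \<open>The trace of the chart is applied to numerators; since it commutes with clearing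
  denominators, it is again \<open>n\<close> times the projection onto the central
  monomials.\<close>

lemma chart_quantum_space: "quantum_space \<alpha> 2 C cl n (chart_trace \<rho> n gw)"
proof -
  interpret C: coord_algebra "bich \<alpha> 2" C cl by (rule chart_coord)
  show ?thesis
  proof
    fix f
    have rt: "rees_trace (reduced_trace (q_alg \<rho>) n) (mon (qk h) d) = mon (qk (scal (of_nat n) (proj_centre h))) d" for h d
      using tr_kap[of h] tr_kap[of 0] by (auto simp: rees_trace_def mon_def kap_zero proj_centre_def fun_eq_iff)
    have "fraction B chart_s (rees_trace (reduced_trace (q_alg \<rho>) n) (mon (qk (numer (n * k) f)) (n * k))) k =
        cl (scal (of_nat n) (C.proj_centre f))" if k: "denom (n * k) f" for k
    proof -
      have "supp (C.proj_centre f) \<subseteq> supp f"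
        using supp_plin[of "\<lambda>p. if p \<in> C.Cset then sgl p 1 else 0" f]
        by (auto simp: C.proj_centre_def split: if_splits)
      then have "denom (n * k) (scal (of_nat n) (C.proj_centre f))"
        using k by (intro denom_scal) (auto simp: denom_def)
      then show ?thesis
        using fraction_numer[of k "scal (of_nat n) (C.proj_centre f)"]
        by (simp add: rt numer_proj_centre[OF k] numer_scal)
    qed
    then show "chart_trace \<rho> n gw (cl f) = cl (scal (of_nat n) (C.proj_centre f))"
      by (auto simp: chart_trace_def loc_trace_def intro!: cl_UN)
  qed (use n_ge_3 n_odd alpha_prim in auto)
qed

lemma to_chart_qk: "denom 0 f \<Longrightarrow> to_chart \<rho> n gw (qk (numer 0 f)) = cl f"
  by (simp add: to_chart_def monom_UP fraction_zero_denom)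

text \<open>The point of \<open>A\<close> gives the values at \<open>W^n\<close> and
  \<open>Y^n\<close> only; \<open>U^n\<close> has a denominator in terms of \<open>A\<close>, and
  its vanishing comes from \<phi> not being simple.\<close>

lemma chart_local_structure:
  assumes trep: "\<phi> \<in> trep C (chart_trace \<rho> n gw) n id"
    and ss: "semisimple_rep C n \<phi>" and ns: "\<not> simple_rep C n \<phi>"
    and over: "lies_over (q_alg \<rho>) n (\<phi> \<circ> to_chart \<rho> n gw) (q_point \<rho> n 0 (b ^ n) 0 0)"
    and b: "b \<noteq> 0"
  shows "\<forall>v<n. local_quiver_setting C (chart_trace \<rho> n gw) n \<phi> (cyclic_quiver n v) (\<lambda>_. 1)"
    and "defect_at C (chart_trace \<rho> n gw) n (central_point C \<phi>) = int n - 1"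
proof -
  interpret C: quantum_space \<alpha> 2 C cl n "chart_trace \<rho> n gw" by (rule chart_quantum_space)
  have "numer 0 (sgl (n, 0, 0) 1) = sgl (n, 0, 0) 1" "numer 0 (sgl (0, n, 0) 1) = sgl (0, n, 0) 1"
    "denom 0 (sgl (n, 0, 0) 1)" "denom 0 (sgl (0, n, 0) 1)"
    by (simp_all add: numer_def denom_def)
  \<comment> \<open>Monomials without \<open>u\<close> have no denominator, so \<open>w^n\<close>
    and \<open>y^n\<close> keep their coordinates in the chart.\<close>
  then have "to_chart \<rho> n gw (W [^]\<^bsub>q_alg \<rho>\<^esub> n) = C.W [^]\<^bsub>C\<^esub> n" "to_chart \<rho> n gw (Y [^]\<^bsub>q_alg \<rho>\<^esub> n) = C.Y [^]\<^bsub>C\<^esub> n"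
    using to_chart_qk[of "sgl (n, 0, 0) 1"] to_chart_qk[of "sgl (0, n, 0) 1"]
    by (simp_all add: W_pow Y_pow C.W_pow C.Y_pow)
  moreover have "\<phi> (to_chart \<rho> n gw c) = point b c \<cdot>\<^sub>m 1\<^sub>m n" if "c \<in> centre (q_alg \<rho>)" for c
    using over that by (simp add: lies_over_def q_point_eq)
  ultimately have W0: "\<phi> (C.W [^]\<^bsub>C\<^esub> n) = 0 \<cdot>\<^sub>m 1\<^sub>m n" and Yb: "\<phi> (C.Y [^]\<^bsub>C\<^esub> n) = b ^ n \<cdot>\<^sub>m 1\<^sub>m n"
    using pow_in_centre(1,2) point_values by metis+
  have bn: "b ^ n \<noteq> 0" using b by simp
  have U0: "\<phi> (C.U [^]\<^bsub>C\<^esub> n) = 0 \<cdot>\<^sub>m 1\<^sub>m n" by (rule C.nonsimple_kills_U[OF trep ss ns Yb bn])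
  show "\<forall>v<n. local_quiver_setting C (chart_trace \<rho> n gw) n \<phi> (cyclic_quiver n v) (\<lambda>_. 1)"
    using C.local_structure(1)[OF trep ss W0 U0 Yb bn] by (simp add: step_quiver_2)
  have "lies_over C n \<phi> (central_point C \<phi>)"
    using C.trep_central_scalar[OF trep] by (simp add: lies_over_def central_point_def)
  then show "defect_at C (chart_trace \<rho> n gw) n (central_point C \<phi>) = int n - 1"
    by (rule C.defect_at_eq[OF trep ss]) (use W0 U0 Yb bn C.pow_in_centre in \<open>simp_all add: central_point_def\<close>)
qed

end

theorem theorem6p5:
  fixes n :: nat and \<rho> b :: complex
  assumes "n \<ge> 2" and "coprime n 3" and "odd n"
    and "primitive_root_of_unity n \<rho>"
    and "b \<noteq> 0"
  shows "(\<forall>g\<in>{gx, gz}. \<forall>\<phi>\<in>trep (chart_alg \<rho> n g) (chart_trace \<rho> n g) n id.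
            semisimple_rep (chart_alg \<rho> n g) n \<phi> \<and> \<not> simple_rep (chart_alg \<rho> n g) n \<phi> \<and>
            lies_over (q_alg \<rho>) n (\<phi> \<circ> to_chart \<rho> n g) (q_point \<rho> n 0 (b ^ n) 0 0) \<longrightarrow>
              (\<forall>v<n. local_quiver_setting (chart_alg \<rho> n g) (chart_trace \<rho> n g) n \<phi>
                        (cyclic_quiver n v) (\<lambda>_. 1)) \<and>
              defect_at (chart_alg \<rho> n g) (chart_trace \<rho> n g) n
                (central_point (chart_alg \<rho> n g) \<phi>) = int n - 1)
         \<and> defect_at (q_alg \<rho>) (reduced_trace (q_alg \<rho>) n) n (q_point \<rho> n 0 (b ^ n) 0 0) = int n - 1"
proof -
  \<comment> \<open>An odd number that is at least \<open>2\<close> is at least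
    \<open>3\<close>.\<close>
  have n: "n \<ge> 3" using assms(1,3) by (cases "n = 2") auto
  have \<rho>: "\<rho> \<noteq> 0"
    using assms(4) n by (auto simp: primitive_root_of_unity_def power_0_left split: if_splits)
  \<comment> \<open>The chart where \<open>X^n\<close> is invertible has \<open>w = x\<close>, and
    \<open>yx = (1/\<rho>) xy\<close> gives \<open>\<alpha> = 1/\<rho>\<close>; for
    \<open>w = z\<close> the relation \<open>yz = \<rho> zy\<close> gives
    \<open>\<alpha> = \<rho>\<close>.\<close>
  interpret x: qpoly \<rho> "1 / \<rho>" gx gz n by unfold_locales (use n \<rho> assms in auto)
  interpret z: qpoly \<rho> \<rho> gz gx n by unfold_locales (use n \<rho> assms in auto)
  show ?thesis
    using x.chart_local_structure[OF _ _ _ _ \<open>b \<noteq> 0\<close>] z.chart_local_structure[OF _ _ _ _ \<open>b \<noteq> 0\<close>]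
      x.defect_at_q_alg[OF \<open>b \<noteq> 0\<close>] by auto
qed

end
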